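(* Let $\mathcal V$ be a braided rigid monoidal category admitting a coend $C$, and let $H$ be a Hopf algebra in $\mathcal V$. (a) The assignment $\mathfrak p\mapsto \phi$, $\phi_{M}=\mu_M\circ \Sigma(\mathfrak p)^\sharp_M$ (for $M\in\mathcal V_H$), is a (canonical) bijection between the set $\mathsf{CPiv}(H)$ of $C$-pivotal elements of $H$ and the set $\mathsf{Piv}(\mathcal V_H)$ of pivotal structures of $\mathcal V_H$. (b) Assume that $H$ is quasitriangular with an $R$-matrix $\mathfrak R:C\otimes C\to H\otimes H$, and equip $\mathcal V_H$ with the induced braiding $c=c^{\mathfrak R}$. (i) The assignment $\mathfrak t\mapsto\Sigma(\mathfrak t)^\sharp$ is a (canonical) bijection between the set $\mathsf{CBal}(H)$ of $C$-balanced elements of $H$ and the set $\mathsf{Bal}(\mathcal V_H)$ of balanced structures of $\mathcal V_H$. (ii) The bijection in (i) restricts to a bijection between the subset $\mathsf{CRbn}(H)$ of $C$-ribbon elements of $H$ and the subset $\mathsf{Rbn}(\mathcal V_H)$ of ribbon structures of $\mathcal V_H$.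
   Context: **Categories.** Monoidal categories are strict, with product $\otimes$ and unit $\mathbf 1$; the braiding of $\mathcal V$ is $\sigma_{X,Y}:X\otimes Y\to Y\otimes X$. $\mathrm{Nat}(F,G)$ is the set of natural transformations and $\mathrm{End}(F)=\mathrm{Nat}(F,F)$. Rigid means every $X$ has a left dual ${}^\vee X$ with $\mathrm{ev}^l_X:{}^\vee X\otimes X\to\mathbf 1$, $\mathrm{coev}^l_X:\mathbf 1\to X\otimes{}^\vee X$ and a right dual $X^\vee$ with $\mathrm{ev}^r_X:X\otimes X^\vee\to\mathbf 1$, $\mathrm{coev}^r_X:\mathbf 1\to X^\vee\otimes X$ satisfying the snake identities; ${}^\vee f$, $f^\vee$ denote the dual morphisms. The canonical isomorphisms $({}^\vee X)^\vee\cong X\cong{}^\vee(X^\vee)$, $(X\otimes Y)^\vee\cong Y^\vee\otimes X^\vee$, etc. are suppressed. A pivotal structure on a rigid category is a monoidal natural transformation $\phi_X:X\to X^{\vee\vee}$. A lax braiding is a natural $c_{X,Y}:X\otimes Y\to Y\otimes X$ satisfying both hexagon identities and $c_{X,\mathbf 1}=\mathrm{id}_X=c_{\mathbf 1,X}$; a braiding is an invertible one. A balanced structure on $(\mathcal C,c)$ is $\theta\in\mathrm{End}(1_{\mathcal C})$ with $\theta_{X\otimes Y}=(\theta_X\otimes\theta_Y)c_{Y,X}c_{X,Y}$ and $\theta_{\mathbf 1}=\mathrm{id}$; it is ribbon if $\theta_X={}^\vee(\theta_{X^\vee})$ for all $X$. The Drinfeld morphism of a braided rigid category $(\mathcal C,c)$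 is $(\mathrm{id}_{X^{\vee\vee}}\otimes\mathrm{ev}^r_X)(\mathrm{id}_{X^{\vee\vee}}\otimes c_{X^\vee,X})(\mathrm{coev}^r_{X^\vee}\otimes\mathrm{id}_X):X\to X^{\vee\vee}$ (an isomorphism); $\mu$ denotes the Drinfeld morphism of $(\mathcal V,\sigma)$. **Hopf algebra.** $H=(H,m,u_H,\Delta_H,\epsilon_H,S_H)$ is a Hopf algebra in $(\mathcal V,\sigma)$ with invertible antipode. $\mathcal V_H$ is the category of right $H$-modules $(M,r)$, $r:M\otimes H\to M$. It is monoidal: $(M,r)\otimes(N,s)$ has action $(r\otimes s)(\mathrm{id}_M\otimes\sigma_{N,H}\otimes\mathrm{id}_H)(\mathrm{id}_{M\otimes N}\otimes\Delta_H)$, and $\mathbf 1$ has action $\epsilon_H$. It is rigid, with duals those of the underlying objects, the actions being the unique ones making (co)evaluations $H$-linear. $U_H:\mathcal V_H\to\mathcal V$ is the forgetful functor. For $h\in\mathrm{Nat}(1_{\mathcal V},1_{\mathcal V}\otimes H)$ put $h^\sharp_{(M,r)}=r\,h_M$; $h\mapsto h^\sharp$ is a bijection $\mathrm{Nat}(1_{\mathcal V},1_{\mathcal V}\otimes H)\to\mathrm{End}(U_H)$ with inverse $f\mapsto f^\flat$, $f^\flat_X=f_{(X\otimes H,\mathrm{id}_X\otimes m)}(\mathrm{id}_X\otimes u_H)$. **Coend.** $\mathcal V$ admits a coend if the functor $(X,Y)\mapsto{}^\vee X\otimes Y$, $\mathcal V^{op}\times\mathcal V\to\mathcal V$, has a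 coend $(C,\iota)$. The universal coaction is $\delta_X=(\mathrm{id}_X\otimes\iota_X)(\mathrm{coev}^l_X\otimes\mathrm{id}_X):X\to X\otimes C$. For each $D$, $f\mapsto((\mathrm{id}_X\otimes f)\delta_X)_X$ is a bijection $\mathrm{Hom}(C,D)\to\mathrm{Nat}(1_{\mathcal V},1_{\mathcal V}\otimes D)$; for $D=H$ it is denoted $\Sigma$. Put $\delta^{(2)}_{X,Y}=(\mathrm{id}_X\otimes\sigma_{C,Y}\otimes\mathrm{id}_C)(\delta_X\otimes\delta_Y)$; similarly $f\mapsto((\mathrm{id}_{X\otimes Y}\otimes f)\delta^{(2)}_{X,Y})_{X,Y}$ is a bijection from $\mathrm{Hom}(C\otimes C,D)$ to natural transformations $X\otimes Y\to X\otimes Y\otimes D$. $C$ is a Hopf algebra with structure determined by $(\mathrm{id}\otimes m_C)\delta^{(2)}_{X,Y}=\delta_{X\otimes Y}$, $u_C=\delta_{\mathbf 1}$, $(\mathrm{id}_X\otimes\Delta_C)\delta_X=(\delta_X\otimes\mathrm{id}_C)\delta_X$, $(\mathrm{id}_X\otimes\epsilon_C)\delta_X=\mathrm{id}_X$. The pairings $\omega,\underline\omega:C\otimes C\to\mathbf 1$ are determined by $(\mathrm{id}\otimes\omega)\delta^{(2)}_{X,Y}=\sigma_{Y,X}\sigma_{X,Y}$ and $(\mathrm{id}\otimes\underline\omega)\delta^{(2)}_{X,Y}=(\sigma_{Y,X}\sigma_{X,Y})^{-1}$. A $C$-element of $H$ is a morphism $C\to H$. **$C$-pivotal elements.** A $C$-element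 $\mathfrak p$ is twisted grouplike if $\epsilon_H\mathfrak p u_C=\mathrm{id}_{\mathbf 1}$ and $$\Delta_H\mathfrak p\,m_C=\Big(\big[(\mathfrak p\otimes\mathfrak p)(\mathrm{id}_C\otimes\underline\omega\otimes\mathrm{id}_C)(\delta_C\otimes\Delta_C)\big]\otimes\omega\Big)(\mathrm{id}_C\otimes\sigma_{C,C}\otimes\mathrm{id}_C)(\Delta_C\otimes\Delta_C).$$ It is $C$-pivotal if moreover, as morphisms $C\otimes H\to H$, $$m(\mathrm{id}_H\otimes\mathfrak p\,m_C)(\sigma_{C,H}\otimes\mathrm{id}_C)(\mathrm{id}_C\otimes\delta_H)=m(\mathfrak p\otimes\mathrm{id}_H\otimes\omega)(\mathrm{id}_C\otimes\sigma_{C,H}\otimes\mathrm{id}_C)(\Delta_C\otimes\delta_H S_H^2).$$ **$R$-matrices.** For $\mathfrak R:C\otimes C\to H\otimes H$ put $R_{X,Y}=(\sigma_{X,Y\otimes H}\otimes\mathrm{id}_H)(\mathrm{id}_{X\otimes Y}\otimes\mathfrak R)\delta^{(2)}_{X,Y}:X\otimes Y\to Y\otimes H\otimes X\otimes H$. $\mathfrak R$ is an $R$-matrix if for all $X,Y,Z\in\mathcal V$ (writing objects for identities): 1. $(Y\otimes m\otimes X\otimes m)R_{X\otimes H,Y\otimes H}(X\otimes\sigma_{Y,H}\otimes H)(X\otimes Y\otimes\Delta_H)=(Y\otimes m\otimes X\otimes m)(Y\otimes H\otimes\sigma_{X\otimes H,H}\otimes H)(R_{X,Y}\otimes\Delta_H)$;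 2. $(Y\otimes\sigma_{Z,H}\otimes H\otimes X\otimes H)(Y\otimes Z\otimes\Delta_H\otimes X\otimes H)R_{X,Y\otimes Z}=(Y\otimes H\otimes Z\otimes H\otimes X\otimes m)(Y\otimes H\otimes R_{X\otimes H,Z})(R_{X,Y}\otimes Z)$; 3. $(Z\otimes H\otimes X\otimes\sigma_{Y,H}\otimes H)(Z\otimes H\otimes X\otimes Y\otimes\Delta_H)R_{X\otimes Y,Z}=(Z\otimes m\otimes X\otimes H\otimes Y\otimes H)(R_{X,Z\otimes H}\otimes Y\otimes H)(X\otimes R_{Y,Z})$; 4. $(\epsilon_H\otimes X\otimes H)R_{X,\mathbf 1}=X\otimes u_H=(X\otimes H\otimes\epsilon_H)R_{\mathbf 1,X}$. Then $c^{\mathfrak R}_{(M,r),(N,s)}=(s\otimes r)R_{M,N}$ is a braiding on $\mathcal V_H$. A quasitriangular Hopf algebra is a Hopf algebra with an $R$-matrix. **$C$-balanced and $C$-ribbon elements.** Given $\mathfrak R$, a $C$-element $\mathfrak t$ with $t=\Sigma(\mathfrak t)$ is $C$-balanced if: (CT1) it is central, i.e. $m(\mathrm{id}_H\otimes\mathfrak t\,m_C)(\sigma_{C,H}\otimes\mathrm{id}_C)(\mathrm{id}_C\otimes\delta_H)=m(\mathfrak t\otimes\mathrm{id}_H)$ as morphisms $C\otimes H\to H$; (CT2) $\epsilon_H\mathfrak t u_C=\mathrm{id}_{\mathbf 1}$; (CT3) for all $X,Y$, $$(X\otimes\sigma_{Y,H}\otimes H)(X\otimes Y\otimes\Delta_H)\,t_{X\otimes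 Y}=(L_{t,X}\otimes L_{t,Y})(X\otimes m\otimes Y\otimes m)R_{Y\otimes H,X\otimes H}R_{X,Y},$$ where $L_{t,X}=(\mathrm{id}_X\otimes m)t_{X\otimes H}:X\otimes H\to X\otimes H$. It is $C$-ribbon if also (CT4) $S(\mathfrak t)=\mathfrak t$, where for a $C$-element $\mathfrak a$, $S(\mathfrak a)$ is the unique $C$-element with $\Sigma(S(\mathfrak a))^\sharp_M=\big(\Sigma(\mathfrak a)^\sharp_{{}^\vee M}\big)^\vee$ for all $M\in\mathcal V_H$. *)

theory Defs
  imports Main "HOL-Library.FuncSet"
begin

section \<open>Strict rigid monoidal categories\<close>

text \<open>
  Objects and morphisms are elements of two types; \<open>Obj\<close> and \<open>Arr\<close> carve out the actual objects
  and morphisms.  Every morphism has one domain and one codomain.  \<open>g \<cdot> f\<close> is \<open>g\<close> after \<open>f\<close>,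
  \<open>\<langle>X\<rangle>\<close> is the identity of \<open>X\<close>, \<open>\<otimes>\<close> is the product of objects and \<open>\<odot>\<close> the product of morphisms.
  \<open>ld X\<close> and \<open>rd X\<close> are the chosen left and right duals of \<open>X\<close>.
\<close>

record ('o, 'a) rigid_cat =
  Obj :: "'o set"
  Arr :: "'a set"
  Dom :: "'a \<Rightarrow> 'o"
  Cod :: "'a \<Rightarrow> 'o"
  ident :: "'o \<Rightarrow> 'a"  (\<open>\<langle>_\<rangle>\<index>\<close>)
  cmp :: "'a \<Rightarrow> 'a \<Rightarrow> 'a"  (infixr \<open>\<cdot>\<index>\<close> 60)
  tenO :: "'o \<Rightarrow> 'o \<Rightarrow> 'o"  (infixr \<open>\<otimes>\<index>\<close> 70)
  tenA :: "'a \<Rightarrow> 'a \<Rightarrow> 'a"  (infixr \<open>\<odot>\<index>\<close> 70)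
  unitO :: 'o  (\<open>\<one>\<index>\<close>)
  ld :: "'o \<Rightarrow> 'o"
  rd :: "'o \<Rightarrow> 'o"
  evl :: "'o \<Rightarrow> 'a"
  coevl :: "'o \<Rightarrow> 'a"
  evr :: "'o \<Rightarrow> 'a"
  coevr :: "'o \<Rightarrow> 'a"

locale rigid_data =
  fixes V :: "('o, 'a) rigid_cat" (structure)
begin

definition hom :: "'o \<Rightarrow> 'o \<Rightarrow> 'a set" where
  "hom X Y = {f \<in> Arr V. Dom V f = X \<and> Cod V f = Y}"

definition is_inverse :: "'a \<Rightarrow> 'a \<Rightarrow> bool" where
  "is_inverse f g \<longleftrightarrow> f \<in> Arr V \<and> g \<in> hom (Cod V f) (Dom V f) \<and>
     g \<cdot> f = \<langle>Dom V f\<rangle> \<and> f \<cdot> g = \<langle>Cod V f\<rangle>"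

definition is_iso :: "'a \<Rightarrow> bool" where
  "is_iso f \<longleftrightarrow> (\<exists>g. is_inverse f g)"

definition inv_arr :: "'a \<Rightarrow> 'a" where
  "inv_arr f = (THE g. is_inverse f g)"

subsection \<open>Dual morphisms and the canonical isomorphisms between iterated duals\<close>

definition ldual_arr :: "'a \<Rightarrow> 'a" where
  "ldual_arr f = (let X = Dom V f; Y = Cod V f in
     (evl V Y \<odot> \<langle>ld V X\<rangle>) \<cdot> (\<langle>ld V Y\<rangle> \<odot> f \<odot> \<langle>ld V X\<rangle>) \<cdot> (\<langle>ld V Y\<rangle> \<odot> coevl V X))"

definition rdual_arr :: "'a \<Rightarrow> 'a" where
  "rdual_arr f = (let X = Dom V f; Y = Cod V f in
     (\<langle>rd V X\<rangle> \<odot> evr V Y) \<cdot> (\<langle>rd V X\<rangle> \<odot> f \<odot> \<langle>rd V Y\<rangle>) \<cdot> (coevr V X \<odot> \<langle>rd V Y\<rangle>))"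

text \<open>
  \<open>to_lr X : X \<rightarrow> ld (rd X)\<close> and \<open>from_lr X : ld (rd X) \<rightarrow> X\<close> are the mutually inverse canonical
  isomorphisms, and likewise \<open>to_rl X : X \<rightarrow> rd (ld X)\<close> and \<open>from_rl X : rd (ld X) \<rightarrow> X\<close>.
\<close>

definition to_lr :: "'o \<Rightarrow> 'a" where
  "to_lr X = (evr V X \<odot> \<langle>ld V (rd V X)\<rangle>) \<cdot> (\<langle>X\<rangle> \<odot> coevl V (rd V X))"

definition from_lr :: "'o \<Rightarrow> 'a" where
  "from_lr X = (evl V (rd V X) \<odot> \<langle>X\<rangle>) \<cdot> (\<langle>ld V (rd V X)\<rangle> \<odot> coevr V X)"

definition to_rl :: "'o \<Rightarrow> 'a" where
  "to_rl X = (\<langle>rd V (ld V X)\<rangle> \<odot> evl V X) \<cdot> (coevr V (ld V X) \<odot> \<langle>X\<rangle>)"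

definition from_rl :: "'o \<Rightarrow> 'a" where
  "from_rl X = (\<langle>X\<rangle> \<odot> evr V (ld V X)) \<cdot> (coevl V X \<odot> \<langle>rd V (ld V X)\<rangle>)"

text \<open>
  \<open>rd_ten X Y : rd Y \<otimes> rd X \<rightarrow> rd (X \<otimes> Y)\<close> and its inverse \<open>rd_split X Y\<close>.
\<close>

definition rd_ten :: "'o \<Rightarrow> 'o \<Rightarrow> 'a" where
  "rd_ten X Y =
     (\<langle>rd V (X \<otimes> Y)\<rangle> \<odot> (evr V X \<cdot> (\<langle>X\<rangle> \<odot> evr V Y \<odot> \<langle>rd V X\<rangle>)))
     \<cdot> (coevr V (X \<otimes> Y) \<odot> \<langle>rd V Y \<otimes> rd V X\<rangle>)"

definition rd_split :: "'o \<Rightarrow> 'o \<Rightarrow> 'a" where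
  "rd_split X Y =
     (\<langle>rd V Y \<otimes> rd V X\<rangle> \<odot> evr V (X \<otimes> Y))
     \<cdot> (((\<langle>rd V Y\<rangle> \<odot> coevr V X \<odot> \<langle>Y\<rangle>) \<cdot> coevr V Y) \<odot> \<langle>rd V (X \<otimes> Y)\<rangle>)"

text \<open>
  The monoidal structure of the double right dual functor:
  \<open>rdd_ten X Y : rd (rd X) \<otimes> rd (rd Y) \<rightarrow> rd (rd (X \<otimes> Y))\<close> and \<open>rdd_unit : \<one> \<rightarrow> rd (rd \<one>)\<close>.
  By strictness \<open>coevr \<one> : \<one> \<rightarrow> rd \<one>\<close> is the canonical isomorphism and
  \<open>evr \<one> : rd \<one> \<rightarrow> \<one>\<close> is its inverse.
\<close>

definition rdd_ten :: "'o \<Rightarrow> 'o \<Rightarrow> 'a" where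
  "rdd_ten X Y = rdual_arr (rd_split X Y) \<cdot> rd_ten (rd V Y) (rd V X)"

definition rdd_unit :: 'a where
  "rdd_unit = rdual_arr (evr V \<one>) \<cdot> coevr V \<one>"

subsection \<open>Natural transformations, pivotal, braided, balanced and ribbon structures\<close>

text \<open>
  A functor is a pair of maps on objects and on morphisms.  Transformations are extensional
  (equal to \<^term>\<open>undefined\<close> off \<open>Obj V\<close>), so that equality of functions is equality of all components.
\<close>

definition Nat :: "('o \<Rightarrow> 'o) \<times> ('a \<Rightarrow> 'a) \<Rightarrow> ('o \<Rightarrow> 'o) \<times> ('a \<Rightarrow> 'a) \<Rightarrow> ('o \<Rightarrow> 'a) set" where
  "Nat F G = {\<phi> \<in> extensional (Obj V).
     (\<forall>X\<in>Obj V. \<phi> X \<in> hom (fst F X) (fst G X)) \<and>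
     (\<forall>f\<in>Arr V. snd G f \<cdot> \<phi> (Dom V f) = \<phi> (Cod V f) \<cdot> snd F f)}"

definition id_functor :: "('o \<Rightarrow> 'o) \<times> ('a \<Rightarrow> 'a)" where
  "id_functor = ((\<lambda>X. X), (\<lambda>f. f))"

definition rdd_functor :: "('o \<Rightarrow> 'o) \<times> ('a \<Rightarrow> 'a)" where
  "rdd_functor = ((\<lambda>X. rd V (rd V X)), (\<lambda>f. rdual_arr (rdual_arr f)))"

definition Piv :: "('o \<Rightarrow> 'a) set" where
  "Piv = {\<phi> \<in> Nat id_functor rdd_functor.
     (\<forall>X\<in>Obj V. \<forall>Y\<in>Obj V. \<phi> (X \<otimes> Y) = rdd_ten X Y \<cdot> (\<phi> X \<odot> \<phi> Y)) \<and>
     \<phi> \<one> = rdd_unit}"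

definition lax_braiding :: "('o \<Rightarrow> 'o \<Rightarrow> 'a) \<Rightarrow> bool" where
  "lax_braiding c \<longleftrightarrow>
     (\<forall>X\<in>Obj V. \<forall>Y\<in>Obj V. c X Y \<in> hom (X \<otimes> Y) (Y \<otimes> X)) \<and>
     (\<forall>f\<in>Arr V. \<forall>g\<in>Arr V.
        (g \<odot> f) \<cdot> c (Dom V f) (Dom V g) = c (Cod V f) (Cod V g) \<cdot> (f \<odot> g)) \<and>
     (\<forall>X\<in>Obj V. \<forall>Y\<in>Obj V. \<forall>Z\<in>Obj V.
        c X (Y \<otimes> Z) = (\<langle>Y\<rangle> \<odot> c X Z) \<cdot> (c X Y \<odot> \<langle>Z\<rangle>) \<and>
        c (X \<otimes> Y) Z = (c X Z \<odot> \<langle>Y\<rangle>) \<cdot> (\<langle>X\<rangle> \<odot> c Y Z)) \<and>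
     (\<forall>X\<in>Obj V. c X \<one> = \<langle>X\<rangle> \<and> c \<one> X = \<langle>X\<rangle>)"

definition braiding :: "('o \<Rightarrow> 'o \<Rightarrow> 'a) \<Rightarrow> bool" where
  "braiding c \<longleftrightarrow> lax_braiding c \<and> (\<forall>X\<in>Obj V. \<forall>Y\<in>Obj V. is_iso (c X Y))"

definition drinfeld :: "('o \<Rightarrow> 'o \<Rightarrow> 'a) \<Rightarrow> 'o \<Rightarrow> 'a" where
  "drinfeld c X =
     (\<langle>rd V (rd V X)\<rangle> \<odot> evr V X)
     \<cdot> (\<langle>rd V (rd V X)\<rangle> \<odot> c (rd V X) X)
     \<cdot> (coevr V (rd V X) \<odot> \<langle>X\<rangle>)"

definition Bal :: "('o \<Rightarrow> 'o \<Rightarrow> 'a) \<Rightarrow> ('o \<Rightarrow> 'a) set" where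
  "Bal c = {\<theta> \<in> Nat id_functor id_functor.
     (\<forall>X\<in>Obj V. \<forall>Y\<in>Obj V. \<theta> (X \<otimes> Y) = (\<theta> X \<odot> \<theta> Y) \<cdot> c Y X \<cdot> c X Y) \<and>
     \<theta> \<one> = \<langle>\<one>\<rangle>}"

definition Rbn :: "('o \<Rightarrow> 'o \<Rightarrow> 'a) \<Rightarrow> ('o \<Rightarrow> 'a) set" where
  "Rbn c = {\<theta> \<in> Bal c. \<forall>X\<in>Obj V. \<theta> X = from_lr X \<cdot> ldual_arr (\<theta> (rd V X)) \<cdot> to_lr X}"

end

locale rigid_category = rigid_data +
  assumes dom_obj: "f \<in> Arr V \<Longrightarrow> Dom V f \<in> Obj V"
    and cod_obj: "f \<in> Arr V \<Longrightarrow> Cod V f \<in> Obj V"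
    and ident_hom: "X \<in> Obj V \<Longrightarrow> \<langle>X\<rangle> \<in> hom X X"
    and cmp_hom: "\<lbrakk>f \<in> hom X Y; g \<in> hom Y Z\<rbrakk> \<Longrightarrow> g \<cdot> f \<in> hom X Z"
    and ident_left: "f \<in> hom X Y \<Longrightarrow> \<langle>Y\<rangle> \<cdot> f = f"
    and ident_right: "f \<in> hom X Y \<Longrightarrow> f \<cdot> \<langle>X\<rangle> = f"
    and cmp_assoc: "\<lbrakk>f \<in> hom W X; g \<in> hom X Y; h \<in> hom Y Z\<rbrakk> \<Longrightarrow> (h \<cdot> g) \<cdot> f = h \<cdot> (g \<cdot> f)"
    and unit_obj: "\<one> \<in> Obj V"
    and ten_obj: "\<lbrakk>X \<in> Obj V; Y \<in> Obj V\<rbrakk> \<Longrightarrow> X \<otimes> Y \<in> Obj V"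
    and ten_hom: "\<lbrakk>f \<in> hom X X'; g \<in> hom Y Y'\<rbrakk> \<Longrightarrow> f \<odot> g \<in> hom (X \<otimes> Y) (X' \<otimes> Y')"
    and ten_ident: "\<lbrakk>X \<in> Obj V; Y \<in> Obj V\<rbrakk> \<Longrightarrow> \<langle>X\<rangle> \<odot> \<langle>Y\<rangle> = \<langle>X \<otimes> Y\<rangle>"
    and ten_cmp: "\<lbrakk>f \<in> hom X Y; f' \<in> hom Y Z; g \<in> hom X' Y'; g' \<in> hom Y' Z'\<rbrakk> \<Longrightarrow>
      (f' \<cdot> f) \<odot> (g' \<cdot> g) = (f' \<odot> g') \<cdot> (f \<odot> g)"
    and ten_assoc: "\<lbrakk>X \<in> Obj V; Y \<in> Obj V; Z \<in> Obj V\<rbrakk> \<Longrightarrow> (X \<otimes> Y) \<otimes> Z = X \<otimes> (Y \<otimes> Z)"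
    and ten_assoc_arr: "\<lbrakk>f \<in> Arr V; g \<in> Arr V; h \<in> Arr V\<rbrakk> \<Longrightarrow> (f \<odot> g) \<odot> h = f \<odot> (g \<odot> h)"
    and ten_unit: "X \<in> Obj V \<Longrightarrow> \<one> \<otimes> X = X" "X \<in> Obj V \<Longrightarrow> X \<otimes> \<one> = X"
    and ten_unit_arr: "f \<in> Arr V \<Longrightarrow> \<langle>\<one>\<rangle> \<odot> f = f" "f \<in> Arr V \<Longrightarrow> f \<odot> \<langle>\<one>\<rangle> = f"
    and ld_obj: "X \<in> Obj V \<Longrightarrow> ld V X \<in> Obj V"
    and rd_obj: "X \<in> Obj V \<Longrightarrow> rd V X \<in> Obj V"
    and evl_hom: "X \<in> Obj V \<Longrightarrow> evl V X \<in> hom (ld V X \<otimes> X) \<one>"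
    and coevl_hom: "X \<in> Obj V \<Longrightarrow> coevl V X \<in> hom \<one> (X \<otimes> ld V X)"
    and evr_hom: "X \<in> Obj V \<Longrightarrow> evr V X \<in> hom (X \<otimes> rd V X) \<one>"
    and coevr_hom: "X \<in> Obj V \<Longrightarrow> coevr V X \<in> hom \<one> (rd V X \<otimes> X)"
    and snake_l1: "X \<in> Obj V \<Longrightarrow> (\<langle>X\<rangle> \<odot> evl V X) \<cdot> (coevl V X \<odot> \<langle>X\<rangle>) = \<langle>X\<rangle>"
    and snake_l2: "X \<in> Obj V \<Longrightarrow>
      (evl V X \<odot> \<langle>ld V X\<rangle>) \<cdot> (\<langle>ld V X\<rangle> \<odot> coevl V X) = \<langle>ld V X\<rangle>"
    and snake_r1: "X \<in> Obj V \<Longrightarrow> (evr V X \<odot> \<langle>X\<rangle>) \<cdot> (\<langle>X\<rangle> \<odot> coevr V X) = \<langle>X\<rangle>"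
    and snake_r2: "X \<in> Obj V \<Longrightarrow>
      (\<langle>rd V X\<rangle> \<odot> evr V X) \<cdot> (coevr V X \<odot> \<langle>rd V X\<rangle>) = \<langle>rd V X\<rangle>"

locale braided_rigid_category = rigid_category V for V :: "('o, 'a) rigid_cat" (structure) +
  fixes \<sigma> :: "'o \<Rightarrow> 'o \<Rightarrow> 'a"
  assumes braiding: "braiding \<sigma>"

section \<open>Hopf algebras and their categories of right modules\<close>

record ('o, 'a) hopf =
  hobj :: 'o
  hmul :: 'a
  hunit :: 'a
  hcomul :: 'a
  hcounit :: 'a
  hant :: 'a

locale hopf_data = rigid_data V for V :: "('o, 'a) rigid_cat" (structure) +
  fixes \<sigma> :: "'o \<Rightarrow> 'o \<Rightarrow> 'a" and HH :: "('o, 'a) hopf"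
begin

abbreviation "H \<equiv> hobj HH"
abbreviation "m \<equiv> hmul HH"
abbreviation "u \<equiv> hunit HH"
abbreviation "\<Delta> \<equiv> hcomul HH"
abbreviation "\<epsilon> \<equiv> hcounit HH"
abbreviation "S \<equiv> hant HH"

definition hopf_algebra :: bool where
  "hopf_algebra \<longleftrightarrow>
     H \<in> Obj V \<and> m \<in> hom (H \<otimes> H) H \<and> u \<in> hom \<one> H \<and>
     \<Delta> \<in> hom H (H \<otimes> H) \<and> \<epsilon> \<in> hom H \<one> \<and> S \<in> hom H H \<and>
     m \<cdot> (m \<odot> \<langle>H\<rangle>) = m \<cdot> (\<langle>H\<rangle> \<odot> m) \<and>
     m \<cdot> (u \<odot> \<langle>H\<rangle>) = \<langle>H\<rangle> \<and> m \<cdot> (\<langle>H\<rangle> \<odot> u) = \<langle>H\<rangle> \<and>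
     (\<Delta> \<odot> \<langle>H\<rangle>) \<cdot> \<Delta> = (\<langle>H\<rangle> \<odot> \<Delta>) \<cdot> \<Delta> \<and>
     (\<epsilon> \<odot> \<langle>H\<rangle>) \<cdot> \<Delta> = \<langle>H\<rangle> \<and> (\<langle>H\<rangle> \<odot> \<epsilon>) \<cdot> \<Delta> = \<langle>H\<rangle> \<and>
     \<Delta> \<cdot> m = (m \<odot> m) \<cdot> (\<langle>H\<rangle> \<odot> \<sigma> H H \<odot> \<langle>H\<rangle>) \<cdot> (\<Delta> \<odot> \<Delta>) \<and>
     \<Delta> \<cdot> u = u \<odot> u \<and> \<epsilon> \<cdot> m = \<epsilon> \<odot> \<epsilon> \<and> \<epsilon> \<cdot> u = \<langle>\<one>\<rangle> \<and>
     m \<cdot> (S \<odot> \<langle>H\<rangle>) \<cdot> \<Delta> = u \<cdot> \<epsilon> \<and> m \<cdot> (\<langle>H\<rangle> \<odot> S) \<cdot> \<Delta> = u \<cdot> \<epsilon> \<and>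
     is_iso S"

text \<open>A right module is a pair of its underlying object and its action.\<close>

definition is_module :: "'o \<times> 'a \<Rightarrow> bool" where
  "is_module = (\<lambda>(M, r). M \<in> Obj V \<and> r \<in> hom (M \<otimes> H) M \<and>
     r \<cdot> (r \<odot> \<langle>H\<rangle>) = r \<cdot> (\<langle>M\<rangle> \<odot> m) \<and> r \<cdot> (\<langle>M\<rangle> \<odot> u) = \<langle>M\<rangle>)"

definition linear :: "'o \<times> 'a \<Rightarrow> 'o \<times> 'a \<Rightarrow> 'a \<Rightarrow> bool" where
  "linear = (\<lambda>(M, r) (N, s) f. f \<in> hom M N \<and> f \<cdot> r = s \<cdot> (f \<odot> \<langle>H\<rangle>))"

definition mod_unit :: "'o \<times> 'a" where
  "mod_unit = (\<one>, \<epsilon>)"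

definition mod_ten :: "'o \<times> 'a \<Rightarrow> 'o \<times> 'a \<Rightarrow> 'o \<times> 'a" where
  "mod_ten = (\<lambda>(M, r) (N, s). (M \<otimes> N,
     (r \<odot> s) \<cdot> (\<langle>M\<rangle> \<odot> \<sigma> N H \<odot> \<langle>H\<rangle>) \<cdot> (\<langle>M \<otimes> N\<rangle> \<odot> \<Delta>)))"

definition mod_ld :: "'o \<times> 'a \<Rightarrow> 'o \<times> 'a" where
  "mod_ld A = (let M = fst A in (ld V M, THE r'. is_module (ld V M, r') \<and>
     linear (mod_ten (ld V M, r') A) mod_unit (evl V M) \<and>
     linear mod_unit (mod_ten A (ld V M, r')) (coevl V M)))"

definition mod_rd :: "'o \<times> 'a \<Rightarrow> 'o \<times> 'a" where
  "mod_rd A = (let M = fst A in (rd V M, THE r'. is_module (rd V M, r') \<and>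
     linear (mod_ten A (rd V M, r')) mod_unit (evr V M) \<and>
     linear mod_unit (mod_ten (rd V M, r') A) (coevr V M)))"

text \<open>
  The category of right modules.  A morphism is a triple of its domain, its underlying morphism
  and its codomain.
\<close>

definition Mod :: "('o \<times> 'a, ('o \<times> 'a) \<times> 'a \<times> ('o \<times> 'a)) rigid_cat" where
  "Mod = \<lparr>
     Obj = {A. is_module A},
     Arr = {(A, f, B). is_module A \<and> is_module B \<and> linear A B f},
     Dom = (\<lambda>(A, f, B). A),
     Cod = (\<lambda>(A, f, B). B),
     ident = (\<lambda>A. (A, \<langle>fst A\<rangle>, A)),
     cmp = (\<lambda>(B', g, D) (A, f, B). (A, g \<cdot> f, D)),
     tenO = mod_ten,
     tenA = (\<lambda>(A, f, B) (A', f', B'). (mod_ten A A', f \<odot> f', mod_ten B B')),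
     unitO = mod_unit,
     ld = mod_ld,
     rd = mod_rd,
     evl = (\<lambda>A. (mod_ten (mod_ld A) A, evl V (fst A), mod_unit)),
     coevl = (\<lambda>A. (mod_unit, coevl V (fst A), mod_ten A (mod_ld A))),
     evr = (\<lambda>A. (mod_ten A (mod_rd A), evr V (fst A), mod_unit)),
     coevr = (\<lambda>A. (mod_unit, coevr V (fst A), mod_ten (mod_rd A) A))\<rparr>"

definition sharp :: "('o \<Rightarrow> 'a) \<Rightarrow> 'o \<times> 'a \<Rightarrow> 'a" where
  "sharp h = (\<lambda>(M, r)\<in>Obj Mod. r \<cdot> h M)"

end

section \<open>The coend and its structure\<close>

locale coend_data = rigid_data V for V :: "('o, 'a) rigid_cat" (structure) +
  fixes \<sigma> :: "'o \<Rightarrow> 'o \<Rightarrow> 'a" and C :: 'o and \<iota> :: "'o \<Rightarrow> 'a"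
begin

text \<open>
  \<open>cowedge D \<kappa>\<close>: the family \<open>\<kappa> X : ld X \<otimes> X \<rightarrow> D\<close> is dinatural for the functor sending
  \<open>(X, Y)\<close> to \<open>ld X \<otimes> Y\<close>.
\<close>

definition cowedge :: "'o \<Rightarrow> ('o \<Rightarrow> 'a) \<Rightarrow> bool" where
  "cowedge D \<kappa> \<longleftrightarrow>
     (\<forall>X\<in>Obj V. \<kappa> X \<in> hom (ld V X \<otimes> X) D) \<and>
     (\<forall>X\<in>Obj V. \<forall>Y\<in>Obj V. \<forall>f\<in>hom X Y.
        \<kappa> Y \<cdot> (\<langle>ld V Y\<rangle> \<odot> f) = \<kappa> X \<cdot> (ldual_arr f \<odot> \<langle>X\<rangle>))"

definition is_coend :: bool where
  "is_coend \<longleftrightarrow> C \<in> Obj V \<and> cowedge C \<iota> \<and>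
     (\<forall>D\<in>Obj V. \<forall>\<kappa>. cowedge D \<kappa> \<longrightarrow> (\<exists>!g. g \<in> hom C D \<and> (\<forall>X\<in>Obj V. g \<cdot> \<iota> X = \<kappa> X)))"

definition \<delta> :: "'o \<Rightarrow> 'a" where
  "\<delta> X = (\<langle>X\<rangle> \<odot> \<iota> X) \<cdot> (coevl V X \<odot> \<langle>X\<rangle>)"

definition \<delta>2 :: "'o \<Rightarrow> 'o \<Rightarrow> 'a" where
  "\<delta>2 X Y = (\<langle>X\<rangle> \<odot> \<sigma> C Y \<odot> \<langle>C\<rangle>) \<cdot> (\<delta> X \<odot> \<delta> Y)"

definition \<Sigma> :: "'a \<Rightarrow> 'o \<Rightarrow> 'a" where
  "\<Sigma> f = (\<lambda>X\<in>Obj V. (\<langle>X\<rangle> \<odot> f) \<cdot> \<delta> X)"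

definition mC :: 'a where
  "mC = (THE f. f \<in> hom (C \<otimes> C) C \<and>
     (\<forall>X\<in>Obj V. \<forall>Y\<in>Obj V. (\<langle>X \<otimes> Y\<rangle> \<odot> f) \<cdot> \<delta>2 X Y = \<delta> (X \<otimes> Y)))"

definition uC :: 'a where
  "uC = \<delta> \<one>"

definition \<Delta>C :: 'a where
  "\<Delta>C = (THE f. f \<in> hom C (C \<otimes> C) \<and>
     (\<forall>X\<in>Obj V. (\<langle>X\<rangle> \<odot> f) \<cdot> \<delta> X = (\<delta> X \<odot> \<langle>C\<rangle>) \<cdot> \<delta> X))"

definition \<omega> :: 'a where
  "\<omega> = (THE f. f \<in> hom (C \<otimes> C) \<one> \<and>
     (\<forall>X\<in>Obj V. \<forall>Y\<in>Obj V. (\<langle>X \<otimes> Y\<rangle> \<odot> f) \<cdot> \<delta>2 X Y = \<sigma> Y X \<cdot> \<sigma> X Y))"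

definition \<omega>_inv :: 'a where
  "\<omega>_inv = (THE f. f \<in> hom (C \<otimes> C) \<one> \<and>
     (\<forall>X\<in>Obj V. \<forall>Y\<in>Obj V. (\<langle>X \<otimes> Y\<rangle> \<odot> f) \<cdot> \<delta>2 X Y = inv_arr (\<sigma> Y X \<cdot> \<sigma> X Y)))"

end

section \<open>Pivotal, balanced and ribbon elements and R-matrices\<close>

locale hopf_coend_data = hopf_data V \<sigma> HH + coend_data V \<sigma> C \<iota>
  for V :: "('o, 'a) rigid_cat" (structure)
    and \<sigma> :: "'o \<Rightarrow> 'o \<Rightarrow> 'a" and HH :: "('o, 'a) hopf"
    and C :: 'o and \<iota> :: "'o \<Rightarrow> 'a"
begin

definition twisted_grouplike :: "'a \<Rightarrow> bool" where
  "twisted_grouplike p \<longleftrightarrow>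
     \<epsilon> \<cdot> p \<cdot> uC = \<langle>\<one>\<rangle> \<and>
     \<Delta> \<cdot> p \<cdot> mC =
       (((p \<odot> p) \<cdot> (\<langle>C\<rangle> \<odot> \<omega>_inv \<odot> \<langle>C\<rangle>) \<cdot> (\<delta> C \<odot> \<Delta>C)) \<odot> \<omega>)
       \<cdot> (\<langle>C\<rangle> \<odot> \<sigma> C C \<odot> \<langle>C\<rangle>) \<cdot> (\<Delta>C \<odot> \<Delta>C)"

definition CPiv :: "'a set" where
  "CPiv = {p \<in> hom C H. twisted_grouplike p \<and>
     m \<cdot> (\<langle>H\<rangle> \<odot> (p \<cdot> mC)) \<cdot> (\<sigma> C H \<odot> \<langle>C\<rangle>) \<cdot> (\<langle>C\<rangle> \<odot> \<delta> H) =
     m \<cdot> (p \<odot> \<langle>H\<rangle> \<odot> \<omega>) \<cdot> (\<langle>C\<rangle> \<odot> \<sigma> C H \<odot> \<langle>C\<rangle>) \<cdot> (\<Delta>C \<odot> (\<delta> H \<cdot> S \<cdot> S))}"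

definition Rfam :: "'a \<Rightarrow> 'o \<Rightarrow> 'o \<Rightarrow> 'a" where
  "Rfam \<RR> X Y = (\<sigma> X (Y \<otimes> H) \<odot> \<langle>H\<rangle>) \<cdot> (\<langle>X \<otimes> Y\<rangle> \<odot> \<RR>) \<cdot> \<delta>2 X Y"

definition R_matrix :: "'a \<Rightarrow> bool" where
  "R_matrix \<RR> \<longleftrightarrow> \<RR> \<in> hom (C \<otimes> C) (H \<otimes> H) \<and>
     (\<forall>X\<in>Obj V. \<forall>Y\<in>Obj V.
        (\<langle>Y\<rangle> \<odot> m \<odot> \<langle>X\<rangle> \<odot> m) \<cdot> Rfam \<RR> (X \<otimes> H) (Y \<otimes> H)
          \<cdot> (\<langle>X\<rangle> \<odot> \<sigma> Y H \<odot> \<langle>H\<rangle>) \<cdot> (\<langle>X\<rangle> \<odot> \<langle>Y\<rangle> \<odot> \<Delta>)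
        = (\<langle>Y\<rangle> \<odot> m \<odot> \<langle>X\<rangle> \<odot> m) \<cdot> (\<langle>Y\<rangle> \<odot> \<langle>H\<rangle> \<odot> \<sigma> (X \<otimes> H) H \<odot> \<langle>H\<rangle>)
          \<cdot> (Rfam \<RR> X Y \<odot> \<Delta>)) \<and>
     (\<forall>X\<in>Obj V. \<forall>Y\<in>Obj V. \<forall>Z\<in>Obj V.
        (\<langle>Y\<rangle> \<odot> \<sigma> Z H \<odot> \<langle>H\<rangle> \<odot> \<langle>X\<rangle> \<odot> \<langle>H\<rangle>) \<cdot> (\<langle>Y\<rangle> \<odot> \<langle>Z\<rangle> \<odot> \<Delta> \<odot> \<langle>X\<rangle> \<odot> \<langle>H\<rangle>)
          \<cdot> Rfam \<RR> X (Y \<otimes> Z)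
        = (\<langle>Y\<rangle> \<odot> \<langle>H\<rangle> \<odot> \<langle>Z\<rangle> \<odot> \<langle>H\<rangle> \<odot> \<langle>X\<rangle> \<odot> m) \<cdot> (\<langle>Y\<rangle> \<odot> \<langle>H\<rangle> \<odot> Rfam \<RR> (X \<otimes> H) Z)
          \<cdot> (Rfam \<RR> X Y \<odot> \<langle>Z\<rangle>)) \<and>
     (\<forall>X\<in>Obj V. \<forall>Y\<in>Obj V. \<forall>Z\<in>Obj V.
        (\<langle>Z\<rangle> \<odot> \<langle>H\<rangle> \<odot> \<langle>X\<rangle> \<odot> \<sigma> Y H \<odot> \<langle>H\<rangle>) \<cdot> (\<langle>Z\<rangle> \<odot> \<langle>H\<rangle> \<odot> \<langle>X\<rangle> \<odot> \<langle>Y\<rangle> \<odot> \<Delta>)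
          \<cdot> Rfam \<RR> (X \<otimes> Y) Z
        = (\<langle>Z\<rangle> \<odot> m \<odot> \<langle>X\<rangle> \<odot> \<langle>H\<rangle> \<odot> \<langle>Y\<rangle> \<odot> \<langle>H\<rangle>) \<cdot> (Rfam \<RR> X (Z \<otimes> H) \<odot> \<langle>Y\<rangle> \<odot> \<langle>H\<rangle>)
          \<cdot> (\<langle>X\<rangle> \<odot> Rfam \<RR> Y Z)) \<and>
     (\<forall>X\<in>Obj V.
        (\<epsilon> \<odot> \<langle>X\<rangle> \<odot> \<langle>H\<rangle>) \<cdot> Rfam \<RR> X \<one> = \<langle>X\<rangle> \<odot> u \<and>
        (\<langle>X\<rangle> \<odot> \<langle>H\<rangle> \<odot> \<epsilon>) \<cdot> Rfam \<RR> \<one> X = \<langle>X\<rangle> \<odot> u)"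

definition cR :: "'a \<Rightarrow> 'o \<times> 'a \<Rightarrow> 'o \<times> 'a \<Rightarrow> ('o \<times> 'a) \<times> 'a \<times> ('o \<times> 'a)" where
  "cR \<RR> = (\<lambda>(M, r) (N, s).
     (mod_ten (M, r) (N, s), (s \<odot> r) \<cdot> Rfam \<RR> M N, mod_ten (N, s) (M, r)))"

definition L :: "('o \<Rightarrow> 'a) \<Rightarrow> 'o \<Rightarrow> 'a" where
  "L t X = (\<langle>X\<rangle> \<odot> m) \<cdot> t (X \<otimes> H)"

definition CBal :: "'a \<Rightarrow> 'a set" where
  "CBal \<RR> = {t \<in> hom C H.
     m \<cdot> (\<langle>H\<rangle> \<odot> (t \<cdot> mC)) \<cdot> (\<sigma> C H \<odot> \<langle>C\<rangle>) \<cdot> (\<langle>C\<rangle> \<odot> \<delta> H) = m \<cdot> (t \<odot> \<langle>H\<rangle>) \<and>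
     \<epsilon> \<cdot> t \<cdot> uC = \<langle>\<one>\<rangle> \<and>
     (\<forall>X\<in>Obj V. \<forall>Y\<in>Obj V.
        (\<langle>X\<rangle> \<odot> \<sigma> Y H \<odot> \<langle>H\<rangle>) \<cdot> (\<langle>X\<rangle> \<odot> \<langle>Y\<rangle> \<odot> \<Delta>) \<cdot> \<Sigma> t (X \<otimes> Y)
        = (L (\<Sigma> t) X \<odot> L (\<Sigma> t) Y) \<cdot> (\<langle>X\<rangle> \<odot> m \<odot> \<langle>Y\<rangle> \<odot> m)
          \<cdot> Rfam \<RR> (Y \<otimes> H) (X \<otimes> H) \<cdot> Rfam \<RR> X Y)}"

text \<open>
  The antipode on \<open>C\<close>-elements.  The right dual of an endomorphism of \<open>ld M\<close> is an endomorphism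
  of \<open>rd (ld M)\<close>, which is transported to \<open>M\<close> along the canonical isomorphism.
\<close>

definition S_elem :: "'a \<Rightarrow> 'a" where
  "S_elem a = (THE b. b \<in> hom C H \<and>
     (\<forall>A\<in>Obj Mod. sharp (\<Sigma> b) A =
        from_rl (fst A) \<cdot> rdual_arr (sharp (\<Sigma> a) (mod_ld A)) \<cdot> to_rl (fst A)))"

definition CRbn :: "'a \<Rightarrow> 'a set" where
  "CRbn \<RR> = {t \<in> CBal \<RR>. S_elem t = t}"

text \<open>
  The assignments from elements to structures.  Their components, given in \<open>V\<close>, are regarded as
  morphisms of \<^term>\<open>Mod\<close>.
\<close>

definition pivotal_of :: "'a \<Rightarrow> 'o \<times> 'a \<Rightarrow> ('o \<times> 'a) \<times> 'a \<times> ('o \<times> 'a)" where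
  "pivotal_of p = (\<lambda>A\<in>Obj Mod. (A, drinfeld \<sigma> (fst A) \<cdot> sharp (\<Sigma> p) A, mod_rd (mod_rd A)))"

definition endo_of :: "'a \<Rightarrow> 'o \<times> 'a \<Rightarrow> ('o \<times> 'a) \<times> 'a \<times> ('o \<times> 'a)" where
  "endo_of t = (\<lambda>A\<in>Obj Mod. (A, sharp (\<Sigma> t) A, A))"

end

end

theory Submission
  imports Defs
begin

text \<open>
  A \<open>C\<close>-element \<open>t\<close> of \<open>H\<close> and a natural endomorphism \<open>f\<close> of the forgetful functor of the category
  of modules determine each other: \<open>f\<close> is recovered from its values on the free modules \<open>X \<otimes> H\<close>
  restricted to \<open>X\<close>, and these form a natural family \<open>X \<rightarrow> X \<otimes> H\<close>, that is, a morphism \<open>C \<rightarrow> H\<close>.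
  Every axiom on \<open>f\<close> (linearity, compatibility with tensor products and with the unit) can be
  tested on free modules, where the universal property of \<open>C\<close> or \<open>C \<otimes> C\<close> turns it into the
  corresponding axiom on \<open>t\<close>.

  For pivotal structures one divides by the Drinfeld morphism \<open>\<mu>\<close> of \<open>V\<close>.  It is natural and
  invertible, it is monoidal up to the double braiding, and it identifies the action on the double
  dual with the original action twisted by \<open>S \<cdot> S\<close> and the double braiding; these two defects are
  the twists in the definition of a pivotal element.

  Both ribbon conditions say that \<open>\<theta>\<close> on a module and \<open>\<theta>\<close> on its dual are adjoint with respect to
  the evaluation, and the canonical maps from a module to its iterated mixed duals are linear, so
  that naturality of \<open>\<theta>\<close> passes from right duals to left duals and back.

  Equations that hold in every strict monoidal category are proved by reflection: a morphism term
  is read as a list of layers, each a generator at a given position, and two terms are equal if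
  commuting independent layers leads to the same list.
\<close>

section \<open>Coherence in strict monoidal categories\<close>

text \<open>Free modules suffice because an action \<open>r\<close> is itself a linear map from the
  free module on \<open>M\<close> to \<open>M\<close>, split in \<open>V\<close> by
  \<open>\<langle>M\<rangle> \<odot> u\<close>: naturality along \<open>r\<close> carries an
  equation from the free module to \<open>M\<close>. The braiding is not symmetric, so every formula
  depends on the choice of its crossings. The action on a tensor product moves \<open>H\<close> to
  the left of the second factor by \<open>\<sigma> N H\<close>, while \<open>\<delta>2\<close> moves
  \<open>C\<close> to the right of \<open>Y\<close> by \<open>\<sigma> C Y\<close>. Undoing the
  former takes the reverse crossing, and \<open>\<omega>_inv\<close> in the twisted grouplike
  condition exchanges the latter for it. The pairing \<open>\<omega>\<close> stands for the double
  braiding by which \<mu> fails to be monoidal. It enters through \<open>\<Delta>C\<close> because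
  composing natural families amounts to convolving the morphisms on \<open>C\<close> that represent
  them. Dual morphisms, dual actions and \<mu> are handled through their pairings with an
  evaluation. These determine them, and they turn statements about duals into statements about
  crossings.\<close>

text \<open>
  A layer \<open>(k, f, a, b)\<close> applies the morphism \<open>f\<close> from the product of the objects \<open>a\<close> to the product
  of the objects \<open>b\<close>, leaving the first \<open>k\<close> factors and the remaining last factors alone.
\<close>

type_synonym ('a, 'b) layer = "nat \<times> 'b \<times> 'a list \<times> 'a list"

text \<open>
  On connected diagrams \<open>slide_all\<close> leads to a normal form; generators without inputs or outputs may
  need a second pass.  Only its soundness is used.
\<close>

fun slide :: "('a, 'b) layer \<Rightarrow> ('a, 'b) layer list \<Rightarrow> ('a, 'b) layer list" where
  "slide l [] = [l]"
| "slide (k, f, a, b) ((k', g, a', b') # ls) =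
    (if k + length b \<le> k' then (k' - length b + length a, g, a', b') # slide (k, f, a, b) ls
     else (k, f, a, b) # (k', g, a', b') # ls)"

fun slide_all :: "('a, 'b) layer list \<Rightarrow> ('a, 'b) layer list" where
  "slide_all [] = []"
| "slide_all (l # ls) = slide l (slide_all ls)"

fun shift :: "nat \<Rightarrow> ('a, 'b) layer list \<Rightarrow> ('a, 'b) layer list" where
  "shift n [] = []"
| "shift n ((k, f, a, b) # ls) = (n + k, f, a, b) # shift n ls"

lemma shift_shift: "shift n (shift k ls) = shift (n + k) ls"
  by (induction k ls rule: shift.induct) auto

lemma shift_append: "shift n (ls @ ls') = shift n ls @ shift n ls'"
  by (induction n ls rule: shift.induct) auto

lemma shift_0: "shift 0 ls = ls"
  by (induction "0::nat" ls rule: shift.induct) auto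

named_theorems diagram

section \<open>Evaluation and sorting of layer lists\<close>

context rigid_category
begin

lemma hom_obj: "f \<in> hom X Y \<Longrightarrow> X \<in> Obj V" "f \<in> hom X Y \<Longrightarrow> Y \<in> Obj V"
  using dom_obj cod_obj unfolding hom_def by auto

lemma hom_arr: "f \<in> hom X Y \<Longrightarrow> f \<in> Arr V"
  unfolding hom_def by auto

lemma hom_dom_cod: "f \<in> hom X Y \<Longrightarrow> Dom V f = X" "f \<in> hom X Y \<Longrightarrow> Cod V f = Y"
  unfolding hom_def by auto

definition wires :: "'a list \<Rightarrow> 'a" where
  "wires xs = foldr (\<lambda>X Y. X \<otimes> Y) xs \<one>"

abbreviation objs :: "'a list \<Rightarrow> bool" where
  "objs xs \<equiv> set xs \<subseteq> Obj V"

lemma wires_simps [simp]: "wires [] = \<one>" "wires (X # xs) = X \<otimes> wires xs"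
  unfolding wires_def by simp_all

lemma wires_obj: "objs xs \<Longrightarrow> wires xs \<in> Obj V"
  by (induction xs) (auto simp: unit_obj ten_obj)

lemma wires_append: "objs xs \<Longrightarrow> objs ys \<Longrightarrow> wires (xs @ ys) = wires xs \<otimes> wires ys"
  by (induction xs) (auto simp: ten_unit ten_assoc wires_obj)

text \<open>Evaluation is a relation, since a list makes sense only if every layer fits the factors
  present when it is reached. The head of the list is applied before the tail, and the number in a
  layer is the count \<open>length u\<close> of untouched factors on the left; the factors
  \<open>w\<close> on the right stay implicit.\<close>

inductive run :: "'a list \<Rightarrow> ('a, 'b) layer list \<Rightarrow> 'a list \<Rightarrow> 'b \<Rightarrow> bool" where
  run_Nil: "objs xs \<Longrightarrow> run xs [] xs \<langle>wires xs\<rangle>"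
| run_Cons: "f \<in> hom (wires a) (wires b) \<Longrightarrow> objs u \<Longrightarrow> objs a \<Longrightarrow> objs b \<Longrightarrow> objs w
    \<Longrightarrow> run (u @ b @ w) ls ys h
    \<Longrightarrow> run (u @ a @ w) ((length u, f, a, b) # ls) ys (h \<cdot> (\<langle>wires u\<rangle> \<odot> f \<odot> \<langle>wires w\<rangle>))"

lemma whisker_hom:
  "f \<in> hom (wires a) (wires b) \<Longrightarrow> objs u \<Longrightarrow> objs a \<Longrightarrow> objs b \<Longrightarrow> objs w \<Longrightarrow>
   \<langle>wires u\<rangle> \<odot> f \<odot> \<langle>wires w\<rangle> \<in> hom (wires (u @ a @ w)) (wires (u @ b @ w))"
  by (simp add: wires_append ten_hom ident_hom wires_obj)

lemma run_hom: "run xs ls ys h \<Longrightarrow> objs xs \<and> objs ys \<and> h \<in> hom (wires xs) (wires ys)"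
proof (induction rule: run.induct)
  case (run_Nil xs)
  then show ?case by (simp add: ident_hom wires_obj)
next
  case (run_Cons f a b u w ls ys h)
  then show ?case
    using cmp_hom[OF whisker_hom[of f a b u w], of h "wires ys"] by auto
qed

text \<open>A layer records its position and its inputs, which fixes the splitting
  \<open>u @ a @ w\<close>, so a list has at most one value. This is what turns equality of lists
  into equality of morphisms.\<close>

lemma run_unique: "run xs ls ys h \<Longrightarrow> run xs ls ys' h' \<Longrightarrow> ys' = ys \<and> h' = h"
proof (induction arbitrary: ys' h' rule: run.induct)
  case (run_Nil xs)
  then show ?case by (auto elim: run.cases)
next
  case (run_Cons f a b u w ls ys h)
  from run_Cons.prems show ?case
  proof (cases rule: run.cases)
    case (run_Cons u' w' h'')
    then show ?thesis using run_Cons.IH by auto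
  qed
qed

lemma run_append: "run xs ls ys h \<Longrightarrow> run ys ls' zs h' \<Longrightarrow> run xs (ls @ ls') zs (h' \<cdot> h)"
proof (induction rule: run.induct)
  case (run_Nil xs)
  then show ?case using run_hom ident_right by fastforce
next
  case (run_Cons f a b u w ls ys h)
  have "h \<in> hom (wires (u @ b @ w)) (wires ys)" "h' \<in> hom (wires ys) (wires zs)"
    using run_hom run_Cons by blast+
  then have "(h' \<cdot> h) \<cdot> (\<langle>wires u\<rangle> \<odot> f \<odot> \<langle>wires w\<rangle>) = h' \<cdot> (h \<cdot> (\<langle>wires u\<rangle> \<odot> f \<odot> \<langle>wires w\<rangle>))"
    using cmp_assoc whisker_hom run_Cons.hyps by metis
  then show ?case
    using run.run_Cons[OF run_Cons.hyps(1-5) run_Cons.IH[OF run_Cons.prems]] by simp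
qed

lemma ten_cmp_ident:
  assumes "f \<in> hom X Y" "g \<in> hom Y Z" "A \<in> Obj V"
  shows "\<langle>A\<rangle> \<odot> (g \<cdot> f) = (\<langle>A\<rangle> \<odot> g) \<cdot> (\<langle>A\<rangle> \<odot> f)" "(g \<cdot> f) \<odot> \<langle>A\<rangle> = (g \<odot> \<langle>A\<rangle>) \<cdot> (f \<odot> \<langle>A\<rangle>)"
  using ten_cmp[OF ident_hom ident_hom assms(1,2)] ten_cmp[OF assms(1,2) ident_hom ident_hom] assms
    ident_left[OF ident_hom] by metis+

lemma ten_interchange:
  assumes "f \<in> hom X Y" "g \<in> hom X' Y'"
  shows "f \<odot> g = (f \<odot> \<langle>Y'\<rangle>) \<cdot> (\<langle>X\<rangle> \<odot> g)" "f \<odot> g = (\<langle>Y\<rangle> \<odot> g) \<cdot> (f \<odot> \<langle>X'\<rangle>)"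
proof -
  note i = ident_hom[OF hom_obj(1)[OF assms(1)]] ident_hom[OF hom_obj(2)[OF assms(2)]]
    ident_hom[OF hom_obj(2)[OF assms(1)]] ident_hom[OF hom_obj(1)[OF assms(2)]]
  show "f \<odot> g = (f \<odot> \<langle>Y'\<rangle>) \<cdot> (\<langle>X\<rangle> \<odot> g)"
    using ten_cmp[OF i(1) assms(1) assms(2) i(2)] ident_left ident_right assms by metis
  show "f \<odot> g = (\<langle>Y\<rangle> \<odot> g) \<cdot> (f \<odot> \<langle>X'\<rangle>)"
    using ten_cmp[OF assms(1) i(3) i(4) assms(2)] ident_left ident_right assms by metis
qed

text \<open>Layers count only the untouched factors on the left. Extra factors on the right
  therefore change no layer, and extra factors on the left change only the positions.\<close>

lemma run_whisker:
  "run xs ls ys h \<Longrightarrow> objs u \<Longrightarrow> objs w \<Longrightarrow>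
   run (u @ xs @ w) (shift (length u) ls) (u @ ys @ w) (\<langle>wires u\<rangle> \<odot> h \<odot> \<langle>wires w\<rangle>)"
proof (induction rule: run.induct)
  case (run_Nil xs)
  then show ?case
    using run.run_Nil[of "u @ xs @ w"] by (simp add: ten_ident wires_append wires_obj ten_obj)
next
  case (run_Cons f a b u' w' ls ys h)
  let ?U = "wires u" and ?W = "wires w" and ?f = "\<langle>wires u'\<rangle> \<odot> f \<odot> \<langle>wires w'\<rangle>"
  have o: "?U \<in> Obj V" "?W \<in> Obj V" "wires u' \<in> Obj V" "wires w' \<in> Obj V"
    using run_Cons by (auto simp: wires_obj)
  have h: "h \<in> hom (wires (u' @ b @ w')) (wires ys)" using run_hom run_Cons by blast
  have f: "?f \<in> hom (wires (u' @ a @ w')) (wires (u' @ b @ w'))"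
    using whisker_hom run_Cons by blast
  have "\<langle>?U\<rangle> \<odot> (h \<cdot> ?f) \<odot> \<langle>?W\<rangle> = (\<langle>?U\<rangle> \<odot> h \<odot> \<langle>?W\<rangle>) \<cdot> (\<langle>?U\<rangle> \<odot> ?f \<odot> \<langle>?W\<rangle>)"
    using ten_cmp_ident(2)[OF f h o(2)]
      ten_cmp_ident(1)[OF ten_hom[OF f ident_hom[OF o(2)]] ten_hom[OF h ident_hom[OF o(2)]] o(1)]
    by simp
  also have "\<langle>?U\<rangle> \<odot> ?f \<odot> \<langle>?W\<rangle> = \<langle>wires (u @ u')\<rangle> \<odot> f \<odot> \<langle>wires (w' @ w)\<rangle>"
    using o run_Cons.hyps run_Cons.prems
      hom_arr[OF run_Cons.hyps(1)] hom_arr[OF ident_hom]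
      hom_arr[OF ten_hom[OF run_Cons.hyps(1) ident_hom]]
      hom_arr[OF ten_hom[OF run_Cons.hyps(1) ten_hom[OF ident_hom ident_hom]]]
    by (simp add: wires_append ten_ident[symmetric] ten_assoc_arr)
  finally show ?case
    using run.run_Cons[of f a b "u @ u'" "w' @ w" "shift (length u) ls" "u @ ys @ w"
        "\<langle>?U\<rangle> \<odot> h \<odot> \<langle>?W\<rangle>"] run_Cons by auto
qed

text \<open>The interchange law for two generators on disjoint factors. The condition says that the
  inputs of \<open>g\<close> begin to the right of all outputs of \<open>f\<close>; when
  \<open>g\<close> comes earlier, the inputs of \<open>f\<close> still stand in their place, which
  changes the position of \<open>g\<close> by the difference of the two lengths.\<close>

lemma run_swap:
  assumes "run xs ((k, f, a, b) # (k', g, a', b') # ls) ys h" "k + length b \<le> k'"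
  shows "run xs ((k' - length b + length a, g, a', b') # (k, f, a, b) # ls) ys h"
  using assms(1)
proof (cases rule: run.cases)
  case (run_Cons u w h1)
  from run_Cons(9) show ?thesis
  proof (cases rule: run.cases)
    case i: (run_Cons u' w' h2)
    \<comment> \<open>\<open>v\<close> collects the factors strictly between the outputs of
      \<open>f\<close> and the inputs of \<open>g\<close>. The positions force \<open>u'\<close> to
      begin with \<open>u @ b\<close>.\<close>
    define v where "v = drop (length u + length b) u'"
    have "take (length u + length b) (u' @ a' @ w') = u @ b"
      using i(1) by (metis append.assoc append_eq_conv_conj length_append)
    then have "take (length u + length b) u' = u @ b"
      using assms(2) i(2) run_Cons(1-4) by simp
    then have u': "u' = u @ b @ v"
      unfolding v_def by (metis append.assoc append_take_drop_id)
    then have w: "w = v @ a' @ w'" using i(1) by simp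
    have v: "objs v" using i u' by auto
    let ?u = "wires u" and ?v = "wires v" and ?w = "wires w'"
    have o: "?u \<in> Obj V" "?v \<in> Obj V" "?w \<in> Obj V" using wires_obj run_Cons i v by auto
    have o': "wires a \<in> Obj V" "wires b \<in> Obj V" "wires a' \<in> Obj V" "wires b' \<in> Obj V"
      using wires_obj run_Cons i by auto
    have f: "f \<in> hom (wires a) (wires b)" and g: "g \<in> hom (wires a') (wires b')"
      using run_Cons i by auto
    have ar: "f \<in> Arr V" "g \<in> Arr V" "\<langle>?u\<rangle> \<in> Arr V" "\<langle>?v\<rangle> \<in> Arr V" "\<langle>?w\<rangle> \<in> Arr V"
      "\<langle>wires a\<rangle> \<in> Arr V" "\<langle>wires b\<rangle> \<in> Arr V" "\<langle>wires a'\<rangle> \<in> Arr V" "\<langle>wires b'\<rangle> \<in> Arr V"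
      using f g hom_arr ident_hom o o' by blast+
    have at: "\<And>x y. x \<in> Arr V \<Longrightarrow> y \<in> Arr V \<Longrightarrow> x \<odot> y \<in> Arr V"
      using ten_hom hom_arr unfolding hom_def by blast
    have gv: "\<langle>?v\<rangle> \<odot> g \<odot> \<langle>?w\<rangle> \<in> hom (?v \<otimes> wires a' \<otimes> ?w) (?v \<otimes> wires b' \<otimes> ?w)"
      using g o ten_hom ident_hom by blast
    have fh: "\<langle>?u\<rangle> \<odot> f \<in> hom (?u \<otimes> wires a) (?u \<otimes> wires b)"
      using f o ten_hom ident_hom by blast
    have "(\<langle>wires u'\<rangle> \<odot> g \<odot> \<langle>?w\<rangle>) \<cdot> (\<langle>?u\<rangle> \<odot> f \<odot> \<langle>wires w\<rangle>) = (\<langle>?u\<rangle> \<odot> f) \<odot> (\<langle>?v\<rangle> \<odot> g \<odot> \<langle>?w\<rangle>)"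
      unfolding ten_interchange(2)[OF fh gv] using u' w o o' v i run_Cons ar at
      by (simp add: wires_append ten_ident[symmetric] ten_assoc_arr ten_obj)
    moreover have "(\<langle>?u\<rangle> \<odot> f) \<odot> (\<langle>?v\<rangle> \<odot> g \<odot> \<langle>?w\<rangle>) =
      (\<langle>?u\<rangle> \<odot> f \<odot> \<langle>wires (v @ b' @ w')\<rangle>) \<cdot> (\<langle>wires (u @ a @ v)\<rangle> \<odot> g \<odot> \<langle>?w\<rangle>)"
      unfolding ten_interchange(1)[OF fh gv] using u' w o o' v i run_Cons ar at
      by (simp add: wires_append ten_ident[symmetric] ten_assoc_arr ten_obj)
    ultimately have eq: "(\<langle>wires u'\<rangle> \<odot> g \<odot> \<langle>?w\<rangle>) \<cdot> (\<langle>?u\<rangle> \<odot> f \<odot> \<langle>wires w\<rangle>) =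
      (\<langle>?u\<rangle> \<odot> f \<odot> \<langle>wires (v @ b' @ w')\<rangle>) \<cdot> (\<langle>wires (u @ a @ v)\<rangle> \<odot> g \<odot> \<langle>?w\<rangle>)" by simp
    have h2: "h2 \<in> hom (wires (u' @ b' @ w')) (wires ys)" using run_hom i by blast
    have 1: "\<langle>wires u'\<rangle> \<odot> g \<odot> \<langle>?w\<rangle> \<in> hom (wires (u' @ a' @ w')) (wires (u' @ b' @ w'))"
      using whisker_hom i by blast
    have 2: "\<langle>?u\<rangle> \<odot> f \<odot> \<langle>wires w\<rangle> \<in> hom (wires (u @ a @ w)) (wires (u' @ a' @ w'))"
      using whisker_hom[of f a b u w] run_Cons i(1) by auto
    have 3: "\<langle>?u\<rangle> \<odot> f \<odot> \<langle>wires (v @ b' @ w')\<rangle>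
        \<in> hom (wires (u @ a @ v @ b' @ w')) (wires (u' @ b' @ w'))"
      using whisker_hom[of f a b u "v @ b' @ w'"] run_Cons i v u' by auto
    have 4: "\<langle>wires (u @ a @ v)\<rangle> \<odot> g \<odot> \<langle>?w\<rangle> \<in> hom (wires (u @ a @ w)) (wires (u @ a @ v @ b' @ w'))"
      using whisker_hom[of g a' b' "u @ a @ v" w'] run_Cons i v w by auto
    have "h = (h2 \<cdot> (\<langle>wires u'\<rangle> \<odot> g \<odot> \<langle>?w\<rangle>)) \<cdot> (\<langle>?u\<rangle> \<odot> f \<odot> \<langle>wires w\<rangle>)"
      using run_Cons(3) i(3) by simp
    also have "\<dots> = (h2 \<cdot> (\<langle>?u\<rangle> \<odot> f \<odot> \<langle>wires (v @ b' @ w')\<rangle>)) \<cdot> (\<langle>wires (u @ a @ v)\<rangle> \<odot> g \<odot> \<langle>?w\<rangle>)"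
      using cmp_assoc[OF 2 1 h2] cmp_assoc[OF 4 3 h2] eq by simp
    finally have h: "h = \<dots>" .
    have "run (u @ b @ v @ b' @ w') ls ys h2" using i u' by simp
    from run.run_Cons[OF f run_Cons(5,6,7) _ this]
    have "run (u @ a @ v @ b' @ w') ((length u, f, a, b) # ls) ys
      (h2 \<cdot> (\<langle>?u\<rangle> \<odot> f \<odot> \<langle>wires (v @ b' @ w')\<rangle>))" using v i by simp
    then have "run (u @ a @ v @ a' @ w')
      ((length (u @ a @ v), g, a', b') # (length u, f, a, b) # ls) ys h"
      unfolding h using run.run_Cons[OF g, of "u @ a @ v" w'] v i run_Cons by auto
    moreover have "length (u @ a @ v) = k' - length b + length a"
      using u' i(2) by simp
    ultimately show ?thesis using run_Cons(1,2) w by (simp del: length_append)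
  qed
qed

text \<open>The factors produced by the head layer do not depend on what follows, so another tail
  with the same value may be put in its place. This is how sorting acts below the head.\<close>

lemma run_ConsE:
  assumes "run xs (l # ls) ys h"
  obtains zs h1 where "run zs ls ys h1"
    "\<And>ls'. run zs ls' ys h1 \<Longrightarrow> run xs (l # ls') ys h"
  using assms
proof (cases rule: run.cases)
  case (run_Cons f a b u w h)
  then show ?thesis using that run.run_Cons by metis
qed

lemma run_slide: "run xs (l # ls) ys h \<Longrightarrow> run xs (slide l ls) ys h"
proof (induction l ls arbitrary: xs h rule: slide.induct)
  case (1 l)
  then show ?case by simp
next
  case (2 k f a b k' g a' b' ls)
  show ?case
  proof (cases "k + length b \<le> k'")
    case True
    from run_swap[OF 2(2) True] show ?thesis
      by (rule run_ConsE) (use 2(1)[OF True] True in auto)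
  next
    case False
    then show ?thesis using 2(2) by simp
  qed
qed

lemma run_slide_all: "run xs ls ys h \<Longrightarrow> run xs (slide_all ls) ys h"
proof (induction ls arbitrary: xs h)
  case (Cons l ls)
  from Cons(2) have "run xs (l # slide_all ls) ys h"
    by (rule run_ConsE) (use Cons(1) in auto)
  then show ?case using run_slide by simp
qed simp

text \<open>
  Difference lists (\<open>(@) xs\<close> for \<open>xs\<close>, and layers as a function of their position) let resolution
  with the rules \<open>diagram\<close> assemble the layers of a morphism term without evaluating list
  operations.  Objects that are not to be decomposed are marked by \<open>atom\<close>; the rules are tried in
  the order of their declaration, so those for products come first.
\<close>

definition object :: "'a \<Rightarrow> ('a list \<Rightarrow> 'a list) \<Rightarrow> bool" where
  "object A X \<longleftrightarrow> (\<exists>xs. X = (@) xs \<and> objs xs \<and> A = wires xs)"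

definition diagram ::
  "'b \<Rightarrow> ('a list \<Rightarrow> 'a list) \<Rightarrow> ('a list \<Rightarrow> 'a list) \<Rightarrow>
   (nat \<Rightarrow> ('a, 'b) layer list \<Rightarrow> ('a, 'b) layer list) \<Rightarrow> bool" where
  "diagram f X Y L \<longleftrightarrow> (\<exists>xs ys ls. X = (@) xs \<and> Y = (@) ys \<and> run xs ls ys f \<and>
     L = (\<lambda>k t. shift k ls @ t))"

definition atom :: "'a \<Rightarrow> bool" where
  "atom A \<longleftrightarrow> A \<in> Obj V"

text \<open>Equality of difference lists, kept as a goal of its own: in \<open>diagram_cmp\<close>
  the target of \<open>f\<close> and the source of \<open>g\<close> are both found by resolution
  before they are compared, so that no known list has to be unified with a pattern such as
  \<open>\<lambda>t. X (X' t)\<close>.\<close>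

definition agree :: "('a list \<Rightarrow> 'a list) \<Rightarrow> ('a list \<Rightarrow> 'a list) \<Rightarrow> bool" where
  "agree X Y \<longleftrightarrow> X = Y"

lemma agree_refl [diagram]: "agree X X"
  unfolding agree_def ..

lemma atomI: "A \<in> Obj V \<Longrightarrow> atom A"
  unfolding atom_def .

lemma atom_obj: "atom A \<Longrightarrow> A \<in> Obj V"
  unfolding atom_def .

lemma object_atom: "atom A \<Longrightarrow> object A (\<lambda>t. A # t)"
  unfolding object_def atom_def by (intro exI[of _ "[A]"]) (auto simp: ten_unit)

lemma object_ten [diagram]: "object A X \<Longrightarrow> object B Y \<Longrightarrow> object (A \<otimes> B) (\<lambda>t. X (Y t))"
  unfolding object_def
  proof (elim exE conjE)
    fix xs ys
    assume "X = (@) xs" "objs xs" "A = wires xs" "Y = (@) ys" "objs ys" "B = wires ys"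
    then show "\<exists>zs. (\<lambda>t. X (Y t)) = (@) zs \<and> objs zs \<and> A \<otimes> B = wires zs"
      by (intro exI[of _ "xs @ ys"]) (auto simp: wires_append)
  qed

lemma object_unit [diagram]: "object \<one> (\<lambda>t. t)"
  unfolding object_def by (intro exI[of _ "[]"]) auto

lemma atom_duals [diagram]: "X \<in> Obj V \<Longrightarrow> atom (ld V X)" "X \<in> Obj V \<Longrightarrow> atom (rd V X)"
  unfolding atom_def by (rule ld_obj rd_obj, assumption)+

lemmas [diagram] = object_atom ten_obj unit_obj atom_obj

lemma diagramI:
  "X = (@) xs \<Longrightarrow> Y = (@) ys \<Longrightarrow> run xs ls ys f \<Longrightarrow> (\<And>k t. L k t = shift k ls @ t) \<Longrightarrow>
   diagram f X Y L"
  unfolding diagram_def by blast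

text \<open>Applying a difference list to \<open>[]\<close> gives back the list that a layer stores.
  Source and target may be products, so one generator can have several inputs and outputs.\<close>

lemma diagram_gen:
  assumes "f \<in> hom A B" "object A X" "object B Y"
  shows "diagram f X Y (\<lambda>k t. (k, f, X [], Y []) # t)"
proof -
  obtain xs ys where [simp]: "X = (@) xs" "objs xs" "A = wires xs" "Y = (@) ys" "objs ys"
    "B = wires ys"
    using assms(2,3) unfolding object_def by auto
  have "\<langle>\<one>\<rangle> \<odot> f \<odot> \<langle>\<one>\<rangle> = f" "\<langle>wires ys\<rangle> \<cdot> f = f"
    using assms(1) hom_arr ten_unit_arr ident_left by auto
  then have "run xs [(0, f, xs, ys)] ys f"
    using run.run_Cons[of f xs ys "[]" "[]" "[]" ys "\<langle>wires ys\<rangle>"] run_Nil[of ys] assms(1) by simp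
  then show ?thesis
    by (intro diagramI[of _ xs _ ys "[(0, f, xs, ys)]"]) auto
qed

lemma diagram_ident [diagram]: "object A X \<Longrightarrow> diagram \<langle>A\<rangle> X X (\<lambda>k t. t)"
  unfolding object_def diagram_def using run_Nil by fastforce

lemma diagram_cmp [diagram]:
  "diagram f X Y L \<Longrightarrow> diagram g Y' Z L' \<Longrightarrow> agree Y' Y \<Longrightarrow> diagram (g \<cdot> f) X Z (\<lambda>k t. L k (L' k t))"
  unfolding diagram_def[of f] diagram_def[of g] agree_def
  proof (elim exE conjE)
    fix xs ys ls ys' zs ls'
    assume *: "X = (@) xs" "Y = (@) ys" "run xs ls ys f" "L = (\<lambda>k t. shift k ls @ t)"
      "Y' = (@) ys'" "Z = (@) zs" "run ys' ls' zs g" "L' = (\<lambda>k t. shift k ls' @ t)" "Y' = Y"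
    have "ys' = ys"
      using fun_cong[OF trans[OF trans[OF *(5)[symmetric] *(9)] *(2)], of "[]"] by simp
    then have "run xs (ls @ ls') zs (g \<cdot> f)" using run_append *(3,7) by blast
    then show "diagram (g \<cdot> f) X Z (\<lambda>k t. L k (L' k t))"
      using * by (intro diagramI[of _ xs _ zs "ls @ ls'"]) (auto simp: shift_append)
  qed

text \<open>The layers of \<open>f\<close> are executed before those of \<open>g\<close>, so
  positions in \<open>g\<close> are counted behind the outputs of \<open>f\<close>. This is the
  origin of \<open>k + length (Y [])\<close>.\<close>

lemma diagram_ten [diagram]:
  assumes "diagram f X Y L" "diagram g X' Y' L'"
  shows "diagram (f \<odot> g) (\<lambda>t. X (X' t)) (\<lambda>t. Y (Y' t)) (\<lambda>k t. L k (L' (k + length (Y [])) t))"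
proof -
  obtain xs ys ls xs' ys' ls' where *: "X = (@) xs" "Y = (@) ys" "run xs ls ys f"
    "L = (\<lambda>k t. shift k ls @ t)" "X' = (@) xs'" "Y' = (@) ys'" "run xs' ls' ys' g"
    "L' = (\<lambda>k t. shift k ls' @ t)"
    using assms unfolding diagram_def by blast
  note h = run_hom[OF *(3)] run_hom[OF *(7)]
  then have a: "f \<in> hom (wires xs) (wires ys)" "g \<in> hom (wires xs') (wires ys')"
    and o: "objs xs" "objs ys" "objs xs'" "objs ys'" by auto
  have "run (xs @ xs') ls (ys @ xs') (f \<odot> \<langle>wires xs'\<rangle>)"
    using run_whisker[OF *(3), of "[]" "xs'"] o a ten_hom[OF a(1) ident_hom[of "wires xs'"]]
      hom_arr ten_unit_arr wires_obj by (simp add: shift_0)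
  moreover have "run (ys @ xs') (shift (length ys) ls') (ys @ ys') (\<langle>wires ys\<rangle> \<odot> g)"
    using run_whisker[OF *(7), of ys "[]"] o a hom_arr ten_unit_arr by simp
  ultimately have "run (xs @ xs') (ls @ shift (length ys) ls') (ys @ ys') (f \<odot> g)"
    using ten_interchange(2)[OF a] run_append by metis
  then show ?thesis
    unfolding * by (intro diagramI[of _ "xs @ xs'" _ "ys @ ys'" "ls @ shift (length ys) ls'"])
      (auto simp: shift_append shift_shift)
qed

text \<open>Sorting preserves the value of a list and values are unique, so equal sorted lists force
  equal morphisms. The last premise is a computation with lists; it is the goal left to
  \<open>simp\<close> wherever a step ends in \<open>(rule diagram)+, simp\<close>.\<close>

lemma coherence:
  assumes "diagram f X Y L" "diagram g X' Y' L'" "agree X' X" "agree Y' Y"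
    "slide_all (slide_all (L 0 [])) = slide_all (slide_all (L' 0 []))"
  shows "f = g"
proof -
  note assms = assms[unfolded agree_def]
  obtain xs ys ls xs' ys' ls' where *: "X = (@) xs" "Y = (@) ys" "run xs ls ys f"
    "L = (\<lambda>k t. shift k ls @ t)" "X' = (@) xs'" "Y' = (@) ys'" "run xs' ls' ys' g"
    "L' = (\<lambda>k t. shift k ls' @ t)"
    using assms unfolding diagram_def by blast
  have "xs' = xs"
    using fun_cong[OF trans[OF trans[OF *(5)[symmetric] assms(3)] *(1)], of "[]"] by simp
  moreover have "slide_all (slide_all ls) = slide_all (slide_all ls')"
    using assms(5) * by (simp add: shift_0)
  ultimately show ?thesis
    using run_unique run_slide_all[OF run_slide_all[OF *(3)]]
      run_slide_all[OF run_slide_all[OF *(7)]] by metis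
qed

lemmas [diagram] = coherence

text \<open>The typing of a composite is read off from the same assembled list of layers; only its
  two ends are compared with the claimed source and target.\<close>

lemma diagram_hom:
  assumes "diagram f X Y L" "object A X'" "object B Y'" "agree X' X" "agree Y' Y"
  shows "f \<in> hom A B"
proof -
  note assms = assms[unfolded agree_def]
  obtain xs ys ls xs' ys' where *: "X = (@) xs" "Y = (@) ys" "run xs ls ys f"
    "X' = (@) xs'" "A = wires xs'" "Y' = (@) ys'" "B = wires ys'"
    using assms(1-3) unfolding diagram_def object_def by blast
  have "xs' = xs"
    using fun_cong[OF trans[OF trans[OF *(4)[symmetric] assms(4)] *(1)], of "[]"] by simp
  moreover have "ys' = ys"
    using fun_cong[OF trans[OF trans[OF *(6)[symmetric] assms(5)] *(2)], of "[]"] by simp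
  ultimately show ?thesis using run_hom[OF *(3)] * by simp
qed

end

section \<open>Duals\<close>

context rigid_category
begin

lemmas [diagram] = evl_hom[THEN diagram_gen] coevl_hom[THEN diagram_gen]
  evr_hom[THEN diagram_gen] coevr_hom[THEN diagram_gen]

text \<open>Transposition is injective: the snake identity recovers a morphism into
  \<open>rd V X\<close> from its pairing by bending \<open>X\<close> back with \<open>coevr\<close>.
  The next three lemmas are the variants for left duals and for morphisms into \<open>X\<close>
  itself.\<close>

lemma into_rd_eqI:
  assumes X: "X \<in> Obj V" and f: "f \<in> hom W (rd V X)" and g: "g \<in> hom W (rd V X)"
    and eq: "evr V X \<cdot> \<langle>X\<rangle> \<odot> f = evr V X \<cdot> \<langle>X\<rangle> \<odot> g"
  shows "f = g"
proof -
  note [diagram] = X[THEN atomI] hom_obj(1)[OF f, THEN atomI]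
  have *: "h = \<langle>rd V X\<rangle> \<odot> (evr V X \<cdot> \<langle>X\<rangle> \<odot> h) \<cdot> coevr V X \<odot> \<langle>W\<rangle>"
    if h: "h \<in> hom W (rd V X)" for h
  proof -
    note [diagram] = h[THEN diagram_gen]
    have "h = (\<langle>rd V X\<rangle> \<odot> evr V X \<cdot> coevr V X \<odot> \<langle>rd V X\<rangle>) \<cdot> h"
      unfolding snake_r2[OF X] by ((rule diagram)+, simp)
    also have "\<dots> = \<langle>rd V X\<rangle> \<odot> (evr V X \<cdot> \<langle>X\<rangle> \<odot> h) \<cdot> coevr V X \<odot> \<langle>W\<rangle>"
      by ((rule diagram)+, simp)
    finally show ?thesis .
  qed
  show ?thesis using *[OF f] *[OF g] eq by simp
qed

lemma into_ld_eqI: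
  assumes X: "X \<in> Obj V" and f: "f \<in> hom W (ld V X)" and g: "g \<in> hom W (ld V X)"
    and eq: "evl V X \<cdot> f \<odot> \<langle>X\<rangle> = evl V X \<cdot> g \<odot> \<langle>X\<rangle>"
  shows "f = g"
proof -
  note [diagram] = X[THEN atomI] hom_obj(1)[OF f, THEN atomI]
  have *: "h = (evl V X \<cdot> h \<odot> \<langle>X\<rangle>) \<odot> \<langle>ld V X\<rangle> \<cdot> \<langle>W\<rangle> \<odot> coevl V X"
    if h: "h \<in> hom W (ld V X)" for h
  proof -
    note [diagram] = h[THEN diagram_gen]
    have "h = (evl V X \<odot> \<langle>ld V X\<rangle> \<cdot> \<langle>ld V X\<rangle> \<odot> coevl V X) \<cdot> h"
      unfolding snake_l2[OF X] by ((rule diagram)+, simp)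
    also have "\<dots> = (evl V X \<cdot> h \<odot> \<langle>X\<rangle>) \<odot> \<langle>ld V X\<rangle> \<cdot> \<langle>W\<rangle> \<odot> coevl V X"
      by ((rule diagram)+, simp)
    finally show ?thesis .
  qed
  show ?thesis using *[OF f] *[OF g] eq by simp
qed

lemma evl_eqI:
  assumes X: "X \<in> Obj V" and f: "f \<in> hom W X" and g: "g \<in> hom W X"
    and eq: "evl V X \<cdot> \<langle>ld V X\<rangle> \<odot> f = evl V X \<cdot> \<langle>ld V X\<rangle> \<odot> g"
  shows "f = g"
proof -
  note [diagram] = X[THEN atomI] hom_obj(1)[OF f, THEN atomI]
  have *: "h = \<langle>X\<rangle> \<odot> (evl V X \<cdot> \<langle>ld V X\<rangle> \<odot> h) \<cdot> coevl V X \<odot> \<langle>W\<rangle>" if h: "h \<in> hom W X" for h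
  proof -
    note [diagram] = h[THEN diagram_gen]
    have "h = (\<langle>X\<rangle> \<odot> evl V X \<cdot> coevl V X \<odot> \<langle>X\<rangle>) \<cdot> h"
      unfolding snake_l1[OF X] by ((rule diagram)+, simp)
    also have "\<dots> = \<langle>X\<rangle> \<odot> (evl V X \<cdot> \<langle>ld V X\<rangle> \<odot> h) \<cdot> coevl V X \<odot> \<langle>W\<rangle>"
      by ((rule diagram)+, simp)
    finally show ?thesis .
  qed
  show ?thesis using *[OF f] *[OF g] eq by simp
qed

lemma evr_eqI:
  assumes X: "X \<in> Obj V" and f: "f \<in> hom W X" and g: "g \<in> hom W X"
    and eq: "evr V X \<cdot> f \<odot> \<langle>rd V X\<rangle> = evr V X \<cdot> g \<odot> \<langle>rd V X\<rangle>"
  shows "f = g"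
proof -
  note [diagram] = X[THEN atomI] hom_obj(1)[OF f, THEN atomI]
  have *: "h = (evr V X \<cdot> h \<odot> \<langle>rd V X\<rangle>) \<odot> \<langle>X\<rangle> \<cdot> \<langle>W\<rangle> \<odot> coevr V X" if h: "h \<in> hom W X" for h
  proof -
    note [diagram] = h[THEN diagram_gen]
    have "h = (evr V X \<odot> \<langle>X\<rangle> \<cdot> \<langle>X\<rangle> \<odot> coevr V X) \<cdot> h"
      unfolding snake_r1[OF X] by ((rule diagram)+, simp)
    also have "\<dots> = (evr V X \<cdot> h \<odot> \<langle>rd V X\<rangle>) \<odot> \<langle>X\<rangle> \<cdot> \<langle>W\<rangle> \<odot> coevr V X"
      by ((rule diagram)+, simp)
    finally show ?thesis .
  qed
  show ?thesis using *[OF f] *[OF g] eq by simp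
qed

text \<open>The snake identity makes \<open>rdual_arr f\<close> the adjoint of \<open>f\<close> for
  the pairing \<open>evr\<close>. This adjointness is the form in which dual morphisms enter the
  later equations; \<open>ldual_arr\<close> is the mirror image.\<close>

lemma rdual_arr:
  assumes f: "f \<in> hom X Y"
  shows rdual_arr_eq: "rdual_arr f =
      \<langle>rd V X\<rangle> \<odot> evr V Y \<cdot> \<langle>rd V X\<rangle> \<odot> f \<odot> \<langle>rd V Y\<rangle> \<cdot> coevr V X \<odot> \<langle>rd V Y\<rangle>"
    and rdual_arr_hom: "rdual_arr f \<in> hom (rd V Y) (rd V X)"
    and rdual_arr_evr: "evr V X \<cdot> \<langle>X\<rangle> \<odot> rdual_arr f = evr V Y \<cdot> f \<odot> \<langle>rd V Y\<rangle>"
proof -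
  note X = hom_obj(1)[OF f] and Y = hom_obj(2)[OF f]
  note [diagram] = X[THEN atomI] Y[THEN atomI] f[THEN diagram_gen]
  show 1: "rdual_arr f = \<langle>rd V X\<rangle> \<odot> evr V Y \<cdot> \<langle>rd V X\<rangle> \<odot> f \<odot> \<langle>rd V Y\<rangle> \<cdot> coevr V X \<odot> \<langle>rd V Y\<rangle>"
    unfolding rdual_arr_def Let_def hom_dom_cod[OF f] ..
  show "rdual_arr f \<in> hom (rd V Y) (rd V X)"
    unfolding 1 by (rule diagram_hom, (rule diagram)+)
  have "evr V X \<cdot> \<langle>X\<rangle> \<odot> rdual_arr f =
      evr V Y \<cdot> f \<odot> \<langle>rd V Y\<rangle> \<cdot> (evr V X \<odot> \<langle>X\<rangle> \<cdot> \<langle>X\<rangle> \<odot> coevr V X) \<odot> \<langle>rd V Y\<rangle>"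
    unfolding 1 by ((rule diagram)+, simp)
  also have "\<dots> = evr V Y \<cdot> f \<odot> \<langle>rd V Y\<rangle>"
    unfolding snake_r1[OF X] by ((rule diagram)+, simp)
  finally show "evr V X \<cdot> \<langle>X\<rangle> \<odot> rdual_arr f = evr V Y \<cdot> f \<odot> \<langle>rd V Y\<rangle>" .
qed

lemma ldual_arr:
  assumes f: "f \<in> hom X Y"
  shows ldual_arr_eq: "ldual_arr f =
      evl V Y \<odot> \<langle>ld V X\<rangle> \<cdot> \<langle>ld V Y\<rangle> \<odot> f \<odot> \<langle>ld V X\<rangle> \<cdot> \<langle>ld V Y\<rangle> \<odot> coevl V X"
    and ldual_arr_hom: "ldual_arr f \<in> hom (ld V Y) (ld V X)"
    and ldual_arr_evl: "evl V X \<cdot> ldual_arr f \<odot> \<langle>X\<rangle> = evl V Y \<cdot> \<langle>ld V Y\<rangle> \<odot> f"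
proof -
  note X = hom_obj(1)[OF f] and Y = hom_obj(2)[OF f]
  note [diagram] = X[THEN atomI] Y[THEN atomI] f[THEN diagram_gen]
  show 1: "ldual_arr f = evl V Y \<odot> \<langle>ld V X\<rangle> \<cdot> \<langle>ld V Y\<rangle> \<odot> f \<odot> \<langle>ld V X\<rangle> \<cdot> \<langle>ld V Y\<rangle> \<odot> coevl V X"
    unfolding ldual_arr_def Let_def hom_dom_cod[OF f] ..
  show "ldual_arr f \<in> hom (ld V Y) (ld V X)"
    unfolding 1 by (rule diagram_hom, (rule diagram)+)
  have "evl V X \<cdot> ldual_arr f \<odot> \<langle>X\<rangle> =
      evl V Y \<cdot> \<langle>ld V Y\<rangle> \<odot> f \<cdot> \<langle>ld V Y\<rangle> \<odot> (\<langle>X\<rangle> \<odot> evl V X \<cdot> coevl V X \<odot> \<langle>X\<rangle>)"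
    unfolding 1 by ((rule diagram)+, simp)
  also have "\<dots> = evl V Y \<cdot> \<langle>ld V Y\<rangle> \<odot> f"
    unfolding snake_l1[OF X] by ((rule diagram)+, simp)
  finally show "evl V X \<cdot> ldual_arr f \<odot> \<langle>X\<rangle> = evl V Y \<cdot> \<langle>ld V Y\<rangle> \<odot> f" .
qed

text \<open>Adjointness on the side of the coevaluation: a morphism moves from one leg of
  \<open>coevl\<close> to the other. It is the step that makes the universal coaction
  natural.\<close>

lemma coevl_ldual_arr:
  assumes f: "f \<in> hom X Y"
  shows "\<langle>Y\<rangle> \<odot> ldual_arr f \<cdot> coevl V Y = f \<odot> \<langle>ld V X\<rangle> \<cdot> coevl V X"
proof -
  note X = hom_obj(1)[OF f] and Y = hom_obj(2)[OF f]
  note [diagram] = X[THEN atomI] Y[THEN atomI] f[THEN diagram_gen]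
  have "\<langle>Y\<rangle> \<odot> ldual_arr f \<cdot> coevl V Y =
      (\<langle>Y\<rangle> \<odot> evl V Y \<cdot> coevl V Y \<odot> \<langle>Y\<rangle>) \<odot> \<langle>ld V X\<rangle> \<cdot> f \<odot> \<langle>ld V X\<rangle> \<cdot> coevl V X"
    unfolding ldual_arr_eq[OF f] by ((rule diagram)+, simp)
  also have "\<dots> = f \<odot> \<langle>ld V X\<rangle> \<cdot> coevl V X"
    unfolding snake_l1[OF Y] by ((rule diagram)+, simp)
  finally show ?thesis .
qed

section \<open>Canonical isomorphisms between mixed double duals\<close>

context
  fixes X assumes X: "X \<in> Obj V"
begin

lemma to_lr_hom: "to_lr X \<in> hom X (ld V (rd V X))"
  and from_lr_hom: "from_lr X \<in> hom (ld V (rd V X)) X"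
  and to_rl_hom: "to_rl X \<in> hom X (rd V (ld V X))"
  and from_rl_hom: "from_rl X \<in> hom (rd V (ld V X)) X"
proof -
  note [diagram] = X[THEN atomI]
  show "to_lr X \<in> hom X (ld V (rd V X))" unfolding to_lr_def by (rule diagram_hom, (rule diagram)+)
  show "from_lr X \<in> hom (ld V (rd V X)) X"
    unfolding from_lr_def by (rule diagram_hom, (rule diagram)+)
  show "to_rl X \<in> hom X (rd V (ld V X))" unfolding to_rl_def by (rule diagram_hom, (rule diagram)+)
  show "from_rl X \<in> hom (rd V (ld V X)) X"
    unfolding from_rl_def by (rule diagram_hom, (rule diagram)+)
qed

text \<open>A canonical isomorphism compares two pairings with the same dual object, here
  \<open>evl\<close> and \<open>evr\<close> for \<open>rd V X\<close>; the snake identity reduces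
  the composite to this. The four identities of this kind represent the isomorphisms in the
  arguments below.\<close>

lemma to_lr_evl: "evl V (rd V X) \<cdot> to_lr X \<odot> \<langle>rd V X\<rangle> = evr V X"
proof -
  note [diagram] = X[THEN atomI]
  have "evl V (rd V X) \<cdot> to_lr X \<odot> \<langle>rd V X\<rangle> =
      evr V X \<cdot> \<langle>X\<rangle> \<odot> (\<langle>rd V X\<rangle> \<odot> evl V (rd V X) \<cdot> coevl V (rd V X) \<odot> \<langle>rd V X\<rangle>)"
    unfolding to_lr_def by ((rule diagram)+, simp)
  note * = this[unfolded snake_l1[OF rd_obj[OF X]]]
  show ?thesis
    by (rule trans[OF *], (rule diagram)+, simp)
qed

lemma from_lr_evr: "evr V X \<cdot> from_lr X \<odot> \<langle>rd V X\<rangle> = evl V (rd V X)"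
proof -
  note [diagram] = X[THEN atomI]
  have "evr V X \<cdot> from_lr X \<odot> \<langle>rd V X\<rangle> =
      evl V (rd V X) \<cdot> \<langle>ld V (rd V X)\<rangle> \<odot> (\<langle>rd V X\<rangle> \<odot> evr V X \<cdot> coevr V X \<odot> \<langle>rd V X\<rangle>)"
    unfolding from_lr_def by ((rule diagram)+, simp)
  note * = this[unfolded snake_r2[OF X]]
  show ?thesis
    by (rule trans[OF *], (rule diagram)+, simp)
qed

lemma to_rl_evr: "evr V (ld V X) \<cdot> \<langle>ld V X\<rangle> \<odot> to_rl X = evl V X"
proof -
  note [diagram] = X[THEN atomI]
  have "evr V (ld V X) \<cdot> \<langle>ld V X\<rangle> \<odot> to_rl X =
      evl V X \<cdot> (evr V (ld V X) \<odot> \<langle>ld V X\<rangle> \<cdot> \<langle>ld V X\<rangle> \<odot> coevr V (ld V X)) \<odot> \<langle>X\<rangle>"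
    unfolding to_rl_def by ((rule diagram)+, simp)
  note * = this[unfolded snake_r1[OF ld_obj[OF X]]]
  show ?thesis
    by (rule trans[OF *], (rule diagram)+, simp)
qed

lemma from_rl_evl: "evl V X \<cdot> \<langle>ld V X\<rangle> \<odot> from_rl X = evr V (ld V X)"
proof -
  note [diagram] = X[THEN atomI]
  have "evl V X \<cdot> \<langle>ld V X\<rangle> \<odot> from_rl X =
      evr V (ld V X) \<cdot> (evl V X \<odot> \<langle>ld V X\<rangle> \<cdot> \<langle>ld V X\<rangle> \<odot> coevl V X) \<odot> \<langle>rd V (ld V X)\<rangle>"
    unfolding from_rl_def by ((rule diagram)+, simp)
  note * = this[unfolded snake_l2[OF X]]
  show ?thesis
    by (rule trans[OF *], (rule diagram)+, simp)
qed

end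

lemmas [diagram] = to_lr_hom[THEN diagram_gen] from_lr_hom[THEN diagram_gen]
  to_rl_hom[THEN diagram_gen] from_rl_hom[THEN diagram_gen]
  rdual_arr_hom[THEN diagram_gen] ldual_arr_hom[THEN diagram_gen]

text \<open>\<open>from_lr\<close> turns \<open>evr\<close> into \<open>evl\<close>, adjointness
  replaces the dual of \<open>s\<close> by \<open>s\<close> on the other strand, and
  \<open>to_lr\<close> turns \<open>evl\<close> back into \<open>evr\<close>. The ribbon condition
  thereby becomes adjointness of two endomorphisms, with no iterated dual left.\<close>

lemma eq_ldual_arr_conj_iff:
  assumes X: "X \<in> Obj V" and s: "s \<in> hom (rd V X) (rd V X)" and f: "f \<in> hom X X"
  shows "f = from_lr X \<cdot> ldual_arr s \<cdot> to_lr X \<longleftrightarrow> evr V X \<cdot> f \<odot> \<langle>rd V X\<rangle> = evr V X \<cdot> \<langle>X\<rangle> \<odot> s"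
proof -
  note [diagram] = X[THEN atomI] s s[THEN diagram_gen]
  have "evr V X \<cdot> (from_lr X \<cdot> ldual_arr s \<cdot> to_lr X) \<odot> \<langle>rd V X\<rangle> =
      (evr V X \<cdot> from_lr X \<odot> \<langle>rd V X\<rangle>) \<cdot> ldual_arr s \<odot> \<langle>rd V X\<rangle> \<cdot> to_lr X \<odot> \<langle>rd V X\<rangle>"
        by ((rule diagram)+, simp)
  also have "\<dots> = (evl V (rd V X) \<cdot> ldual_arr s \<odot> \<langle>rd V X\<rangle>) \<cdot> to_lr X \<odot> \<langle>rd V X\<rangle>"
    unfolding from_lr_evr[OF X] by ((rule diagram)+, simp)
  also have "\<dots> = (evl V (rd V X) \<cdot> to_lr X \<odot> \<langle>rd V X\<rangle>) \<cdot> \<langle>X\<rangle> \<odot> s"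
    unfolding ldual_arr_evl[OF s] by ((rule diagram)+, simp)
  finally have *: "evr V X \<cdot> (from_lr X \<cdot> ldual_arr s \<cdot> to_lr X) \<odot> \<langle>rd V X\<rangle> = evr V X \<cdot> \<langle>X\<rangle> \<odot> s"
    unfolding to_lr_evl[OF X] .
  have "from_lr X \<cdot> ldual_arr s \<cdot> to_lr X \<in> hom X X" by (rule diagram_hom, (rule diagram)+)
  then show ?thesis using * evr_eqI[OF X f] by metis
qed

text \<open>The mirror image, for the transport that defines the antipode on elements.\<close>

lemma eq_rdual_arr_conj_iff:
  assumes X: "X \<in> Obj V" and s: "s \<in> hom (ld V X) (ld V X)" and f: "f \<in> hom X X"
  shows "f = from_rl X \<cdot> rdual_arr s \<cdot> to_rl X \<longleftrightarrow> evl V X \<cdot> \<langle>ld V X\<rangle> \<odot> f = evl V X \<cdot> s \<odot> \<langle>X\<rangle>"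
proof -
  note [diagram] = X[THEN atomI] s s[THEN diagram_gen]
  have "evl V X \<cdot> \<langle>ld V X\<rangle> \<odot> (from_rl X \<cdot> rdual_arr s \<cdot> to_rl X) =
      (evl V X \<cdot> \<langle>ld V X\<rangle> \<odot> from_rl X) \<cdot> \<langle>ld V X\<rangle> \<odot> rdual_arr s \<cdot> \<langle>ld V X\<rangle> \<odot> to_rl X"
        by ((rule diagram)+, simp)
  also have "\<dots> = (evr V (ld V X) \<cdot> \<langle>ld V X\<rangle> \<odot> rdual_arr s) \<cdot> \<langle>ld V X\<rangle> \<odot> to_rl X"
    unfolding from_rl_evl[OF X] by ((rule diagram)+, simp)
  also have "\<dots> = (evr V (ld V X) \<cdot> \<langle>ld V X\<rangle> \<odot> to_rl X) \<cdot> s \<odot> \<langle>X\<rangle>"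
    unfolding rdual_arr_evr[OF s] by ((rule diagram)+, simp)
  finally have *: "evl V X \<cdot> \<langle>ld V X\<rangle> \<odot> (from_rl X \<cdot> rdual_arr s \<cdot> to_rl X) = evl V X \<cdot> s \<odot> \<langle>X\<rangle>"
    unfolding to_rl_evr[OF X] .
  have "from_rl X \<cdot> rdual_arr s \<cdot> to_rl X \<in> hom X X" by (rule diagram_hom, (rule diagram)+)
  then show ?thesis using * evl_eqI[OF X f] by metis
qed

section \<open>Duals of tensor products and the double dual functor\<close>

context
  fixes X Y assumes X: "X \<in> Obj V" and Y: "Y \<in> Obj V"
begin

lemma rd_ten_hom: "rd_ten X Y \<in> hom (rd V Y \<otimes> rd V X) (rd V (X \<otimes> Y))"
  and rd_split_hom: "rd_split X Y \<in> hom (rd V (X \<otimes> Y)) (rd V Y \<otimes> rd V X)"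
proof -
  note [diagram] = X[THEN atomI] Y[THEN atomI]
  show "rd_ten X Y \<in> hom (rd V Y \<otimes> rd V X) (rd V (X \<otimes> Y))"
    unfolding rd_ten_def by (rule diagram_hom, (rule diagram)+)
  show "rd_split X Y \<in> hom (rd V (X \<otimes> Y)) (rd V Y \<otimes> rd V X)"
    unfolding rd_split_def by (rule diagram_hom, (rule diagram)+)
qed

text \<open>\<open>rd_ten\<close> and \<open>rd_split\<close> translate between the evaluation of
  \<open>X \<otimes> Y\<close> and the nested evaluation in which \<open>Y\<close> is paired inside
  \<open>X\<close>. Both identities follow by collapsing coevaluations.\<close>

lemma rd_ten_evr: "evr V (X \<otimes> Y) \<cdot> \<langle>X \<otimes> Y\<rangle> \<odot> rd_ten X Y = evr V X \<cdot> \<langle>X\<rangle> \<odot> evr V Y \<odot> \<langle>rd V X\<rangle>"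
proof -
  note [diagram] = X[THEN atomI] Y[THEN atomI]
  have "evr V (X \<otimes> Y) \<cdot> \<langle>X \<otimes> Y\<rangle> \<odot> rd_ten X Y = (evr V X \<cdot> \<langle>X\<rangle> \<odot> evr V Y \<odot> \<langle>rd V X\<rangle>) \<cdot>
     (evr V (X \<otimes> Y) \<odot> \<langle>X \<otimes> Y\<rangle> \<cdot> \<langle>X \<otimes> Y\<rangle> \<odot> coevr V (X \<otimes> Y)) \<odot> \<langle>rd V Y \<otimes> rd V X\<rangle>"
    unfolding rd_ten_def by ((rule diagram)+, simp)
  note * = this[unfolded snake_r1[OF ten_obj[OF X Y]]]
  show ?thesis
    by (rule trans[OF *], (rule diagram)+, simp)
qed

lemma rd_split_evr:
  "(evr V X \<cdot> \<langle>X\<rangle> \<odot> evr V Y \<odot> \<langle>rd V X\<rangle>) \<cdot> \<langle>X \<otimes> Y\<rangle> \<odot> rd_split X Y = evr V (X \<otimes> Y)"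
proof -
  note [diagram] = X[THEN atomI] Y[THEN atomI]
  have "(evr V X \<cdot> \<langle>X\<rangle> \<odot> evr V Y \<odot> \<langle>rd V X\<rangle>) \<cdot> \<langle>X \<otimes> Y\<rangle> \<odot> rd_split X Y =
     evr V (X \<otimes> Y) \<cdot> (evr V X \<odot> \<langle>X\<rangle> \<cdot> \<langle>X\<rangle> \<odot> coevr V X) \<odot> \<langle>Y \<otimes> rd V (X \<otimes> Y)\<rangle> \<cdot>
     \<langle>X\<rangle> \<odot> (evr V Y \<odot> \<langle>Y\<rangle> \<cdot> \<langle>Y\<rangle> \<odot> coevr V Y) \<odot> \<langle>rd V (X \<otimes> Y)\<rangle>"
    unfolding rd_split_def by ((rule diagram)+, simp)
  note * = this[unfolded snake_r1[OF X] snake_r1[OF Y]]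
  show ?thesis
    by (rule trans[OF *], (rule diagram)+, simp)
qed

end

lemmas [diagram] = rd_ten_hom[THEN diagram_gen] rd_split_hom[THEN diagram_gen] rd_split_hom

context
  fixes X Y assumes X: "X \<in> Obj V" and Y: "Y \<in> Obj V"
begin

lemma rdd_ten_hom: "rdd_ten X Y \<in> hom (rd V (rd V X) \<otimes> rd V (rd V Y)) (rd V (rd V (X \<otimes> Y)))"
proof -
  note [diagram] = X[THEN atomI] Y[THEN atomI]
  show ?thesis unfolding rdd_ten_def by (rule diagram_hom, (rule diagram)+)
qed

text \<open>Adjointness removes the outer dual morphism, so the monoidal structure of the double
  dual is described by nested evaluations precomposed with \<open>rd_split\<close>. This is the form
  compared with the Drinfeld morphism in \<open>mu_ten\<close>.\<close>

lemma rdd_ten_evr: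
  "evr V (rd V (X \<otimes> Y)) \<cdot> \<langle>rd V (X \<otimes> Y)\<rangle> \<odot> rdd_ten X Y =
   (evr V (rd V Y) \<cdot> \<langle>rd V Y\<rangle> \<odot> evr V (rd V X) \<odot> \<langle>rd V (rd V Y)\<rangle>) \<cdot>
       rd_split X Y \<odot> \<langle>rd V (rd V X) \<otimes> rd V (rd V Y)\<rangle>"
proof -
  note [diagram] = X[THEN atomI] Y[THEN atomI]
  have "evr V (rd V (X \<otimes> Y)) \<cdot> \<langle>rd V (X \<otimes> Y)\<rangle> \<odot> rdd_ten X Y =
     (evr V (rd V (X \<otimes> Y)) \<cdot> \<langle>rd V (X \<otimes> Y)\<rangle> \<odot> rdual_arr (rd_split X Y)) \<cdot>
         \<langle>rd V (X \<otimes> Y)\<rangle> \<odot> rd_ten (rd V Y) (rd V X)"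
    unfolding rdd_ten_def by ((rule diagram)+, simp)
  also have "\<dots> = (evr V (rd V Y \<otimes> rd V X) \<cdot> \<langle>rd V Y \<otimes> rd V X\<rangle> \<odot> rd_ten (rd V Y) (rd V X)) \<cdot>
      rd_split X Y \<odot> \<langle>rd V (rd V X) \<otimes> rd V (rd V Y)\<rangle>"
    unfolding rdual_arr_evr[OF rd_split_hom[OF X Y]] by ((rule diagram)+, simp)
  finally show ?thesis
    unfolding rd_ten_evr[OF rd_obj[OF Y] rd_obj[OF X]] .
qed

end

lemma rdd_unit_hom: "rdd_unit \<in> hom \<one> (rd V (rd V \<one>))"
  and rdd_unit_evr: "evr V (rd V \<one>) \<cdot> \<langle>rd V \<one>\<rangle> \<odot> rdd_unit = evr V \<one>"
proof -
  have e: "evr V \<one> \<in> hom (rd V \<one>) \<one>" using evr_hom[OF unit_obj] ten_unit rd_obj unit_obj by simp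
  note [diagram] = e
  show "rdd_unit \<in> hom \<one> (rd V (rd V \<one>))"
    unfolding rdd_unit_def by (rule diagram_hom, (rule diagram)+)
  have "evr V (rd V \<one>) \<cdot> \<langle>rd V \<one>\<rangle> \<odot> rdd_unit =
     (evr V (rd V \<one>) \<cdot> \<langle>rd V \<one>\<rangle> \<odot> rdual_arr (evr V \<one>)) \<cdot> \<langle>rd V \<one>\<rangle> \<odot> coevr V \<one>"
    unfolding rdd_unit_def by ((rule diagram)+, simp)
  also have "\<dots> = evr V \<one> \<cdot> evr V \<one> \<odot> coevr V \<one>"
    unfolding rdual_arr_evr[OF e] by ((rule diagram)+, simp)
  also have "\<dots> = (evr V \<one> \<odot> \<langle>\<one>\<rangle> \<cdot> \<langle>\<one>\<rangle> \<odot> coevr V \<one>) \<cdot> evr V \<one>"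
    by ((rule diagram)+, simp)
  also have "\<dots> = evr V \<one>"
    unfolding snake_r1[OF unit_obj] by ((rule diagram)+, simp)
  finally show "evr V (rd V \<one>) \<cdot> \<langle>rd V \<one>\<rangle> \<odot> rdd_unit = evr V \<one>" .
qed

end

section \<open>The inverse braiding and the Drinfeld morphism\<close>

context rigid_category
begin

lemma inverse_unique: "is_inverse f g \<Longrightarrow> is_inverse f g' \<Longrightarrow> g' = g"
proof -
  assume "is_inverse f g" "is_inverse f g'"
  moreover define X Y where "X = Dom V f" and "Y = Cod V f"
  ultimately have f: "f \<in> hom X Y" and g: "g \<in> hom Y X" and g': "g' \<in> hom Y X"
    and e: "g \<cdot> f = \<langle>X\<rangle>" "f \<cdot> g' = \<langle>Y\<rangle>"
    unfolding is_inverse_def hom_def by auto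
  have "g' = (g \<cdot> f) \<cdot> g'" unfolding e using ident_left[OF g'] by simp
  also have "\<dots> = g \<cdot> f \<cdot> g'" using cmp_assoc[OF g' f g] .
  finally show "g' = g" unfolding e using ident_right[OF g] by simp
qed

lemma inv_arr_eqI: "is_inverse f g \<Longrightarrow> inv_arr f = g"
  unfolding inv_arr_def using inverse_unique by blast

lemma is_inverseI:
  "f \<in> hom X Y \<Longrightarrow> g \<in> hom Y X \<Longrightarrow> g \<cdot> f = \<langle>X\<rangle> \<Longrightarrow> f \<cdot> g = \<langle>Y\<rangle> \<Longrightarrow> is_inverse f g"
  unfolding is_inverse_def hom_def by auto

lemma inv_arr:
  assumes "is_iso f" "f \<in> hom X Y"
  shows inv_arr_hom: "inv_arr f \<in> hom Y X" and inv_arr_left: "inv_arr f \<cdot> f = \<langle>X\<rangle>"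
    and inv_arr_right: "f \<cdot> inv_arr f = \<langle>Y\<rangle>"
proof -
  obtain g where g: "is_inverse f g" using assms unfolding is_iso_def by blast
  then have "inv_arr f = g" by (rule inv_arr_eqI)
  then show "inv_arr f \<in> hom Y X" "inv_arr f \<cdot> f = \<langle>X\<rangle>" "f \<cdot> inv_arr f = \<langle>Y\<rangle>"
    using g assms(2) unfolding is_inverse_def hom_def by auto
qed

end

section \<open>Diagrams with the braiding and the reverse braiding\<close>

context braided_rigid_category
begin

lemma sigma_hom: "X \<in> Obj V \<Longrightarrow> Y \<in> Obj V \<Longrightarrow> \<sigma> X Y \<in> hom (X \<otimes> Y) (Y \<otimes> X)"
  using braiding unfolding braiding_def lax_braiding_def by blast

lemma hexagon:
  assumes "X \<in> Obj V" "Y \<in> Obj V" "Z \<in> Obj V"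
  shows "\<sigma> X (Y \<otimes> Z) = \<langle>Y\<rangle> \<odot> \<sigma> X Z \<cdot> \<sigma> X Y \<odot> \<langle>Z\<rangle>"
    "\<sigma> (X \<otimes> Y) Z = \<sigma> X Z \<odot> \<langle>Y\<rangle> \<cdot> \<langle>X\<rangle> \<odot> \<sigma> Y Z"
  using assms braiding unfolding braiding_def lax_braiding_def by blast+

lemma sigma_unit: "X \<in> Obj V \<Longrightarrow> \<sigma> X \<one> = \<langle>X\<rangle>" "X \<in> Obj V \<Longrightarrow> \<sigma> \<one> X = \<langle>X\<rangle>"
  using braiding unfolding braiding_def lax_braiding_def by blast+

lemma sigma_natural:
  "f \<in> hom X X' \<Longrightarrow> g \<in> hom Y Y' \<Longrightarrow> g \<odot> f \<cdot> \<sigma> X Y = \<sigma> X' Y' \<cdot> f \<odot> g"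
  using braiding unfolding braiding_def lax_braiding_def hom_def by blast

lemma sigma_natural_left: "f \<in> hom X X' \<Longrightarrow> Y \<in> Obj V \<Longrightarrow> \<langle>Y\<rangle> \<odot> f \<cdot> \<sigma> X Y = \<sigma> X' Y \<cdot> f \<odot> \<langle>Y\<rangle>"
  and sigma_natural_right: "g \<in> hom Y Y' \<Longrightarrow> X \<in> Obj V \<Longrightarrow> g \<odot> \<langle>X\<rangle> \<cdot> \<sigma> X Y = \<sigma> X Y' \<cdot> \<langle>X\<rangle> \<odot> g"
  using sigma_natural ident_hom by blast+

lemma diagram_sigma:
  "atom X \<Longrightarrow> atom Y \<Longrightarrow>
      diagram (\<sigma> X Y) (\<lambda>t. X # Y # t) (\<lambda>t. Y # X # t) (\<lambda>k t. (k, \<sigma> X Y, [X, Y], [Y, X]) # t)"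
  using diagram_gen[OF sigma_hom object_ten object_ten, OF _ _ object_atom object_atom object_atom
      object_atom]
  unfolding atom_def .

text \<open>Crossings of products are assembled from crossings of their factors, so that only
  crossings of atoms remain as generators. These rules are declared before
  \<open>diagram_sigma\<close> in order to take precedence over it.\<close>

lemma diagram_hexagon [diagram]:
  "diagram (\<langle>Y\<rangle> \<odot> \<sigma> X Z \<cdot> \<sigma> X Y \<odot> \<langle>Z\<rangle>) A B L \<Longrightarrow> X \<in> Obj V \<Longrightarrow> Y \<in> Obj V \<Longrightarrow> Z \<in> Obj V \<Longrightarrow>
    diagram (\<sigma> X (Y \<otimes> Z)) A B L"
  "diagram (\<sigma> X Z \<odot> \<langle>Y\<rangle> \<cdot> \<langle>X\<rangle> \<odot> \<sigma> Y Z) A B L \<Longrightarrow> X \<in> Obj V \<Longrightarrow> Y \<in> Obj V \<Longrightarrow> Z \<in> Obj V \<Longrightarrow>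
    diagram (\<sigma> (X \<otimes> Y) Z) A B L"
  by (simp_all only: hexagon)

lemma diagram_sigma_unit [diagram]:
  "diagram \<langle>X\<rangle> A B L \<Longrightarrow> X \<in> Obj V \<Longrightarrow> diagram (\<sigma> X \<one>) A B L"
  "diagram \<langle>X\<rangle> A B L \<Longrightarrow> X \<in> Obj V \<Longrightarrow> diagram (\<sigma> \<one> X) A B L"
  by (simp_all only: sigma_unit)

lemmas [diagram] = diagram_sigma

text \<open>The reverse braiding, indexed so that \<open>\<tau> X Y\<close> has the same source and
  target as \<open>\<sigma> X Y\<close>.\<close>

definition \<tau> :: "'o \<Rightarrow> 'o \<Rightarrow> 'a" where
  "\<tau> X Y = inv_arr (\<sigma> Y X)"

lemma
  assumes X: "X \<in> Obj V" and Y: "Y \<in> Obj V"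
  shows tau_hom: "\<tau> X Y \<in> hom (X \<otimes> Y) (Y \<otimes> X)"
    and tau_sigma: "\<tau> Y X \<cdot> \<sigma> X Y = \<langle>X \<otimes> Y\<rangle>"
    and sigma_tau: "\<sigma> X Y \<cdot> \<tau> Y X = \<langle>Y \<otimes> X\<rangle>"
proof -
  have i: "is_iso (\<sigma> X Y)" if "X \<in> Obj V" "Y \<in> Obj V" for X Y
    using braiding that unfolding braiding_def by blast
  show "\<tau> X Y \<in> hom (X \<otimes> Y) (Y \<otimes> X)"
    unfolding \<tau>_def using inv_arr_hom[OF i sigma_hom] X Y by blast
  show "\<tau> Y X \<cdot> \<sigma> X Y = \<langle>X \<otimes> Y\<rangle>" "\<sigma> X Y \<cdot> \<tau> Y X = \<langle>Y \<otimes> X\<rangle>"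
    unfolding \<tau>_def using inv_arr_left[OF i sigma_hom] inv_arr_right[OF i sigma_hom] X Y by blast+
qed

lemma tau_eqI:
  assumes X: "X \<in> Obj V" and Y: "Y \<in> Obj V" and g: "g \<in> hom (X \<otimes> Y) (Y \<otimes> X)"
    and e: "g \<cdot> \<sigma> Y X = \<langle>Y \<otimes> X\<rangle>" "\<sigma> Y X \<cdot> g = \<langle>X \<otimes> Y\<rangle>"
  shows "\<tau> X Y = g"
  unfolding \<tau>_def by (rule inv_arr_eqI[OF is_inverseI[OF sigma_hom[OF Y X] g e]])

lemma diagram_tau:
  "atom X \<Longrightarrow> atom Y \<Longrightarrow>
      diagram (\<tau> X Y) (\<lambda>t. X # Y # t) (\<lambda>t. Y # X # t) (\<lambda>k t. (k, \<tau> X Y, [X, Y], [Y, X]) # t)"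
  using diagram_gen[OF tau_hom object_ten object_ten, OF _ _ object_atom object_atom object_atom
      object_atom]
  unfolding atom_def .

text \<open>The reverse braiding satisfies the hexagons too: each composite is a two-sided inverse
  of a hexagon composite of \<sigma>, since the inner crossings cancel and after them the outer
  ones.\<close>

lemma tau_hexagon:
  assumes X: "X \<in> Obj V" and Y: "Y \<in> Obj V" and Z: "Z \<in> Obj V"
  shows "\<tau> X (Y \<otimes> Z) = \<langle>Y\<rangle> \<odot> \<tau> X Z \<cdot> \<tau> X Y \<odot> \<langle>Z\<rangle>"
    "\<tau> (X \<otimes> Y) Z = \<tau> X Z \<odot> \<langle>Y\<rangle> \<cdot> \<langle>X\<rangle> \<odot> \<tau> Y Z"
proof -
  note [diagram] = X[THEN atomI] Y[THEN atomI] Z[THEN atomI] diagram_tau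
  show "\<tau> X (Y \<otimes> Z) = \<langle>Y\<rangle> \<odot> \<tau> X Z \<cdot> \<tau> X Y \<odot> \<langle>Z\<rangle>"
  proof (rule tau_eqI[OF X ten_obj[OF Y Z]])
    show "\<langle>Y\<rangle> \<odot> \<tau> X Z \<cdot> \<tau> X Y \<odot> \<langle>Z\<rangle> \<in> hom (X \<otimes> (Y \<otimes> Z)) ((Y \<otimes> Z) \<otimes> X)"
      by (rule diagram_hom, (rule diagram)+)
    have "(\<langle>Y\<rangle> \<odot> \<tau> X Z \<cdot> \<tau> X Y \<odot> \<langle>Z\<rangle>) \<cdot> \<sigma> (Y \<otimes> Z) X =
        \<langle>Y\<rangle> \<odot> \<tau> X Z \<cdot> (\<tau> X Y \<cdot> \<sigma> Y X) \<odot> \<langle>Z\<rangle> \<cdot> \<langle>Y\<rangle> \<odot> \<sigma> Z X"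
      by ((rule diagram)+, simp)
    also have "\<dots> = \<langle>Y\<rangle> \<odot> (\<tau> X Z \<cdot> \<sigma> Z X)" unfolding tau_sigma[OF Y X] by ((rule diagram)+, simp)
    also have "\<dots> = \<langle>(Y \<otimes> Z) \<otimes> X\<rangle>" unfolding tau_sigma[OF Z X] by ((rule diagram)+, simp)
    finally show "(\<langle>Y\<rangle> \<odot> \<tau> X Z \<cdot> \<tau> X Y \<odot> \<langle>Z\<rangle>) \<cdot> \<sigma> (Y \<otimes> Z) X = \<langle>(Y \<otimes> Z) \<otimes> X\<rangle>" .
    have "\<sigma> (Y \<otimes> Z) X \<cdot> (\<langle>Y\<rangle> \<odot> \<tau> X Z \<cdot> \<tau> X Y \<odot> \<langle>Z\<rangle>) =
        \<sigma> Y X \<odot> \<langle>Z\<rangle> \<cdot> \<langle>Y\<rangle> \<odot> (\<sigma> Z X \<cdot> \<tau> X Z) \<cdot> \<tau> X Y \<odot> \<langle>Z\<rangle>"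
      by ((rule diagram)+, simp)
    also have "\<dots> = (\<sigma> Y X \<cdot> \<tau> X Y) \<odot> \<langle>Z\<rangle>" unfolding sigma_tau[OF Z X] by ((rule diagram)+, simp)
    also have "\<dots> = \<langle>X \<otimes> (Y \<otimes> Z)\<rangle>" unfolding sigma_tau[OF Y X] by ((rule diagram)+, simp)
    finally show "\<sigma> (Y \<otimes> Z) X \<cdot> (\<langle>Y\<rangle> \<odot> \<tau> X Z \<cdot> \<tau> X Y \<odot> \<langle>Z\<rangle>) = \<langle>X \<otimes> (Y \<otimes> Z)\<rangle>" .
  qed
  show "\<tau> (X \<otimes> Y) Z = \<tau> X Z \<odot> \<langle>Y\<rangle> \<cdot> \<langle>X\<rangle> \<odot> \<tau> Y Z"
  proof (rule tau_eqI[OF ten_obj[OF X Y] Z])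
    show "\<tau> X Z \<odot> \<langle>Y\<rangle> \<cdot> \<langle>X\<rangle> \<odot> \<tau> Y Z \<in> hom ((X \<otimes> Y) \<otimes> Z) (Z \<otimes> (X \<otimes> Y))"
      by (rule diagram_hom, (rule diagram)+)
    have "(\<tau> X Z \<odot> \<langle>Y\<rangle> \<cdot> \<langle>X\<rangle> \<odot> \<tau> Y Z) \<cdot> \<sigma> Z (X \<otimes> Y) =
        \<tau> X Z \<odot> \<langle>Y\<rangle> \<cdot> \<langle>X\<rangle> \<odot> (\<tau> Y Z \<cdot> \<sigma> Z Y) \<cdot> \<sigma> Z X \<odot> \<langle>Y\<rangle>"
      by ((rule diagram)+, simp)
    also have "\<dots> = (\<tau> X Z \<cdot> \<sigma> Z X) \<odot> \<langle>Y\<rangle>" unfolding tau_sigma[OF Z Y] by ((rule diagram)+, simp)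
    also have "\<dots> = \<langle>Z \<otimes> (X \<otimes> Y)\<rangle>" unfolding tau_sigma[OF Z X] by ((rule diagram)+, simp)
    finally show "(\<tau> X Z \<odot> \<langle>Y\<rangle> \<cdot> \<langle>X\<rangle> \<odot> \<tau> Y Z) \<cdot> \<sigma> Z (X \<otimes> Y) = \<langle>Z \<otimes> (X \<otimes> Y)\<rangle>" .
    have "\<sigma> Z (X \<otimes> Y) \<cdot> (\<tau> X Z \<odot> \<langle>Y\<rangle> \<cdot> \<langle>X\<rangle> \<odot> \<tau> Y Z) =
        \<langle>X\<rangle> \<odot> \<sigma> Z Y \<cdot> (\<sigma> Z X \<cdot> \<tau> X Z) \<odot> \<langle>Y\<rangle> \<cdot> \<langle>X\<rangle> \<odot> \<tau> Y Z"
      by ((rule diagram)+, simp)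
    also have "\<dots> = \<langle>X\<rangle> \<odot> (\<sigma> Z Y \<cdot> \<tau> Y Z)" unfolding sigma_tau[OF Z X] by ((rule diagram)+, simp)
    also have "\<dots> = \<langle>(X \<otimes> Y) \<otimes> Z\<rangle>" unfolding sigma_tau[OF Z Y] by ((rule diagram)+, simp)
    finally show "\<sigma> Z (X \<otimes> Y) \<cdot> (\<tau> X Z \<odot> \<langle>Y\<rangle> \<cdot> \<langle>X\<rangle> \<odot> \<tau> Y Z) = \<langle>(X \<otimes> Y) \<otimes> Z\<rangle>" .
  qed
qed

lemma diagram_tau_hexagon [diagram]:
  "diagram (\<langle>Y\<rangle> \<odot> \<tau> X Z \<cdot> \<tau> X Y \<odot> \<langle>Z\<rangle>) A B L \<Longrightarrow> X \<in> Obj V \<Longrightarrow> Y \<in> Obj V \<Longrightarrow> Z \<in> Obj V \<Longrightarrow>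
    diagram (\<tau> X (Y \<otimes> Z)) A B L"
  "diagram (\<tau> X Z \<odot> \<langle>Y\<rangle> \<cdot> \<langle>X\<rangle> \<odot> \<tau> Y Z) A B L \<Longrightarrow> X \<in> Obj V \<Longrightarrow> Y \<in> Obj V \<Longrightarrow> Z \<in> Obj V \<Longrightarrow>
    diagram (\<tau> (X \<otimes> Y) Z) A B L"
  by (simp_all only: tau_hexagon)

lemma diagram_tau_unit [diagram]:
  assumes "diagram \<langle>X\<rangle> A B L" "X \<in> Obj V"
  shows "diagram (\<tau> X \<one>) A B L" "diagram (\<tau> \<one> X) A B L"
proof -
  note X = assms(2) and i = ident_hom[OF assms(2)]
  have "\<tau> X \<one> = \<langle>X\<rangle>" "\<tau> \<one> X = \<langle>X\<rangle>"
    using X i ident_left[OF i] by (auto intro!: tau_eqI simp: unit_obj sigma_unit ten_unit)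
  then show "diagram (\<tau> X \<one>) A B L" "diagram (\<tau> \<one> X) A B L" using assms by simp_all
qed

lemmas [diagram] = diagram_tau

text \<open>Naturality of \<sigma>, conjugated by the inverse crossings on both sides.\<close>

lemma tau_natural:
  assumes f: "f \<in> hom X X'" and g: "g \<in> hom Y Y'"
  shows "g \<odot> f \<cdot> \<tau> X Y = \<tau> X' Y' \<cdot> f \<odot> g"
proof -
  note o = hom_obj[OF f] hom_obj[OF g]
  note [diagram] = o[THEN atomI] f[THEN diagram_gen] g[THEN diagram_gen]
  have "g \<odot> f \<cdot> \<tau> X Y = (\<tau> X' Y' \<cdot> \<sigma> Y' X') \<cdot> g \<odot> f \<cdot> \<tau> X Y"
    unfolding tau_sigma[OF o(4,2)] by ((rule diagram)+, simp)
  also have "\<dots> = \<tau> X' Y' \<cdot> (\<sigma> Y' X' \<cdot> g \<odot> f) \<cdot> \<tau> X Y" by ((rule diagram)+, simp)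
  also have "\<dots> = \<tau> X' Y' \<cdot> f \<odot> g \<cdot> (\<sigma> Y X \<cdot> \<tau> X Y)"
    unfolding sigma_natural[OF g f, symmetric] by ((rule diagram)+, simp)
  also have "\<dots> = \<tau> X' Y' \<cdot> f \<odot> g"
    unfolding sigma_tau[OF o(3,1)] by ((rule diagram)+, simp)
  finally show ?thesis .
qed

lemma tau_natural_left: "f \<in> hom X X' \<Longrightarrow> Y \<in> Obj V \<Longrightarrow> \<langle>Y\<rangle> \<odot> f \<cdot> \<tau> X Y = \<tau> X' Y \<cdot> f \<odot> \<langle>Y\<rangle>"
  and tau_natural_right: "g \<in> hom Y Y' \<Longrightarrow> X \<in> Obj V \<Longrightarrow> g \<odot> \<langle>X\<rangle> \<cdot> \<tau> X Y = \<tau> X Y' \<cdot> \<langle>X\<rangle> \<odot> g"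
  using tau_natural ident_hom by blast+

text \<open>Expresses the inverse that occurs in the definition of \<open>\<omega>_inv\<close> by
  reverse crossings, which can be treated as diagrams.\<close>

lemma inv_double_braiding:
  assumes X: "X \<in> Obj V" and Y: "Y \<in> Obj V"
  shows "inv_arr (\<sigma> Y X \<cdot> \<sigma> X Y) = \<tau> Y X \<cdot> \<tau> X Y"
    and double_braiding_inv: "(\<sigma> Y X \<cdot> \<sigma> X Y) \<cdot> (\<tau> Y X \<cdot> \<tau> X Y) = \<langle>X \<otimes> Y\<rangle>"
      "(\<tau> Y X \<cdot> \<tau> X Y) \<cdot> (\<sigma> Y X \<cdot> \<sigma> X Y) = \<langle>X \<otimes> Y\<rangle>"
proof -
  note [diagram] = X[THEN atomI] Y[THEN atomI]
  have "(\<tau> Y X \<cdot> \<tau> X Y) \<cdot> (\<sigma> Y X \<cdot> \<sigma> X Y) = \<tau> Y X \<cdot> (\<tau> X Y \<cdot> \<sigma> Y X) \<cdot> \<sigma> X Y"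
    by ((rule diagram)+, simp)
  also have "\<dots> = \<tau> Y X \<cdot> \<sigma> X Y" unfolding tau_sigma[OF Y X] by ((rule diagram)+, simp)
  finally show 1: "(\<tau> Y X \<cdot> \<tau> X Y) \<cdot> (\<sigma> Y X \<cdot> \<sigma> X Y) = \<langle>X \<otimes> Y\<rangle>" unfolding tau_sigma[OF X Y] .
  have "(\<sigma> Y X \<cdot> \<sigma> X Y) \<cdot> (\<tau> Y X \<cdot> \<tau> X Y) = \<sigma> Y X \<cdot> (\<sigma> X Y \<cdot> \<tau> Y X) \<cdot> \<tau> X Y"
    by ((rule diagram)+, simp)
  also have "\<dots> = \<sigma> Y X \<cdot> \<tau> X Y" unfolding sigma_tau[OF X Y] by ((rule diagram)+, simp)
  finally show 2: "(\<sigma> Y X \<cdot> \<sigma> X Y) \<cdot> (\<tau> Y X \<cdot> \<tau> X Y) = \<langle>X \<otimes> Y\<rangle>" unfolding sigma_tau[OF Y X] .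
  show "inv_arr (\<sigma> Y X \<cdot> \<sigma> X Y) = \<tau> Y X \<cdot> \<tau> X Y"
  proof (rule inv_arr_eqI[OF is_inverseI[OF _ _ 1 2]])
    show "\<sigma> Y X \<cdot> \<sigma> X Y \<in> hom (X \<otimes> Y) (X \<otimes> Y)" by (rule diagram_hom, (rule diagram)+)
    show "\<tau> Y X \<cdot> \<tau> X Y \<in> hom (X \<otimes> Y) (X \<otimes> Y)" by (rule diagram_hom, (rule diagram)+)
  qed
qed

section \<open>Naturality, monoidal defect and invertibility of the Drinfeld morphism\<close>

abbreviation \<mu> :: "'o \<Rightarrow> 'a" where
  "\<mu> \<equiv> drinfeld \<sigma>"

text \<open>The snake identity collapses the coevaluation in the Drinfeld morphism. What remains is
  its pairing, which determines \<mu> by \<open>into_rd_eqI\<close>.\<close>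

lemma
  assumes X: "X \<in> Obj V"
  shows mu_hom: "\<mu> X \<in> hom X (rd V (rd V X))"
    and mu_evr: "evr V (rd V X) \<cdot> \<langle>rd V X\<rangle> \<odot> \<mu> X = evr V X \<cdot> \<sigma> (rd V X) X"
proof -
  note [diagram] = X[THEN atomI]
  show "\<mu> X \<in> hom X (rd V (rd V X))" unfolding drinfeld_def by (rule diagram_hom, (rule diagram)+)
  have "evr V (rd V X) \<cdot> \<langle>rd V X\<rangle> \<odot> \<mu> X = evr V X \<cdot> \<sigma> (rd V X) X \<cdot>
     (evr V (rd V X) \<odot> \<langle>rd V X\<rangle> \<cdot> \<langle>rd V X\<rangle> \<odot> coevr V (rd V X)) \<odot> \<langle>X\<rangle>"
    unfolding drinfeld_def by ((rule diagram)+, simp)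
  note * = this[unfolded snake_r1[OF rd_obj[OF X]]]
  show "evr V (rd V X) \<cdot> \<langle>rd V X\<rangle> \<odot> \<mu> X = evr V X \<cdot> \<sigma> (rd V X) X"
    by (rule trans[OF *], (rule diagram)+, simp)
qed

lemmas [diagram] = mu_hom[THEN diagram_gen]

text \<open>After pairing, adjointness moves the dual morphisms across the evaluations and
  naturality of \<sigma> moves \<open>f\<close> across the crossing; both sides become
  \<open>evr V Y\<close> after a crossing with \<open>f\<close> on one strand.\<close>

lemma mu_natural:
  assumes f: "f \<in> hom X Y"
  shows "rdual_arr (rdual_arr f) \<cdot> \<mu> X = \<mu> Y \<cdot> f"
proof -
  note X = hom_obj(1)[OF f] and Y = hom_obj(2)[OF f] and f' = rdual_arr_hom[OF f]
  note [diagram] = X[THEN atomI] Y[THEN atomI] f f[THEN diagram_gen] f'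
  show ?thesis
  proof (rule into_rd_eqI[OF rd_obj[OF Y]])
    show "rdual_arr (rdual_arr f) \<cdot> \<mu> X \<in> hom X (rd V (rd V Y))"
      by (rule diagram_hom, (rule diagram)+)
    show "\<mu> Y \<cdot> f \<in> hom X (rd V (rd V Y))" by (rule diagram_hom, (rule diagram)+)
    have "evr V (rd V Y) \<cdot> \<langle>rd V Y\<rangle> \<odot> (rdual_arr (rdual_arr f) \<cdot> \<mu> X) =
       (evr V (rd V Y) \<cdot> \<langle>rd V Y\<rangle> \<odot> rdual_arr (rdual_arr f)) \<cdot> \<langle>rd V Y\<rangle> \<odot> \<mu> X"
         by ((rule diagram)+, simp)
    also have "\<dots> = (evr V (rd V X) \<cdot> \<langle>rd V X\<rangle> \<odot> \<mu> X) \<cdot> rdual_arr f \<odot> \<langle>X\<rangle>"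
      unfolding rdual_arr_evr[OF f'] by ((rule diagram)+, simp)
    also have "\<dots> = evr V X \<cdot> (\<sigma> (rd V X) X \<cdot> rdual_arr f \<odot> \<langle>X\<rangle>)"
      unfolding mu_evr[OF X] by ((rule diagram)+, simp)
    also have "\<dots> = (evr V X \<cdot> \<langle>X\<rangle> \<odot> rdual_arr f) \<cdot> \<sigma> (rd V Y) X"
      unfolding sigma_natural_left[OF f' X, symmetric] by ((rule diagram)+, simp)
    also have "\<dots> = evr V Y \<cdot> (f \<odot> \<langle>rd V Y\<rangle> \<cdot> \<sigma> (rd V Y) X)"
      unfolding rdual_arr_evr[OF f] by ((rule diagram)+, simp)
    also have "\<dots> = (evr V Y \<cdot> \<sigma> (rd V Y) Y) \<cdot> \<langle>rd V Y\<rangle> \<odot> f"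
      unfolding sigma_natural_right[OF f rd_obj[OF Y]] by ((rule diagram)+, simp)
    also have "\<dots> = evr V (rd V Y) \<cdot> \<langle>rd V Y\<rangle> \<odot> (\<mu> Y \<cdot> f)"
      unfolding mu_evr[OF Y, symmetric] by ((rule diagram)+, simp)
    finally show "evr V (rd V Y) \<cdot> \<langle>rd V Y\<rangle> \<odot> (rdual_arr (rdual_arr f) \<cdot> \<mu> X) =
        evr V (rd V Y) \<cdot> \<langle>rd V Y\<rangle> \<odot> (\<mu> Y \<cdot> f)" .
  qed
qed

text \<open>On the left each object crosses only its own dual, while the pairing of
  \<open>\<mu> (X \<otimes> Y)\<close> crosses both duals with both objects. The extra crossings, of
  each object with the dual of the other, are absorbed by the double braiding of \<open>X\<close>
  and \<open>Y\<close>.\<close>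

lemma mu_ten:
  assumes X: "X \<in> Obj V" and Y: "Y \<in> Obj V"
  shows "rdd_ten X Y \<cdot> \<mu> X \<odot> \<mu> Y = \<mu> (X \<otimes> Y) \<cdot> \<sigma> Y X \<cdot> \<sigma> X Y"
proof -
  let ?X = "rd V X" and ?Y = "rd V Y"
  note X' = rd_obj[OF X] and Y' = rd_obj[OF Y]
  note [diagram] = X[THEN atomI] Y[THEN atomI] rdd_ten_hom[THEN diagram_gen]
  define eX where "eX = evr V X \<cdot> \<sigma> ?X X"
  define eY where "eY = evr V Y \<cdot> \<sigma> ?Y Y"
  have eX: "eX \<in> hom (?X \<otimes> X) \<one>" unfolding eX_def by (rule diagram_hom, (rule diagram)+)
  have eY: "eY \<in> hom (?Y \<otimes> Y) \<one>" unfolding eY_def by (rule diagram_hom, (rule diagram)+)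
  note [diagram] = eX[THEN diagram_gen] eY[THEN diagram_gen]
  \<comment> \<open>A pairing ends in the unit object, which braids trivially. A strand may
    therefore be pulled across \<open>eX\<close>.\<close>
  have nX: "eX \<odot> \<langle>Y\<rangle> = \<langle>Y\<rangle> \<odot> eX \<cdot> \<sigma> (?X \<otimes> X) Y"
  proof -
    have "eX \<odot> \<langle>Y\<rangle> = \<sigma> \<one> Y \<cdot> eX \<odot> \<langle>Y\<rangle>" by ((rule diagram)+, simp)
    then show ?thesis unfolding sigma_natural_left[OF eX Y, symmetric] .
  qed
  have nY: "eY \<odot> \<langle>X\<rangle> = \<langle>X\<rangle> \<odot> eY \<cdot> \<sigma> (?Y \<otimes> Y) X"
  proof -
    have "eY \<odot> \<langle>X\<rangle> = \<sigma> \<one> X \<cdot> eY \<odot> \<langle>X\<rangle>" by ((rule diagram)+, simp)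
    then show ?thesis unfolding sigma_natural_left[OF eY X, symmetric] .
  qed
  show ?thesis
  proof (rule into_rd_eqI[OF rd_obj[OF ten_obj[OF X Y]]])
    show "rdd_ten X Y \<cdot> \<mu> X \<odot> \<mu> Y \<in> hom (X \<otimes> Y) (rd V (rd V (X \<otimes> Y)))"
      by (rule diagram_hom, (rule diagram)+)
    show "\<mu> (X \<otimes> Y) \<cdot> \<sigma> Y X \<cdot> \<sigma> X Y \<in> hom (X \<otimes> Y) (rd V (rd V (X \<otimes> Y)))"
      by (rule diagram_hom, (rule diagram)+)
    have "evr V (rd V (X \<otimes> Y)) \<cdot> \<langle>rd V (X \<otimes> Y)\<rangle> \<odot> (rdd_ten X Y \<cdot> \<mu> X \<odot> \<mu> Y) =
       (evr V (rd V (X \<otimes> Y)) \<cdot> \<langle>rd V (X \<otimes> Y)\<rangle> \<odot> rdd_ten X Y) \<cdot> \<langle>rd V (X \<otimes> Y)\<rangle> \<odot> \<mu> X \<odot> \<mu> Y"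
         by ((rule diagram)+, simp)
    also have "\<dots> = (evr V ?Y \<cdot> \<langle>?Y\<rangle> \<odot> \<mu> Y) \<cdot> \<langle>?Y\<rangle> \<odot> (evr V ?X \<cdot> \<langle>?X\<rangle> \<odot> \<mu> X) \<odot> \<langle>Y\<rangle> \<cdot>
        rd_split X Y \<odot> \<langle>X \<otimes> Y\<rangle>"
      unfolding rdd_ten_evr[OF X Y] by ((rule diagram)+, simp)
    also have "\<dots> = eY \<cdot> \<langle>?Y\<rangle> \<odot> (eX \<odot> \<langle>Y\<rangle>) \<cdot> rd_split X Y \<odot> \<langle>X \<otimes> Y\<rangle>"
      unfolding mu_evr[OF X] mu_evr[OF Y] eX_def[symmetric] eY_def[symmetric]
      by ((rule diagram)+, simp)
    also have "\<dots> = (eY \<cdot> \<langle>?Y\<rangle> \<odot> eX \<odot> \<langle>Y\<rangle>) \<cdot> rd_split X Y \<odot> \<langle>X \<otimes> Y\<rangle>" by ((rule diagram)+, simp)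
    \<comment> \<open>Proved from right to left: the crossing of \<open>X\<close> is slid past that
      of \<open>Y\<close>, after which \<open>X\<close> is pulled across \<open>eY\<close> and
      \<open>Y\<close> across \<open>eX\<close>, which removes the mixed crossings.\<close>
    also have "eY \<cdot> \<langle>?Y\<rangle> \<odot> eX \<odot> \<langle>Y\<rangle> =
        (evr V X \<cdot> \<langle>X\<rangle> \<odot> evr V Y \<odot> \<langle>?X\<rangle>) \<cdot> \<sigma> (?Y \<otimes> ?X) (X \<otimes> Y) \<cdot> \<langle>?Y \<otimes> ?X\<rangle> \<odot> (\<sigma> Y X \<cdot> \<sigma> X Y)"
    proof -
      have "(evr V X \<cdot> \<langle>X\<rangle> \<odot> evr V Y \<odot> \<langle>?X\<rangle>) \<cdot> \<sigma> (?Y \<otimes> ?X) (X \<otimes> Y) \<cdot> \<langle>?Y \<otimes> ?X\<rangle> \<odot> (\<sigma> Y X \<cdot> \<sigma> X Y) =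
        evr V X \<cdot> \<langle>X\<rangle> \<odot> eY \<odot> \<langle>?X\<rangle> \<cdot> \<sigma> ?Y X \<odot> \<langle>Y \<otimes> ?X\<rangle> \<cdot> \<langle>?Y\<rangle> \<odot> (\<sigma> ?X (X \<otimes> Y) \<cdot> \<langle>?X\<rangle> \<odot> \<sigma> Y X) \<cdot>
            \<langle>?Y \<otimes> ?X\<rangle> \<odot> \<sigma> X Y"
        unfolding eY_def by ((rule diagram)+, simp)
      also have "\<dots> = evr V X \<cdot> (\<langle>X\<rangle> \<odot> eY \<cdot> \<sigma> (?Y \<otimes> Y) X) \<odot> \<langle>?X\<rangle> \<cdot> \<langle>?Y\<rangle> \<odot> \<sigma> ?X (Y \<otimes> X) \<cdot>
          \<langle>?Y \<otimes> ?X\<rangle> \<odot> \<sigma> X Y"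
        unfolding sigma_natural_right[OF sigma_hom[OF Y X] X', symmetric] by ((rule diagram)+, simp)
      also have "\<dots> = eY \<cdot> \<langle>?Y \<otimes> Y\<rangle> \<odot> (evr V X \<cdot> \<sigma> ?X X) \<cdot> \<langle>?Y\<rangle> \<odot> \<sigma> ?X Y \<odot> \<langle>X\<rangle> \<cdot> \<langle>?Y \<otimes> ?X\<rangle> \<odot> \<sigma> X Y"
        unfolding nY[symmetric] by ((rule diagram)+, simp)
      also have "\<dots> = eY \<cdot> \<langle>?Y\<rangle> \<odot> (\<langle>Y\<rangle> \<odot> eX \<cdot> \<sigma> (?X \<otimes> X) Y)"
        unfolding eX_def by ((rule diagram)+, simp)
      finally show ?thesis unfolding nX[symmetric] by simp
    qed
    also have "\<dots> \<cdot> rd_split X Y \<odot> \<langle>X \<otimes> Y\<rangle> =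
       (evr V X \<cdot> \<langle>X\<rangle> \<odot> evr V Y \<odot> \<langle>?X\<rangle>) \<cdot> (\<sigma> (?Y \<otimes> ?X) (X \<otimes> Y) \<cdot> rd_split X Y \<odot> \<langle>X \<otimes> Y\<rangle>) \<cdot>
           \<langle>rd V (X \<otimes> Y)\<rangle> \<odot> (\<sigma> Y X \<cdot> \<sigma> X Y)"
      by ((rule diagram)+, simp)
    also have "\<dots> = ((evr V X \<cdot> \<langle>X\<rangle> \<odot> evr V Y \<odot> \<langle>?X\<rangle>) \<cdot> \<langle>X \<otimes> Y\<rangle> \<odot> rd_split X Y) \<cdot>
        \<sigma> (rd V (X \<otimes> Y)) (X \<otimes> Y) \<cdot> \<langle>rd V (X \<otimes> Y)\<rangle> \<odot> (\<sigma> Y X \<cdot> \<sigma> X Y)"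
      unfolding sigma_natural_left[OF rd_split_hom[OF X Y] ten_obj[OF X Y], symmetric]
      by ((rule diagram)+, simp)
    also have "\<dots> = (evr V (rd V (X \<otimes> Y)) \<cdot> \<langle>rd V (X \<otimes> Y)\<rangle> \<odot> \<mu> (X \<otimes> Y)) \<cdot>
        \<langle>rd V (X \<otimes> Y)\<rangle> \<odot> (\<sigma> Y X \<cdot> \<sigma> X Y)"
      unfolding rd_split_evr[OF X Y] mu_evr[OF ten_obj[OF X Y]] by ((rule diagram)+, simp)
    also have "\<dots> = evr V (rd V (X \<otimes> Y)) \<cdot> \<langle>rd V (X \<otimes> Y)\<rangle> \<odot> (\<mu> (X \<otimes> Y) \<cdot> \<sigma> Y X \<cdot> \<sigma> X Y)"
      by ((rule diagram)+, simp)
    finally show "evr V (rd V (X \<otimes> Y)) \<cdot> \<langle>rd V (X \<otimes> Y)\<rangle> \<odot> (rdd_ten X Y \<cdot> \<mu> X \<odot> \<mu> Y) =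
       evr V (rd V (X \<otimes> Y)) \<cdot> \<langle>rd V (X \<otimes> Y)\<rangle> \<odot> (\<mu> (X \<otimes> Y) \<cdot> \<sigma> Y X \<cdot> \<sigma> X Y)" .
  qed
qed

lemma mu_unit: "\<mu> \<one> = rdd_unit"
proof (rule into_rd_eqI[OF rd_obj[OF unit_obj] mu_hom[OF unit_obj] rdd_unit_hom])
  have "evr V (rd V \<one>) \<cdot> \<langle>rd V \<one>\<rangle> \<odot> \<mu> \<one> = evr V \<one>"
    unfolding mu_evr[OF unit_obj] by ((rule diagram)+, simp)
  then show "evr V (rd V \<one>) \<cdot> \<langle>rd V \<one>\<rangle> \<odot> \<mu> \<one> = evr V (rd V \<one>) \<cdot> \<langle>rd V \<one>\<rangle> \<odot> rdd_unit"
    unfolding rdd_unit_evr .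
qed

text \<open>Braiding makes \<open>X\<close> a second right dual of \<open>rd V X\<close>: the
  braided evaluation and \<open>k\<close> satisfy the snake identities. \<mu> is the comparison
  between the two right duals \<open>X\<close> and \<open>rd V (rd V X)\<close>, so its inverse is
  built from \<open>k\<close> in the same way.\<close>

lemma mu_iso:
  assumes X: "X \<in> Obj V"
  shows "is_iso (\<mu> X)"
proof -
  let ?X = "rd V X" and ?XX = "rd V (rd V X)"
  note X' = rd_obj[OF X]
  note [diagram] = X[THEN atomI]
  \<comment> \<open>The reverse crossing is chosen so that it cancels against the crossing in the
    braided evaluation.\<close>
  define k where "k = \<tau> ?X X \<cdot> coevr V X"
  have k: "k \<in> hom \<one> (X \<otimes> ?X)" unfolding k_def by (rule diagram_hom, (rule diagram)+)
  note [diagram] = k[THEN diagram_gen]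
  have snake1: "\<langle>X\<rangle> \<odot> (evr V X \<cdot> \<sigma> ?X X) \<cdot> k \<odot> \<langle>X\<rangle> = \<langle>X\<rangle>"
  proof -
    \<comment> \<open>A cancelling pair of crossings of \<open>X\<close> with itself is inserted; it
      completes a crossing of \<open>X \<otimes> rd V X\<close> with \<open>X\<close>, across which
      \<open>k\<close> can be pulled.\<close>
    have "\<langle>X\<rangle> \<odot> (evr V X \<cdot> \<sigma> ?X X) \<cdot> k \<odot> \<langle>X\<rangle> =
       \<langle>X\<rangle> \<odot> evr V X \<cdot> (\<tau> X X \<cdot> \<sigma> X X) \<odot> \<langle>?X\<rangle> \<cdot> \<langle>X\<rangle> \<odot> \<sigma> ?X X \<cdot> k \<odot> \<langle>X\<rangle>"
      unfolding tau_sigma[OF X X] by ((rule diagram)+, simp)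
    also have "\<dots> = \<langle>X\<rangle> \<odot> evr V X \<cdot> \<tau> X X \<odot> \<langle>?X\<rangle> \<cdot> (\<sigma> (X \<otimes> ?X) X \<cdot> k \<odot> \<langle>X\<rangle>)"
      by ((rule diagram)+, simp)
    also have "\<dots> = \<langle>X\<rangle> \<odot> evr V X \<cdot> \<tau> (X \<otimes> ?X) X \<cdot> \<langle>X\<rangle> \<odot> coevr V X"
      unfolding sigma_natural_left[OF k X, symmetric] unfolding k_def by ((rule diagram)+, simp)
    also have "\<dots> = (\<langle>X\<rangle> \<odot> evr V X \<cdot> \<tau> (X \<otimes> ?X) X) \<cdot> \<langle>X\<rangle> \<odot> coevr V X" by ((rule diagram)+, simp)
    also have "\<dots> = evr V X \<odot> \<langle>X\<rangle> \<cdot> \<langle>X\<rangle> \<odot> coevr V X"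
      unfolding tau_natural_left[OF evr_hom[OF X] X] by ((rule diagram)+, simp)
    finally show ?thesis unfolding snake_r1[OF X] .
  qed
  have snake2: "(evr V X \<cdot> \<sigma> ?X X) \<odot> \<langle>?X\<rangle> \<cdot> \<langle>?X\<rangle> \<odot> k = \<langle>?X\<rangle>"
  proof -
    have "(evr V X \<cdot> \<sigma> ?X X) \<odot> \<langle>?X\<rangle> \<cdot> \<langle>?X\<rangle> \<odot> k =
      evr V X \<odot> \<langle>?X\<rangle> \<cdot> \<sigma> ?X X \<odot> \<langle>?X\<rangle> \<cdot> \<langle>?X\<rangle> \<odot> \<tau> ?X X \<cdot> (\<langle>?X\<rangle> \<odot> coevr V X \<cdot> \<tau> \<one> ?X)"
      unfolding k_def by ((rule diagram)+, simp)
    also have "\<dots> = evr V X \<odot> \<langle>?X\<rangle> \<cdot> \<sigma> ?X X \<odot> \<langle>?X\<rangle> \<cdot> (\<langle>?X\<rangle> \<odot> \<tau> ?X X \<cdot> \<tau> (?X \<otimes> X) ?X) \<cdot>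
        coevr V X \<odot> \<langle>?X\<rangle>"
      unfolding tau_natural_left[OF coevr_hom[OF X] X'] by ((rule diagram)+, simp)
    also have "\<dots> = evr V X \<odot> \<langle>?X\<rangle> \<cdot> (\<sigma> ?X X \<cdot> \<tau> X ?X) \<odot> \<langle>?X\<rangle> \<cdot> \<langle>X\<rangle> \<odot> \<tau> ?X ?X \<cdot> \<tau> ?X X \<odot> \<langle>?X\<rangle> \<cdot>
        coevr V X \<odot> \<langle>?X\<rangle>"
      unfolding tau_natural_left[OF tau_hom[OF X' X] X'] by ((rule diagram)+, simp)
    also have "\<dots> = (evr V X \<odot> \<langle>?X\<rangle> \<cdot> \<tau> ?X (X \<otimes> ?X)) \<cdot> coevr V X \<odot> \<langle>?X\<rangle>"
      unfolding sigma_tau[OF X' X] by ((rule diagram)+, simp)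
    also have "\<dots> = \<langle>?X\<rangle> \<odot> evr V X \<cdot> coevr V X \<odot> \<langle>?X\<rangle>"
      unfolding tau_natural_right[OF evr_hom[OF X] X'] by ((rule diagram)+, simp)
    finally show ?thesis unfolding snake_r2[OF X] .
  qed
  let ?g = "\<langle>X\<rangle> \<odot> evr V ?X \<cdot> k \<odot> \<langle>?XX\<rangle>"
  have "is_inverse (\<mu> X) ?g"
  proof (rule is_inverseI[OF mu_hom[OF X]])
    show "?g \<in> hom ?XX X" by (rule diagram_hom, (rule diagram)+)
    have "?g \<cdot> \<mu> X = \<langle>X\<rangle> \<odot> (evr V ?X \<cdot> \<langle>?X\<rangle> \<odot> \<mu> X) \<cdot> k \<odot> \<langle>X\<rangle>" by ((rule diagram)+, simp)
    then show "?g \<cdot> \<mu> X = \<langle>X\<rangle>" unfolding mu_evr[OF X] snake1 .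
    show "\<mu> X \<cdot> ?g = \<langle>?XX\<rangle>"
    proof (rule into_rd_eqI[OF X'])
      show "\<mu> X \<cdot> ?g \<in> hom ?XX ?XX" by (rule diagram_hom, (rule diagram)+)
      show "\<langle>?XX\<rangle> \<in> hom ?XX ?XX" by (rule diagram_hom, (rule diagram)+)
      have "evr V ?X \<cdot> \<langle>?X\<rangle> \<odot> (\<mu> X \<cdot> ?g) = (evr V ?X \<cdot> \<langle>?X\<rangle> \<odot> \<mu> X) \<cdot> \<langle>?X\<rangle> \<odot> ?g"
        by ((rule diagram)+, simp)
      also have "\<dots> = evr V ?X \<cdot> ((evr V X \<cdot> \<sigma> ?X X) \<odot> \<langle>?X\<rangle> \<cdot> \<langle>?X\<rangle> \<odot> k) \<odot> \<langle>?XX\<rangle>"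
        unfolding mu_evr[OF X] by ((rule diagram)+, simp)
      also have "\<dots> = evr V ?X \<cdot> \<langle>?X\<rangle> \<odot> \<langle>?XX\<rangle>"
        unfolding snake2 by ((rule diagram)+, simp)
      finally show "evr V ?X \<cdot> \<langle>?X\<rangle> \<odot> (\<mu> X \<cdot> ?g) = evr V ?X \<cdot> \<langle>?X\<rangle> \<odot> \<langle>?XX\<rangle>" .
    qed
  qed
  then show ?thesis unfolding is_iso_def by blast
qed

end

section \<open>The universal coaction\<close>

locale braided_coend = braided_rigid_category V \<sigma> + coend_data V \<sigma> C \<iota>
  for V :: "('o, 'a) rigid_cat" (structure) and \<sigma> and C :: 'o and \<iota> :: "'o \<Rightarrow> 'a" +
  assumes is_coend: is_coend
begin

lemma C_obj: "C \<in> Obj V"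
  and iota_hom: "X \<in> Obj V \<Longrightarrow> \<iota> X \<in> hom (ld V X \<otimes> X) C"
  and iota_dinatural: "f \<in> hom X Y \<Longrightarrow> \<iota> Y \<cdot> \<langle>ld V Y\<rangle> \<odot> f = \<iota> X \<cdot> ldual_arr f \<odot> \<langle>X\<rangle>"
  using is_coend hom_obj unfolding is_coend_def cowedge_def by blast+

lemmas [diagram] = C_obj[THEN atomI] iota_hom[THEN diagram_gen]

lemma delta_hom: "X \<in> Obj V \<Longrightarrow> \<delta> X \<in> hom X (X \<otimes> C)"
proof -
  assume "X \<in> Obj V"
  note [diagram] = this[THEN atomI]
  show ?thesis unfolding \<delta>_def by (rule diagram_hom, (rule diagram)+)
qed

lemmas [diagram] = delta_hom[THEN diagram_gen]

text \<open>Dinaturality of \<iota>, with the dual morphism moved from one leg of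
  \<open>coevl\<close> to the other.\<close>

lemma delta_natural:
  assumes f: "f \<in> hom X Y"
  shows "f \<odot> \<langle>C\<rangle> \<cdot> \<delta> X = \<delta> Y \<cdot> f"
proof -
  note X = hom_obj(1)[OF f] and Y = hom_obj(2)[OF f]
  note [diagram] = X[THEN atomI] Y[THEN atomI] f[THEN diagram_gen] f
  have "f \<odot> \<langle>C\<rangle> \<cdot> \<delta> X = \<langle>Y\<rangle> \<odot> \<iota> X \<cdot> (f \<odot> \<langle>ld V X\<rangle> \<cdot> coevl V X) \<odot> \<langle>X\<rangle>"
    unfolding \<delta>_def by ((rule diagram)+, simp)
  also have "\<dots> = \<langle>Y\<rangle> \<odot> (\<iota> X \<cdot> ldual_arr f \<odot> \<langle>X\<rangle>) \<cdot> coevl V Y \<odot> \<langle>X\<rangle>"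
    unfolding coevl_ldual_arr[OF f, symmetric] by ((rule diagram)+, simp)
  also have "\<dots> = \<delta> Y \<cdot> f"
    unfolding iota_dinatural[OF f, symmetric] \<delta>_def by ((rule diagram)+, simp)
  finally show ?thesis .
qed

text \<open>Transposing a natural family along \<open>evl\<close> gives a cowedge, because a dual
  morphism is adjoint to the original one. The snake identity undoes the transposition and returns
  the family.\<close>

lemma coend_exists:
  assumes D: "D \<in> Obj V" and n: "\<And>X. X \<in> Obj V \<Longrightarrow> n X \<in> hom X (X \<otimes> D)"
    and nat: "\<And>f X Y. f \<in> hom X Y \<Longrightarrow> f \<odot> \<langle>D\<rangle> \<cdot> n X = n Y \<cdot> f"
  shows "\<exists>g \<in> hom C D. \<forall>X \<in> Obj V. \<langle>X\<rangle> \<odot> g \<cdot> \<delta> X = n X"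
proof -
  define \<kappa> where "\<kappa> X = evl V X \<odot> \<langle>D\<rangle> \<cdot> \<langle>ld V X\<rangle> \<odot> n X" for X
  note [diagram] = D[THEN atomI] n[THEN diagram_gen]
  have \<kappa>: "\<kappa> X \<in> hom (ld V X \<otimes> X) D" if X: "X \<in> Obj V" for X
  proof -
    note [diagram] = X[THEN atomI]
    show ?thesis unfolding \<kappa>_def by (rule diagram_hom, (rule diagram)+)
  qed
  have "\<kappa> Y \<cdot> \<langle>ld V Y\<rangle> \<odot> f = \<kappa> X \<cdot> ldual_arr f \<odot> \<langle>X\<rangle>" if f: "f \<in> hom X Y" for f X Y
  proof -
    note o = hom_obj[OF f]
    note [diagram] = f f[THEN diagram_gen] o[THEN atomI]
    have "\<kappa> Y \<cdot> \<langle>ld V Y\<rangle> \<odot> f = evl V Y \<odot> \<langle>D\<rangle> \<cdot> \<langle>ld V Y\<rangle> \<odot> (n Y \<cdot> f)"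
      unfolding \<kappa>_def by ((rule diagram)+, simp)
    also have "\<dots> = (evl V Y \<cdot> \<langle>ld V Y\<rangle> \<odot> f) \<odot> \<langle>D\<rangle> \<cdot> \<langle>ld V Y\<rangle> \<odot> n X"
      unfolding nat[OF f, symmetric] by ((rule diagram)+, simp)
    also have "\<dots> = \<kappa> X \<cdot> ldual_arr f \<odot> \<langle>X\<rangle>"
      unfolding ldual_arr_evl[OF f, symmetric] \<kappa>_def by ((rule diagram)+, simp)
    finally show ?thesis .
  qed
  then have "cowedge D \<kappa>" unfolding cowedge_def using \<kappa> by blast
  then obtain g where g: "g \<in> hom C D" and g\<kappa>: "\<And>X. X \<in> Obj V \<Longrightarrow> g \<cdot> \<iota> X = \<kappa> X"
    using is_coend D unfolding is_coend_def by blast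
  have "\<langle>X\<rangle> \<odot> g \<cdot> \<delta> X = n X" if X: "X \<in> Obj V" for X
  proof -
    note [diagram] = X[THEN atomI] g[THEN diagram_gen]
    have "\<langle>X\<rangle> \<odot> g \<cdot> \<delta> X = \<langle>X\<rangle> \<odot> (g \<cdot> \<iota> X) \<cdot> coevl V X \<odot> \<langle>X\<rangle>"
      unfolding \<delta>_def by ((rule diagram)+, simp)
    also have "\<dots> = (\<langle>X\<rangle> \<odot> evl V X \<cdot> coevl V X \<odot> \<langle>X\<rangle>) \<odot> \<langle>D\<rangle> \<cdot> n X"
      unfolding g\<kappa>[OF X] \<kappa>_def by ((rule diagram)+, simp)
    also have "\<dots> = n X" unfolding snake_l1[OF X] by ((rule diagram)+, simp)
    finally show ?thesis .
  qed
  then show ?thesis using g by blast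
qed

lemma coend_eqI:
  assumes g: "g \<in> hom C D" and g': "g' \<in> hom C D"
    and eq: "\<And>X. X \<in> Obj V \<Longrightarrow> \<langle>X\<rangle> \<odot> g \<cdot> \<delta> X = \<langle>X\<rangle> \<odot> g' \<cdot> \<delta> X"
  shows "g = g'"
proof -
  note D = hom_obj(2)[OF g]
  note [diagram] = D[THEN atomI]
  have *: "h \<cdot> \<iota> X = evl V X \<odot> \<langle>D\<rangle> \<cdot> \<langle>ld V X\<rangle> \<odot> (\<langle>X\<rangle> \<odot> h \<cdot> \<delta> X)"
    if h: "h \<in> hom C D" and X: "X \<in> Obj V" for h X
  proof -
    note [diagram] = h[THEN diagram_gen] X[THEN atomI]
    have "evl V X \<odot> \<langle>D\<rangle> \<cdot> \<langle>ld V X\<rangle> \<odot> (\<langle>X\<rangle> \<odot> h \<cdot> \<delta> X) =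
       h \<cdot> \<iota> X \<cdot> (evl V X \<odot> \<langle>ld V X\<rangle> \<cdot> \<langle>ld V X\<rangle> \<odot> coevl V X) \<odot> \<langle>X\<rangle>"
      unfolding \<delta>_def by ((rule diagram)+, simp)
    also have "\<dots> = h \<cdot> \<iota> X" unfolding snake_l2[OF X] by ((rule diagram)+, simp)
    finally show ?thesis ..
  qed
  have "cowedge D (\<lambda>X. g \<cdot> \<iota> X)"
    unfolding cowedge_def
  proof (intro conjI ballI)
    fix X assume X: "X \<in> Obj V"
    show "g \<cdot> \<iota> X \<in> hom (ld V X \<otimes> X) D" using cmp_hom[OF iota_hom[OF X] g] .
  next
    fix X Y f assume o: "X \<in> Obj V" "Y \<in> Obj V" and f: "f \<in> hom X Y"
    note [diagram] = f f[THEN diagram_gen] o[THEN atomI] g[THEN diagram_gen]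
    have "(g \<cdot> \<iota> Y) \<cdot> \<langle>ld V Y\<rangle> \<odot> f = g \<cdot> (\<iota> Y \<cdot> \<langle>ld V Y\<rangle> \<odot> f)" by ((rule diagram)+, simp)
    also have "\<dots> = (g \<cdot> \<iota> X) \<cdot> ldual_arr f \<odot> \<langle>X\<rangle>"
      unfolding iota_dinatural[OF f] by ((rule diagram)+, simp)
    finally show "(g \<cdot> \<iota> Y) \<cdot> \<langle>ld V Y\<rangle> \<odot> f = (g \<cdot> \<iota> X) \<cdot> ldual_arr f \<odot> \<langle>X\<rangle>" .
  qed
  then have "\<exists>!h. h \<in> hom C D \<and> (\<forall>X\<in>Obj V. h \<cdot> \<iota> X = g \<cdot> \<iota> X)"
    using is_coend D unfolding is_coend_def by blast
  moreover have "\<forall>X\<in>Obj V. g' \<cdot> \<iota> X = g \<cdot> \<iota> X"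
    using *[OF g] *[OF g'] eq by simp
  ultimately show ?thesis using g g' by blast
qed

text \<open>The parameter \<open>Y\<close> is bent to the target by \<open>coevl V Y\<close>, which
  leaves a natural family with values in \<open>X \<otimes> (E \<otimes> ld V Y)\<close>; the
  resulting morphism on \<open>C\<close> is bent back by \<open>evl V Y\<close>.\<close>

lemma coend_ten_exists:
  assumes Y: "Y \<in> Obj V" and E: "E \<in> Obj V" and n: "\<And>X. X \<in> Obj V \<Longrightarrow> n X \<in> hom (X \<otimes> Y) (X \<otimes> E)"
    and nat: "\<And>f X X'. f \<in> hom X X' \<Longrightarrow> f \<odot> \<langle>E\<rangle> \<cdot> n X = n X' \<cdot> f \<odot> \<langle>Y\<rangle>"
  shows "\<exists>g \<in> hom (C \<otimes> Y) E. \<forall>X \<in> Obj V. \<langle>X\<rangle> \<odot> g \<cdot> \<delta> X \<odot> \<langle>Y\<rangle> = n X"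
proof -
  define n' where "n' X = n X \<odot> \<langle>ld V Y\<rangle> \<cdot> \<langle>X\<rangle> \<odot> coevl V Y" for X
  note [diagram] = Y[THEN atomI] E[THEN atomI] n[THEN diagram_gen]
  have "\<exists>g \<in> hom C (E \<otimes> ld V Y). \<forall>X \<in> Obj V. \<langle>X\<rangle> \<odot> g \<cdot> \<delta> X = n' X"
  proof (rule coend_exists)
    show "E \<otimes> ld V Y \<in> Obj V" using ten_obj[OF E ld_obj[OF Y]] .
    fix X assume X: "X \<in> Obj V"
    note [diagram] = X[THEN atomI]
    show "n' X \<in> hom X (X \<otimes> E \<otimes> ld V Y)" unfolding n'_def by (rule diagram_hom, (rule diagram)+)
  next
    fix f X X' assume f: "f \<in> hom X X'"
    note [diagram] = f[THEN diagram_gen] hom_obj[OF f, THEN atomI]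
    have "f \<odot> \<langle>E \<otimes> ld V Y\<rangle> \<cdot> n' X = (f \<odot> \<langle>E\<rangle> \<cdot> n X) \<odot> \<langle>ld V Y\<rangle> \<cdot> \<langle>X\<rangle> \<odot> coevl V Y"
      unfolding n'_def by ((rule diagram)+, simp)
    also have "\<dots> = n' X' \<cdot> f"
      unfolding nat[OF f] n'_def by ((rule diagram)+, simp)
    finally show "f \<odot> \<langle>E \<otimes> ld V Y\<rangle> \<cdot> n' X = n' X' \<cdot> f" .
  qed
  then obtain g where g: "g \<in> hom C (E \<otimes> ld V Y)" and gn: "\<And>X. X \<in> Obj V \<Longrightarrow> \<langle>X\<rangle> \<odot> g \<cdot> \<delta> X = n' X"
    by blast
  note [diagram] = g[THEN diagram_gen]
  have "\<langle>X\<rangle> \<odot> (\<langle>E\<rangle> \<odot> evl V Y \<cdot> g \<odot> \<langle>Y\<rangle>) \<cdot> \<delta> X \<odot> \<langle>Y\<rangle> = n X" if X: "X \<in> Obj V" for X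
  proof -
    note [diagram] = X[THEN atomI]
    have "\<langle>X\<rangle> \<odot> (\<langle>E\<rangle> \<odot> evl V Y \<cdot> g \<odot> \<langle>Y\<rangle>) \<cdot> \<delta> X \<odot> \<langle>Y\<rangle> = \<langle>X \<otimes> E\<rangle> \<odot> evl V Y \<cdot> (\<langle>X\<rangle> \<odot> g \<cdot> \<delta> X) \<odot> \<langle>Y\<rangle>"
      by ((rule diagram)+, simp)
    also have "\<dots> = n X \<cdot> \<langle>X\<rangle> \<odot> (\<langle>Y\<rangle> \<odot> evl V Y \<cdot> coevl V Y \<odot> \<langle>Y\<rangle>)"
      unfolding gn[OF X] n'_def by ((rule diagram)+, simp)
    also have "\<dots> = n X" unfolding snake_l1[OF Y] by ((rule diagram)+, simp)
    finally show ?thesis .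
  qed
  moreover have "\<langle>E\<rangle> \<odot> evl V Y \<cdot> g \<odot> \<langle>Y\<rangle> \<in> hom (C \<otimes> Y) E" by (rule diagram_hom, (rule diagram)+)
  ultimately show ?thesis by blast
qed

lemma coend_ten_eqI:
  assumes Y: "Y \<in> Obj V" and g: "g \<in> hom (C \<otimes> Y) E" and g': "g' \<in> hom (C \<otimes> Y) E"
    and eq: "\<And>X. X \<in> Obj V \<Longrightarrow> \<langle>X\<rangle> \<odot> g \<cdot> \<delta> X \<odot> \<langle>Y\<rangle> = \<langle>X\<rangle> \<odot> g' \<cdot> \<delta> X \<odot> \<langle>Y\<rangle>"
  shows "g = g'"
proof -
  note [diagram] = Y[THEN atomI] hom_obj(2)[OF g, THEN atomI]
  have *: "h = \<langle>E\<rangle> \<odot> evl V Y \<cdot> (h \<odot> \<langle>ld V Y\<rangle> \<cdot> \<langle>C\<rangle> \<odot> coevl V Y) \<odot> \<langle>Y\<rangle>"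
    if h: "h \<in> hom (C \<otimes> Y) E" for h
  proof -
    note [diagram] = h[THEN diagram_gen]
    have "\<langle>E\<rangle> \<odot> evl V Y \<cdot> (h \<odot> \<langle>ld V Y\<rangle> \<cdot> \<langle>C\<rangle> \<odot> coevl V Y) \<odot> \<langle>Y\<rangle> =
        h \<cdot> \<langle>C\<rangle> \<odot> (\<langle>Y\<rangle> \<odot> evl V Y \<cdot> coevl V Y \<odot> \<langle>Y\<rangle>)" by ((rule diagram)+, simp)
    also have "\<dots> = h" unfolding snake_l1[OF Y] by ((rule diagram)+, simp)
    finally show ?thesis ..
  qed
  note [diagram] = g[THEN diagram_gen] g'[THEN diagram_gen]
  have "g \<odot> \<langle>ld V Y\<rangle> \<cdot> \<langle>C\<rangle> \<odot> coevl V Y = g' \<odot> \<langle>ld V Y\<rangle> \<cdot> \<langle>C\<rangle> \<odot> coevl V Y"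
  proof (rule coend_eqI)
    show "g \<odot> \<langle>ld V Y\<rangle> \<cdot> \<langle>C\<rangle> \<odot> coevl V Y \<in> hom C (E \<otimes> ld V Y)"
      by (rule diagram_hom, (rule diagram)+)
    show "g' \<odot> \<langle>ld V Y\<rangle> \<cdot> \<langle>C\<rangle> \<odot> coevl V Y \<in> hom C (E \<otimes> ld V Y)"
      by (rule diagram_hom, (rule diagram)+)
    fix X assume X: "X \<in> Obj V"
    note [diagram] = X[THEN atomI]
    have "\<langle>X\<rangle> \<odot> (g \<odot> \<langle>ld V Y\<rangle> \<cdot> \<langle>C\<rangle> \<odot> coevl V Y) \<cdot> \<delta> X =
        (\<langle>X\<rangle> \<odot> g \<cdot> \<delta> X \<odot> \<langle>Y\<rangle>) \<odot> \<langle>ld V Y\<rangle> \<cdot> \<langle>X\<rangle> \<odot> coevl V Y"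
      by ((rule diagram)+, simp)
    also have "\<dots> = \<langle>X\<rangle> \<odot> (g' \<odot> \<langle>ld V Y\<rangle> \<cdot> \<langle>C\<rangle> \<odot> coevl V Y) \<cdot> \<delta> X"
      unfolding eq[OF X] by ((rule diagram)+, simp)
    finally show "\<langle>X\<rangle> \<odot> (g \<odot> \<langle>ld V Y\<rangle> \<cdot> \<langle>C\<rangle> \<odot> coevl V Y) \<cdot> \<delta> X =
        \<langle>X\<rangle> \<odot> (g' \<odot> \<langle>ld V Y\<rangle> \<cdot> \<langle>C\<rangle> \<odot> coevl V Y) \<cdot> \<delta> X" .
  qed
  then show ?thesis using *[OF g] *[OF g'] by simp
qed

section \<open>Universal property of the coend in two variables\<close>

lemma delta2_hom: "X \<in> Obj V \<Longrightarrow> Y \<in> Obj V \<Longrightarrow> \<delta>2 X Y \<in> hom (X \<otimes> Y) (X \<otimes> Y \<otimes> C \<otimes> C)"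
proof -
  assume "X \<in> Obj V" "Y \<in> Obj V"
  note [diagram] = this[THEN atomI]
  show ?thesis unfolding \<delta>2_def by (rule diagram_hom, (rule diagram)+)
qed

lemmas [diagram] = delta2_hom[THEN diagram_gen]

lemma delta2_natural:
  assumes f: "f \<in> hom X X'" and g: "g \<in> hom Y Y'"
  shows "f \<odot> g \<odot> \<langle>C\<rangle> \<odot> \<langle>C\<rangle> \<cdot> \<delta>2 X Y = \<delta>2 X' Y' \<cdot> f \<odot> g"
proof -
  note [diagram] =
      f[THEN diagram_gen] g[THEN diagram_gen] hom_obj[OF f, THEN atomI] hom_obj[OF g, THEN atomI]
  have "f \<odot> g \<odot> \<langle>C\<rangle> \<odot> \<langle>C\<rangle> \<cdot> \<delta>2 X Y = \<langle>X'\<rangle> \<odot> (g \<odot> \<langle>C\<rangle> \<cdot> \<sigma> C Y) \<odot> \<langle>C\<rangle> \<cdot> (f \<odot> \<langle>C\<rangle> \<cdot> \<delta> X) \<odot> \<delta> Y"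
    unfolding \<delta>2_def by ((rule diagram)+, simp)
  also have "\<dots> = \<langle>X'\<rangle> \<odot> \<sigma> C Y' \<odot> \<langle>C\<rangle> \<cdot> (\<delta> X' \<cdot> f) \<odot> (g \<odot> \<langle>C\<rangle> \<cdot> \<delta> Y)"
    unfolding sigma_natural_right[OF g C_obj] delta_natural[OF f] by ((rule diagram)+, simp)
  also have "\<dots> = \<delta>2 X' Y' \<cdot> f \<odot> g"
    unfolding delta_natural[OF g] \<delta>2_def by ((rule diagram)+, simp)
  finally show ?thesis .
qed

text \<open>
  The universal property for two variables is the one-variable property applied twice; the second
  application needs \<open>Y\<close> on the left of the remaining copy of \<open>C\<close>, whence the braidings.
\<close>

lemma coend2_swap:
  assumes Y: "Y \<in> Obj V" and D: "D \<in> Obj V" and h: "h \<in> hom (C \<otimes> C) D"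
  shows "\<langle>Y\<rangle> \<odot> (h \<cdot> \<sigma> C C) \<cdot> \<sigma> C Y \<odot> \<langle>C\<rangle> \<cdot> \<langle>C\<rangle> \<odot> \<delta> Y = (\<langle>Y\<rangle> \<odot> h \<cdot> \<delta> Y \<odot> \<langle>C\<rangle>) \<cdot> \<sigma> C Y"
proof -
  note [diagram] = Y[THEN atomI] D[THEN atomI] h[THEN diagram_gen]
  have "\<langle>Y\<rangle> \<odot> (h \<cdot> \<sigma> C C) \<cdot> \<sigma> C Y \<odot> \<langle>C\<rangle> \<cdot> \<langle>C\<rangle> \<odot> \<delta> Y = \<langle>Y\<rangle> \<odot> h \<cdot> (\<sigma> C (Y \<otimes> C) \<cdot> \<langle>C\<rangle> \<odot> \<delta> Y)"
    by ((rule diagram)+, simp)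
  also have "\<dots> = (\<langle>Y\<rangle> \<odot> h \<cdot> \<delta> Y \<odot> \<langle>C\<rangle>) \<cdot> \<sigma> C Y"
    unfolding sigma_natural_right[OF delta_hom[OF Y] C_obj, symmetric] by ((rule diagram)+, simp)
  finally show ?thesis .
qed

lemma coend2_exists:
  assumes D: "D \<in> Obj V"
    and n: "\<And>X Y. X \<in> Obj V \<Longrightarrow> Y \<in> Obj V \<Longrightarrow> n X Y \<in> hom (X \<otimes> Y) (X \<otimes> Y \<otimes> D)"
    and nat: "\<And>f X X' g Y Y'. f \<in> hom X X' \<Longrightarrow> g \<in> hom Y Y' \<Longrightarrow> f \<odot> g \<odot> \<langle>D\<rangle> \<cdot> n X Y = n X' Y' \<cdot> f \<odot> g"
  shows "\<exists>g \<in> hom (C \<otimes> C) D. \<forall>X \<in> Obj V. \<forall>Y \<in> Obj V. \<langle>X \<otimes> Y\<rangle> \<odot> g \<cdot> \<delta>2 X Y = n X Y"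
proof -
  note [diagram] = D[THEN atomI] n[THEN diagram_gen]
  have "\<exists>G. \<forall>Y \<in> Obj V. G Y \<in> hom (C \<otimes> Y) (Y \<otimes> D) \<and> (\<forall>X \<in> Obj V. \<langle>X\<rangle> \<odot> G Y \<cdot> \<delta> X \<odot> \<langle>Y\<rangle> = n X Y)"
  proof (rule bchoice, rule ballI)
    fix Y assume Y: "Y \<in> Obj V"
    have "\<exists>g \<in> hom (C \<otimes> Y) (Y \<otimes> D). \<forall>X \<in> Obj V. \<langle>X\<rangle> \<odot> g \<cdot> \<delta> X \<odot> \<langle>Y\<rangle> = n X Y"
    proof (rule coend_ten_exists[OF Y ten_obj[OF Y D] n[OF _ Y]])
      fix f X X' assume f: "f \<in> hom X X'"
      note [diagram] = f[THEN diagram_gen] hom_obj[OF f, THEN atomI] Y[THEN atomI]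
      have "f \<odot> \<langle>Y \<otimes> D\<rangle> \<cdot> n X Y = f \<odot> \<langle>Y\<rangle> \<odot> \<langle>D\<rangle> \<cdot> n X Y" by ((rule diagram)+, simp)
      then show "f \<odot> \<langle>Y \<otimes> D\<rangle> \<cdot> n X Y = n X' Y \<cdot> f \<odot> \<langle>Y\<rangle>"
        unfolding nat[OF f ident_hom[OF Y]] .
    qed
    then show "\<exists>g. g \<in> hom (C \<otimes> Y) (Y \<otimes> D) \<and> (\<forall>X \<in> Obj V. \<langle>X\<rangle> \<odot> g \<cdot> \<delta> X \<odot> \<langle>Y\<rangle> = n X Y)" by blast
  qed
  then obtain G where G: "\<And>Y. Y \<in> Obj V \<Longrightarrow> G Y \<in> hom (C \<otimes> Y) (Y \<otimes> D)"
    and Gn: "\<And>X Y. X \<in> Obj V \<Longrightarrow> Y \<in> Obj V \<Longrightarrow> \<langle>X\<rangle> \<odot> G Y \<cdot> \<delta> X \<odot> \<langle>Y\<rangle> = n X Y" by blast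
  note [diagram] = G[THEN diagram_gen]
  \<comment> \<open>Each \<open>G Y\<close> is chosen separately. Naturality in \<open>Y\<close>
    follows afterwards from uniqueness, by testing both sides on the coaction of every
    \<open>X\<close>.\<close>
  have Gnat: "g \<odot> \<langle>D\<rangle> \<cdot> G Y = G Y' \<cdot> \<langle>C\<rangle> \<odot> g" if g: "g \<in> hom Y Y'" for g Y Y'
  proof (rule coend_ten_eqI)
    note [diagram] = g[THEN diagram_gen] hom_obj[OF g, THEN atomI]
    show "Y \<in> Obj V" by (rule hom_obj[OF g])
    show "g \<odot> \<langle>D\<rangle> \<cdot> G Y \<in> hom (C \<otimes> Y) (Y' \<otimes> D)" by (rule diagram_hom, (rule diagram)+)
    show "G Y' \<cdot> \<langle>C\<rangle> \<odot> g \<in> hom (C \<otimes> Y) (Y' \<otimes> D)" by (rule diagram_hom, (rule diagram)+)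
    fix X assume X: "X \<in> Obj V"
    note [diagram] = X[THEN atomI]
    have "\<langle>X\<rangle> \<odot> (g \<odot> \<langle>D\<rangle> \<cdot> G Y) \<cdot> \<delta> X \<odot> \<langle>Y\<rangle> = \<langle>X\<rangle> \<odot> g \<odot> \<langle>D\<rangle> \<cdot> (\<langle>X\<rangle> \<odot> G Y \<cdot> \<delta> X \<odot> \<langle>Y\<rangle>)"
      by ((rule diagram)+, simp)
    also have "\<dots> = (\<langle>X\<rangle> \<odot> G Y' \<cdot> \<delta> X \<odot> \<langle>Y'\<rangle>) \<cdot> \<langle>X\<rangle> \<odot> g"
      unfolding Gn[OF X hom_obj(1)[OF g]] Gn[OF X hom_obj(2)[OF g]] nat[OF ident_hom[OF X] g] ..
    also have "\<dots> = \<langle>X\<rangle> \<odot> (G Y' \<cdot> \<langle>C\<rangle> \<odot> g) \<cdot> \<delta> X \<odot> \<langle>Y\<rangle>" by ((rule diagram)+, simp)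
    finally show "\<langle>X\<rangle> \<odot> (g \<odot> \<langle>D\<rangle> \<cdot> G Y) \<cdot> \<delta> X \<odot> \<langle>Y\<rangle> = \<langle>X\<rangle> \<odot> (G Y' \<cdot> \<langle>C\<rangle> \<odot> g) \<cdot> \<delta> X \<odot> \<langle>Y\<rangle>" .
  qed
  \<comment> \<open>\<tau> brings \<open>Y\<close> to the left of \<open>C\<close>. It is the
    inverse of the crossing \<open>\<sigma> C Y\<close> in \<open>\<delta>2\<close>, and the two
    cancel once \<open>coend2_swap\<close> has moved that crossing next to it.\<close>
  have "\<exists>h \<in> hom (C \<otimes> C) D. \<forall>Y \<in> Obj V. \<langle>Y\<rangle> \<odot> h \<cdot> \<delta> Y \<odot> \<langle>C\<rangle> = G Y \<cdot> \<tau> Y C"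
  proof (rule coend_ten_exists[OF C_obj D])
    fix Y assume Y: "Y \<in> Obj V"
    note [diagram] = Y[THEN atomI]
    show "G Y \<cdot> \<tau> Y C \<in> hom (Y \<otimes> C) (Y \<otimes> D)" by (rule diagram_hom, (rule diagram)+)
  next
    fix g Y Y' assume g: "g \<in> hom Y Y'"
    note [diagram] = g[THEN diagram_gen] hom_obj[OF g, THEN atomI]
    have "g \<odot> \<langle>D\<rangle> \<cdot> G Y \<cdot> \<tau> Y C = (g \<odot> \<langle>D\<rangle> \<cdot> G Y) \<cdot> \<tau> Y C" by ((rule diagram)+, simp)
    also have "\<dots> = G Y' \<cdot> (\<langle>C\<rangle> \<odot> g \<cdot> \<tau> Y C)" unfolding Gnat[OF g] by ((rule diagram)+, simp)
    also have "\<dots> = (G Y' \<cdot> \<tau> Y' C) \<cdot> g \<odot> \<langle>C\<rangle>"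
      unfolding tau_natural_left[OF g C_obj] by ((rule diagram)+, simp)
    finally show "g \<odot> \<langle>D\<rangle> \<cdot> G Y \<cdot> \<tau> Y C = (G Y' \<cdot> \<tau> Y' C) \<cdot> g \<odot> \<langle>C\<rangle>" .
  qed
  then obtain h where h: "h \<in> hom (C \<otimes> C) D"
    and hG: "\<And>Y. Y \<in> Obj V \<Longrightarrow> \<langle>Y\<rangle> \<odot> h \<cdot> \<delta> Y \<odot> \<langle>C\<rangle> = G Y \<cdot> \<tau> Y C" by blast
  note [diagram] = h[THEN diagram_gen]
  have "\<langle>X \<otimes> Y\<rangle> \<odot> (h \<cdot> \<sigma> C C) \<cdot> \<delta>2 X Y = n X Y" if X: "X \<in> Obj V" and Y: "Y \<in> Obj V" for X Y
  proof -
    note [diagram] = X[THEN atomI] Y[THEN atomI]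
    have "\<langle>X \<otimes> Y\<rangle> \<odot> (h \<cdot> \<sigma> C C) \<cdot> \<delta>2 X Y =
        \<langle>X\<rangle> \<odot> (\<langle>Y\<rangle> \<odot> (h \<cdot> \<sigma> C C) \<cdot> \<sigma> C Y \<odot> \<langle>C\<rangle> \<cdot> \<langle>C\<rangle> \<odot> \<delta> Y) \<cdot> \<delta> X \<odot> \<langle>Y\<rangle>"
      unfolding \<delta>2_def by ((rule diagram)+, simp)
    also have "\<dots> = \<langle>X\<rangle> \<odot> G Y \<cdot> \<langle>X\<rangle> \<odot> (\<tau> Y C \<cdot> \<sigma> C Y) \<cdot> \<delta> X \<odot> \<langle>Y\<rangle>"
      unfolding coend2_swap[OF Y D h] hG[OF Y] by ((rule diagram)+, simp)
    also have "\<dots> = \<langle>X\<rangle> \<odot> G Y \<cdot> \<delta> X \<odot> \<langle>Y\<rangle>"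
      unfolding tau_sigma[OF C_obj Y] by ((rule diagram)+, simp)
    finally show ?thesis unfolding Gn[OF X Y] .
  qed
  moreover have "h \<cdot> \<sigma> C C \<in> hom (C \<otimes> C) D" by (rule diagram_hom, (rule diagram)+)
  ultimately show ?thesis by blast
qed

text \<open>The variables are removed one at a time: \<open>X\<close> by
  \<open>coend_ten_eqI\<close>, after which composing with \<open>\<tau> C C\<close> brings the
  remaining identity into the form that the same lemma needs for \<open>Y\<close>.\<close>

lemma coend2_eqI:
  assumes f: "f \<in> hom (C \<otimes> C) D" and g: "g \<in> hom (C \<otimes> C) D"
    and eq: "\<And>X Y. X \<in> Obj V \<Longrightarrow> Y \<in> Obj V \<Longrightarrow> \<langle>X \<otimes> Y\<rangle> \<odot> f \<cdot> \<delta>2 X Y = \<langle>X \<otimes> Y\<rangle> \<odot> g \<cdot> \<delta>2 X Y"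
  shows "f = g"
proof -
  note D = hom_obj(2)[OF f]
  note [diagram] = D[THEN atomI] f[THEN diagram_gen] g[THEN diagram_gen]
  have 1: "\<langle>Y\<rangle> \<odot> f \<cdot> \<sigma> C Y \<odot> \<langle>C\<rangle> \<cdot> \<langle>C\<rangle> \<odot> \<delta> Y = \<langle>Y\<rangle> \<odot> g \<cdot> \<sigma> C Y \<odot> \<langle>C\<rangle> \<cdot> \<langle>C\<rangle> \<odot> \<delta> Y"
    if Y: "Y \<in> Obj V" for Y
  proof (rule coend_ten_eqI[OF Y])
    note [diagram] = Y[THEN atomI]
    show "\<langle>Y\<rangle> \<odot> f \<cdot> \<sigma> C Y \<odot> \<langle>C\<rangle> \<cdot> \<langle>C\<rangle> \<odot> \<delta> Y \<in> hom (C \<otimes> Y) (Y \<otimes> D)"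
      by (rule diagram_hom, (rule diagram)+)
    show "\<langle>Y\<rangle> \<odot> g \<cdot> \<sigma> C Y \<odot> \<langle>C\<rangle> \<cdot> \<langle>C\<rangle> \<odot> \<delta> Y \<in> hom (C \<otimes> Y) (Y \<otimes> D)"
      by (rule diagram_hom, (rule diagram)+)
    fix X assume X: "X \<in> Obj V"
    note [diagram] = X[THEN atomI]
    have "\<langle>X\<rangle> \<odot> (\<langle>Y\<rangle> \<odot> f \<cdot> \<sigma> C Y \<odot> \<langle>C\<rangle> \<cdot> \<langle>C\<rangle> \<odot> \<delta> Y) \<cdot> \<delta> X \<odot> \<langle>Y\<rangle> = \<langle>X \<otimes> Y\<rangle> \<odot> f \<cdot> \<delta>2 X Y"
      unfolding \<delta>2_def by ((rule diagram)+, simp)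
    also have "\<dots> = \<langle>X\<rangle> \<odot> (\<langle>Y\<rangle> \<odot> g \<cdot> \<sigma> C Y \<odot> \<langle>C\<rangle> \<cdot> \<langle>C\<rangle> \<odot> \<delta> Y) \<cdot> \<delta> X \<odot> \<langle>Y\<rangle>"
      unfolding eq[OF X Y] unfolding \<delta>2_def by ((rule diagram)+, simp)
    finally show "\<langle>X\<rangle> \<odot> (\<langle>Y\<rangle> \<odot> f \<cdot> \<sigma> C Y \<odot> \<langle>C\<rangle> \<cdot> \<langle>C\<rangle> \<odot> \<delta> Y) \<cdot> \<delta> X \<odot> \<langle>Y\<rangle> =
      \<langle>X\<rangle> \<odot> (\<langle>Y\<rangle> \<odot> g \<cdot> \<sigma> C Y \<odot> \<langle>C\<rangle> \<cdot> \<langle>C\<rangle> \<odot> \<delta> Y) \<cdot> \<delta> X \<odot> \<langle>Y\<rangle>" .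
  qed
  have 2: "h = (h \<cdot> \<tau> C C) \<cdot> \<sigma> C C" if h: "h \<in> hom (C \<otimes> C) D" for h
  proof -
    note [diagram] = h[THEN diagram_gen]
    have "(h \<cdot> \<tau> C C) \<cdot> \<sigma> C C = h \<cdot> (\<tau> C C \<cdot> \<sigma> C C)" by ((rule diagram)+, simp)
    also have "\<dots> = h" unfolding tau_sigma[OF C_obj C_obj] by ((rule diagram)+, simp)
    finally show ?thesis ..
  qed
  have 3: "\<langle>Y\<rangle> \<odot> (h \<cdot> \<tau> C C) \<cdot> \<delta> Y \<odot> \<langle>C\<rangle> = (\<langle>Y\<rangle> \<odot> h \<cdot> \<sigma> C Y \<odot> \<langle>C\<rangle> \<cdot> \<langle>C\<rangle> \<odot> \<delta> Y) \<cdot> \<tau> Y C"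
    if h: "h \<in> hom (C \<otimes> C) D" and Y: "Y \<in> Obj V" for h Y
  proof -
    note [diagram] = h[THEN diagram_gen] Y[THEN atomI]
    have h': "h \<cdot> \<tau> C C \<in> hom (C \<otimes> C) D" by (rule diagram_hom, (rule diagram)+)
    have "\<langle>Y\<rangle> \<odot> (h \<cdot> \<tau> C C) \<cdot> \<delta> Y \<odot> \<langle>C\<rangle> = (\<langle>Y\<rangle> \<odot> (h \<cdot> \<tau> C C) \<cdot> \<delta> Y \<odot> \<langle>C\<rangle>) \<cdot> (\<sigma> C Y \<cdot> \<tau> Y C)"
      unfolding sigma_tau[OF C_obj Y] by ((rule diagram)+, simp)
    also have "\<dots> = ((\<langle>Y\<rangle> \<odot> (h \<cdot> \<tau> C C) \<cdot> \<delta> Y \<odot> \<langle>C\<rangle>) \<cdot> \<sigma> C Y) \<cdot> \<tau> Y C" by ((rule diagram)+, simp)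
    finally show ?thesis
      unfolding coend2_swap[OF Y D h', symmetric] 2[OF h, symmetric] .
  qed
  have "f \<cdot> \<tau> C C = g \<cdot> \<tau> C C"
  proof (rule coend_ten_eqI[OF C_obj])
    show "f \<cdot> \<tau> C C \<in> hom (C \<otimes> C) D" by (rule diagram_hom, (rule diagram)+)
    show "g \<cdot> \<tau> C C \<in> hom (C \<otimes> C) D" by (rule diagram_hom, (rule diagram)+)
  qed (simp add: 3[OF f] 3[OF g] 1)
  then show ?thesis using 2[OF f] 2[OF g] by simp
qed

section \<open>Multiplication, comultiplication and pairings of the coend\<close>

lemma mC: shows mC_hom: "mC \<in> hom (C \<otimes> C) C"
  and mC_delta2: "X \<in> Obj V \<Longrightarrow> Y \<in> Obj V \<Longrightarrow> \<langle>X \<otimes> Y\<rangle> \<odot> mC \<cdot> \<delta>2 X Y = \<delta> (X \<otimes> Y)"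
proof -
  have "\<exists>f \<in> hom (C \<otimes> C) C. \<forall>X \<in> Obj V. \<forall>Y \<in> Obj V. \<langle>X \<otimes> Y\<rangle> \<odot> f \<cdot> \<delta>2 X Y = \<delta> (X \<otimes> Y)"
  proof (rule coend2_exists[OF C_obj])
    fix X Y assume o: "X \<in> Obj V" "Y \<in> Obj V"
    note [diagram] = o[THEN atomI]
    show "\<delta> (X \<otimes> Y) \<in> hom (X \<otimes> Y) (X \<otimes> Y \<otimes> C)" by (rule diagram_hom, (rule diagram)+)
  next
    fix f X X' g Y Y' assume f: "f \<in> hom X X'" and g: "g \<in> hom Y Y'"
    note [diagram] =
        f[THEN diagram_gen] g[THEN diagram_gen] hom_obj[OF f, THEN atomI] hom_obj[OF g, THEN atomI]
    have "f \<odot> g \<odot> \<langle>C\<rangle> \<cdot> \<delta> (X \<otimes> Y) = (f \<odot> g) \<odot> \<langle>C\<rangle> \<cdot> \<delta> (X \<otimes> Y)" by ((rule diagram)+, simp)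
    then show "f \<odot> g \<odot> \<langle>C\<rangle> \<cdot> \<delta> (X \<otimes> Y) = \<delta> (X' \<otimes> Y') \<cdot> f \<odot> g"
      unfolding delta_natural[OF ten_hom[OF f g]] .
  qed
  then have "\<exists>!f. f \<in> hom (C \<otimes> C) C \<and> (\<forall>X \<in> Obj V. \<forall>Y \<in> Obj V. \<langle>X \<otimes> Y\<rangle> \<odot> f \<cdot> \<delta>2 X Y = \<delta> (X \<otimes> Y))"
    using coend2_eqI by (metis (no_types, lifting))
  from theI'[OF this] show "mC \<in> hom (C \<otimes> C) C"
    "X \<in> Obj V \<Longrightarrow> Y \<in> Obj V \<Longrightarrow> \<langle>X \<otimes> Y\<rangle> \<odot> mC \<cdot> \<delta>2 X Y = \<delta> (X \<otimes> Y)" unfolding mC_def by blast+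
qed

lemma \<Delta>C: shows DeltaC_hom: "\<Delta>C \<in> hom C (C \<otimes> C)"
  and DeltaC_delta: "X \<in> Obj V \<Longrightarrow> \<langle>X\<rangle> \<odot> \<Delta>C \<cdot> \<delta> X = \<delta> X \<odot> \<langle>C\<rangle> \<cdot> \<delta> X"
proof -
  have "\<exists>f \<in> hom C (C \<otimes> C). \<forall>X \<in> Obj V. \<langle>X\<rangle> \<odot> f \<cdot> \<delta> X = \<delta> X \<odot> \<langle>C\<rangle> \<cdot> \<delta> X"
  proof (rule coend_exists[OF ten_obj[OF C_obj C_obj]])
    fix X assume o: "X \<in> Obj V"
    note [diagram] = o[THEN atomI]
    show "\<delta> X \<odot> \<langle>C\<rangle> \<cdot> \<delta> X \<in> hom X (X \<otimes> C \<otimes> C)" by (rule diagram_hom, (rule diagram)+)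
  next
    fix f X Y assume f: "f \<in> hom X Y"
    note [diagram] = f[THEN diagram_gen] hom_obj[OF f, THEN atomI]
    have "f \<odot> \<langle>C \<otimes> C\<rangle> \<cdot> \<delta> X \<odot> \<langle>C\<rangle> \<cdot> \<delta> X = (f \<odot> \<langle>C\<rangle> \<cdot> \<delta> X) \<odot> \<langle>C\<rangle> \<cdot> \<delta> X" by ((rule diagram)+, simp)
    also have "\<dots> = (\<delta> Y \<cdot> f) \<odot> \<langle>C\<rangle> \<cdot> \<delta> X" unfolding delta_natural[OF f] ..
    also have "\<dots> = \<delta> Y \<odot> \<langle>C\<rangle> \<cdot> (f \<odot> \<langle>C\<rangle> \<cdot> \<delta> X)" by ((rule diagram)+, simp)
    also have "\<dots> = (\<delta> Y \<odot> \<langle>C\<rangle> \<cdot> \<delta> Y) \<cdot> f" unfolding delta_natural[OF f] by ((rule diagram)+, simp)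
    finally show "f \<odot> \<langle>C \<otimes> C\<rangle> \<cdot> \<delta> X \<odot> \<langle>C\<rangle> \<cdot> \<delta> X = (\<delta> Y \<odot> \<langle>C\<rangle> \<cdot> \<delta> Y) \<cdot> f" .
  qed
  then have "\<exists>!f. f \<in> hom C (C \<otimes> C) \<and> (\<forall>X \<in> Obj V. \<langle>X\<rangle> \<odot> f \<cdot> \<delta> X = \<delta> X \<odot> \<langle>C\<rangle> \<cdot> \<delta> X)"
    using coend_eqI by (metis (no_types, lifting))
  from theI'[OF this] show "\<Delta>C \<in> hom C (C \<otimes> C)"
    "X \<in> Obj V \<Longrightarrow> \<langle>X\<rangle> \<odot> \<Delta>C \<cdot> \<delta> X = \<delta> X \<odot> \<langle>C\<rangle> \<cdot> \<delta> X" unfolding \<Delta>C_def by blast+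
qed

text \<open>The case of trivial coefficients: natural endomorphisms of \<open>X \<otimes> Y\<close>
  are represented by pairings on \<open>C \<otimes> C\<close>. It justifies the descriptions
  defining \<open>\<omega>\<close> and \<open>\<omega>_inv\<close>.\<close>

lemma pairing_exists:
  assumes n: "\<And>X Y. X \<in> Obj V \<Longrightarrow> Y \<in> Obj V \<Longrightarrow> n X Y \<in> hom (X \<otimes> Y) (X \<otimes> Y)"
    and nat: "\<And>f X X' g Y Y'. f \<in> hom X X' \<Longrightarrow> g \<in> hom Y Y' \<Longrightarrow> f \<odot> g \<cdot> n X Y = n X' Y' \<cdot> f \<odot> g"
  shows "\<exists>!w. w \<in> hom (C \<otimes> C) \<one> \<and> (\<forall>X \<in> Obj V. \<forall>Y \<in> Obj V. \<langle>X \<otimes> Y\<rangle> \<odot> w \<cdot> \<delta>2 X Y = n X Y)"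
proof -
  have "\<exists>w \<in> hom (C \<otimes> C) \<one>. \<forall>X \<in> Obj V. \<forall>Y \<in> Obj V. \<langle>X \<otimes> Y\<rangle> \<odot> w \<cdot> \<delta>2 X Y = n X Y"
  proof (rule coend2_exists[OF unit_obj])
    fix X Y assume o: "X \<in> Obj V" "Y \<in> Obj V"
    then show "n X Y \<in> hom (X \<otimes> Y) (X \<otimes> Y \<otimes> \<one>)" using n ten_unit by simp
  next
    fix f X X' g Y Y' assume f: "f \<in> hom X X'" and g: "g \<in> hom Y Y'"
    then show "f \<odot> g \<odot> \<langle>\<one>\<rangle> \<cdot> n X Y = n X' Y' \<cdot> f \<odot> g"
      using nat[OF f g] hom_arr ten_unit_arr by simp
  qed
  then show ?thesis
    using coend2_eqI by (metis (no_types, lifting))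
qed

lemma omega: shows omega_hom: "\<omega> \<in> hom (C \<otimes> C) \<one>"
  and omega_delta2: "X \<in> Obj V \<Longrightarrow> Y \<in> Obj V \<Longrightarrow> \<langle>X \<otimes> Y\<rangle> \<odot> \<omega> \<cdot> \<delta>2 X Y = \<sigma> Y X \<cdot> \<sigma> X Y"
proof -
  have "\<exists>!w. w \<in> hom (C \<otimes> C) \<one> \<and> (\<forall>X \<in> Obj V. \<forall>Y \<in> Obj V. \<langle>X \<otimes> Y\<rangle> \<odot> w \<cdot> \<delta>2 X Y = \<sigma> Y X \<cdot> \<sigma> X Y)"
  proof (rule pairing_exists)
    fix X Y assume o: "X \<in> Obj V" "Y \<in> Obj V"
    note [diagram] = o[THEN atomI]
    show "\<sigma> Y X \<cdot> \<sigma> X Y \<in> hom (X \<otimes> Y) (X \<otimes> Y)" by (rule diagram_hom, (rule diagram)+)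
  next
    fix f X X' g Y Y' assume f: "f \<in> hom X X'" and g: "g \<in> hom Y Y'"
    note [diagram] =
        f[THEN diagram_gen] g[THEN diagram_gen] hom_obj[OF f, THEN atomI] hom_obj[OF g, THEN atomI]
    have "f \<odot> g \<cdot> \<sigma> Y X \<cdot> \<sigma> X Y = (f \<odot> g \<cdot> \<sigma> Y X) \<cdot> \<sigma> X Y" by ((rule diagram)+, simp)
    also have "\<dots> = \<sigma> Y' X' \<cdot> (g \<odot> f \<cdot> \<sigma> X Y)"
      unfolding sigma_natural[OF g f] by ((rule diagram)+, simp)
    also have "\<dots> = (\<sigma> Y' X' \<cdot> \<sigma> X' Y') \<cdot> f \<odot> g"
      unfolding sigma_natural[OF f g] by ((rule diagram)+, simp)
    finally show "f \<odot> g \<cdot> \<sigma> Y X \<cdot> \<sigma> X Y = (\<sigma> Y' X' \<cdot> \<sigma> X' Y') \<cdot> f \<odot> g" .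
  qed
  from theI'[OF this] show "\<omega> \<in> hom (C \<otimes> C) \<one>"
    "X \<in> Obj V \<Longrightarrow> Y \<in> Obj V \<Longrightarrow> \<langle>X \<otimes> Y\<rangle> \<odot> \<omega> \<cdot> \<delta>2 X Y = \<sigma> Y X \<cdot> \<sigma> X Y" unfolding \<omega>_def by blast+
qed

lemma omega_inv: shows omega_inv_hom: "\<omega>_inv \<in> hom (C \<otimes> C) \<one>"
  and omega_inv_delta2: "X \<in> Obj V \<Longrightarrow> Y \<in> Obj V \<Longrightarrow> \<langle>X \<otimes> Y\<rangle> \<odot> \<omega>_inv \<cdot> \<delta>2 X Y = \<tau> Y X \<cdot> \<tau> X Y"
proof -
  have "\<exists>!w. w \<in> hom (C \<otimes> C) \<one> \<and> (\<forall>X \<in> Obj V. \<forall>Y \<in> Obj V. \<langle>X \<otimes> Y\<rangle> \<odot> w \<cdot> \<delta>2 X Y =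
      inv_arr (\<sigma> Y X \<cdot> \<sigma> X Y))"
  proof (rule pairing_exists)
    fix X Y assume o: "X \<in> Obj V" "Y \<in> Obj V"
    note [diagram] = o[THEN atomI]
    show "inv_arr (\<sigma> Y X \<cdot> \<sigma> X Y) \<in> hom (X \<otimes> Y) (X \<otimes> Y)"
      unfolding inv_double_braiding[OF o] by (rule diagram_hom, (rule diagram)+)
  next
    fix f X X' g Y Y' assume f: "f \<in> hom X X'" and g: "g \<in> hom Y Y'"
    note [diagram] =
        f[THEN diagram_gen] g[THEN diagram_gen] hom_obj[OF f, THEN atomI] hom_obj[OF g, THEN atomI]
    have "f \<odot> g \<cdot> \<tau> Y X \<cdot> \<tau> X Y = (f \<odot> g \<cdot> \<tau> Y X) \<cdot> \<tau> X Y" by ((rule diagram)+, simp)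
    also have "\<dots> = \<tau> Y' X' \<cdot> (g \<odot> f \<cdot> \<tau> X Y)"
      unfolding tau_natural[OF g f] by ((rule diagram)+, simp)
    also have "\<dots> = (\<tau> Y' X' \<cdot> \<tau> X' Y') \<cdot> f \<odot> g"
      unfolding tau_natural[OF f g] by ((rule diagram)+, simp)
    finally show "f \<odot> g \<cdot> inv_arr (\<sigma> Y X \<cdot> \<sigma> X Y) = inv_arr (\<sigma> Y' X' \<cdot> \<sigma> X' Y') \<cdot> f \<odot> g"
      unfolding inv_double_braiding[OF hom_obj(1)[OF f] hom_obj(1)[OF g]]
        inv_double_braiding[OF hom_obj(2)[OF f] hom_obj(2)[OF g]] .
  qed
  from theI'[OF this] show "\<omega>_inv \<in> hom (C \<otimes> C) \<one>"
    "X \<in> Obj V \<Longrightarrow> Y \<in> Obj V \<Longrightarrow> \<langle>X \<otimes> Y\<rangle> \<odot> \<omega>_inv \<cdot> \<delta>2 X Y = \<tau> Y X \<cdot> \<tau> X Y"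
    unfolding \<omega>_inv_def using inv_double_braiding by auto
qed

lemmas [diagram] = mC_hom[THEN diagram_gen] DeltaC_hom[THEN diagram_gen] omega_hom[THEN diagram_gen]
  omega_inv_hom[THEN diagram_gen]

text \<open>This explains the inner factor of the twisted grouplike condition.
  \<open>\<omega>_inv\<close> contributes the inverse double braiding of \<open>C\<close> and
  \<open>Y\<close>, which turns the crossing \<open>\<sigma> C Y\<close> of \<open>\<delta>2\<close>
  into the reverse crossing \<open>\<tau> C Y\<close>.\<close>

lemma omega_inv_tau:
  assumes X: "X \<in> Obj V" and Y: "Y \<in> Obj V"
  shows "\<langle>X \<otimes> Y\<rangle> \<odot> (\<langle>C\<rangle> \<odot> \<omega>_inv \<odot> \<langle>C\<rangle> \<cdot> \<delta> C \<odot> \<Delta>C) \<cdot> \<delta>2 X Y = \<langle>X\<rangle> \<odot> \<tau> C Y \<odot> \<langle>C\<rangle> \<cdot> \<delta> X \<odot> \<delta> Y"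
proof -
  note [diagram] = X[THEN atomI] Y[THEN atomI]
  have "\<langle>X \<otimes> Y\<rangle> \<odot> (\<langle>C\<rangle> \<odot> \<omega>_inv \<odot> \<langle>C\<rangle> \<cdot> \<delta> C \<odot> \<Delta>C) \<cdot> \<delta>2 X Y =
     \<langle>X \<otimes> Y\<rangle> \<odot> \<langle>C\<rangle> \<odot> \<omega>_inv \<odot> \<langle>C\<rangle> \<cdot> \<langle>X\<rangle> \<odot> (\<langle>Y\<rangle> \<odot> \<delta> C \<cdot> \<sigma> C Y) \<odot> \<langle>C\<rangle> \<odot> \<langle>C\<rangle> \<cdot> \<delta> X \<odot> (\<langle>Y\<rangle> \<odot> \<Delta>C \<cdot> \<delta> Y)"
    unfolding \<delta>2_def by ((rule diagram)+, simp)
  \<comment> \<open>The coaction of \<open>C\<close>, taken as an object of \<open>V\<close>, and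
    the second coaction of \<open>Y\<close> combine to \<open>\<delta>2 C Y\<close>, on which
    \<open>\<omega>_inv\<close> is known.\<close>
  also have "\<dots> = \<langle>X\<rangle> \<odot> (\<sigma> C Y \<cdot> \<langle>C \<otimes> Y\<rangle> \<odot> \<omega>_inv \<cdot> \<delta>2 C Y) \<odot> \<langle>C\<rangle> \<cdot> \<delta> X \<odot> \<delta> Y"
    unfolding sigma_natural_left[OF delta_hom[OF C_obj] Y] DeltaC_delta[OF Y] unfolding \<delta>2_def
    by ((rule diagram)+, simp)
  also have "\<dots> = \<langle>X\<rangle> \<odot> ((\<sigma> C Y \<cdot> \<tau> Y C) \<cdot> \<tau> C Y) \<odot> \<langle>C\<rangle> \<cdot> \<delta> X \<odot> \<delta> Y"
    unfolding omega_inv_delta2[OF C_obj Y] by ((rule diagram)+, simp)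
  also have "\<dots> = \<langle>X\<rangle> \<odot> \<tau> C Y \<odot> \<langle>C\<rangle> \<cdot> \<delta> X \<odot> \<delta> Y"
    unfolding sigma_tau[OF C_obj Y] by ((rule diagram)+, simp)
  finally show ?thesis .
qed

text \<open>\<open>\<delta>2\<close> is the coaction of the braided tensor product coalgebra
  \<open>C \<otimes> C\<close> on \<open>X \<otimes> Y\<close>, and the identity is its
  coassociativity. The crossings match by naturality in \<open>\<Delta>C\<close> and in
  \<open>\<delta> Y\<close>.\<close>

lemma delta2_coaction:
  assumes X: "X \<in> Obj V" and Y: "Y \<in> Obj V"
  shows "\<langle>X \<otimes> Y\<rangle> \<odot> (\<langle>C\<rangle> \<odot> \<sigma> C C \<odot> \<langle>C\<rangle> \<cdot> \<Delta>C \<odot> \<Delta>C) \<cdot> \<delta>2 X Y = \<delta>2 X Y \<odot> \<langle>C\<rangle> \<odot> \<langle>C\<rangle> \<cdot> \<delta>2 X Y"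
proof -
  note [diagram] = X[THEN atomI] Y[THEN atomI]
  have "\<langle>X \<otimes> Y\<rangle> \<odot> (\<langle>C\<rangle> \<odot> \<sigma> C C \<odot> \<langle>C\<rangle> \<cdot> \<Delta>C \<odot> \<Delta>C) \<cdot> \<delta>2 X Y =
    \<langle>X \<otimes> Y\<rangle> \<odot> \<langle>C\<rangle> \<odot> \<sigma> C C \<odot> \<langle>C\<rangle> \<cdot> \<langle>X\<rangle> \<odot> (\<langle>Y\<rangle> \<odot> \<Delta>C \<cdot> \<sigma> C Y) \<odot> \<langle>C\<rangle> \<odot> \<langle>C\<rangle> \<cdot> \<delta> X \<odot> (\<langle>Y\<rangle> \<odot> \<Delta>C \<cdot> \<delta> Y)"
    unfolding \<delta>2_def by ((rule diagram)+, simp)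
  also have "\<dots> = \<langle>X \<otimes> Y\<rangle> \<odot> \<langle>C\<rangle> \<odot> \<sigma> C C \<odot> \<langle>C\<rangle> \<cdot> \<langle>X\<rangle> \<odot> \<sigma> (C \<otimes> C) Y \<odot> \<langle>C\<rangle> \<odot> \<langle>C\<rangle> \<cdot>
      (\<langle>X\<rangle> \<odot> \<Delta>C \<cdot> \<delta> X) \<odot> (\<delta> Y \<odot> \<langle>C\<rangle> \<cdot> \<delta> Y)"
    unfolding sigma_natural_left[OF DeltaC_hom Y] DeltaC_delta[OF Y] by ((rule diagram)+, simp)
  also have "\<dots> = \<langle>X\<rangle> \<odot> \<sigma> C Y \<odot> \<langle>C\<rangle> \<odot> \<langle>C \<otimes> C\<rangle> \<cdot> \<langle>X\<rangle> \<odot> \<langle>C\<rangle> \<odot> (\<sigma> C (Y \<otimes> C) \<cdot> \<langle>C\<rangle> \<odot> \<delta> Y) \<odot> \<langle>C\<rangle> \<cdot>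
      (\<delta> X \<odot> \<langle>C\<rangle> \<cdot> \<delta> X) \<odot> \<delta> Y"
    unfolding DeltaC_delta[OF X] by ((rule diagram)+, simp)
  also have "\<dots> = \<delta>2 X Y \<odot> \<langle>C\<rangle> \<odot> \<langle>C\<rangle> \<cdot> \<delta>2 X Y"
    unfolding sigma_natural_right[OF delta_hom[OF Y] C_obj, symmetric] \<delta>2_def
    by ((rule diagram)+, simp)
  finally show ?thesis .
qed

text \<open>Convolution on \<open>C \<otimes> C\<close> corresponds to composing natural families,
  and \<open>\<omega>\<close> represents the double braiding; convolving with
  \<open>\<omega>\<close> on the right is thus precomposition with the double braiding.\<close>

lemma omega_convolution:
  assumes X: "X \<in> Obj V" and Y: "Y \<in> Obj V" and g: "g \<in> hom (C \<otimes> C) D"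
  shows "\<langle>X \<otimes> Y\<rangle> \<odot> (g \<odot> \<omega> \<cdot> \<langle>C\<rangle> \<odot> \<sigma> C C \<odot> \<langle>C\<rangle> \<cdot> \<Delta>C \<odot> \<Delta>C) \<cdot> \<delta>2 X Y =
    (\<langle>X \<otimes> Y\<rangle> \<odot> g \<cdot> \<delta>2 X Y) \<cdot> \<sigma> Y X \<cdot> \<sigma> X Y"
proof -
  note [diagram] = X[THEN atomI] Y[THEN atomI] g[THEN diagram_gen] hom_obj(2)[OF g, THEN atomI]
  have "\<langle>X \<otimes> Y\<rangle> \<odot> (g \<odot> \<omega> \<cdot> \<langle>C\<rangle> \<odot> \<sigma> C C \<odot> \<langle>C\<rangle> \<cdot> \<Delta>C \<odot> \<Delta>C) \<cdot> \<delta>2 X Y =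
    \<langle>X \<otimes> Y\<rangle> \<odot> g \<odot> \<omega> \<cdot> (\<langle>X \<otimes> Y\<rangle> \<odot> (\<langle>C\<rangle> \<odot> \<sigma> C C \<odot> \<langle>C\<rangle> \<cdot> \<Delta>C \<odot> \<Delta>C) \<cdot> \<delta>2 X Y)" by ((rule diagram)+, simp)
  also have "\<dots> = (\<langle>X \<otimes> Y\<rangle> \<odot> g \<cdot> \<delta>2 X Y) \<cdot> (\<langle>X \<otimes> Y\<rangle> \<odot> \<omega> \<cdot> \<delta>2 X Y)"
    unfolding delta2_coaction[OF X Y] by ((rule diagram)+, simp)
  finally show ?thesis unfolding omega_delta2[OF X Y] .
qed

end

section \<open>Hopf algebras and dual modules\<close>

locale braided_hopf = braided_rigid_category V \<sigma> + hopf_data V \<sigma> HH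
  for V :: "('o, 'a) rigid_cat" (structure) and \<sigma> and HH :: "('o, 'a) hopf" +
  assumes hopf_algebra: hopf_algebra
begin

lemma H_obj: "H \<in> Obj V" and m_hom: "m \<in> hom (H \<otimes> H) H" and u_hom: "u \<in> hom \<one> H"
  and Delta_hom: "\<Delta> \<in> hom H (H \<otimes> H)" and eps_hom: "\<epsilon> \<in> hom H \<one>" and S_hom: "S \<in> hom H H"
  and m_assoc: "m \<cdot> m \<odot> \<langle>H\<rangle> = m \<cdot> \<langle>H\<rangle> \<odot> m"
  and m_unit: "m \<cdot> u \<odot> \<langle>H\<rangle> = \<langle>H\<rangle>" "m \<cdot> \<langle>H\<rangle> \<odot> u = \<langle>H\<rangle>"
  and Delta_coassoc: "\<Delta> \<odot> \<langle>H\<rangle> \<cdot> \<Delta> = \<langle>H\<rangle> \<odot> \<Delta> \<cdot> \<Delta>"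
  and Delta_counit: "\<epsilon> \<odot> \<langle>H\<rangle> \<cdot> \<Delta> = \<langle>H\<rangle>" "\<langle>H\<rangle> \<odot> \<epsilon> \<cdot> \<Delta> = \<langle>H\<rangle>"
  and Delta_m: "\<Delta> \<cdot> m = m \<odot> m \<cdot> \<langle>H\<rangle> \<odot> \<sigma> H H \<odot> \<langle>H\<rangle> \<cdot> \<Delta> \<odot> \<Delta>"
  and Delta_u: "\<Delta> \<cdot> u = u \<odot> u" and eps_m: "\<epsilon> \<cdot> m = \<epsilon> \<odot> \<epsilon>" and eps_u: "\<epsilon> \<cdot> u = \<langle>\<one>\<rangle>"
  and antipode: "m \<cdot> S \<odot> \<langle>H\<rangle> \<cdot> \<Delta> = u \<cdot> \<epsilon>" "m \<cdot> \<langle>H\<rangle> \<odot> S \<cdot> \<Delta> = u \<cdot> \<epsilon>"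
  and S_iso: "is_iso S"
  using hopf_algebra unfolding hopf_algebra_def by blast+

lemmas [diagram] = H_obj[THEN atomI] m_hom[THEN diagram_gen] u_hom[THEN diagram_gen]
  Delta_hom[THEN diagram_gen] eps_hom[THEN diagram_gen] S_hom[THEN diagram_gen]

definition T :: 'a where
  "T = inv_arr S"

lemma T_hom: "T \<in> hom H H" and T_S: "T \<cdot> S = \<langle>H\<rangle>" and S_T: "S \<cdot> T = \<langle>H\<rangle>"
  unfolding T_def using inv_arr[OF S_iso S_hom] by blast+

lemmas [diagram] = T_hom[THEN diagram_gen]

lemma S_u: "S \<cdot> u = u"
proof -
  have "S \<cdot> u = (m \<cdot> \<langle>H\<rangle> \<odot> u) \<cdot> S \<cdot> u"
    unfolding m_unit by ((rule diagram)+, simp)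
  also have "\<dots> = m \<cdot> S \<odot> \<langle>H\<rangle> \<cdot> u \<odot> u" by ((rule diagram)+, simp)
  also have "\<dots> = (m \<cdot> S \<odot> \<langle>H\<rangle> \<cdot> \<Delta>) \<cdot> u"
    unfolding Delta_u[symmetric] by ((rule diagram)+, simp)
  also have "\<dots> = u \<cdot> (\<epsilon> \<cdot> u)" unfolding antipode by ((rule diagram)+, simp)
  also have "\<dots> = u" unfolding eps_u by ((rule diagram)+, simp)
  finally show ?thesis .
qed

text \<open>The comultiplication of the braided tensor product coalgebra
  \<open>H \<otimes> H\<close>, with respect to which the convolution in \<open>S_m\<close> is
  taken.\<close>

definition \<Delta>2 :: 'a where
  "\<Delta>2 = \<langle>H\<rangle> \<odot> \<sigma> H H \<odot> \<langle>H\<rangle> \<cdot> \<Delta> \<odot> \<Delta>"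

lemma Delta2_hom: "\<Delta>2 \<in> hom (H \<otimes> H) (H \<otimes> H \<otimes> H \<otimes> H)"
  unfolding \<Delta>2_def by (rule diagram_hom, (rule diagram)+)

lemmas [diagram] = Delta2_hom[THEN diagram_gen]

lemma Delta2_coassoc: "\<Delta>2 \<odot> \<langle>H\<rangle> \<odot> \<langle>H\<rangle> \<cdot> \<Delta>2 = \<langle>H\<rangle> \<odot> \<langle>H\<rangle> \<odot> \<Delta>2 \<cdot> \<Delta>2"
proof -
  have "\<Delta>2 \<odot> \<langle>H\<rangle> \<odot> \<langle>H\<rangle> \<cdot> \<Delta>2 =
    \<langle>H\<rangle> \<odot> \<sigma> H H \<odot> \<langle>H\<rangle> \<odot> \<langle>H\<rangle> \<odot> \<langle>H\<rangle> \<cdot> \<Delta> \<odot> (\<Delta> \<odot> \<langle>H\<rangle> \<cdot> \<sigma> H H) \<odot> \<langle>H\<rangle> \<cdot> \<Delta> \<odot> \<Delta>"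
    unfolding \<Delta>2_def by ((rule diagram)+, simp)
  also have "\<dots> = \<langle>H\<rangle> \<odot> \<sigma> H H \<odot> \<langle>H\<rangle> \<odot> \<langle>H\<rangle> \<odot> \<langle>H\<rangle> \<cdot> \<langle>H\<rangle> \<odot> \<langle>H\<rangle> \<odot> \<sigma> H (H \<otimes> H) \<odot> \<langle>H\<rangle> \<cdot>
     (\<Delta> \<odot> \<langle>H\<rangle> \<cdot> \<Delta>) \<odot> (\<Delta> \<odot> \<langle>H\<rangle> \<cdot> \<Delta>)"
    unfolding sigma_natural_right[OF Delta_hom H_obj] by ((rule diagram)+, simp)
  also have "\<dots> = \<langle>H\<rangle> \<odot> \<langle>H\<rangle> \<odot> \<langle>H\<rangle> \<odot> \<sigma> H H \<odot> \<langle>H\<rangle> \<cdot> \<langle>H\<rangle> \<odot> (\<sigma> (H \<otimes> H) H \<cdot> \<Delta> \<odot> \<langle>H\<rangle>) \<odot> \<Delta> \<cdot> \<Delta> \<odot> \<Delta>"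
    unfolding Delta_coassoc by ((rule diagram)+, simp)
  also have "\<dots> = \<langle>H\<rangle> \<odot> \<langle>H\<rangle> \<odot> \<Delta>2 \<cdot> \<Delta>2"
    unfolding sigma_natural_left[OF Delta_hom H_obj, symmetric] \<Delta>2_def by ((rule diagram)+, simp)
  finally show ?thesis .
qed

lemma Delta2_counit: "\<epsilon> \<odot> \<epsilon> \<odot> \<langle>H\<rangle> \<odot> \<langle>H\<rangle> \<cdot> \<Delta>2 = \<langle>H \<otimes> H\<rangle>" "\<langle>H\<rangle> \<odot> \<langle>H\<rangle> \<odot> \<epsilon> \<odot> \<epsilon> \<cdot> \<Delta>2 = \<langle>H \<otimes> H\<rangle>"
proof -
  have "\<epsilon> \<odot> \<epsilon> \<odot> \<langle>H\<rangle> \<odot> \<langle>H\<rangle> \<cdot> \<Delta>2 = (\<epsilon> \<odot> \<langle>H\<rangle> \<cdot> \<sigma> H H) \<odot> \<langle>H\<rangle> \<cdot> (\<epsilon> \<odot> \<langle>H\<rangle> \<cdot> \<Delta>) \<odot> \<Delta>"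
    unfolding \<Delta>2_def by ((rule diagram)+, simp)
  also have "\<dots> = (\<epsilon> \<odot> \<langle>H\<rangle> \<cdot> \<Delta>) \<odot> (\<epsilon> \<odot> \<langle>H\<rangle> \<cdot> \<Delta>)"
    unfolding sigma_natural_right[OF eps_hom H_obj] by ((rule diagram)+, simp)
  finally show "\<epsilon> \<odot> \<epsilon> \<odot> \<langle>H\<rangle> \<odot> \<langle>H\<rangle> \<cdot> \<Delta>2 = \<langle>H \<otimes> H\<rangle>"
    unfolding Delta_counit using ten_ident[OF H_obj H_obj] by simp
  have "\<langle>H\<rangle> \<odot> \<langle>H\<rangle> \<odot> \<epsilon> \<odot> \<epsilon> \<cdot> \<Delta>2 = \<langle>H\<rangle> \<odot> (\<langle>H\<rangle> \<odot> \<epsilon> \<cdot> \<sigma> H H) \<cdot> \<Delta> \<odot> (\<langle>H\<rangle> \<odot> \<epsilon> \<cdot> \<Delta>)"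
    unfolding \<Delta>2_def by ((rule diagram)+, simp)
  also have "\<dots> = (\<langle>H\<rangle> \<odot> \<epsilon> \<cdot> \<Delta>) \<odot> (\<langle>H\<rangle> \<odot> \<epsilon> \<cdot> \<Delta>)"
    unfolding sigma_natural_left[OF eps_hom H_obj] by ((rule diagram)+, simp)
  finally show "\<langle>H\<rangle> \<odot> \<langle>H\<rangle> \<odot> \<epsilon> \<odot> \<epsilon> \<cdot> \<Delta>2 = \<langle>H \<otimes> H\<rangle>"
    unfolding Delta_counit using ten_ident[OF H_obj H_obj] by simp
qed

text \<open>Both sides are convolution inverse to \<open>m\<close> on the coalgebra \<open>H \<otimes> H\<close>.\<close>

lemma S_m: "S \<cdot> m = m \<cdot> S \<odot> S \<cdot> \<sigma> H H"
proof -
  define B where "B = m \<cdot> S \<odot> S \<cdot> \<sigma> H H"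
  have B: "B \<in> hom (H \<otimes> H) H" unfolding B_def by (rule diagram_hom, (rule diagram)+)
  note [diagram] = B[THEN diagram_gen]
  have A: "m \<cdot> (S \<cdot> m) \<odot> m \<cdot> \<Delta>2 = u \<cdot> \<epsilon> \<odot> \<epsilon>"
  proof -
    have "m \<cdot> (S \<cdot> m) \<odot> m \<cdot> \<Delta>2 = m \<cdot> S \<odot> \<langle>H\<rangle> \<cdot> (\<Delta> \<cdot> m)"
      unfolding Delta_m \<Delta>2_def by ((rule diagram)+, simp)
    also have "\<dots> = (m \<cdot> S \<odot> \<langle>H\<rangle> \<cdot> \<Delta>) \<cdot> m" by ((rule diagram)+, simp)
    also have "\<dots> = u \<cdot> (\<epsilon> \<cdot> m)" unfolding antipode by ((rule diagram)+, simp)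
    finally show ?thesis unfolding eps_m .
  qed
  \<comment> \<open>The second factor of \<open>H \<otimes> H\<close> is cancelled against its
    antipode on the inside, which leaves the antipode axiom for the first factor.\<close>
  have B': "m \<cdot> m \<odot> B \<cdot> \<Delta>2 = u \<cdot> \<epsilon> \<odot> \<epsilon>"
  proof -
    have "m \<cdot> m \<odot> B \<cdot> \<Delta>2 =
        (m \<cdot> m \<odot> \<langle>H\<rangle>) \<cdot> \<langle>H\<rangle> \<odot> \<langle>H\<rangle> \<odot> m \<cdot> \<langle>H\<rangle> \<odot> \<langle>H\<rangle> \<odot> S \<odot> S \<cdot> \<langle>H\<rangle> \<odot> (\<sigma> H (H \<otimes> H) \<cdot> \<langle>H\<rangle> \<odot> \<Delta>) \<cdot> \<Delta> \<odot> \<langle>H\<rangle>"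
      unfolding B_def \<Delta>2_def by ((rule diagram)+, simp)
    also have "\<dots> = m \<cdot> \<langle>H\<rangle> \<odot> (m \<cdot> \<langle>H\<rangle> \<odot> m) \<cdot> \<langle>H\<rangle> \<odot> \<langle>H\<rangle> \<odot> S \<odot> S \<cdot> \<langle>H\<rangle> \<odot> \<Delta> \<odot> \<langle>H\<rangle> \<cdot> \<langle>H\<rangle> \<odot> \<sigma> H H \<cdot>
        \<Delta> \<odot> \<langle>H\<rangle>"
      unfolding sigma_natural_right[OF Delta_hom H_obj, symmetric] m_assoc
      by ((rule diagram)+, simp)
    also have "\<dots> = m \<cdot> \<langle>H\<rangle> \<odot> m \<cdot> \<langle>H\<rangle> \<odot> (m \<cdot> \<langle>H\<rangle> \<odot> S \<cdot> \<Delta>) \<odot> S \<cdot> \<langle>H\<rangle> \<odot> \<sigma> H H \<cdot> \<Delta> \<odot> \<langle>H\<rangle>"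
      unfolding m_assoc[symmetric] by ((rule diagram)+, simp)
    also have "\<dots> = m \<cdot> \<langle>H\<rangle> \<odot> (m \<cdot> u \<odot> \<langle>H\<rangle>) \<cdot> \<langle>H\<rangle> \<odot> S \<cdot> \<langle>H\<rangle> \<odot> (\<epsilon> \<odot> \<langle>H\<rangle> \<cdot> \<sigma> H H) \<cdot> \<Delta> \<odot> \<langle>H\<rangle>"
      unfolding antipode by ((rule diagram)+, simp)
    also have "\<dots> = (m \<cdot> \<langle>H\<rangle> \<odot> S \<cdot> \<Delta>) \<odot> \<epsilon>"
      unfolding sigma_natural_right[OF eps_hom H_obj] m_unit by ((rule diagram)+, simp)
    also have "\<dots> = u \<cdot> \<epsilon> \<odot> \<epsilon>"
      unfolding antipode by ((rule diagram)+, simp)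
    finally show ?thesis .
  qed
  \<comment> \<open>Uniqueness of convolution inverses: the unit is replaced by the convolution
    product of \<open>m\<close> with \<open>B\<close>, the threefold product is reassociated, and
    \<open>S \<cdot> m\<close> with \<open>m\<close> gives the unit again, leaving
    \<open>B\<close>.\<close>
  have "S \<cdot> m = S \<cdot> m \<cdot> (\<langle>H\<rangle> \<odot> \<langle>H\<rangle> \<odot> \<epsilon> \<odot> \<epsilon> \<cdot> \<Delta>2)"
    unfolding Delta2_counit by ((rule diagram)+, simp)
  also have "\<dots> = (m \<cdot> \<langle>H\<rangle> \<odot> u) \<cdot> (S \<cdot> m) \<odot> \<epsilon> \<odot> \<epsilon> \<cdot> \<Delta>2"
    unfolding m_unit by ((rule diagram)+, simp)
  also have "\<dots> = m \<cdot> (S \<cdot> m) \<odot> (u \<cdot> \<epsilon> \<odot> \<epsilon>) \<cdot> \<Delta>2" by ((rule diagram)+, simp)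
  also have "\<dots> = (m \<cdot> \<langle>H\<rangle> \<odot> m) \<cdot> (S \<cdot> m) \<odot> m \<odot> B \<cdot> (\<langle>H\<rangle> \<odot> \<langle>H\<rangle> \<odot> \<Delta>2 \<cdot> \<Delta>2)"
    unfolding B'[symmetric] by ((rule diagram)+, simp)
  also have "\<dots> = m \<cdot> (m \<cdot> (S \<cdot> m) \<odot> m \<cdot> \<Delta>2) \<odot> B \<cdot> \<Delta>2"
    unfolding m_assoc[symmetric] Delta2_coassoc[symmetric] by ((rule diagram)+, simp)
  also have "\<dots> = (m \<cdot> u \<odot> \<langle>H\<rangle>) \<cdot> B \<cdot> (\<epsilon> \<odot> \<epsilon> \<odot> \<langle>H\<rangle> \<odot> \<langle>H\<rangle> \<cdot> \<Delta>2)"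
    unfolding A by ((rule diagram)+, simp)
  also have "\<dots> = B" unfolding m_unit Delta2_counit by ((rule diagram)+, simp)
  finally show ?thesis unfolding B_def .
qed

lemma T_u: "T \<cdot> u = u"
proof -
  have "T \<cdot> u = T \<cdot> S \<cdot> u" unfolding S_u ..
  also have "\<dots> = (T \<cdot> S) \<cdot> u" by ((rule diagram)+, simp)
  also have "\<dots> = u" unfolding T_S by ((rule diagram)+, simp)
  finally show ?thesis .
qed

text \<open>Inverting the anti-multiplicativity of \<open>S\<close> also inverts its crossing,
  whence \<tau> in place of \<sigma>.\<close>

lemma T_m: "T \<cdot> m = m \<cdot> T \<odot> T \<cdot> \<tau> H H"
proof -
  have "m \<cdot> T \<odot> T \<cdot> \<tau> H H = (T \<cdot> S) \<cdot> m \<cdot> T \<odot> T \<cdot> \<tau> H H" unfolding T_S by ((rule diagram)+, simp)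
  also have "\<dots> = T \<cdot> (S \<cdot> m) \<cdot> T \<odot> T \<cdot> \<tau> H H" by ((rule diagram)+, simp)
  also have "\<dots> = T \<cdot> m \<cdot> S \<odot> S \<cdot> (\<sigma> H H \<cdot> T \<odot> T) \<cdot> \<tau> H H" unfolding S_m by ((rule diagram)+, simp)
  also have "\<dots> = T \<cdot> m \<cdot> (S \<cdot> T) \<odot> (S \<cdot> T) \<cdot> (\<sigma> H H \<cdot> \<tau> H H)"
    unfolding sigma_natural[OF T_hom T_hom, symmetric] by ((rule diagram)+, simp)
  also have "\<dots> = T \<cdot> m" unfolding S_T sigma_tau[OF H_obj H_obj] by ((rule diagram)+, simp)
  finally show ?thesis ..
qed

text \<open>\<open>T\<close> is an antipode for the reversed comultiplication
  \<open>\<tau> H H \<cdot> \<Delta>\<close>. After applying \<open>T \<cdot> S\<close>, the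
  crossing produced by \<open>S_m\<close> cancels \<tau> and the antipode axiom remains. These
  identities play for left duals the role of the antipode axioms for right duals.\<close>

lemma antipode_coop: "m \<cdot> T \<odot> \<langle>H\<rangle> \<cdot> \<tau> H H \<cdot> \<Delta> = u \<cdot> \<epsilon>" "m \<cdot> \<langle>H\<rangle> \<odot> T \<cdot> \<tau> H H \<cdot> \<Delta> = u \<cdot> \<epsilon>"
proof -
  have "m \<cdot> T \<odot> \<langle>H\<rangle> \<cdot> \<tau> H H \<cdot> \<Delta> = (T \<cdot> S) \<cdot> m \<cdot> T \<odot> \<langle>H\<rangle> \<cdot> \<tau> H H \<cdot> \<Delta>"
    unfolding T_S by ((rule diagram)+, simp)
  also have "\<dots> = T \<cdot> (S \<cdot> m) \<cdot> T \<odot> \<langle>H\<rangle> \<cdot> \<tau> H H \<cdot> \<Delta>" by ((rule diagram)+, simp)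
  also have "\<dots> = T \<cdot> m \<cdot> S \<odot> S \<cdot> (\<sigma> H H \<cdot> T \<odot> \<langle>H\<rangle>) \<cdot> \<tau> H H \<cdot> \<Delta>"
    unfolding S_m by ((rule diagram)+, simp)
  also have "\<dots> = T \<cdot> m \<cdot> S \<odot> (S \<cdot> T) \<cdot> (\<sigma> H H \<cdot> \<tau> H H) \<cdot> \<Delta>"
    unfolding sigma_natural_left[OF T_hom H_obj, symmetric] by ((rule diagram)+, simp)
  also have "\<dots> = T \<cdot> (m \<cdot> S \<odot> \<langle>H\<rangle> \<cdot> \<Delta>)"
    unfolding S_T sigma_tau[OF H_obj H_obj] by ((rule diagram)+, simp)
  also have "\<dots> = (T \<cdot> u) \<cdot> \<epsilon>" unfolding antipode by ((rule diagram)+, simp)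
  finally show "m \<cdot> T \<odot> \<langle>H\<rangle> \<cdot> \<tau> H H \<cdot> \<Delta> = u \<cdot> \<epsilon>" unfolding T_u .
  have "m \<cdot> \<langle>H\<rangle> \<odot> T \<cdot> \<tau> H H \<cdot> \<Delta> = (T \<cdot> S) \<cdot> m \<cdot> \<langle>H\<rangle> \<odot> T \<cdot> \<tau> H H \<cdot> \<Delta>"
    unfolding T_S by ((rule diagram)+, simp)
  also have "\<dots> = T \<cdot> (S \<cdot> m) \<cdot> \<langle>H\<rangle> \<odot> T \<cdot> \<tau> H H \<cdot> \<Delta>" by ((rule diagram)+, simp)
  also have "\<dots> = T \<cdot> m \<cdot> S \<odot> S \<cdot> (\<sigma> H H \<cdot> \<langle>H\<rangle> \<odot> T) \<cdot> \<tau> H H \<cdot> \<Delta>"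
    unfolding S_m by ((rule diagram)+, simp)
  also have "\<dots> = T \<cdot> m \<cdot> (S \<cdot> T) \<odot> S \<cdot> (\<sigma> H H \<cdot> \<tau> H H) \<cdot> \<Delta>"
    unfolding sigma_natural_right[OF T_hom H_obj, symmetric] by ((rule diagram)+, simp)
  also have "\<dots> = T \<cdot> (m \<cdot> \<langle>H\<rangle> \<odot> S \<cdot> \<Delta>)"
    unfolding S_T sigma_tau[OF H_obj H_obj] by ((rule diagram)+, simp)
  also have "\<dots> = (T \<cdot> u) \<cdot> \<epsilon>" unfolding antipode by ((rule diagram)+, simp)
  finally show "m \<cdot> \<langle>H\<rangle> \<odot> T \<cdot> \<tau> H H \<cdot> \<Delta> = u \<cdot> \<epsilon>" unfolding T_u .
qed

section \<open>Modules and their tensor products\<close>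

lemma is_module_iff:
  "is_module (M, r) \<longleftrightarrow> M \<in> Obj V \<and> r \<in> hom (M \<otimes> H) M \<and>
     r \<cdot> r \<odot> \<langle>H\<rangle> = r \<cdot> \<langle>M\<rangle> \<odot> m \<and> r \<cdot> \<langle>M\<rangle> \<odot> u = \<langle>M\<rangle>"
  unfolding is_module_def by simp

lemma linear_iff: "linear (M, r) (N, s) f \<longleftrightarrow> f \<in> hom M N \<and> f \<cdot> r = s \<cdot> f \<odot> \<langle>H\<rangle>"
  unfolding linear_def by simp

lemma moduleD:
  assumes "is_module (M, r)"
  shows "M \<in> Obj V" "r \<in> hom (M \<otimes> H) M" "r \<cdot> r \<odot> \<langle>H\<rangle> = r \<cdot> \<langle>M\<rangle> \<odot> m" "r \<cdot> \<langle>M\<rangle> \<odot> u = \<langle>M\<rangle>"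
  using assms unfolding is_module_iff by auto

lemma free_module:
  assumes X: "X \<in> Obj V"
  shows "is_module (X \<otimes> H, \<langle>X\<rangle> \<odot> m)"
proof -
  note [diagram] = X[THEN atomI]
  have "\<langle>X\<rangle> \<odot> m \<cdot> (\<langle>X\<rangle> \<odot> m) \<odot> \<langle>H\<rangle> = \<langle>X\<rangle> \<odot> (m \<cdot> m \<odot> \<langle>H\<rangle>)" by ((rule diagram)+, simp)
  also have "\<dots> = \<langle>X\<rangle> \<odot> m \<cdot> \<langle>X \<otimes> H\<rangle> \<odot> m" unfolding m_assoc by ((rule diagram)+, simp)
  finally have 1: "\<langle>X\<rangle> \<odot> m \<cdot> (\<langle>X\<rangle> \<odot> m) \<odot> \<langle>H\<rangle> = \<langle>X\<rangle> \<odot> m \<cdot> \<langle>X \<otimes> H\<rangle> \<odot> m" .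
  have "\<langle>X\<rangle> \<odot> m \<cdot> \<langle>X \<otimes> H\<rangle> \<odot> u = \<langle>X\<rangle> \<odot> (m \<cdot> \<langle>H\<rangle> \<odot> u)" by ((rule diagram)+, simp)
  also have "\<dots> = \<langle>X \<otimes> H\<rangle>" unfolding m_unit by ((rule diagram)+, simp)
  finally have 2: "\<langle>X\<rangle> \<odot> m \<cdot> \<langle>X \<otimes> H\<rangle> \<odot> u = \<langle>X \<otimes> H\<rangle>" .
  have "\<langle>X\<rangle> \<odot> m \<in> hom ((X \<otimes> H) \<otimes> H) (X \<otimes> H)" by (rule diagram_hom, (rule diagram)+)
  then show ?thesis unfolding is_module_iff using 1 2 ten_obj[OF X H_obj] by simp
qed

lemma unit_module: "is_module mod_unit"
proof -
  have "\<epsilon> \<in> hom (\<one> \<otimes> H) \<one>" "\<epsilon> \<cdot> \<epsilon> \<odot> \<langle>H\<rangle> = \<epsilon> \<cdot> \<langle>\<one>\<rangle> \<odot> m" "\<epsilon> \<cdot> \<langle>\<one>\<rangle> \<odot> u = \<langle>\<one>\<rangle>"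
  proof -
    show "\<epsilon> \<in> hom (\<one> \<otimes> H) \<one>" by (rule diagram_hom, (rule diagram)+)
    have "\<epsilon> \<cdot> \<langle>\<one>\<rangle> \<odot> m = \<epsilon> \<cdot> m" by ((rule diagram)+, simp)
    also have "\<dots> = \<epsilon> \<cdot> \<epsilon> \<odot> \<langle>H\<rangle>" unfolding eps_m by ((rule diagram)+, simp)
    finally show "\<epsilon> \<cdot> \<epsilon> \<odot> \<langle>H\<rangle> = \<epsilon> \<cdot> \<langle>\<one>\<rangle> \<odot> m" ..
    have "\<epsilon> \<cdot> \<langle>\<one>\<rangle> \<odot> u = \<epsilon> \<cdot> u" by ((rule diagram)+, simp)
    then show "\<epsilon> \<cdot> \<langle>\<one>\<rangle> \<odot> u = \<langle>\<one>\<rangle>" unfolding eps_u .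
  qed
  then show ?thesis unfolding mod_unit_def is_module_iff using unit_obj by simp
qed

definition ten_act :: "'o \<Rightarrow> 'a \<Rightarrow> 'o \<Rightarrow> 'a \<Rightarrow> 'a" where
  "ten_act M r N s = r \<odot> s \<cdot> \<langle>M\<rangle> \<odot> \<sigma> N H \<odot> \<langle>H\<rangle> \<cdot> \<langle>M \<otimes> N\<rangle> \<odot> \<Delta>"

lemma mod_ten_eq: "mod_ten (M, r) (N, s) = (M \<otimes> N, ten_act M r N s)"
  unfolding mod_ten_def ten_act_def by simp

text \<open>Two successive actions cross \<open>H\<close> past the result of acting on
  \<open>N\<close>. Naturality in \<open>s\<close> and in \<open>m\<close> moves these crossings
  until the braided bialgebra axiom \<open>Delta_m\<close> applies.\<close>

lemma ten_module:
  assumes Mr: "is_module (M, r)" and Ns: "is_module (N, s)"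
  shows "is_module (mod_ten (M, r) (N, s))"
proof -
  note M = moduleD[OF Mr] and N = moduleD[OF Ns]
  note [diagram] = M(1)[THEN atomI] N(1)[THEN atomI] M(2)[THEN diagram_gen] N(2)[THEN diagram_gen]
  let ?a = "ten_act M r N s"
  have a: "?a \<in> hom ((M \<otimes> N) \<otimes> H) (M \<otimes> N)"
    unfolding ten_act_def by (rule diagram_hom, (rule diagram)+)
  have "?a \<cdot> ?a \<odot> \<langle>H\<rangle> = r \<odot> s \<cdot> \<langle>M\<rangle> \<odot> (\<sigma> N H \<cdot> s \<odot> \<langle>H\<rangle>) \<odot> \<langle>H\<rangle> \<cdot> r \<odot> \<langle>N\<rangle> \<odot> \<langle>H\<rangle> \<odot> \<langle>H\<rangle> \<odot> \<langle>H\<rangle> \<cdot>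
      \<langle>M\<rangle> \<odot> \<sigma> N H \<odot> \<langle>H\<rangle> \<odot> \<langle>H\<rangle> \<odot> \<langle>H\<rangle> \<cdot> \<langle>M \<otimes> N\<rangle> \<odot> \<Delta> \<odot> \<Delta>"
    unfolding ten_act_def by ((rule diagram)+, simp)
  also have "\<dots> = (r \<cdot> r \<odot> \<langle>H\<rangle>) \<odot> (s \<cdot> s \<odot> \<langle>H\<rangle>) \<cdot> \<langle>M \<otimes> H\<rangle> \<odot> \<sigma> (N \<otimes> H) H \<odot> \<langle>H\<rangle> \<cdot>
      \<langle>M\<rangle> \<odot> \<sigma> N H \<odot> \<langle>H\<rangle> \<odot> \<langle>H\<rangle> \<odot> \<langle>H\<rangle> \<cdot> \<langle>M \<otimes> N\<rangle> \<odot> \<Delta> \<odot> \<Delta>"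
    unfolding sigma_natural_left[OF N(2) H_obj, symmetric] by ((rule diagram)+, simp)
  also have "\<dots> = r \<odot> s \<cdot> \<langle>M\<rangle> \<odot> (m \<odot> \<langle>N\<rangle> \<cdot> \<sigma> N (H \<otimes> H)) \<odot> m \<cdot> \<langle>M \<otimes> N\<rangle> \<odot> (\<langle>H\<rangle> \<odot> \<sigma> H H \<odot> \<langle>H\<rangle> \<cdot> \<Delta> \<odot> \<Delta>)"
    unfolding M(3) N(3) by ((rule diagram)+, simp)
  also have "\<dots> = r \<odot> s \<cdot> \<langle>M\<rangle> \<odot> \<sigma> N H \<odot> \<langle>H\<rangle> \<cdot> \<langle>M \<otimes> N\<rangle> \<odot> (m \<odot> m \<cdot> \<langle>H\<rangle> \<odot> \<sigma> H H \<odot> \<langle>H\<rangle> \<cdot> \<Delta> \<odot> \<Delta>)"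
    unfolding sigma_natural_right[OF m_hom N(1)] by ((rule diagram)+, simp)
  also have "\<dots> = ?a \<cdot> \<langle>M \<otimes> N\<rangle> \<odot> m"
    unfolding Delta_m[symmetric] ten_act_def by ((rule diagram)+, simp)
  finally have 1: "?a \<cdot> ?a \<odot> \<langle>H\<rangle> = ?a \<cdot> \<langle>M \<otimes> N\<rangle> \<odot> m" .
  have "?a \<cdot> \<langle>M \<otimes> N\<rangle> \<odot> u = r \<odot> s \<cdot> \<langle>M\<rangle> \<odot> \<sigma> N H \<odot> \<langle>H\<rangle> \<cdot> \<langle>M \<otimes> N\<rangle> \<odot> (\<Delta> \<cdot> u)"
    unfolding ten_act_def by ((rule diagram)+, simp)
  also have "\<dots> = r \<odot> s \<cdot> \<langle>M\<rangle> \<odot> (\<sigma> N H \<cdot> \<langle>N\<rangle> \<odot> u) \<odot> u"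
    unfolding Delta_u by ((rule diagram)+, simp)
  also have "\<dots> = (r \<cdot> \<langle>M\<rangle> \<odot> u) \<odot> (s \<cdot> \<langle>N\<rangle> \<odot> u)"
    unfolding sigma_natural_right[OF u_hom N(1), symmetric] by ((rule diagram)+, simp)
  also have "\<dots> = \<langle>M \<otimes> N\<rangle>" unfolding M(4) N(4) by ((rule diagram)+, simp)
  finally show ?thesis
    unfolding mod_ten_eq is_module_iff using 1 a M(1) N(1) ten_obj by simp
qed

lemma mod_ten_unit:
  assumes Mr: "is_module (M, r)"
  shows "mod_ten (M, r) mod_unit = (M, r)" "mod_ten mod_unit (M, r) = (M, r)"
proof -
  note M = moduleD[OF Mr]
  note [diagram] = M(1)[THEN atomI] M(2)[THEN diagram_gen]
  have "ten_act M r \<one> \<epsilon> = r \<cdot> \<langle>M\<rangle> \<odot> (\<langle>H\<rangle> \<odot> \<epsilon> \<cdot> \<Delta>)" unfolding ten_act_def by ((rule diagram)+, simp)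
  also have "\<dots> = r" unfolding Delta_counit by ((rule diagram)+, simp)
  finally show "mod_ten (M, r) mod_unit = (M, r)"
    unfolding mod_unit_def mod_ten_eq ten_unit[OF M(1)] by simp
  have "ten_act \<one> \<epsilon> M r = r \<cdot> (\<epsilon> \<odot> \<langle>M\<rangle> \<cdot> \<sigma> M H) \<odot> \<langle>H\<rangle> \<cdot> \<langle>M\<rangle> \<odot> \<Delta>"
    unfolding ten_act_def by ((rule diagram)+, simp)
  also have "\<dots> = r \<cdot> \<langle>M\<rangle> \<odot> (\<epsilon> \<odot> \<langle>H\<rangle> \<cdot> \<Delta>)"
    unfolding sigma_natural_right[OF eps_hom M(1)] by ((rule diagram)+, simp)
  also have "\<dots> = r" unfolding Delta_counit by ((rule diagram)+, simp)
  finally show "mod_ten mod_unit (M, r) = (M, r)"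
    unfolding mod_unit_def mod_ten_eq ten_unit[OF M(1)] by simp
qed

section \<open>Actions on right and left duals\<close>

text \<open>
  The right dual action transposes \<open>r\<close> precomposed with the antipode, the left dual action
  transposes \<open>r\<close> precomposed with its inverse.
\<close>

context
  fixes M r assumes Mr: "is_module (M, r)"
begin

private abbreviation (input) "M' \<equiv> rd V M"

private abbreviation (input) "N' \<equiv> ld V M"

private lemma M: "M \<in> Obj V" and r: "r \<in> hom (M \<otimes> H) M"
  and r_assoc: "r \<cdot> r \<odot> \<langle>H\<rangle> = r \<cdot> \<langle>M\<rangle> \<odot> m" and r_unit: "r \<cdot> \<langle>M\<rangle> \<odot> u = \<langle>M\<rangle>"
  by (rule moduleD[OF Mr])+

private lemma rM: "rd V M \<in> Obj V" and lM: "ld V M \<in> Obj V"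
  using M rd_obj ld_obj by blast+

definition rd_action :: "'a \<Rightarrow> bool" where
  "rd_action r' \<longleftrightarrow> r' \<in> hom (M' \<otimes> H) M' \<and>
     evr V M \<cdot> \<langle>M\<rangle> \<odot> r' = evr V M \<cdot> (r \<cdot> \<langle>M\<rangle> \<odot> S) \<odot> \<langle>M'\<rangle> \<cdot> \<langle>M\<rangle> \<odot> \<sigma> M' H"

definition ld_action :: "'a \<Rightarrow> bool" where
  "ld_action r' \<longleftrightarrow> r' \<in> hom (N' \<otimes> H) N' \<and>
     evl V M \<cdot> r' \<odot> \<langle>M\<rangle> = evl V M \<cdot> \<langle>N'\<rangle> \<odot> (r \<cdot> \<langle>M\<rangle> \<odot> T) \<cdot> \<langle>N'\<rangle> \<odot> \<tau> H M"

text \<open>Linearity of the evaluation forces the dual action. Expanding by the counit creates an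
  outer \<epsilon>, which linearity exchanges for the action on \<open>M \<otimes> rd V M\<close>;
  on \<open>M\<close> the action through \<open>S\<close> then cancels against the next action by
  the antipode axiom, and only \<open>r'\<close> is left.\<close>

lemma rd_actionI:
  assumes r': "r' \<in> hom (M' \<otimes> H) M'" and lin: "evr V M \<cdot> ten_act M r M' r' = \<epsilon> \<cdot> evr V M \<odot> \<langle>H\<rangle>"
  shows "rd_action r'"
proof -
  note [diagram] = M[THEN atomI] r[THEN diagram_gen] r'[THEN diagram_gen]
  have t: "ten_act M r M' r' \<in> hom ((M \<otimes> M') \<otimes> H) (M \<otimes> M')"
    unfolding ten_act_def by (rule diagram_hom, (rule diagram)+)
  note [diagram] = t[THEN diagram_gen]
  have "evr V M \<cdot> (r \<cdot> \<langle>M\<rangle> \<odot> S) \<odot> \<langle>M'\<rangle> \<cdot> \<langle>M\<rangle> \<odot> \<sigma> M' H =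
      evr V M \<cdot> (r \<cdot> \<langle>M\<rangle> \<odot> S) \<odot> \<langle>M'\<rangle> \<cdot> \<langle>M\<rangle> \<odot> \<sigma> M' H \<cdot> \<langle>M \<otimes> M'\<rangle> \<odot> (\<langle>H\<rangle> \<odot> \<epsilon> \<cdot> \<Delta>)"
    unfolding Delta_counit by ((rule diagram)+, simp)
  also have "\<dots> = (\<epsilon> \<cdot> evr V M \<odot> \<langle>H\<rangle>) \<cdot> (r \<cdot> \<langle>M\<rangle> \<odot> S) \<odot> \<langle>M'\<rangle> \<odot> \<langle>H\<rangle> \<cdot> \<langle>M\<rangle> \<odot> \<sigma> M' H \<odot> \<langle>H\<rangle> \<cdot>
      \<langle>M \<otimes> M'\<rangle> \<odot> \<Delta>"
    by ((rule diagram)+, simp)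
  also have "\<dots> = evr V M \<cdot> (r \<cdot> r \<odot> \<langle>H\<rangle>) \<odot> r' \<cdot> \<langle>M\<rangle> \<odot> S \<odot> \<langle>H\<rangle> \<odot> \<langle>M'\<rangle> \<odot> \<langle>H\<rangle> \<cdot>
      \<langle>M\<rangle> \<odot> \<sigma> M' (H \<otimes> H) \<odot> \<langle>H\<rangle> \<cdot> \<langle>M \<otimes> M'\<rangle> \<odot> (\<langle>H\<rangle> \<odot> \<Delta> \<cdot> \<Delta>)"
    unfolding lin[symmetric] ten_act_def by ((rule diagram)+, simp)
  also have "\<dots> = evr V M \<cdot> (r \<cdot> \<langle>M\<rangle> \<odot> (m \<cdot> S \<odot> \<langle>H\<rangle>)) \<odot> r' \<cdot> \<langle>M\<rangle> \<odot> (\<sigma> M' (H \<otimes> H) \<cdot> \<langle>M'\<rangle> \<odot> \<Delta>) \<odot> \<langle>H\<rangle> \<cdot>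
      \<langle>M \<otimes> M'\<rangle> \<odot> \<Delta>"
    unfolding r_assoc Delta_coassoc[symmetric] by ((rule diagram)+, simp)
  also have "\<dots> = evr V M \<cdot> (r \<cdot> \<langle>M\<rangle> \<odot> (m \<cdot> S \<odot> \<langle>H\<rangle> \<cdot> \<Delta>)) \<odot> r' \<cdot> \<langle>M\<rangle> \<odot> \<sigma> M' H \<odot> \<langle>H\<rangle> \<cdot> \<langle>M \<otimes> M'\<rangle> \<odot> \<Delta>"
    unfolding sigma_natural_right[OF Delta_hom rM, symmetric] by ((rule diagram)+, simp)
  also have "\<dots> = evr V M \<cdot> (r \<cdot> \<langle>M\<rangle> \<odot> u) \<odot> r' \<cdot> \<langle>M\<rangle> \<odot> (\<epsilon> \<odot> \<langle>M'\<rangle> \<cdot> \<sigma> M' H) \<odot> \<langle>H\<rangle> \<cdot> \<langle>M \<otimes> M'\<rangle> \<odot> \<Delta>"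
    unfolding antipode by ((rule diagram)+, simp)
  also have "\<dots> = evr V M \<cdot> \<langle>M\<rangle> \<odot> r' \<cdot> \<langle>M \<otimes> M'\<rangle> \<odot> (\<epsilon> \<odot> \<langle>H\<rangle> \<cdot> \<Delta>)"
    unfolding r_unit sigma_natural_right[OF eps_hom rM] by ((rule diagram)+, simp)
  also have "\<dots> = evr V M \<cdot> \<langle>M\<rangle> \<odot> r'"
    unfolding Delta_counit by ((rule diagram)+, simp)
  finally show ?thesis unfolding rd_action_def using r' by simp
qed

lemma rd_action_unique: "rd_action r' \<Longrightarrow> rd_action r'' \<Longrightarrow> r' = r''"
  unfolding rd_action_def by (elim conjE, rule into_rd_eqI[OF M], assumption, assumption, simp)

text \<open>The prescribed pairing is bent into a morphism to \<open>rd V M\<close> by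
  \<open>coevr\<close>, and a snake identity returns it.\<close>

lemma rd_action_exists: "\<exists>r'. rd_action r'"
proof -
  note [diagram] = M[THEN atomI] r[THEN diagram_gen]
  let ?e = "evr V M \<cdot> (r \<cdot> \<langle>M\<rangle> \<odot> S) \<odot> \<langle>M'\<rangle> \<cdot> \<langle>M\<rangle> \<odot> \<sigma> M' H"
  have "evr V M \<cdot> \<langle>M\<rangle> \<odot> (\<langle>M'\<rangle> \<odot> ?e \<cdot> coevr V M \<odot> \<langle>M' \<otimes> H\<rangle>) =
      ?e \<cdot> (evr V M \<odot> \<langle>M\<rangle> \<cdot> \<langle>M\<rangle> \<odot> coevr V M) \<odot> \<langle>M' \<otimes> H\<rangle>" by ((rule diagram)+, simp)
  also have "\<dots> = ?e" unfolding snake_r1[OF M] by ((rule diagram)+, simp)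
  finally have "evr V M \<cdot> \<langle>M\<rangle> \<odot> (\<langle>M'\<rangle> \<odot> ?e \<cdot> coevr V M \<odot> \<langle>M' \<otimes> H\<rangle>) = ?e" .
  moreover have "\<langle>M'\<rangle> \<odot> ?e \<cdot> coevr V M \<odot> \<langle>M' \<otimes> H\<rangle> \<in> hom (M' \<otimes> H) M'"
    by (rule diagram_hom, (rule diagram)+)
  ultimately show ?thesis unfolding rd_action_def by blast
qed

lemma ld_actionI:
  assumes r': "r' \<in> hom (N' \<otimes> H) N'" and lin: "evl V M \<cdot> ten_act N' r' M r = \<epsilon> \<cdot> evl V M \<odot> \<langle>H\<rangle>"
  shows "ld_action r'"
proof -
  note [diagram] = M[THEN atomI] r[THEN diagram_gen] r'[THEN diagram_gen]
  have t: "ten_act N' r' M r \<in> hom ((N' \<otimes> M) \<otimes> H) (N' \<otimes> M)"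
    unfolding ten_act_def by (rule diagram_hom, (rule diagram)+)
  note [diagram] = t[THEN diagram_gen]
  have "evl V M \<cdot> \<langle>N'\<rangle> \<odot> (r \<cdot> \<langle>M\<rangle> \<odot> T) = evl V M \<cdot> \<langle>N'\<rangle> \<odot> (r \<cdot> \<langle>M\<rangle> \<odot> T) \<cdot> \<langle>N' \<otimes> M\<rangle> \<odot> (\<epsilon> \<odot> \<langle>H\<rangle> \<cdot> \<Delta>)"
    unfolding Delta_counit by ((rule diagram)+, simp)
  \<comment> \<open>The trivial crossing \<open>\<tau> \<one> H\<close> is inserted so that
    naturality in \<epsilon> produces \<open>\<tau> H H \<cdot> \<Delta>\<close>, the
    comultiplication for which \<open>T\<close> is an antipode.\<close>
  also have "\<dots> = evl V M \<cdot> \<langle>N'\<rangle> \<odot> (r \<cdot> \<langle>M\<rangle> \<odot> T) \<cdot> \<langle>N' \<otimes> M\<rangle> \<odot> ((\<tau> \<one> H \<cdot> \<epsilon> \<odot> \<langle>H\<rangle>) \<cdot> \<Delta>)"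
    by ((rule diagram)+, simp)
  also have "\<dots> = (\<epsilon> \<cdot> evl V M \<odot> \<langle>H\<rangle>) \<cdot> \<langle>N'\<rangle> \<odot> (r \<cdot> \<langle>M\<rangle> \<odot> T) \<odot> \<langle>H\<rangle> \<cdot> \<langle>N' \<otimes> M\<rangle> \<odot> (\<tau> H H \<cdot> \<Delta>)"
    unfolding tau_natural_left[OF eps_hom H_obj, symmetric] by ((rule diagram)+, simp)
  also have "\<dots> = evl V M \<cdot> r' \<odot> r \<cdot> \<langle>N'\<rangle> \<odot> (\<sigma> M H \<cdot> r \<odot> \<langle>H\<rangle>) \<odot> \<langle>H\<rangle> \<cdot> \<langle>N' \<otimes> M\<rangle> \<odot> (T \<odot> \<Delta> \<cdot> \<tau> H H \<cdot> \<Delta>)"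
    unfolding lin[symmetric] ten_act_def by ((rule diagram)+, simp)
  also have "\<dots> = evl V M \<cdot> r' \<odot> (r \<cdot> r \<odot> \<langle>H\<rangle>) \<cdot> \<langle>N'\<rangle> \<odot> \<sigma> (M \<otimes> H) H \<odot> \<langle>H\<rangle> \<cdot>
      \<langle>N' \<otimes> M\<rangle> \<odot> T \<odot> \<langle>H\<rangle> \<odot> \<langle>H\<rangle> \<cdot>
      \<langle>N' \<otimes> M\<rangle> \<odot> (\<langle>H\<rangle> \<odot> \<Delta> \<cdot> \<tau> H H) \<cdot> \<langle>N' \<otimes> M\<rangle> \<odot> \<Delta>"
    unfolding sigma_natural_left[OF r H_obj, symmetric] by ((rule diagram)+, simp)
  also have "\<dots> = evl V M \<cdot> r' \<odot> (r \<cdot> \<langle>M\<rangle> \<odot> m) \<cdot> \<langle>N'\<rangle> \<odot> \<sigma> M H \<odot> \<langle>H\<rangle> \<odot> \<langle>H\<rangle> \<cdot>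
      \<langle>N' \<otimes> M\<rangle> \<odot> (\<sigma> H H \<cdot> T \<odot> \<langle>H\<rangle>) \<odot> \<langle>H\<rangle> \<cdot> \<langle>N' \<otimes> M\<rangle> \<odot> \<tau> (H \<otimes> H) H \<cdot> \<langle>N' \<otimes> M\<rangle> \<odot> (\<Delta> \<odot> \<langle>H\<rangle> \<cdot> \<Delta>)"
    unfolding r_assoc tau_natural_left[OF Delta_hom H_obj] by ((rule diagram)+, simp)
  also have "\<dots> = evl V M \<cdot> r' \<odot> (r \<cdot> \<langle>M\<rangle> \<odot> m) \<cdot> \<langle>N'\<rangle> \<odot> \<sigma> M H \<odot> T \<odot> \<langle>H\<rangle> \<cdot>
      \<langle>N' \<otimes> M\<rangle> \<odot> (\<sigma> H H \<cdot> \<tau> H H) \<odot> \<langle>H\<rangle> \<cdot> \<langle>N' \<otimes> M\<rangle> \<odot> \<langle>H\<rangle> \<odot> \<tau> H H \<cdot> \<langle>N' \<otimes> M\<rangle> \<odot> (\<langle>H\<rangle> \<odot> \<Delta> \<cdot> \<Delta>)"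
    unfolding sigma_natural_left[OF T_hom H_obj, symmetric] Delta_coassoc by ((rule diagram)+, simp)
  also have "\<dots> = evl V M \<cdot> r' \<odot> (r \<cdot> \<langle>M\<rangle> \<odot> (m \<cdot> T \<odot> \<langle>H\<rangle> \<cdot> \<tau> H H \<cdot> \<Delta>)) \<cdot> \<langle>N'\<rangle> \<odot> \<sigma> M H \<odot> \<langle>H\<rangle> \<cdot>
      \<langle>N' \<otimes> M\<rangle> \<odot> \<Delta>"
    unfolding sigma_tau[OF H_obj H_obj] by ((rule diagram)+, simp)
  also have "\<dots> = evl V M \<cdot> r' \<odot> (r \<cdot> \<langle>M\<rangle> \<odot> u) \<cdot> \<langle>N'\<rangle> \<odot> \<sigma> M H \<cdot> \<langle>N' \<otimes> M\<rangle> \<odot> (\<langle>H\<rangle> \<odot> \<epsilon> \<cdot> \<Delta>)"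
    unfolding antipode_coop by ((rule diagram)+, simp)
  also have "\<dots> = (evl V M \<cdot> r' \<odot> \<langle>M\<rangle>) \<cdot> \<langle>N'\<rangle> \<odot> \<sigma> M H"
    unfolding r_unit Delta_counit by ((rule diagram)+, simp)
  finally have F: "(evl V M \<cdot> r' \<odot> \<langle>M\<rangle>) \<cdot> \<langle>N'\<rangle> \<odot> \<sigma> M H = evl V M \<cdot> \<langle>N'\<rangle> \<odot> (r \<cdot> \<langle>M\<rangle> \<odot> T)" ..
  \<comment> \<open>\<open>F\<close> describes the pairing after the crossing
    \<open>\<sigma> M H\<close>; composing with the inverse crossing isolates the pairing
    itself.\<close>
  have "evl V M \<cdot> r' \<odot> \<langle>M\<rangle> = evl V M \<cdot> r' \<odot> \<langle>M\<rangle> \<cdot> \<langle>N'\<rangle> \<odot> (\<sigma> M H \<cdot> \<tau> H M)"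
    unfolding sigma_tau[OF M H_obj] by ((rule diagram)+, simp)
  also have "\<dots> = ((evl V M \<cdot> r' \<odot> \<langle>M\<rangle>) \<cdot> \<langle>N'\<rangle> \<odot> \<sigma> M H) \<cdot> \<langle>N'\<rangle> \<odot> \<tau> H M" by ((rule diagram)+, simp)
  also have "\<dots> = evl V M \<cdot> \<langle>N'\<rangle> \<odot> (r \<cdot> \<langle>M\<rangle> \<odot> T) \<cdot> \<langle>N'\<rangle> \<odot> \<tau> H M"
    unfolding F by ((rule diagram)+, simp)
  finally show ?thesis unfolding ld_action_def using r' by simp
qed

lemma ld_action_unique: "ld_action r' \<Longrightarrow> ld_action r'' \<Longrightarrow> r' = r''"
  unfolding ld_action_def by (elim conjE, rule into_ld_eqI[OF M], assumption, assumption, simp)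

lemma ld_action_exists: "\<exists>r'. ld_action r'"
proof -
  note [diagram] = M[THEN atomI] r[THEN diagram_gen]
  let ?e = "evl V M \<cdot> \<langle>N'\<rangle> \<odot> (r \<cdot> \<langle>M\<rangle> \<odot> T) \<cdot> \<langle>N'\<rangle> \<odot> \<tau> H M"
  have "evl V M \<cdot> (?e \<odot> \<langle>N'\<rangle> \<cdot> \<langle>N' \<otimes> H\<rangle> \<odot> coevl V M) \<odot> \<langle>M\<rangle> =
      ?e \<cdot> \<langle>N' \<otimes> H\<rangle> \<odot> (\<langle>M\<rangle> \<odot> evl V M \<cdot> coevl V M \<odot> \<langle>M\<rangle>)" by ((rule diagram)+, simp)
  also have "\<dots> = ?e" unfolding snake_l1[OF M] by ((rule diagram)+, simp)
  finally have "evl V M \<cdot> (?e \<odot> \<langle>N'\<rangle> \<cdot> \<langle>N' \<otimes> H\<rangle> \<odot> coevl V M) \<odot> \<langle>M\<rangle> = ?e" .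
  moreover have "?e \<odot> \<langle>N'\<rangle> \<cdot> \<langle>N' \<otimes> H\<rangle> \<odot> coevl V M \<in> hom (N' \<otimes> H) N'"
    by (rule diagram_hom, (rule diagram)+)
  ultimately show ?thesis unfolding ld_action_def by blast
qed

context
  fixes r' assumes act: "rd_action r'"
begin

private lemma r': "r' \<in> hom (M' \<otimes> H) M'"
  and r'_evr: "evr V M \<cdot> \<langle>M\<rangle> \<odot> r' = evr V M \<cdot> (r \<cdot> \<langle>M\<rangle> \<odot> S) \<odot> \<langle>M'\<rangle> \<cdot> \<langle>M\<rangle> \<odot> \<sigma> M' H"
  using act unfolding rd_action_def by blast+

private lemmas dgs = M[THEN atomI] r[THEN diagram_gen] r'[THEN diagram_gen]

lemma rd_action_evr_linear: "evr V M \<cdot> ten_act M r M' r' = \<epsilon> \<cdot> evr V M \<odot> \<langle>H\<rangle>"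
proof -
  note [diagram] = dgs
  have "evr V M \<cdot> ten_act M r M' r' =
      (evr V M \<cdot> \<langle>M\<rangle> \<odot> r') \<cdot> r \<odot> \<langle>M'\<rangle> \<odot> \<langle>H\<rangle> \<cdot> \<langle>M\<rangle> \<odot> \<sigma> M' H \<odot> \<langle>H\<rangle> \<cdot> \<langle>M \<otimes> M'\<rangle> \<odot> \<Delta>"
    unfolding ten_act_def by ((rule diagram)+, simp)
  also have "\<dots> = evr V M \<cdot> (r \<cdot> r \<odot> \<langle>H\<rangle>) \<odot> \<langle>M'\<rangle> \<cdot> \<langle>M\<rangle> \<odot> \<langle>H\<rangle> \<odot> S \<odot> \<langle>M'\<rangle> \<cdot>
      \<langle>M\<rangle> \<odot> (\<sigma> M' (H \<otimes> H) \<cdot> \<langle>M'\<rangle> \<odot> \<Delta>)"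
    unfolding r'_evr by ((rule diagram)+, simp)
  also have "\<dots> = evr V M \<cdot> (r \<cdot> \<langle>M\<rangle> \<odot> (m \<cdot> \<langle>H\<rangle> \<odot> S \<cdot> \<Delta>)) \<odot> \<langle>M'\<rangle> \<cdot> \<langle>M\<rangle> \<odot> \<sigma> M' H"
    unfolding r_assoc sigma_natural_right[OF Delta_hom rM, symmetric] by ((rule diagram)+, simp)
  also have "\<dots> = evr V M \<cdot> (r \<cdot> \<langle>M\<rangle> \<odot> u) \<odot> \<langle>M'\<rangle> \<cdot> \<langle>M\<rangle> \<odot> (\<epsilon> \<odot> \<langle>M'\<rangle> \<cdot> \<sigma> M' H)"
    unfolding antipode by ((rule diagram)+, simp)
  also have "\<dots> = \<epsilon> \<cdot> evr V M \<odot> \<langle>H\<rangle>"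
    unfolding r_unit sigma_natural_right[OF eps_hom rM] by ((rule diagram)+, simp)
  finally show ?thesis .
qed

lemma rd_action_coevr_linear: "coevr V M \<cdot> \<epsilon> = ten_act M' r' M r \<cdot> coevr V M \<odot> \<langle>H\<rangle>"
proof -
  note [diagram] = dgs
  \<comment> \<open>Transposed across the coevaluation, the dual action becomes the action of
    \<open>H\<close> on \<open>M\<close> through \<open>S\<close>.\<close>
  have "r' \<odot> \<langle>M\<rangle> \<cdot> \<langle>M'\<rangle> \<odot> \<sigma> M H \<cdot> coevr V M \<odot> \<langle>H\<rangle> =
     (\<langle>M'\<rangle> \<odot> evr V M \<cdot> coevr V M \<odot> \<langle>M'\<rangle>) \<odot> \<langle>M\<rangle> \<cdot> r' \<odot> \<langle>M\<rangle> \<cdot> \<langle>M'\<rangle> \<odot> \<sigma> M H \<cdot> coevr V M \<odot> \<langle>H\<rangle>"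
    unfolding snake_r2[OF M] by ((rule diagram)+, simp)
  also have "\<dots> = \<langle>M'\<rangle> \<odot> (evr V M \<cdot> \<langle>M\<rangle> \<odot> r') \<odot> \<langle>M\<rangle> \<cdot> coevr V M \<odot> (\<langle>M'\<rangle> \<odot> \<sigma> M H \<cdot> coevr V M \<odot> \<langle>H\<rangle>)"
    by ((rule diagram)+, simp)
  also have "\<dots> = \<langle>M'\<rangle> \<odot> evr V M \<odot> \<langle>M\<rangle> \<cdot> \<langle>M'\<rangle> \<odot> (r \<cdot> \<langle>M\<rangle> \<odot> S) \<odot> \<langle>M' \<otimes> M\<rangle> \<cdot>
      coevr V M \<odot> (\<sigma> (M' \<otimes> M) H \<cdot> coevr V M \<odot> \<langle>H\<rangle>)"
    unfolding r'_evr by ((rule diagram)+, simp)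
  also have "\<dots> = \<langle>M'\<rangle> \<odot> (evr V M \<odot> \<langle>M\<rangle> \<cdot> \<langle>M\<rangle> \<odot> coevr V M) \<cdot> \<langle>M'\<rangle> \<odot> (r \<cdot> \<langle>M\<rangle> \<odot> S) \<cdot> coevr V M \<odot> \<langle>H\<rangle>"
    unfolding sigma_natural_left[OF coevr_hom[OF M] H_obj, symmetric] by ((rule diagram)+, simp)
  also have "\<dots> = \<langle>M'\<rangle> \<odot> (r \<cdot> \<langle>M\<rangle> \<odot> S) \<cdot> coevr V M \<odot> \<langle>H\<rangle>"
    unfolding snake_r1[OF M] by ((rule diagram)+, simp)
  finally have *: "r' \<odot> \<langle>M\<rangle> \<cdot> \<langle>M'\<rangle> \<odot> \<sigma> M H \<cdot> coevr V M \<odot> \<langle>H\<rangle> =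
      \<langle>M'\<rangle> \<odot> (r \<cdot> \<langle>M\<rangle> \<odot> S) \<cdot> coevr V M \<odot> \<langle>H\<rangle>" .
  have "ten_act M' r' M r \<cdot> coevr V M \<odot> \<langle>H\<rangle> =
      \<langle>M'\<rangle> \<odot> r \<cdot> (r' \<odot> \<langle>M\<rangle> \<cdot> \<langle>M'\<rangle> \<odot> \<sigma> M H \<cdot> coevr V M \<odot> \<langle>H\<rangle>) \<odot> \<langle>H\<rangle> \<cdot> \<Delta>"
    unfolding ten_act_def by ((rule diagram)+, simp)
  also have "\<dots> = \<langle>M'\<rangle> \<odot> (r \<cdot> r \<odot> \<langle>H\<rangle>) \<cdot> \<langle>M' \<otimes> M\<rangle> \<odot> S \<odot> \<langle>H\<rangle> \<cdot> coevr V M \<odot> \<Delta>"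
    unfolding * by ((rule diagram)+, simp)
  also have "\<dots> = \<langle>M'\<rangle> \<odot> (r \<cdot> \<langle>M\<rangle> \<odot> (m \<cdot> S \<odot> \<langle>H\<rangle> \<cdot> \<Delta>)) \<cdot> coevr V M \<odot> \<langle>H\<rangle>"
    unfolding r_assoc by ((rule diagram)+, simp)
  also have "\<dots> = \<langle>M'\<rangle> \<odot> (r \<cdot> \<langle>M\<rangle> \<odot> u) \<cdot> coevr V M \<odot> \<epsilon>"
    unfolding antipode by ((rule diagram)+, simp)
  also have "\<dots> = coevr V M \<cdot> \<epsilon>"
    unfolding r_unit by ((rule diagram)+, simp)
  finally show ?thesis ..
qed

text \<open>Dualising reverses the order of two actions and makes the two copies of \<open>H\<close>
  cross. Anti-multiplicativity of \<open>S\<close> contains exactly this crossing, so the result is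
  again a right action.\<close>

lemma rd_action_module: "is_module (M', r')"
proof -
  note [diagram] = dgs
  have "r' \<cdot> r' \<odot> \<langle>H\<rangle> = r' \<cdot> \<langle>M'\<rangle> \<odot> m"
  proof (rule into_rd_eqI[OF M])
    show "r' \<cdot> r' \<odot> \<langle>H\<rangle> \<in> hom (M' \<otimes> H \<otimes> H) M'" by (rule diagram_hom, (rule diagram)+)
    show "r' \<cdot> \<langle>M'\<rangle> \<odot> m \<in> hom (M' \<otimes> H \<otimes> H) M'" by (rule diagram_hom, (rule diagram)+)
    have "evr V M \<cdot> \<langle>M\<rangle> \<odot> (r' \<cdot> r' \<odot> \<langle>H\<rangle>) = (evr V M \<cdot> \<langle>M\<rangle> \<odot> r') \<cdot> \<langle>M\<rangle> \<odot> r' \<odot> \<langle>H\<rangle>"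
      by ((rule diagram)+, simp)
    also have "\<dots> = evr V M \<cdot> (r \<cdot> \<langle>M\<rangle> \<odot> S) \<odot> \<langle>M'\<rangle> \<cdot> \<langle>M\<rangle> \<odot> (\<sigma> M' H \<cdot> r' \<odot> \<langle>H\<rangle>)"
      unfolding r'_evr by ((rule diagram)+, simp)
    also have "\<dots> = (evr V M \<cdot> \<langle>M\<rangle> \<odot> r') \<cdot> (r \<cdot> \<langle>M\<rangle> \<odot> S) \<odot> \<langle>M' \<otimes> H\<rangle> \<cdot> \<langle>M\<rangle> \<odot> \<sigma> (M' \<otimes> H) H"
      unfolding sigma_natural_left[OF r' H_obj, symmetric] by ((rule diagram)+, simp)
    also have "\<dots> = evr V M \<cdot> (r \<cdot> r \<odot> \<langle>H\<rangle>) \<odot> \<langle>M'\<rangle> \<cdot> \<langle>M\<rangle> \<odot> S \<odot> S \<odot> \<langle>M'\<rangle> \<cdot>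
        \<langle>M\<rangle> \<odot> (\<sigma> M' (H \<otimes> H) \<cdot> \<langle>M'\<rangle> \<odot> \<sigma> H H)"
      unfolding r'_evr by ((rule diagram)+, simp)
    also have "\<dots> = evr V M \<cdot> (r \<cdot> \<langle>M\<rangle> \<odot> (m \<cdot> S \<odot> S \<cdot> \<sigma> H H)) \<odot> \<langle>M'\<rangle> \<cdot> \<langle>M\<rangle> \<odot> \<sigma> M' (H \<otimes> H)"
      unfolding r_assoc sigma_natural_right[OF sigma_hom[OF H_obj H_obj] rM, symmetric]
      by ((rule diagram)+, simp)
    also have "\<dots> = evr V M \<cdot> (r \<cdot> \<langle>M\<rangle> \<odot> S) \<odot> \<langle>M'\<rangle> \<cdot> \<langle>M\<rangle> \<odot> (m \<odot> \<langle>M'\<rangle> \<cdot> \<sigma> M' (H \<otimes> H))"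
      unfolding S_m[symmetric] by ((rule diagram)+, simp)
    also have "\<dots> = (evr V M \<cdot> \<langle>M\<rangle> \<odot> r') \<cdot> \<langle>M \<otimes> M'\<rangle> \<odot> m"
      unfolding sigma_natural_right[OF m_hom rM] r'_evr by ((rule diagram)+, simp)
    also have "\<dots> = evr V M \<cdot> \<langle>M\<rangle> \<odot> (r' \<cdot> \<langle>M'\<rangle> \<odot> m)" by ((rule diagram)+, simp)
    finally show "evr V M \<cdot> \<langle>M\<rangle> \<odot> (r' \<cdot> r' \<odot> \<langle>H\<rangle>) = evr V M \<cdot> \<langle>M\<rangle> \<odot> (r' \<cdot> \<langle>M'\<rangle> \<odot> m)" .
  qed
  moreover have "r' \<cdot> \<langle>M'\<rangle> \<odot> u = \<langle>M'\<rangle>"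
  proof (rule into_rd_eqI[OF M])
    show "r' \<cdot> \<langle>M'\<rangle> \<odot> u \<in> hom M' M'" by (rule diagram_hom, (rule diagram)+)
    show "\<langle>M'\<rangle> \<in> hom M' M'" by (rule diagram_hom, (rule diagram)+)
    have "evr V M \<cdot> \<langle>M\<rangle> \<odot> (r' \<cdot> \<langle>M'\<rangle> \<odot> u) = (evr V M \<cdot> \<langle>M\<rangle> \<odot> r') \<cdot> \<langle>M \<otimes> M'\<rangle> \<odot> u"
      by ((rule diagram)+, simp)
    also have "\<dots> = evr V M \<cdot> (r \<cdot> \<langle>M\<rangle> \<odot> S) \<odot> \<langle>M'\<rangle> \<cdot> \<langle>M\<rangle> \<odot> (\<sigma> M' H \<cdot> \<langle>M'\<rangle> \<odot> u)"
      unfolding r'_evr by ((rule diagram)+, simp)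
    also have "\<dots> = evr V M \<cdot> (r \<cdot> \<langle>M\<rangle> \<odot> (S \<cdot> u)) \<odot> \<langle>M'\<rangle>"
      unfolding sigma_natural_right[OF u_hom rM, symmetric] by ((rule diagram)+, simp)
    also have "\<dots> = evr V M \<cdot> \<langle>M\<rangle> \<odot> \<langle>M'\<rangle>" unfolding S_u r_unit ..
    finally show "evr V M \<cdot> \<langle>M\<rangle> \<odot> (r' \<cdot> \<langle>M'\<rangle> \<odot> u) = evr V M \<cdot> \<langle>M\<rangle> \<odot> \<langle>M'\<rangle>" .
  qed
  ultimately show ?thesis unfolding is_module_iff using r' rM by simp
qed

end

context
  fixes r' assumes act: "ld_action r'"
begin

private lemma ld_r': "r' \<in> hom (N' \<otimes> H) N'"
  and r'_evl: "evl V M \<cdot> r' \<odot> \<langle>M\<rangle> = evl V M \<cdot> \<langle>N'\<rangle> \<odot> (r \<cdot> \<langle>M\<rangle> \<odot> T) \<cdot> \<langle>N'\<rangle> \<odot> \<tau> H M"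
  using act unfolding ld_action_def by blast+

private lemmas ld_dgs = M[THEN atomI] r[THEN diagram_gen] ld_r'[THEN diagram_gen]

lemma ld_action_evl_linear: "evl V M \<cdot> ten_act N' r' M r = \<epsilon> \<cdot> evl V M \<odot> \<langle>H\<rangle>"
proof -
  note [diagram] = ld_dgs
  have "evl V M \<cdot> ten_act N' r' M r =
      (evl V M \<cdot> r' \<odot> \<langle>M\<rangle>) \<cdot> \<langle>N' \<otimes> H\<rangle> \<odot> r \<cdot> \<langle>N'\<rangle> \<odot> \<sigma> M H \<odot> \<langle>H\<rangle> \<cdot> \<langle>N' \<otimes> M\<rangle> \<odot> \<Delta>"
    unfolding ten_act_def by ((rule diagram)+, simp)
  also have "\<dots> = evl V M \<cdot> \<langle>N'\<rangle> \<odot> (r \<cdot> \<langle>M\<rangle> \<odot> T) \<cdot> \<langle>N'\<rangle> \<odot> (\<tau> H M \<cdot> \<langle>H\<rangle> \<odot> r) \<cdot> \<langle>N'\<rangle> \<odot> \<sigma> M H \<odot> \<langle>H\<rangle> \<cdot>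
      \<langle>N' \<otimes> M\<rangle> \<odot> \<Delta>"
    unfolding r'_evl by ((rule diagram)+, simp)
  also have "\<dots> = evl V M \<cdot> \<langle>N'\<rangle> \<odot> (r \<cdot> r \<odot> \<langle>H\<rangle>) \<cdot> \<langle>N' \<otimes> M \<otimes> H\<rangle> \<odot> T \<cdot> \<langle>N' \<otimes> M\<rangle> \<odot> \<tau> H H \<cdot>
      \<langle>N'\<rangle> \<odot> (\<tau> H M \<cdot> \<sigma> M H) \<odot> \<langle>H\<rangle> \<cdot> \<langle>N' \<otimes> M\<rangle> \<odot> \<Delta>"
    unfolding tau_natural_right[OF r H_obj, symmetric] by ((rule diagram)+, simp)
  also have "\<dots> = evl V M \<cdot> \<langle>N'\<rangle> \<odot> (r \<cdot> \<langle>M\<rangle> \<odot> (m \<cdot> \<langle>H\<rangle> \<odot> T \<cdot> \<tau> H H \<cdot> \<Delta>))"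
    unfolding tau_sigma[OF M H_obj] r_assoc by ((rule diagram)+, simp)
  also have "\<dots> = evl V M \<cdot> \<langle>N'\<rangle> \<odot> (r \<cdot> \<langle>M\<rangle> \<odot> u) \<cdot> \<langle>N' \<otimes> M\<rangle> \<odot> \<epsilon>"
    unfolding antipode_coop by ((rule diagram)+, simp)
  also have "\<dots> = \<epsilon> \<cdot> evl V M \<odot> \<langle>H\<rangle>"
    unfolding r_unit by ((rule diagram)+, simp)
  finally show ?thesis .
qed

lemma ld_action_coevl_linear: "coevl V M \<cdot> \<epsilon> = ten_act M r N' r' \<cdot> coevl V M \<odot> \<langle>H\<rangle>"
proof -
  note [diagram] = ld_dgs
  have "\<langle>M\<rangle> \<odot> r' \<cdot> coevl V M \<odot> \<langle>H\<rangle> =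
      \<langle>M\<rangle> \<odot> (evl V M \<odot> \<langle>N'\<rangle> \<cdot> \<langle>N'\<rangle> \<odot> coevl V M) \<cdot> \<langle>M\<rangle> \<odot> r' \<cdot> coevl V M \<odot> \<langle>H\<rangle>"
    unfolding snake_l2[OF M] by ((rule diagram)+, simp)
  also have "\<dots> = \<langle>M\<rangle> \<odot> (evl V M \<cdot> r' \<odot> \<langle>M\<rangle>) \<odot> \<langle>N'\<rangle> \<cdot> coevl V M \<odot> \<langle>H\<rangle> \<odot> coevl V M"
    by ((rule diagram)+, simp)
  also have "\<dots> = (\<langle>M\<rangle> \<odot> evl V M \<cdot> coevl V M \<odot> \<langle>M\<rangle>) \<odot> \<langle>N'\<rangle> \<cdot> (r \<cdot> \<langle>M\<rangle> \<odot> T) \<odot> \<langle>N'\<rangle> \<cdot> \<tau> H M \<odot> \<langle>N'\<rangle> \<cdot>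
      \<langle>H\<rangle> \<odot> coevl V M"
    unfolding r'_evl by ((rule diagram)+, simp)
  also have "\<dots> = (r \<cdot> \<langle>M\<rangle> \<odot> T) \<odot> \<langle>N'\<rangle> \<cdot> \<langle>M\<rangle> \<odot> (\<sigma> N' H \<cdot> \<tau> H N') \<cdot> \<tau> H M \<odot> \<langle>N'\<rangle> \<cdot> \<langle>H\<rangle> \<odot> coevl V M"
    unfolding snake_l1[OF M] sigma_tau[OF lM H_obj] by ((rule diagram)+, simp)
  also have "\<dots> = (r \<cdot> \<langle>M\<rangle> \<odot> T) \<odot> \<langle>N'\<rangle> \<cdot> \<langle>M\<rangle> \<odot> \<sigma> N' H \<cdot> (\<tau> H (M \<otimes> N') \<cdot> \<langle>H\<rangle> \<odot> coevl V M)"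
    by ((rule diagram)+, simp)
  also have "\<dots> = (r \<cdot> \<langle>M\<rangle> \<odot> T) \<odot> \<langle>N'\<rangle> \<cdot> \<langle>M\<rangle> \<odot> \<sigma> N' H \<cdot> coevl V M \<odot> \<langle>H\<rangle>"
    unfolding tau_natural_right[OF coevl_hom[OF M] H_obj, symmetric] by ((rule diagram)+, simp)
  finally have *: "\<langle>M\<rangle> \<odot> r' \<cdot> coevl V M \<odot> \<langle>H\<rangle> =
      (r \<cdot> \<langle>M\<rangle> \<odot> T) \<odot> \<langle>N'\<rangle> \<cdot> \<langle>M\<rangle> \<odot> \<sigma> N' H \<cdot> coevl V M \<odot> \<langle>H\<rangle>" .
  have tD: "\<tau> H H \<cdot> \<Delta> \<in> hom H (H \<otimes> H)" by (rule diagram_hom, (rule diagram)+)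
  \<comment> \<open>A cancelling pair of crossings of \<open>H\<close> with itself is inserted:
    \<sigma> lets \<open>r'\<close> slide past \<open>H\<close>, and \<tau> stays with
    \<open>\<Delta>\<close> for \<open>antipode_coop\<close>.\<close>
  have "ten_act M r N' r' \<cdot> coevl V M \<odot> \<langle>H\<rangle> =
      r \<odot> \<langle>N'\<rangle> \<cdot> \<langle>M \<otimes> H\<rangle> \<odot> r' \<cdot> \<langle>M\<rangle> \<odot> \<sigma> N' H \<odot> \<langle>H\<rangle> \<cdot> coevl V M \<odot> (\<sigma> H H \<cdot> \<tau> H H) \<cdot> \<Delta>"
    unfolding ten_act_def sigma_tau[OF H_obj H_obj] by ((rule diagram)+, simp)
  also have "\<dots> = r \<odot> \<langle>N'\<rangle> \<cdot> \<langle>M\<rangle> \<odot> (\<langle>H\<rangle> \<odot> r' \<cdot> \<sigma> (N' \<otimes> H) H) \<cdot> coevl V M \<odot> (\<tau> H H \<cdot> \<Delta>)"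
    by ((rule diagram)+, simp)
  also have "\<dots> = r \<odot> \<langle>N'\<rangle> \<cdot> \<langle>M\<rangle> \<odot> \<sigma> N' H \<cdot> (\<langle>M\<rangle> \<odot> r' \<cdot> coevl V M \<odot> \<langle>H\<rangle>) \<odot> \<langle>H\<rangle> \<cdot> \<tau> H H \<cdot> \<Delta>"
    unfolding sigma_natural_left[OF ld_r' H_obj] by ((rule diagram)+, simp)
  also have "\<dots> = (r \<cdot> r \<odot> \<langle>H\<rangle>) \<odot> \<langle>N'\<rangle> \<cdot> \<langle>M\<rangle> \<odot> T \<odot> \<langle>H\<rangle> \<odot> \<langle>N'\<rangle> \<cdot>
      \<langle>M\<rangle> \<odot> (\<sigma> N' (H \<otimes> H) \<cdot> \<langle>N'\<rangle> \<odot> (\<tau> H H \<cdot> \<Delta>)) \<cdot> coevl V M \<odot> \<langle>H\<rangle>"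
    unfolding * by ((rule diagram)+, simp)
  also have "\<dots> = (r \<cdot> \<langle>M\<rangle> \<odot> (m \<cdot> T \<odot> \<langle>H\<rangle> \<cdot> \<tau> H H \<cdot> \<Delta>)) \<odot> \<langle>N'\<rangle> \<cdot> \<langle>M\<rangle> \<odot> \<sigma> N' H \<cdot> coevl V M \<odot> \<langle>H\<rangle>"
    unfolding r_assoc sigma_natural_right[OF tD lM, symmetric] by ((rule diagram)+, simp)
  also have "\<dots> = (r \<cdot> \<langle>M\<rangle> \<odot> u) \<odot> \<langle>N'\<rangle> \<cdot> \<langle>M\<rangle> \<odot> (\<epsilon> \<odot> \<langle>N'\<rangle> \<cdot> \<sigma> N' H) \<cdot> coevl V M \<odot> \<langle>H\<rangle>"
    unfolding antipode_coop by ((rule diagram)+, simp)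
  also have "\<dots> = coevl V M \<cdot> \<epsilon>"
    unfolding r_unit sigma_natural_right[OF eps_hom lM] by ((rule diagram)+, simp)
  finally show ?thesis ..
qed

lemma ld_action_module: "is_module (N', r')"
proof -
  note [diagram] = ld_dgs
  have rT: "r \<cdot> \<langle>M\<rangle> \<odot> T \<in> hom (M \<otimes> H) M" by (rule diagram_hom, (rule diagram)+)
  have "r' \<cdot> r' \<odot> \<langle>H\<rangle> = r' \<cdot> \<langle>N'\<rangle> \<odot> m"
  proof (rule into_ld_eqI[OF M])
    show "r' \<cdot> r' \<odot> \<langle>H\<rangle> \<in> hom (N' \<otimes> H \<otimes> H) N'" by (rule diagram_hom, (rule diagram)+)
    show "r' \<cdot> \<langle>N'\<rangle> \<odot> m \<in> hom (N' \<otimes> H \<otimes> H) N'" by (rule diagram_hom, (rule diagram)+)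
    have "evl V M \<cdot> (r' \<cdot> r' \<odot> \<langle>H\<rangle>) \<odot> \<langle>M\<rangle> = (evl V M \<cdot> r' \<odot> \<langle>M\<rangle>) \<cdot> r' \<odot> \<langle>H \<otimes> M\<rangle>"
      by ((rule diagram)+, simp)
    also have "\<dots> = (evl V M \<cdot> \<langle>N'\<rangle> \<odot> (r \<cdot> \<langle>M\<rangle> \<odot> T) \<cdot> \<langle>N'\<rangle> \<odot> \<tau> H M) \<cdot> r' \<odot> \<langle>H \<otimes> M\<rangle>"
      unfolding r'_evl ..
    also have "\<dots> = (evl V M \<cdot> r' \<odot> \<langle>M\<rangle>) \<cdot> \<langle>N' \<otimes> H\<rangle> \<odot> (r \<cdot> \<langle>M\<rangle> \<odot> T) \<cdot> \<langle>N' \<otimes> H\<rangle> \<odot> \<tau> H M"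
      by ((rule diagram)+, simp)
    also have "\<dots> = evl V M \<cdot> \<langle>N'\<rangle> \<odot> (r \<cdot> \<langle>M\<rangle> \<odot> T) \<cdot> \<langle>N'\<rangle> \<odot> (\<tau> H M \<cdot> \<langle>H\<rangle> \<odot> (r \<cdot> \<langle>M\<rangle> \<odot> T)) \<cdot>
        \<langle>N' \<otimes> H\<rangle> \<odot> \<tau> H M"
      unfolding r'_evl by ((rule diagram)+, simp)
    also have "\<dots> = evl V M \<cdot> \<langle>N'\<rangle> \<odot> (r \<cdot> r \<odot> \<langle>H\<rangle>) \<cdot> \<langle>N' \<otimes> M\<rangle> \<odot> T \<odot> T \<cdot> \<langle>N' \<otimes> M\<rangle> \<odot> \<tau> H H \<cdot>
        \<langle>N'\<rangle> \<odot> \<tau> (H \<otimes> H) M"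
      unfolding tau_natural_right[OF rT H_obj, symmetric] by ((rule diagram)+, simp)
    also have "\<dots> = evl V M \<cdot> \<langle>N'\<rangle> \<odot> (r \<cdot> \<langle>M\<rangle> \<odot> (m \<cdot> T \<odot> T \<cdot> \<tau> H H)) \<cdot> \<langle>N'\<rangle> \<odot> \<tau> (H \<otimes> H) M"
      unfolding r_assoc by ((rule diagram)+, simp)
    also have "\<dots> = evl V M \<cdot> \<langle>N'\<rangle> \<odot> (r \<cdot> \<langle>M\<rangle> \<odot> T) \<cdot> \<langle>N'\<rangle> \<odot> (\<langle>M\<rangle> \<odot> m \<cdot> \<tau> (H \<otimes> H) M)"
      unfolding T_m[symmetric] by ((rule diagram)+, simp)
    also have "\<dots> = (evl V M \<cdot> r' \<odot> \<langle>M\<rangle>) \<cdot> \<langle>N'\<rangle> \<odot> m \<odot> \<langle>M\<rangle>"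
      unfolding tau_natural_left[OF m_hom M] r'_evl by ((rule diagram)+, simp)
    also have "\<dots> = evl V M \<cdot> (r' \<cdot> \<langle>N'\<rangle> \<odot> m) \<odot> \<langle>M\<rangle>" by ((rule diagram)+, simp)
    finally show "evl V M \<cdot> (r' \<cdot> r' \<odot> \<langle>H\<rangle>) \<odot> \<langle>M\<rangle> = evl V M \<cdot> (r' \<cdot> \<langle>N'\<rangle> \<odot> m) \<odot> \<langle>M\<rangle>" .
  qed
  moreover have "r' \<cdot> \<langle>N'\<rangle> \<odot> u = \<langle>N'\<rangle>"
  proof (rule into_ld_eqI[OF M])
    show "r' \<cdot> \<langle>N'\<rangle> \<odot> u \<in> hom N' N'" by (rule diagram_hom, (rule diagram)+)
    show "\<langle>N'\<rangle> \<in> hom N' N'" by (rule diagram_hom, (rule diagram)+)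
    have "evl V M \<cdot> (r' \<cdot> \<langle>N'\<rangle> \<odot> u) \<odot> \<langle>M\<rangle> = (evl V M \<cdot> r' \<odot> \<langle>M\<rangle>) \<cdot> \<langle>N'\<rangle> \<odot> u \<odot> \<langle>M\<rangle>"
      by ((rule diagram)+, simp)
    also have "\<dots> = evl V M \<cdot> \<langle>N'\<rangle> \<odot> (r \<cdot> \<langle>M\<rangle> \<odot> T) \<cdot> \<langle>N'\<rangle> \<odot> (\<tau> H M \<cdot> u \<odot> \<langle>M\<rangle>)"
      unfolding r'_evl by ((rule diagram)+, simp)
    also have "\<dots> = evl V M \<cdot> \<langle>N'\<rangle> \<odot> (r \<cdot> \<langle>M\<rangle> \<odot> (T \<cdot> u))"
      unfolding tau_natural_left[OF u_hom M, symmetric] by ((rule diagram)+, simp)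
    also have "\<dots> = evl V M \<cdot> \<langle>N'\<rangle> \<odot> \<langle>M\<rangle>" unfolding T_u r_unit ..
    finally show "evl V M \<cdot> (r' \<cdot> \<langle>N'\<rangle> \<odot> u) \<odot> \<langle>M\<rangle> = evl V M \<cdot> \<langle>N'\<rangle> \<odot> \<langle>M\<rangle>"
      using ten_ident[OF lM M] by simp
  qed
  ultimately show ?thesis unfolding is_module_iff using ld_r' lM by simp
qed

end

section \<open>Dual modules and linearity of the canonical morphisms\<close>

lemma linear_unit_iff:
  "linear mod_unit (N, s) f \<longleftrightarrow> f \<in> hom \<one> N \<and> f \<cdot> \<epsilon> = s \<cdot> f \<odot> \<langle>H\<rangle>"
  "linear (N, s) mod_unit f \<longleftrightarrow> f \<in> hom N \<one> \<and> f \<cdot> s = \<epsilon> \<cdot> f \<odot> \<langle>H\<rangle>"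
  unfolding mod_unit_def linear_iff by simp_all

text \<open>The description in \<open>mod_rd\<close> denotes an action because the transposed action
  satisfies the linearity conditions and, by \<open>rd_actionI\<close>, any other candidate has the
  same pairing.\<close>

lemma mod_rd_eq: "\<exists>r'. mod_rd (M, r) = (M', r') \<and> rd_action r'"
proof -
  obtain r' where r': "rd_action r'" using rd_action_exists by blast
  have "(THE r'. is_module (M', r') \<and> linear (mod_ten (M, r) (M', r')) mod_unit (evr V M) \<and>
      linear mod_unit (mod_ten (M', r') (M, r)) (coevr V M)) = r'"
  proof (rule the_equality)
    show "is_module (M', r') \<and> linear (mod_ten (M, r) (M', r')) mod_unit (evr V M) \<and>
      linear mod_unit (mod_ten (M', r') (M, r)) (coevr V M)"
      using rd_action_module[OF r'] rd_action_evr_linear[OF r'] rd_action_coevr_linear[OF r']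
        evr_hom[OF M] coevr_hom[OF M] unfolding mod_ten_eq linear_unit_iff by blast
    fix s assume "is_module (M', s) \<and> linear (mod_ten (M, r) (M', s)) mod_unit (evr V M) \<and>
      linear mod_unit (mod_ten (M', s) (M, r)) (coevr V M)"
    then show "s = r'"
      using rd_actionI[of s] rd_action_unique[OF _ r'] moduleD(2)[of M' s]
      unfolding mod_ten_eq linear_unit_iff by blast
  qed
  then show ?thesis using r' unfolding mod_rd_def by simp
qed

lemma mod_ld_eq: "\<exists>r'. mod_ld (M, r) = (N', r') \<and> ld_action r'"
proof -
  obtain r' where r': "ld_action r'" using ld_action_exists by blast
  have "(THE r'. is_module (N', r') \<and> linear (mod_ten (N', r') (M, r)) mod_unit (evl V M) \<and>
      linear mod_unit (mod_ten (M, r) (N', r')) (coevl V M)) = r'"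
  proof (rule the_equality)
    show "is_module (N', r') \<and> linear (mod_ten (N', r') (M, r)) mod_unit (evl V M) \<and>
      linear mod_unit (mod_ten (M, r) (N', r')) (coevl V M)"
      using ld_action_module[OF r'] ld_action_evl_linear[OF r'] ld_action_coevl_linear[OF r']
        evl_hom[OF M] coevl_hom[OF M] unfolding mod_ten_eq linear_unit_iff by blast
    fix s assume "is_module (N', s) \<and> linear (mod_ten (N', s) (M, r)) mod_unit (evl V M) \<and>
      linear mod_unit (mod_ten (M, r) (N', s)) (coevl V M)"
    then show "s = r'"
      using ld_actionI[of s] ld_action_unique[OF _ r'] moduleD(2)[of N' s]
      unfolding mod_ten_eq linear_unit_iff by blast
  qed
  then show ?thesis using r' unfolding mod_ld_def by simp
qed

end

text \<open>Dualising twice applies \<open>S\<close> twice, and the crossings of \<open>H\<close> in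
  the two dual actions, together with the one in \<mu>, leave a double braiding of \<open>M\<close>
  and \<open>H\<close>. This is the source of \<open>S \<cdot> S\<close> and of
  \<open>\<omega>\<close> in the linearity condition on pivotal elements.\<close>

lemma mu_action:
  assumes Mr: "is_module (M, r)" and r': "rd_action M r r'" and r'': "rd_action (rd V M) r' r''"
  shows "r'' \<cdot> \<mu> M \<odot> \<langle>H\<rangle> = \<mu> M \<cdot> r \<cdot> \<langle>M\<rangle> \<odot> (S \<cdot> S) \<cdot> \<sigma> H M \<cdot> \<sigma> M H"
proof -
  let ?M = "rd V M" and ?MM = "rd V (rd V M)"
  note M = moduleD(1)[OF Mr] and r = moduleD(2)[OF Mr]
  note M' = rd_obj[OF M]
  have h: "r' \<in> hom (?M \<otimes> H) ?M" "r'' \<in> hom (?MM \<otimes> H) ?MM"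
    and e: "evr V M \<cdot> \<langle>M\<rangle> \<odot> r' = evr V M \<cdot> (r \<cdot> \<langle>M\<rangle> \<odot> S) \<odot> \<langle>?M\<rangle> \<cdot> \<langle>M\<rangle> \<odot> \<sigma> ?M H"
      "evr V ?M \<cdot> \<langle>?M\<rangle> \<odot> r'' = evr V ?M \<cdot> (r' \<cdot> \<langle>?M\<rangle> \<odot> S) \<odot> \<langle>?MM\<rangle> \<cdot> \<langle>?M\<rangle> \<odot> \<sigma> ?MM H"
    using r' r'' unfolding rd_action_def[OF Mr] rd_action_def[OF rd_action_module[OF Mr r']] by
        blast+
  note [diagram] = M[THEN atomI] r[THEN diagram_gen] h[THEN diagram_gen]
  have r'S: "r' \<cdot> \<langle>?M\<rangle> \<odot> S \<in> hom (?M \<otimes> H) ?M" and rSS: "r \<cdot> \<langle>M\<rangle> \<odot> (S \<cdot> S) \<in> hom (M \<otimes> H) M"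
    by (rule diagram_hom, (rule diagram)+)+
  show ?thesis
  proof (rule into_rd_eqI[OF M'])
    show "r'' \<cdot> \<mu> M \<odot> \<langle>H\<rangle> \<in> hom (M \<otimes> H) ?MM" by (rule diagram_hom, (rule diagram)+)
    show "\<mu> M \<cdot> r \<cdot> \<langle>M\<rangle> \<odot> (S \<cdot> S) \<cdot> \<sigma> H M \<cdot> \<sigma> M H \<in> hom (M \<otimes> H) ?MM"
      by (rule diagram_hom, (rule diagram)+)
    have "evr V ?M \<cdot> \<langle>?M\<rangle> \<odot> (r'' \<cdot> \<mu> M \<odot> \<langle>H\<rangle>) = (evr V ?M \<cdot> \<langle>?M\<rangle> \<odot> r'') \<cdot> \<langle>?M\<rangle> \<odot> \<mu> M \<odot> \<langle>H\<rangle>"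
      by ((rule diagram)+, simp)
    also have "\<dots> = evr V ?M \<cdot> (r' \<cdot> \<langle>?M\<rangle> \<odot> S) \<odot> \<langle>?MM\<rangle> \<cdot> \<langle>?M\<rangle> \<odot> (\<sigma> ?MM H \<cdot> \<mu> M \<odot> \<langle>H\<rangle>)"
      unfolding e(2) by ((rule diagram)+, simp)
    also have "\<dots> = (evr V ?M \<cdot> \<langle>?M\<rangle> \<odot> \<mu> M) \<cdot> (r' \<cdot> \<langle>?M\<rangle> \<odot> S) \<odot> \<langle>M\<rangle> \<cdot> \<langle>?M\<rangle> \<odot> \<sigma> M H"
      unfolding sigma_natural_left[OF mu_hom[OF M] H_obj, symmetric] by ((rule diagram)+, simp)
    also have "\<dots> = evr V M \<cdot> (\<sigma> ?M M \<cdot> (r' \<cdot> \<langle>?M\<rangle> \<odot> S) \<odot> \<langle>M\<rangle>) \<cdot> \<langle>?M\<rangle> \<odot> \<sigma> M H"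
      unfolding mu_evr[OF M] by ((rule diagram)+, simp)
    also have "\<dots> = (evr V M \<cdot> \<langle>M\<rangle> \<odot> r') \<cdot> \<langle>M \<otimes> ?M\<rangle> \<odot> S \<cdot> \<sigma> (?M \<otimes> H) M \<cdot> \<langle>?M\<rangle> \<odot> \<sigma> M H"
      unfolding sigma_natural_left[OF r'S M, symmetric] by ((rule diagram)+, simp)
    also have "\<dots> = evr V M \<cdot> (r \<cdot> \<langle>M\<rangle> \<odot> S) \<odot> \<langle>?M\<rangle> \<cdot> \<langle>M\<rangle> \<odot> (\<sigma> ?M H \<cdot> \<langle>?M\<rangle> \<odot> S) \<cdot> \<sigma> (?M \<otimes> H) M \<cdot>
        \<langle>?M\<rangle> \<odot> \<sigma> M H"
      unfolding e(1) by ((rule diagram)+, simp)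
    also have "\<dots> = evr V M \<cdot> ((r \<cdot> \<langle>M\<rangle> \<odot> (S \<cdot> S)) \<odot> \<langle>?M\<rangle> \<cdot> \<sigma> ?M (M \<otimes> H)) \<cdot> \<langle>?M\<rangle> \<odot> (\<sigma> H M \<cdot> \<sigma> M H)"
      unfolding sigma_natural_right[OF S_hom M', symmetric] by ((rule diagram)+, simp)
    also have "\<dots> = (evr V M \<cdot> \<sigma> ?M M) \<cdot> \<langle>?M\<rangle> \<odot> (r \<cdot> \<langle>M\<rangle> \<odot> (S \<cdot> S) \<cdot> \<sigma> H M \<cdot> \<sigma> M H)"
      unfolding sigma_natural_right[OF rSS M'] by ((rule diagram)+, simp)
    also have "\<dots> = evr V ?M \<cdot> \<langle>?M\<rangle> \<odot> (\<mu> M \<cdot> r \<cdot> \<langle>M\<rangle> \<odot> (S \<cdot> S) \<cdot> \<sigma> H M \<cdot> \<sigma> M H)"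
      unfolding mu_evr[OF M, symmetric] by ((rule diagram)+, simp)
    finally show "evr V ?M \<cdot> \<langle>?M\<rangle> \<odot> (r'' \<cdot> \<mu> M \<odot> \<langle>H\<rangle>) =
      evr V ?M \<cdot> \<langle>?M\<rangle> \<odot> (\<mu> M \<cdot> r \<cdot> \<langle>M\<rangle> \<odot> (S \<cdot> S) \<cdot> \<sigma> H M \<cdot> \<sigma> M H)" .
  qed
qed

text \<open>The left dual contributes \<open>T\<close> and \<tau>, the right dual \<open>S\<close>
  and \<sigma>. They cancel, in contrast to the double right dual in
  \<open>mu_action\<close>.\<close>

lemma to_rl_linear:
  assumes Mr: "is_module (M, r)" and r': "ld_action M r r'" and r'': "rd_action (ld V M) r' r''"
  shows "to_rl M \<cdot> r = r'' \<cdot> to_rl M \<odot> \<langle>H\<rangle>"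
proof -
  let ?N = "ld V M" and ?K = "rd V (ld V M)"
  note M = moduleD(1)[OF Mr] and r = moduleD(2)[OF Mr]
  note N = ld_obj[OF M]
  have h: "r' \<in> hom (?N \<otimes> H) ?N" "r'' \<in> hom (?K \<otimes> H) ?K"
    and e: "evl V M \<cdot> r' \<odot> \<langle>M\<rangle> = evl V M \<cdot> \<langle>?N\<rangle> \<odot> (r \<cdot> \<langle>M\<rangle> \<odot> T) \<cdot> \<langle>?N\<rangle> \<odot> \<tau> H M"
      "evr V ?N \<cdot> \<langle>?N\<rangle> \<odot> r'' = evr V ?N \<cdot> (r' \<cdot> \<langle>?N\<rangle> \<odot> S) \<odot> \<langle>?K\<rangle> \<cdot> \<langle>?N\<rangle> \<odot> \<sigma> ?K H"
    using r' r'' unfolding ld_action_def[OF Mr] rd_action_def[OF ld_action_module[OF Mr r']] by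
        blast+
  note [diagram] = M[THEN atomI] r[THEN diagram_gen] h[THEN diagram_gen]
  show ?thesis
  proof (rule into_rd_eqI[OF N])
    show "to_rl M \<cdot> r \<in> hom (M \<otimes> H) ?K" by (rule diagram_hom, (rule diagram)+)
    show "r'' \<cdot> to_rl M \<odot> \<langle>H\<rangle> \<in> hom (M \<otimes> H) ?K" by (rule diagram_hom, (rule diagram)+)
    have "evr V ?N \<cdot> \<langle>?N\<rangle> \<odot> (r'' \<cdot> to_rl M \<odot> \<langle>H\<rangle>) = (evr V ?N \<cdot> \<langle>?N\<rangle> \<odot> r'') \<cdot> \<langle>?N\<rangle> \<odot> to_rl M \<odot> \<langle>H\<rangle>"
      by ((rule diagram)+, simp)
    also have "\<dots> = evr V ?N \<cdot> (r' \<cdot> \<langle>?N\<rangle> \<odot> S) \<odot> \<langle>?K\<rangle> \<cdot> \<langle>?N\<rangle> \<odot> (\<sigma> ?K H \<cdot> to_rl M \<odot> \<langle>H\<rangle>)"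
      unfolding e(2) by ((rule diagram)+, simp)
    also have "\<dots> = (evr V ?N \<cdot> \<langle>?N\<rangle> \<odot> to_rl M) \<cdot> (r' \<cdot> \<langle>?N\<rangle> \<odot> S) \<odot> \<langle>M\<rangle> \<cdot> \<langle>?N\<rangle> \<odot> \<sigma> M H"
      unfolding sigma_natural_left[OF to_rl_hom[OF M] H_obj, symmetric] by ((rule diagram)+, simp)
    also have "\<dots> = (evl V M \<cdot> r' \<odot> \<langle>M\<rangle>) \<cdot> \<langle>?N\<rangle> \<odot> (S \<odot> \<langle>M\<rangle> \<cdot> \<sigma> M H)"
      unfolding to_rl_evr[OF M] by ((rule diagram)+, simp)
    also have "\<dots> = evl V M \<cdot> \<langle>?N\<rangle> \<odot> (r \<cdot> \<langle>M\<rangle> \<odot> T) \<cdot> \<langle>?N\<rangle> \<odot> (\<tau> H M \<cdot> \<sigma> M H) \<cdot> \<langle>?N \<otimes> M\<rangle> \<odot> S"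
      unfolding sigma_natural_right[OF S_hom M] e(1) by ((rule diagram)+, simp)
    also have "\<dots> = evl V M \<cdot> \<langle>?N\<rangle> \<odot> (r \<cdot> \<langle>M\<rangle> \<odot> (T \<cdot> S))"
      unfolding tau_sigma[OF M H_obj] by ((rule diagram)+, simp)
    also have "\<dots> = (evr V ?N \<cdot> \<langle>?N\<rangle> \<odot> to_rl M) \<cdot> \<langle>?N\<rangle> \<odot> r"
      unfolding to_rl_evr[OF M] T_S by ((rule diagram)+, simp)
    also have "\<dots> = evr V ?N \<cdot> \<langle>?N\<rangle> \<odot> (to_rl M \<cdot> r)" by ((rule diagram)+, simp)
    finally show "evr V ?N \<cdot> \<langle>?N\<rangle> \<odot> (to_rl M \<cdot> r) = evr V ?N \<cdot> \<langle>?N\<rangle> \<odot> (r'' \<cdot> to_rl M \<odot> \<langle>H\<rangle>)" ..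
  qed
qed

lemma to_lr_linear:
  assumes Mr: "is_module (M, r)" and r': "rd_action M r r'" and r'': "ld_action (rd V M) r' r''"
  shows "to_lr M \<cdot> r = r'' \<cdot> to_lr M \<odot> \<langle>H\<rangle>"
proof -
  let ?N = "rd V M" and ?K = "ld V (rd V M)"
  note M = moduleD(1)[OF Mr] and r = moduleD(2)[OF Mr]
  note N = rd_obj[OF M]
  have h: "r' \<in> hom (?N \<otimes> H) ?N" "r'' \<in> hom (?K \<otimes> H) ?K"
    and e: "evr V M \<cdot> \<langle>M\<rangle> \<odot> r' = evr V M \<cdot> (r \<cdot> \<langle>M\<rangle> \<odot> S) \<odot> \<langle>?N\<rangle> \<cdot> \<langle>M\<rangle> \<odot> \<sigma> ?N H"
      "evl V ?N \<cdot> r'' \<odot> \<langle>?N\<rangle> = evl V ?N \<cdot> \<langle>?K\<rangle> \<odot> (r' \<cdot> \<langle>?N\<rangle> \<odot> T) \<cdot> \<langle>?K\<rangle> \<odot> \<tau> H ?N"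
    using r' r'' unfolding rd_action_def[OF Mr] ld_action_def[OF rd_action_module[OF Mr r']] by
        blast+
  note [diagram] = M[THEN atomI] r[THEN diagram_gen] h[THEN diagram_gen]
  show ?thesis
  proof (rule into_ld_eqI[OF N])
    show "to_lr M \<cdot> r \<in> hom (M \<otimes> H) ?K" by (rule diagram_hom, (rule diagram)+)
    show "r'' \<cdot> to_lr M \<odot> \<langle>H\<rangle> \<in> hom (M \<otimes> H) ?K" by (rule diagram_hom, (rule diagram)+)
    have "evl V ?N \<cdot> (r'' \<cdot> to_lr M \<odot> \<langle>H\<rangle>) \<odot> \<langle>?N\<rangle> = (evl V ?N \<cdot> r'' \<odot> \<langle>?N\<rangle>) \<cdot> to_lr M \<odot> \<langle>H \<otimes> ?N\<rangle>"
      by ((rule diagram)+, simp)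
    also have "\<dots> = (evl V ?N \<cdot> to_lr M \<odot> \<langle>?N\<rangle>) \<cdot> \<langle>M\<rangle> \<odot> (r' \<cdot> \<langle>?N\<rangle> \<odot> T) \<cdot> \<langle>M\<rangle> \<odot> \<tau> H ?N"
      unfolding e(2) by ((rule diagram)+, simp)
    also have "\<dots> = (evr V M \<cdot> \<langle>M\<rangle> \<odot> r') \<cdot> \<langle>M \<otimes> ?N\<rangle> \<odot> T \<cdot> \<langle>M\<rangle> \<odot> \<tau> H ?N"
      unfolding to_lr_evl[OF M] by ((rule diagram)+, simp)
    also have "\<dots> = evr V M \<cdot> (r \<cdot> \<langle>M\<rangle> \<odot> S) \<odot> \<langle>?N\<rangle> \<cdot> \<langle>M\<rangle> \<odot> (\<sigma> ?N H \<cdot> \<langle>?N\<rangle> \<odot> T) \<cdot> \<langle>M\<rangle> \<odot> \<tau> H ?N"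
      unfolding e(1) by ((rule diagram)+, simp)
    also have "\<dots> = evr V M \<cdot> (r \<cdot> \<langle>M\<rangle> \<odot> (S \<cdot> T)) \<odot> \<langle>?N\<rangle> \<cdot> \<langle>M\<rangle> \<odot> (\<sigma> ?N H \<cdot> \<tau> H ?N)"
      unfolding sigma_natural_right[OF T_hom N, symmetric] by ((rule diagram)+, simp)
    also have "\<dots> = (evl V ?N \<cdot> to_lr M \<odot> \<langle>?N\<rangle>) \<cdot> r \<odot> \<langle>?N\<rangle>"
      unfolding to_lr_evl[OF M] S_T sigma_tau[OF N H_obj] by ((rule diagram)+, simp)
    also have "\<dots> = evl V ?N \<cdot> (to_lr M \<cdot> r) \<odot> \<langle>?N\<rangle>" by ((rule diagram)+, simp)
    finally show "evl V ?N \<cdot> (to_lr M \<cdot> r) \<odot> \<langle>?N\<rangle> = evl V ?N \<cdot> (r'' \<cdot> to_lr M \<odot> \<langle>H\<rangle>) \<odot> \<langle>?N\<rangle>" ..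
  qed
qed

text \<open>Adjointness moves \<open>g\<close> onto the module on which \<open>H\<close> acts, where
  it commutes with the action by assumption. The antipode on elements needs this, since it evaluates
  an endomorphism on left duals.\<close>

lemma ldual_arr_linear:
  assumes Mr: "is_module (M, r)" and Ns: "is_module (N, s)" and r': "ld_action M r r'"
    and s': "ld_action N s s'"
    and g: "g \<in> hom M N" "g \<cdot> r = s \<cdot> g \<odot> \<langle>H\<rangle>"
  shows "ldual_arr g \<cdot> s' = r' \<cdot> ldual_arr g \<odot> \<langle>H\<rangle>"
proof -
  let ?M = "ld V M" and ?N = "ld V N"
  note M = moduleD(1)[OF Mr] and r = moduleD(2)[OF Mr] and N = moduleD(1)[OF Ns] and s =
      moduleD(2)[OF Ns]
  have h: "r' \<in> hom (?M \<otimes> H) ?M" "s' \<in> hom (?N \<otimes> H) ?N"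
    and e: "evl V M \<cdot> r' \<odot> \<langle>M\<rangle> = evl V M \<cdot> \<langle>?M\<rangle> \<odot> (r \<cdot> \<langle>M\<rangle> \<odot> T) \<cdot> \<langle>?M\<rangle> \<odot> \<tau> H M"
      "evl V N \<cdot> s' \<odot> \<langle>N\<rangle> = evl V N \<cdot> \<langle>?N\<rangle> \<odot> (s \<cdot> \<langle>N\<rangle> \<odot> T) \<cdot> \<langle>?N\<rangle> \<odot> \<tau> H N"
    using r' s' unfolding ld_action_def[OF Mr] ld_action_def[OF Ns] by blast+
  note [diagram] =
      M[THEN atomI] r[THEN diagram_gen] N[THEN atomI] s[THEN diagram_gen] h[THEN diagram_gen]
    g(1) g(1)[THEN diagram_gen]
  show ?thesis
  proof (rule into_ld_eqI[OF M])
    show "ldual_arr g \<cdot> s' \<in> hom (?N \<otimes> H) ?M" by (rule diagram_hom, (rule diagram)+)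
    show "r' \<cdot> ldual_arr g \<odot> \<langle>H\<rangle> \<in> hom (?N \<otimes> H) ?M" by (rule diagram_hom, (rule diagram)+)
    have "evl V M \<cdot> (r' \<cdot> ldual_arr g \<odot> \<langle>H\<rangle>) \<odot> \<langle>M\<rangle> = (evl V M \<cdot> r' \<odot> \<langle>M\<rangle>) \<cdot> ldual_arr g \<odot> \<langle>H \<otimes> M\<rangle>"
      by ((rule diagram)+, simp)
    also have "\<dots> = (evl V M \<cdot> ldual_arr g \<odot> \<langle>M\<rangle>) \<cdot> \<langle>?N\<rangle> \<odot> (r \<cdot> \<langle>M\<rangle> \<odot> T) \<cdot> \<langle>?N\<rangle> \<odot> \<tau> H M"
      unfolding e(1) by ((rule diagram)+, simp)
    also have "\<dots> = evl V N \<cdot> \<langle>?N\<rangle> \<odot> (g \<cdot> r) \<cdot> \<langle>?N \<otimes> M\<rangle> \<odot> T \<cdot> \<langle>?N\<rangle> \<odot> \<tau> H M"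
      unfolding ldual_arr_evl[OF g(1)] by ((rule diagram)+, simp)
    also have "\<dots> = evl V N \<cdot> \<langle>?N\<rangle> \<odot> (s \<cdot> \<langle>N\<rangle> \<odot> T) \<cdot> \<langle>?N\<rangle> \<odot> (g \<odot> \<langle>H\<rangle> \<cdot> \<tau> H M)"
      unfolding g(2) by ((rule diagram)+, simp)
    also have "\<dots> = (evl V N \<cdot> s' \<odot> \<langle>N\<rangle>) \<cdot> \<langle>?N \<otimes> H\<rangle> \<odot> g"
      unfolding tau_natural_right[OF g(1) H_obj] e(2) by ((rule diagram)+, simp)
    also have "\<dots> = (evl V N \<cdot> \<langle>?N\<rangle> \<odot> g) \<cdot> s' \<odot> \<langle>M\<rangle>" by ((rule diagram)+, simp)
    also have "\<dots> = evl V M \<cdot> (ldual_arr g \<cdot> s') \<odot> \<langle>M\<rangle>"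
      unfolding ldual_arr_evl[OF g(1), symmetric] by ((rule diagram)+, simp)
    finally show "evl V M \<cdot> (ldual_arr g \<cdot> s') \<odot> \<langle>M\<rangle> = evl V M \<cdot> (r' \<cdot> ldual_arr g \<odot> \<langle>H\<rangle>) \<odot> \<langle>M\<rangle>" ..
  qed
qed

end

section \<open>Elements and natural endomorphisms\<close>

locale braided_hopf_coend = braided_coend V \<sigma> C \<iota> + braided_hopf V \<sigma> HH + hopf_coend_data V \<sigma> HH C \<iota>
  for V :: "('o, 'a) rigid_cat" (structure) and \<sigma> and HH :: "('o, 'a) hopf"
    and C :: 'o and \<iota> :: "'o \<Rightarrow> 'a"
begin

lemma Sigma_app: "X \<in> Obj V \<Longrightarrow> \<Sigma> t X = \<langle>X\<rangle> \<odot> t \<cdot> \<delta> X"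
  unfolding \<Sigma>_def by simp

lemma Sigma_hom:
  assumes t: "t \<in> hom C D" and X: "X \<in> Obj V"
  shows "\<Sigma> t X \<in> hom X (X \<otimes> D)"
proof -
  note [diagram] = t[THEN diagram_gen] X[THEN atomI] hom_obj(2)[OF t, THEN atomI]
  show ?thesis unfolding Sigma_app[OF X] by (rule diagram_hom, (rule diagram)+)
qed

lemma Sigma_natural:
  assumes t: "t \<in> hom C D" and f: "f \<in> hom X Y"
  shows "f \<odot> \<langle>D\<rangle> \<cdot> \<Sigma> t X = \<Sigma> t Y \<cdot> f"
proof -
  note o = hom_obj[OF f]
  note [diagram] =
      t[THEN diagram_gen] f[THEN diagram_gen] o[THEN atomI] hom_obj(2)[OF t, THEN atomI]
  have "f \<odot> \<langle>D\<rangle> \<cdot> \<Sigma> t X = \<langle>Y\<rangle> \<odot> t \<cdot> (f \<odot> \<langle>C\<rangle> \<cdot> \<delta> X)"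
    unfolding Sigma_app[OF o(1)] by ((rule diagram)+, simp)
  also have "\<dots> = \<Sigma> t Y \<cdot> f"
    unfolding delta_natural[OF f] Sigma_app[OF o(2)] by ((rule diagram)+, simp)
  finally show ?thesis .
qed

lemma sharp_app: "is_module (M, r) \<Longrightarrow> sharp h (M, r) = r \<cdot> h M"
  unfolding sharp_def Mod_def by simp

text \<open>The components are morphisms of \<open>V\<close> and need not be linear; they only
  commute with linear maps. Values at pairs that are not modules are unconstrained.\<close>

definition natural_end :: "('o \<times> 'a \<Rightarrow> 'a) \<Rightarrow> bool" where
  "natural_end f \<longleftrightarrow> (\<forall>M r. is_module (M, r) \<longrightarrow> f (M, r) \<in> hom M M) \<and>
     (\<forall>M r N s g. is_module (M, r) \<longrightarrow> is_module (N, s) \<longrightarrow> linear (M, r) (N, s) g \<longrightarrow>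
        g \<cdot> f (M, r) = f (N, s) \<cdot> g)"

lemma natural_endD:
  assumes "natural_end f" "is_module (M, r)"
  shows "f (M, r) \<in> hom M M"
    and "is_module (N, s) \<Longrightarrow> g \<in> hom M N \<Longrightarrow> g \<cdot> r = s \<cdot> g \<odot> \<langle>H\<rangle> \<Longrightarrow> g \<cdot> f (M, r) = f (N, s) \<cdot> g"
  using assms unfolding natural_end_def linear_iff by auto

lemma sharp_natural:
  assumes t: "t \<in> hom C H"
  shows "natural_end (sharp (\<Sigma> t))"
  unfolding natural_end_def linear_iff
proof (intro conjI allI impI)
  fix M r assume Mr: "is_module (M, r)"
  note [diagram] =
      moduleD(1)[OF Mr, THEN atomI] moduleD(2)[OF Mr, THEN diagram_gen]
          Sigma_hom[OF t, THEN diagram_gen]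
  show "sharp (\<Sigma> t) (M, r) \<in> hom M M"
    unfolding sharp_app[OF Mr] by (rule diagram_hom, (rule diagram)+)
next
  fix M r N s g assume Mr: "is_module (M, r)" and Ns: "is_module (N, s)"
    and g: "g \<in> hom M N \<and> g \<cdot> r = s \<cdot> g \<odot> \<langle>H\<rangle>"
  note g = conjunct1[OF g] conjunct2[OF g]
  note [diagram] =
      moduleD(1)[OF Mr, THEN atomI] moduleD(2)[OF Mr, THEN diagram_gen]
          Sigma_hom[OF t, THEN diagram_gen]
    moduleD(1)[OF Ns, THEN atomI] moduleD(2)[OF Ns, THEN diagram_gen] g(1)[THEN diagram_gen]
  have "g \<cdot> sharp (\<Sigma> t) (M, r) = (g \<cdot> r) \<cdot> \<Sigma> t M"
    unfolding sharp_app[OF Mr] by ((rule diagram)+, simp)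
  also have "\<dots> = s \<cdot> (g \<odot> \<langle>H\<rangle> \<cdot> \<Sigma> t M)" unfolding g(2) by ((rule diagram)+, simp)
  also have "\<dots> = sharp (\<Sigma> t) (N, s) \<cdot> g"
    unfolding Sigma_natural[OF t g(1)] sharp_app[OF Ns] by ((rule diagram)+, simp)
  finally show "g \<cdot> sharp (\<Sigma> t) (M, r) = sharp (\<Sigma> t) (N, s) \<cdot> g" .
qed

text \<open>The inverse passage from endomorphisms to families: naturality of
  \<open>\<Sigma> t\<close> along \<open>\<langle>X\<rangle> \<odot> u\<close> leaves a product with
  the unit of \<open>H\<close>.\<close>

lemma sharp_free_unit:
  assumes t: "t \<in> hom C H" and X: "X \<in> Obj V"
  shows "sharp (\<Sigma> t) (X \<otimes> H, \<langle>X\<rangle> \<odot> m) \<cdot> \<langle>X\<rangle> \<odot> u = \<Sigma> t X"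
proof -
  note [diagram] = X[THEN atomI] Sigma_hom[OF t, THEN diagram_gen]
  have Xu: "\<langle>X\<rangle> \<odot> u \<in> hom X (X \<otimes> H)" by (rule diagram_hom, (rule diagram)+)
  have "sharp (\<Sigma> t) (X \<otimes> H, \<langle>X\<rangle> \<odot> m) \<cdot> \<langle>X\<rangle> \<odot> u = \<langle>X\<rangle> \<odot> m \<cdot> (\<Sigma> t (X \<otimes> H) \<cdot> \<langle>X\<rangle> \<odot> u)"
    unfolding sharp_app[OF free_module[OF X]] by ((rule diagram)+, simp)
  also have "\<dots> = \<langle>X\<rangle> \<odot> (m \<cdot> u \<odot> \<langle>H\<rangle>) \<cdot> \<Sigma> t X"
    unfolding Sigma_natural[OF t Xu, symmetric] by ((rule diagram)+, simp)
  also have "\<dots> = \<Sigma> t X" unfolding m_unit by ((rule diagram)+, simp)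
  finally show ?thesis .
qed

lemma sharp_inj:
  assumes t: "t \<in> hom C H" and t': "t' \<in> hom C H"
    and eq: "\<And>M r. is_module (M, r) \<Longrightarrow> sharp (\<Sigma> t) (M, r) = sharp (\<Sigma> t') (M, r)"
  shows "t = t'"
proof (rule coend_eqI[OF t t'])
  fix X assume X: "X \<in> Obj V"
  show "\<langle>X\<rangle> \<odot> t \<cdot> \<delta> X = \<langle>X\<rangle> \<odot> t' \<cdot> \<delta> X"
    using sharp_free_unit[OF t X] sharp_free_unit[OF t' X] eq[OF free_module[OF X]] Sigma_app[OF X]
        by simp
qed

lemma sharp_surj:
  assumes f: "natural_end f"
  shows "\<exists>t \<in> hom C H. \<forall>M r. is_module (M, r) \<longrightarrow> sharp (\<Sigma> t) (M, r) = f (M, r)"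
proof -
  define n where "n X = f (X \<otimes> H, \<langle>X\<rangle> \<odot> m) \<cdot> \<langle>X\<rangle> \<odot> u" for X
  have fh: "f (X \<otimes> H, \<langle>X\<rangle> \<odot> m) \<in> hom (X \<otimes> H) (X \<otimes> H)" if "X \<in> Obj V" for X
    using natural_endD(1)[OF f free_module[OF that]] .
  note [diagram] = fh[THEN diagram_gen]
  have n: "n X \<in> hom X (X \<otimes> H)" if X: "X \<in> Obj V" for X
  proof -
    note [diagram] = X[THEN atomI]
    show ?thesis unfolding n_def by (rule diagram_hom, (rule diagram)+)
  qed
  have "\<exists>t \<in> hom C H. \<forall>X \<in> Obj V. \<langle>X\<rangle> \<odot> t \<cdot> \<delta> X = n X"
  proof (rule coend_exists[OF H_obj n])
    fix g X Y assume g: "g \<in> hom X Y"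
    note o = hom_obj[OF g]
    note [diagram] = o[THEN atomI] g[THEN diagram_gen]
    have gH: "g \<odot> \<langle>H\<rangle> \<in> hom (X \<otimes> H) (Y \<otimes> H)" by (rule diagram_hom, (rule diagram)+)
    have lin: "g \<odot> \<langle>H\<rangle> \<cdot> \<langle>X\<rangle> \<odot> m = \<langle>Y\<rangle> \<odot> m \<cdot> (g \<odot> \<langle>H\<rangle>) \<odot> \<langle>H\<rangle>" by ((rule diagram)+, simp)
    have "g \<odot> \<langle>H\<rangle> \<cdot> n X = (g \<odot> \<langle>H\<rangle> \<cdot> f (X \<otimes> H, \<langle>X\<rangle> \<odot> m)) \<cdot> \<langle>X\<rangle> \<odot> u"
      unfolding n_def by ((rule diagram)+, simp)
    also have "\<dots> = n Y \<cdot> g"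
      unfolding natural_endD(2)[OF f free_module[OF o(1)] free_module[OF o(2)] gH lin] n_def
      by ((rule diagram)+, simp)
    finally show "g \<odot> \<langle>H\<rangle> \<cdot> n X = n Y \<cdot> g" .
  qed
  then obtain t where t: "t \<in> hom C H" and tn: "\<And>X. X \<in> Obj V \<Longrightarrow> \<langle>X\<rangle> \<odot> t \<cdot> \<delta> X = n X" by blast
  have "sharp (\<Sigma> t) (M, r) = f (M, r)" if Mr: "is_module (M, r)" for M r
  proof -
    note M = moduleD[OF Mr]
    note [diagram] =
        M(1)[THEN atomI] M(2)[THEN diagram_gen] natural_endD(1)[OF f Mr, THEN diagram_gen]
    \<comment> \<open>Associativity of the action, read as linearity of \<open>r\<close> from the
      free module on \<open>M\<close> to \<open>M\<close>. Naturality of \<open>f\<close> along it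
      reduces the value at \<open>M\<close> to the value at a free module.\<close>
    have lin: "r \<cdot> \<langle>M\<rangle> \<odot> m = r \<cdot> r \<odot> \<langle>H\<rangle>" using M(3) ..
    have "sharp (\<Sigma> t) (M, r) = (r \<cdot> f (M \<otimes> H, \<langle>M\<rangle> \<odot> m)) \<cdot> \<langle>M\<rangle> \<odot> u"
      unfolding sharp_app[OF Mr] Sigma_app[OF M(1)] tn[OF M(1)] n_def by ((rule diagram)+, simp)
    also have "\<dots> = f (M, r) \<cdot> (r \<cdot> \<langle>M\<rangle> \<odot> u)"
      unfolding natural_endD(2)[OF f free_module[OF M(1)] Mr M(2) lin] by ((rule diagram)+, simp)
    also have "\<dots> = f (M, r)" unfolding M(4) by ((rule diagram)+, simp)
    finally show ?thesis .
  qed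
  then show ?thesis using t by blast
qed

section \<open>Testing the axioms on free modules\<close>

lemma sharp_unit:
  assumes t: "t \<in> hom C H"
  shows "sharp (\<Sigma> t) mod_unit = \<epsilon> \<cdot> t \<cdot> uC"
proof -
  have i: "is_module (\<one>, \<epsilon>)" using unit_module unfolding mod_unit_def .
  note [diagram] = t[THEN diagram_gen]
  show ?thesis
    unfolding mod_unit_def sharp_app[OF i] Sigma_app[OF unit_obj] uC_def by ((rule diagram)+, simp)
qed

text \<open>One statement serves both linearity conditions: \<open>w\<close> is the identity for
  balanced elements, and \<open>S \<cdot> S\<close> together with the double braiding for pivotal
  ones. Arbitrary modules follow by composing with \<open>r\<close> and using associativity;
  conversely the free module is restricted along \<open>u\<close>, where naturality of
  \<open>w\<close> takes effect.\<close>

lemma sharp_action_iff: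
  assumes t: "t \<in> hom C H" and w: "\<And>X. X \<in> Obj V \<Longrightarrow> w X \<in> hom (X \<otimes> H) (X \<otimes> H)"
    and w_nat: "\<And>f X Y. f \<in> hom X Y \<Longrightarrow> f \<odot> \<langle>H\<rangle> \<cdot> w X = w Y \<cdot> f \<odot> \<langle>H\<rangle>"
  shows "(\<forall>X \<in> Obj V. \<langle>X\<rangle> \<odot> m \<cdot> \<Sigma> t (X \<otimes> H) = \<langle>X\<rangle> \<odot> m \<cdot> \<Sigma> t X \<odot> \<langle>H\<rangle> \<cdot> w X) \<longleftrightarrow>
    (\<forall>M r. is_module (M, r) \<longrightarrow>
       sharp (\<Sigma> t) (M, r) \<cdot> r = r \<cdot> sharp (\<Sigma> t) (M, r) \<odot> \<langle>H\<rangle> \<cdot> w M)"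
proof (intro iffI allI impI ballI)
  fix M r
  assume L: "\<forall>X \<in> Obj V. \<langle>X\<rangle> \<odot> m \<cdot> \<Sigma> t (X \<otimes> H) = \<langle>X\<rangle> \<odot> m \<cdot> \<Sigma> t X \<odot> \<langle>H\<rangle> \<cdot> w X"
    and Mr: "is_module (M, r)"
  note M = moduleD[OF Mr]
  note [diagram] =
      M(1)[THEN atomI] M(2)[THEN diagram_gen] w[THEN diagram_gen] Sigma_hom[OF t, THEN diagram_gen]
  have "sharp (\<Sigma> t) (M, r) \<cdot> r = r \<cdot> (\<Sigma> t M \<cdot> r)"
    unfolding sharp_app[OF Mr] by ((rule diagram)+, simp)
  \<comment> \<open>Naturality of \<open>\<Sigma> t\<close> along the action, regarded as a morphism
    from \<open>M \<otimes> H\<close> to \<open>M\<close> in \<open>V\<close>.\<close>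
  also have "\<dots> = r \<cdot> \<langle>M\<rangle> \<odot> m \<cdot> \<Sigma> t (M \<otimes> H)"
  proof -
    have "r \<cdot> r \<odot> \<langle>H\<rangle> \<cdot> \<Sigma> t (M \<otimes> H) = (r \<cdot> r \<odot> \<langle>H\<rangle>) \<cdot> \<Sigma> t (M \<otimes> H)" by ((rule diagram)+, simp)
    also have "\<dots> = r \<cdot> \<langle>M\<rangle> \<odot> m \<cdot> \<Sigma> t (M \<otimes> H)" unfolding M(3) by ((rule diagram)+, simp)
    finally show ?thesis unfolding Sigma_natural[OF t M(2), symmetric] .
  qed
  also have "\<dots> = (r \<cdot> \<langle>M\<rangle> \<odot> m) \<cdot> \<Sigma> t M \<odot> \<langle>H\<rangle> \<cdot> w M"
    unfolding bspec[OF L M(1)] by ((rule diagram)+, simp)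
  also have "\<dots> = r \<cdot> sharp (\<Sigma> t) (M, r) \<odot> \<langle>H\<rangle> \<cdot> w M"
    unfolding M(3)[symmetric] sharp_app[OF Mr] by ((rule diagram)+, simp)
  finally show "sharp (\<Sigma> t) (M, r) \<cdot> r = r \<cdot> sharp (\<Sigma> t) (M, r) \<odot> \<langle>H\<rangle> \<cdot> w M" .
next
  fix X
  assume R: "\<forall>M r. is_module (M, r) \<longrightarrow>
       sharp (\<Sigma> t) (M, r) \<cdot> r = r \<cdot> sharp (\<Sigma> t) (M, r) \<odot> \<langle>H\<rangle> \<cdot> w M" and X: "X \<in> Obj V"
  let ?f = "sharp (\<Sigma> t) (X \<otimes> H, \<langle>X\<rangle> \<odot> m)"
  note f = natural_endD(1)[OF sharp_natural[OF t] free_module[OF X]]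
  note [diagram] =
      X[THEN atomI] w[THEN diagram_gen] Sigma_hom[OF t, THEN diagram_gen] f[THEN diagram_gen]
  have Xu: "\<langle>X\<rangle> \<odot> u \<in> hom X (X \<otimes> H)" by (rule diagram_hom, (rule diagram)+)
  have "\<langle>X\<rangle> \<odot> m \<cdot> \<Sigma> t (X \<otimes> H) = ?f \<cdot> \<langle>X\<rangle> \<odot> (m \<cdot> u \<odot> \<langle>H\<rangle>)"
    unfolding m_unit sharp_app[OF free_module[OF X]] by ((rule diagram)+, simp)
  also have "\<dots> = (?f \<cdot> \<langle>X\<rangle> \<odot> m) \<cdot> \<langle>X\<rangle> \<odot> u \<odot> \<langle>H\<rangle>" by ((rule diagram)+, simp)
  also have "\<dots> = \<langle>X\<rangle> \<odot> m \<cdot> ?f \<odot> \<langle>H\<rangle> \<cdot> (w (X \<otimes> H) \<cdot> (\<langle>X\<rangle> \<odot> u) \<odot> \<langle>H\<rangle>)"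
    unfolding R[rule_format, OF free_module[OF X]] by ((rule diagram)+, simp)
  also have "\<dots> = \<langle>X\<rangle> \<odot> m \<cdot> (?f \<cdot> \<langle>X\<rangle> \<odot> u) \<odot> \<langle>H\<rangle> \<cdot> w X"
    unfolding w_nat[OF Xu, symmetric] by ((rule diagram)+, simp)
  also have "\<dots> = \<langle>X\<rangle> \<odot> m \<cdot> \<Sigma> t X \<odot> \<langle>H\<rangle> \<cdot> w X"
    unfolding sharp_free_unit[OF t X] ..
  finally show "\<langle>X\<rangle> \<odot> m \<cdot> \<Sigma> t (X \<otimes> H) = \<langle>X\<rangle> \<odot> m \<cdot> \<Sigma> t X \<odot> \<langle>H\<rangle> \<cdot> w X" .
qed

text \<open>The two-variable analogue, with \<open>n\<close> covering the monoidality conditions of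
  pivotal and of balanced structures. Acting by \<open>r\<close> and \<open>s\<close> passes from
  families to modules; restricting two free modules along their units, with the unit pulled across
  the crossing in the tensor action, passes back.\<close>

lemma sharp_ten_iff:
  assumes t: "t \<in> hom C H"
    and n: "\<And>X Y. X \<in> Obj V \<Longrightarrow> Y \<in> Obj V \<Longrightarrow> n X Y \<in> hom (X \<otimes> Y) (X \<otimes> H \<otimes> Y \<otimes> H)"
    and n_nat: "\<And>f X X' g Y Y'. f \<in> hom X X' \<Longrightarrow> g \<in> hom Y Y' \<Longrightarrow>
       f \<odot> \<langle>H\<rangle> \<odot> g \<odot> \<langle>H\<rangle> \<cdot> n X Y = n X' Y' \<cdot> f \<odot> g"
  shows "(\<forall>X \<in> Obj V. \<forall>Y \<in> Obj V. \<langle>X\<rangle> \<odot> \<sigma> Y H \<odot> \<langle>H\<rangle> \<cdot> \<langle>X\<rangle> \<odot> \<langle>Y\<rangle> \<odot> \<Delta> \<cdot> \<Sigma> t (X \<otimes> Y) = n X Y) \<longleftrightarrow>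
    (\<forall>M r N s. is_module (M, r) \<longrightarrow> is_module (N, s) \<longrightarrow>
       sharp (\<Sigma> t) (mod_ten (M, r) (N, s)) = r \<odot> s \<cdot> n M N)"
proof (intro iffI allI impI ballI)
  fix M r N s
  assume L: "\<forall>X \<in> Obj V. \<forall>Y \<in> Obj V. \<langle>X\<rangle> \<odot> \<sigma> Y H \<odot> \<langle>H\<rangle> \<cdot> \<langle>X\<rangle> \<odot> \<langle>Y\<rangle> \<odot> \<Delta> \<cdot> \<Sigma> t (X \<otimes> Y) = n X Y"
    and Mr: "is_module (M, r)" and Ns: "is_module (N, s)"
  note M = moduleD[OF Mr] and N = moduleD[OF Ns]
  note [diagram] = M(1)[THEN atomI] M(2)[THEN diagram_gen] N(1)[THEN atomI] N(2)[THEN diagram_gen]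
    Sigma_hom[OF t, THEN diagram_gen]
  have "sharp (\<Sigma> t) (mod_ten (M, r) (N, s)) =
      r \<odot> s \<cdot> \<langle>M\<rangle> \<odot> \<sigma> N H \<odot> \<langle>H\<rangle> \<cdot> \<langle>M\<rangle> \<odot> \<langle>N\<rangle> \<odot> \<Delta> \<cdot> \<Sigma> t (M \<otimes> N)"
    unfolding mod_ten_eq sharp_app[OF ten_module[OF Mr Ns, unfolded mod_ten_eq]]
    unfolding ten_act_def by ((rule diagram)+, simp)
  then show "sharp (\<Sigma> t) (mod_ten (M, r) (N, s)) = r \<odot> s \<cdot> n M N"
    unfolding L[rule_format, OF M(1) N(1)] .
next
  fix X Y
  assume R: "\<forall>M r N s. is_module (M, r) \<longrightarrow> is_module (N, s) \<longrightarrow>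
       sharp (\<Sigma> t) (mod_ten (M, r) (N, s)) = r \<odot> s \<cdot> n M N"
    and X: "X \<in> Obj V" and Y: "Y \<in> Obj V"
  note FX = free_module[OF X] and FY = free_module[OF Y]
  note [diagram] = X[THEN atomI] Y[THEN atomI] n[THEN diagram_gen] Sigma_hom[OF t, THEN diagram_gen]
  have Xu: "\<langle>X\<rangle> \<odot> u \<in> hom X (X \<otimes> H)" and Yu: "\<langle>Y\<rangle> \<odot> u \<in> hom Y (Y \<otimes> H)"
    by (rule diagram_hom, (rule diagram)+)+
  have "sharp (\<Sigma> t) (mod_ten (X \<otimes> H, \<langle>X\<rangle> \<odot> m) (Y \<otimes> H, \<langle>Y\<rangle> \<odot> m)) \<cdot> \<langle>X\<rangle> \<odot> u \<odot> \<langle>Y\<rangle> \<odot> u =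
      \<langle>X\<rangle> \<odot> m \<odot> \<langle>Y\<rangle> \<odot> m \<cdot> \<langle>X \<otimes> H\<rangle> \<odot> \<sigma> (Y \<otimes> H) H \<odot> \<langle>H\<rangle> \<cdot> \<langle>X \<otimes> H \<otimes> Y \<otimes> H\<rangle> \<odot> \<Delta> \<cdot>
          (\<Sigma> t ((X \<otimes> H) \<otimes> (Y \<otimes> H)) \<cdot> (\<langle>X\<rangle> \<odot> u) \<odot> (\<langle>Y\<rangle> \<odot> u))"
    unfolding mod_ten_eq sharp_app[OF ten_module[OF FX FY, unfolded mod_ten_eq]]
    unfolding ten_act_def by ((rule diagram)+, simp)
  also have "\<dots> = \<langle>X\<rangle> \<odot> m \<odot> \<langle>Y\<rangle> \<odot> m \<cdot> \<langle>X\<rangle> \<odot> u \<odot> (\<sigma> (Y \<otimes> H) H \<cdot> (\<langle>Y\<rangle> \<odot> u) \<odot> \<langle>H\<rangle>) \<odot> \<langle>H\<rangle> \<cdot>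
      \<langle>X \<otimes> Y\<rangle> \<odot> \<Delta> \<cdot> \<Sigma> t (X \<otimes> Y)"
    unfolding Sigma_natural[OF t ten_hom[OF Xu Yu], symmetric] by ((rule diagram)+, simp)
  also have "\<dots> = \<langle>X\<rangle> \<odot> (m \<cdot> u \<odot> \<langle>H\<rangle>) \<odot> \<langle>Y\<rangle> \<odot> (m \<cdot> u \<odot> \<langle>H\<rangle>) \<cdot> \<langle>X\<rangle> \<odot> \<sigma> Y H \<odot> \<langle>H\<rangle> \<cdot> \<langle>X \<otimes> Y\<rangle> \<odot> \<Delta> \<cdot>
      \<Sigma> t (X \<otimes> Y)"
    unfolding sigma_natural_left[OF Yu H_obj, symmetric] by ((rule diagram)+, simp)
  also have "\<dots> = \<langle>X\<rangle> \<odot> \<sigma> Y H \<odot> \<langle>H\<rangle> \<cdot> \<langle>X\<rangle> \<odot> \<langle>Y\<rangle> \<odot> \<Delta> \<cdot> \<Sigma> t (X \<otimes> Y)"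
    unfolding m_unit by ((rule diagram)+, simp)
  finally have "\<langle>X\<rangle> \<odot> \<sigma> Y H \<odot> \<langle>H\<rangle> \<cdot> \<langle>X\<rangle> \<odot> \<langle>Y\<rangle> \<odot> \<Delta> \<cdot> \<Sigma> t (X \<otimes> Y) =
      ((\<langle>X\<rangle> \<odot> m) \<odot> (\<langle>Y\<rangle> \<odot> m) \<cdot> n (X \<otimes> H) (Y \<otimes> H)) \<cdot> \<langle>X\<rangle> \<odot> u \<odot> \<langle>Y\<rangle> \<odot> u"
    unfolding R[rule_format, OF FX FY] ..
  also have "\<dots> = \<langle>X\<rangle> \<odot> m \<odot> \<langle>Y\<rangle> \<odot> m \<cdot> (n (X \<otimes> H) (Y \<otimes> H) \<cdot> (\<langle>X\<rangle> \<odot> u) \<odot> (\<langle>Y\<rangle> \<odot> u))"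
    by ((rule diagram)+, simp)
  also have "\<dots> = \<langle>X\<rangle> \<odot> (m \<cdot> u \<odot> \<langle>H\<rangle>) \<odot> \<langle>Y\<rangle> \<odot> (m \<cdot> u \<odot> \<langle>H\<rangle>) \<cdot> n X Y"
    unfolding n_nat[OF Xu Yu, symmetric] by ((rule diagram)+, simp)
  also have "\<dots> = n X Y" unfolding m_unit by ((rule diagram)+, simp)
  finally show "\<langle>X\<rangle> \<odot> \<sigma> Y H \<odot> \<langle>H\<rangle> \<cdot> \<langle>X\<rangle> \<odot> \<langle>Y\<rangle> \<odot> \<Delta> \<cdot> \<Sigma> t (X \<otimes> Y) = n X Y" .
qed

section \<open>Axioms on elements as axioms on endomorphisms\<close>

lemma ten_delta_iff:
  assumes Y: "Y \<in> Obj V" and g: "g \<in> hom (C \<otimes> Y) E" and g': "g' \<in> hom (C \<otimes> Y) E"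
  shows "g = g' \<longleftrightarrow> (\<forall>X \<in> Obj V. \<langle>X\<rangle> \<odot> g \<cdot> \<delta> X \<odot> \<langle>Y\<rangle> = \<langle>X\<rangle> \<odot> g' \<cdot> \<delta> X \<odot> \<langle>Y\<rangle>)"
  using coend_ten_eqI[OF Y g g'] by auto

lemma delta2_iff:
  assumes g: "g \<in> hom (C \<otimes> C) D" and g': "g' \<in> hom (C \<otimes> C) D"
  shows "g = g' \<longleftrightarrow> (\<forall>X \<in> Obj V. \<forall>Y \<in> Obj V. \<langle>X \<otimes> Y\<rangle> \<odot> g \<cdot> \<delta>2 X Y = \<langle>X \<otimes> Y\<rangle> \<odot> g' \<cdot> \<delta>2 X Y)"
  using coend2_eqI[OF g g'] by auto

text \<open>\<open>mC\<close> represents the coaction of a tensor product. The left-hand side shared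
  by centrality and the pivotal condition therefore represents the action of \<open>t\<close> on the
  free module \<open>X \<otimes> H\<close>.\<close>

lemma mC_transpose:
  assumes t: "t \<in> hom C H" and X: "X \<in> Obj V"
  shows "\<langle>X\<rangle> \<odot> (m \<cdot> \<langle>H\<rangle> \<odot> (t \<cdot> mC) \<cdot> \<sigma> C H \<odot> \<langle>C\<rangle> \<cdot> \<langle>C\<rangle> \<odot> \<delta> H) \<cdot> \<delta> X \<odot> \<langle>H\<rangle> = \<langle>X\<rangle> \<odot> m \<cdot> \<Sigma> t (X \<otimes> H)"
proof -
  note [diagram] = t[THEN diagram_gen] X[THEN atomI]
  have "\<langle>X\<rangle> \<odot> (m \<cdot> \<langle>H\<rangle> \<odot> (t \<cdot> mC) \<cdot> \<sigma> C H \<odot> \<langle>C\<rangle> \<cdot> \<langle>C\<rangle> \<odot> \<delta> H) \<cdot> \<delta> X \<odot> \<langle>H\<rangle> =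
     \<langle>X\<rangle> \<odot> m \<cdot> \<langle>X \<otimes> H\<rangle> \<odot> t \<cdot> (\<langle>X \<otimes> H\<rangle> \<odot> mC \<cdot> \<delta>2 X H)"
    unfolding \<delta>2_def by ((rule diagram)+, simp)
  then show ?thesis
    unfolding mC_delta2[OF X H_obj] Sigma_app[OF ten_obj[OF X H_obj]] .
qed

lemma central_iff:
  assumes t: "t \<in> hom C H"
  shows "m \<cdot> \<langle>H\<rangle> \<odot> (t \<cdot> mC) \<cdot> \<sigma> C H \<odot> \<langle>C\<rangle> \<cdot> \<langle>C\<rangle> \<odot> \<delta> H = m \<cdot> t \<odot> \<langle>H\<rangle> \<longleftrightarrow>
    (\<forall>M r. is_module (M, r) \<longrightarrow> sharp (\<Sigma> t) (M, r) \<cdot> r = r \<cdot> sharp (\<Sigma> t) (M, r) \<odot> \<langle>H\<rangle>)"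
proof -
  note [diagram] = t[THEN diagram_gen] Sigma_hom[OF t, THEN diagram_gen]
  have 1: "\<langle>X\<rangle> \<odot> (m \<cdot> t \<odot> \<langle>H\<rangle>) \<cdot> \<delta> X \<odot> \<langle>H\<rangle> = \<langle>X\<rangle> \<odot> m \<cdot> \<Sigma> t X \<odot> \<langle>H\<rangle> \<cdot> \<langle>X \<otimes> H\<rangle>"
    if X: "X \<in> Obj V" for X
  proof -
    note [diagram] = X[THEN atomI]
    show ?thesis unfolding Sigma_app[OF X] by ((rule diagram)+, simp)
  qed
  have a: "m \<cdot> \<langle>H\<rangle> \<odot> (t \<cdot> mC) \<cdot> \<sigma> C H \<odot> \<langle>C\<rangle> \<cdot> \<langle>C\<rangle> \<odot> \<delta> H \<in> hom (C \<otimes> H) H"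
    "m \<cdot> t \<odot> \<langle>H\<rangle> \<in> hom (C \<otimes> H) H"
    by (rule diagram_hom, (rule diagram)+)+
  have i: "\<langle>X \<otimes> H\<rangle> \<in> hom (X \<otimes> H) (X \<otimes> H)" if "X \<in> Obj V" for X
    using ident_hom ten_obj[OF that H_obj] .
  have nat: "f \<odot> \<langle>H\<rangle> \<cdot> \<langle>X \<otimes> H\<rangle> = \<langle>Y \<otimes> H\<rangle> \<cdot> f \<odot> \<langle>H\<rangle>" if f: "f \<in> hom X Y" for f X Y
    using ident_left ident_right ten_hom[OF f ident_hom[OF H_obj]] by simp
  have 2: "sharp (\<Sigma> t) (M, r) \<odot> \<langle>H\<rangle> \<cdot> \<langle>M \<otimes> H\<rangle> = sharp (\<Sigma> t) (M, r) \<odot> \<langle>H\<rangle>"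
    if Mr: "is_module (M, r)" for M r
    using ident_right[OF
        ten_hom[OF natural_endD(1)[OF sharp_natural[OF t] Mr] ident_hom[OF H_obj]]] .
  show ?thesis
    unfolding ten_delta_iff[OF H_obj a]
    using sharp_action_iff[OF t i nat] by (simp add: mC_transpose[OF t] 1 2)
qed

text \<open>On the right-hand side \<open>\<Delta>C\<close> splits off a copy of \<open>C\<close>
  that meets the coaction of \<open>H\<close> in \<open>\<omega>\<close>. On
  \<open>\<delta>2 X H\<close> this pairing is the double braiding found in
  \<open>mu_action\<close>.\<close>

lemma twisted_linear_iff:
  assumes t: "t \<in> hom C H"
  shows "m \<cdot> \<langle>H\<rangle> \<odot> (t \<cdot> mC) \<cdot> \<sigma> C H \<odot> \<langle>C\<rangle> \<cdot> \<langle>C\<rangle> \<odot> \<delta> H =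
      m \<cdot> t \<odot> \<langle>H\<rangle> \<odot> \<omega> \<cdot> \<langle>C\<rangle> \<odot> \<sigma> C H \<odot> \<langle>C\<rangle> \<cdot> \<Delta>C \<odot> (\<delta> H \<cdot> S \<cdot> S) \<longleftrightarrow>
    (\<forall>M r. is_module (M, r) \<longrightarrow> sharp (\<Sigma> t) (M, r) \<cdot> r =
       r \<cdot> sharp (\<Sigma> t) (M, r) \<odot> \<langle>H\<rangle> \<cdot> \<langle>M\<rangle> \<odot> (S \<cdot> S) \<cdot> \<sigma> H M \<cdot> \<sigma> M H)"
proof -
  note [diagram] = t[THEN diagram_gen] Sigma_hom[OF t, THEN diagram_gen]
  have SS: "S \<cdot> S \<in> hom H H" by (rule diagram_hom, (rule diagram)+)
  \<comment> \<open>Naturality of the double braiding in both variables: in \<open>H\<close> it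
    moves \<open>S \<cdot> S\<close> to the other side, in \<open>X\<close> it gives the naturality
    that \<open>sharp_action_iff\<close> asks for.\<close>
  have w_nat: "g \<odot> f \<cdot> \<sigma> Y X \<cdot> \<sigma> X Y = (\<sigma> Y' X' \<cdot> \<sigma> X' Y') \<cdot> g \<odot> f"
    if f: "f \<in> hom Y Y'" and g: "g \<in> hom X X'" for f Y Y' g X X'
  proof -
    note [diagram] =
        f[THEN diagram_gen] g[THEN diagram_gen] hom_obj[OF f, THEN atomI] hom_obj[OF g, THEN atomI]
    have "g \<odot> f \<cdot> \<sigma> Y X \<cdot> \<sigma> X Y = (g \<odot> f \<cdot> \<sigma> Y X) \<cdot> \<sigma> X Y" by ((rule diagram)+, simp)
    also have "\<dots> = \<sigma> Y' X' \<cdot> (f \<odot> g \<cdot> \<sigma> X Y)"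
      unfolding sigma_natural[OF f g] by ((rule diagram)+, simp)
    also have "\<dots> = (\<sigma> Y' X' \<cdot> \<sigma> X' Y') \<cdot> g \<odot> f"
      unfolding sigma_natural[OF g f] by ((rule diagram)+, simp)
    finally show ?thesis .
  qed
  have 1: "\<langle>X\<rangle> \<odot> (m \<cdot> t \<odot> \<langle>H\<rangle> \<odot> \<omega> \<cdot> \<langle>C\<rangle> \<odot> \<sigma> C H \<odot> \<langle>C\<rangle> \<cdot> \<Delta>C \<odot> (\<delta> H \<cdot> S \<cdot> S)) \<cdot> \<delta> X \<odot> \<langle>H\<rangle> =
      \<langle>X\<rangle> \<odot> m \<cdot> \<Sigma> t X \<odot> \<langle>H\<rangle> \<cdot> \<langle>X\<rangle> \<odot> (S \<cdot> S) \<cdot> \<sigma> H X \<cdot> \<sigma> X H" if X: "X \<in> Obj V" for X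
  proof -
    note [diagram] = X[THEN atomI]
    have "\<langle>X\<rangle> \<odot> (m \<cdot> t \<odot> \<langle>H\<rangle> \<odot> \<omega> \<cdot> \<langle>C\<rangle> \<odot> \<sigma> C H \<odot> \<langle>C\<rangle> \<cdot> \<Delta>C \<odot> (\<delta> H \<cdot> S \<cdot> S)) \<cdot> \<delta> X \<odot> \<langle>H\<rangle> =
       \<langle>X\<rangle> \<odot> (m \<cdot> t \<odot> \<langle>H\<rangle> \<odot> \<omega> \<cdot> \<langle>C\<rangle> \<odot> \<sigma> C H \<odot> \<langle>C\<rangle>) \<cdot> (\<langle>X\<rangle> \<odot> \<Delta>C \<cdot> \<delta> X) \<odot> (\<delta> H \<cdot> S \<cdot> S)"
         by ((rule diagram)+, simp)
    also have "\<dots> = \<langle>X\<rangle> \<odot> m \<cdot> (\<langle>X\<rangle> \<odot> t \<cdot> \<delta> X) \<odot> \<langle>H\<rangle> \<cdot> (\<langle>X \<otimes> H\<rangle> \<odot> \<omega> \<cdot> \<delta>2 X H) \<cdot> \<langle>X\<rangle> \<odot> (S \<cdot> S)"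
      unfolding DeltaC_delta[OF X] \<delta>2_def by ((rule diagram)+, simp)
    also have "\<dots> = \<langle>X\<rangle> \<odot> m \<cdot> \<Sigma> t X \<odot> \<langle>H\<rangle> \<cdot> ((\<sigma> H X \<cdot> \<sigma> X H) \<cdot> \<langle>X\<rangle> \<odot> (S \<cdot> S))"
      unfolding omega_delta2[OF X H_obj] Sigma_app[OF X] by ((rule diagram)+, simp)
    finally show ?thesis
      unfolding w_nat[OF SS ident_hom[OF X], symmetric] .
  qed
  have a: "m \<cdot> \<langle>H\<rangle> \<odot> (t \<cdot> mC) \<cdot> \<sigma> C H \<odot> \<langle>C\<rangle> \<cdot> \<langle>C\<rangle> \<odot> \<delta> H \<in> hom (C \<otimes> H) H"
    "m \<cdot> t \<odot> \<langle>H\<rangle> \<odot> \<omega> \<cdot> \<langle>C\<rangle> \<odot> \<sigma> C H \<odot> \<langle>C\<rangle> \<cdot> \<Delta>C \<odot> (\<delta> H \<cdot> S \<cdot> S) \<in> hom (C \<otimes> H) H"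
      by (rule diagram_hom, (rule diagram)+)+
  have i: "\<langle>X\<rangle> \<odot> (S \<cdot> S) \<cdot> \<sigma> H X \<cdot> \<sigma> X H \<in> hom (X \<otimes> H) (X \<otimes> H)" if X: "X \<in> Obj V" for X
  proof -
    note [diagram] = X[THEN atomI]
    show ?thesis by (rule diagram_hom, (rule diagram)+)
  qed
  have nat: "f \<odot> \<langle>H\<rangle> \<cdot> \<langle>X\<rangle> \<odot> (S \<cdot> S) \<cdot> \<sigma> H X \<cdot> \<sigma> X H = (\<langle>Y\<rangle> \<odot> (S \<cdot> S) \<cdot> \<sigma> H Y \<cdot> \<sigma> Y H) \<cdot> f \<odot> \<langle>H\<rangle>"
    if f: "f \<in> hom X Y" for f X Y
  proof -
    note [diagram] = f[THEN diagram_gen] hom_obj[OF f, THEN atomI]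
    have "f \<odot> \<langle>H\<rangle> \<cdot> \<langle>X\<rangle> \<odot> (S \<cdot> S) \<cdot> \<sigma> H X \<cdot> \<sigma> X H = \<langle>Y\<rangle> \<odot> (S \<cdot> S) \<cdot> (f \<odot> \<langle>H\<rangle> \<cdot> \<sigma> H X \<cdot> \<sigma> X H)"
      by ((rule diagram)+, simp)
    also have "\<dots> = (\<langle>Y\<rangle> \<odot> (S \<cdot> S) \<cdot> \<sigma> H Y \<cdot> \<sigma> Y H) \<cdot> f \<odot> \<langle>H\<rangle>"
      unfolding w_nat[OF ident_hom[OF H_obj] f] by ((rule diagram)+, simp)
    finally show ?thesis .
  qed
  show ?thesis
    unfolding ten_delta_iff[OF H_obj a]
    using sharp_action_iff[OF t i nat] by (simp add: mC_transpose[OF t] 1)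
qed

text \<open>The outer \<open>\<omega>\<close> becomes the double braiding of \<open>X\<close> and
  \<open>Y\<close>, and the inner \<open>\<omega>_inv\<close> makes the remaining crossing a reverse
  one. That crossing is the inverse of \<open>\<sigma> Y H\<close> in the action on a tensor
  product.\<close>

lemma grouplike_iff:
  assumes p: "p \<in> hom C H"
  shows "\<Delta> \<cdot> p \<cdot> mC = ((p \<odot> p \<cdot> \<langle>C\<rangle> \<odot> \<omega>_inv \<odot> \<langle>C\<rangle> \<cdot> \<delta> C \<odot> \<Delta>C) \<odot> \<omega>) \<cdot> \<langle>C\<rangle> \<odot> \<sigma> C C \<odot> \<langle>C\<rangle> \<cdot> \<Delta>C \<odot> \<Delta>C \<longleftrightarrow>
    (\<forall>M r N s. is_module (M, r) \<longrightarrow> is_module (N, s) \<longrightarrow> sharp (\<Sigma> p) (mod_ten (M, r) (N, s)) =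
       sharp (\<Sigma> p) (M, r) \<odot> sharp (\<Sigma> p) (N, s) \<cdot> \<sigma> N M \<cdot> \<sigma> M N)"
proof -
  note [diagram] = p[THEN diagram_gen] Sigma_hom[OF p, THEN diagram_gen]
  define n where "n X Y = \<Sigma> p X \<odot> \<Sigma> p Y \<cdot> \<sigma> Y X \<cdot> \<sigma> X Y" for X Y
  have n: "n X Y \<in> hom (X \<otimes> Y) (X \<otimes> H \<otimes> Y \<otimes> H)" if "X \<in> Obj V" "Y \<in> Obj V" for X Y
  proof -
    note [diagram] = that[THEN atomI]
    show ?thesis unfolding n_def by (rule diagram_hom, (rule diagram)+)
  qed
  have n_nat: "f \<odot> \<langle>H\<rangle> \<odot> g \<odot> \<langle>H\<rangle> \<cdot> n X Y = n X' Y' \<cdot> f \<odot> g" if f: "f \<in> hom X X'"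
    and g: "g \<in> hom Y Y'" for f g X X' Y Y'
  proof -
    note [diagram] =
        f[THEN diagram_gen] g[THEN diagram_gen] hom_obj[OF f, THEN atomI] hom_obj[OF g, THEN atomI]
    have "f \<odot> \<langle>H\<rangle> \<odot> g \<odot> \<langle>H\<rangle> \<cdot> n X Y = (f \<odot> \<langle>H\<rangle> \<cdot> \<Sigma> p X) \<odot> (g \<odot> \<langle>H\<rangle> \<cdot> \<Sigma> p Y) \<cdot> \<sigma> Y X \<cdot> \<sigma> X Y"
      unfolding n_def by ((rule diagram)+, simp)
    also have "\<dots> = \<Sigma> p X' \<odot> \<Sigma> p Y' \<cdot> (f \<odot> g \<cdot> \<sigma> Y X) \<cdot> \<sigma> X Y"
      unfolding Sigma_natural[OF p f] Sigma_natural[OF p g] by ((rule diagram)+, simp)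
    also have "\<dots> = \<Sigma> p X' \<odot> \<Sigma> p Y' \<cdot> \<sigma> Y' X' \<cdot> (g \<odot> f \<cdot> \<sigma> X Y)"
      unfolding sigma_natural[OF g f] by ((rule diagram)+, simp)
    also have "\<dots> = n X' Y' \<cdot> f \<odot> g"
      unfolding sigma_natural[OF f g] n_def by ((rule diagram)+, simp)
    finally show ?thesis .
  qed
  have iff: "\<langle>X \<otimes> Y\<rangle> \<odot> (\<Delta> \<cdot> p \<cdot> mC) \<cdot> \<delta>2 X Y =
      \<langle>X \<otimes> Y\<rangle> \<odot> (((p \<odot> p \<cdot> \<langle>C\<rangle> \<odot> \<omega>_inv \<odot> \<langle>C\<rangle> \<cdot> \<delta> C \<odot> \<Delta>C) \<odot> \<omega>) \<cdot> \<langle>C\<rangle> \<odot> \<sigma> C C \<odot> \<langle>C\<rangle> \<cdot> \<Delta>C \<odot> \<Delta>C) \<cdot>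
          \<delta>2 X Y
     \<longleftrightarrow> \<langle>X\<rangle> \<odot> \<sigma> Y H \<odot> \<langle>H\<rangle> \<cdot> \<langle>X\<rangle> \<odot> \<langle>Y\<rangle> \<odot> \<Delta> \<cdot> \<Sigma> p (X \<otimes> Y) = n X Y" (is "?a = ?b \<longleftrightarrow> ?c = n X Y")
    if X: "X \<in> Obj V" and Y: "Y \<in> Obj V" for X Y
  proof -
    note [diagram] = X[THEN atomI] Y[THEN atomI] n[THEN diagram_gen]
    have g: "p \<odot> p \<cdot> \<langle>C\<rangle> \<odot> \<omega>_inv \<odot> \<langle>C\<rangle> \<cdot> \<delta> C \<odot> \<Delta>C \<in> hom (C \<otimes> C) (H \<otimes> H)"
      by (rule diagram_hom, (rule diagram)+)
    have "?a = \<langle>X\<rangle> \<odot> \<langle>Y\<rangle> \<odot> (\<Delta> \<cdot> p) \<cdot> (\<langle>X \<otimes> Y\<rangle> \<odot> mC \<cdot> \<delta>2 X Y)" by ((rule diagram)+, simp)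
    also have "\<dots> = \<langle>X\<rangle> \<odot> \<langle>Y\<rangle> \<odot> \<Delta> \<cdot> \<Sigma> p (X \<otimes> Y)"
      unfolding mC_delta2[OF X Y] Sigma_app[OF ten_obj[OF X Y]] by ((rule diagram)+, simp)
    finally have a: "?a = \<langle>X\<rangle> \<odot> \<langle>Y\<rangle> \<odot> \<Delta> \<cdot> \<Sigma> p (X \<otimes> Y)" .
    have "?b = (\<langle>X \<otimes> Y\<rangle> \<odot> (p \<odot> p) \<cdot> (\<langle>X \<otimes> Y\<rangle> \<odot> (\<langle>C\<rangle> \<odot> \<omega>_inv \<odot> \<langle>C\<rangle> \<cdot> \<delta> C \<odot> \<Delta>C) \<cdot> \<delta>2 X Y)) \<cdot> \<sigma> Y X \<cdot>
        \<sigma> X Y"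
      unfolding omega_convolution[OF X Y g] by ((rule diagram)+, simp)
    also have "\<dots> = \<langle>X\<rangle> \<odot> (\<langle>Y\<rangle> \<odot> p \<cdot> \<tau> C Y) \<odot> p \<cdot> \<delta> X \<odot> \<delta> Y \<cdot> \<sigma> Y X \<cdot> \<sigma> X Y"
      unfolding omega_inv_tau[OF X Y] by ((rule diagram)+, simp)
    also have "\<dots> = \<langle>X\<rangle> \<odot> \<tau> H Y \<odot> \<langle>H\<rangle> \<cdot> n X Y"
      unfolding tau_natural_left[OF p Y] n_def Sigma_app[OF X] Sigma_app[OF Y]
      by ((rule diagram)+, simp)
    finally have b: "?b = \<langle>X\<rangle> \<odot> \<tau> H Y \<odot> \<langle>H\<rangle> \<cdot> n X Y" .
    have "\<langle>X\<rangle> \<odot> \<sigma> Y H \<odot> \<langle>H\<rangle> \<cdot> \<langle>X\<rangle> \<odot> \<tau> H Y \<odot> \<langle>H\<rangle> \<cdot> n X Y = \<langle>X\<rangle> \<odot> (\<sigma> Y H \<cdot> \<tau> H Y) \<odot> \<langle>H\<rangle> \<cdot> n X Y"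
      by ((rule diagram)+, simp)
    also have "\<dots> = n X Y" unfolding sigma_tau[OF Y H_obj] by ((rule diagram)+, simp)
    finally have 1: "\<langle>X\<rangle> \<odot> \<sigma> Y H \<odot> \<langle>H\<rangle> \<cdot> \<langle>X\<rangle> \<odot> \<tau> H Y \<odot> \<langle>H\<rangle> \<cdot> n X Y = n X Y" .
    have "\<langle>X\<rangle> \<odot> \<tau> H Y \<odot> \<langle>H\<rangle> \<cdot> ?c = \<langle>X\<rangle> \<odot> (\<tau> H Y \<cdot> \<sigma> Y H) \<odot> \<langle>H\<rangle> \<cdot> \<langle>X\<rangle> \<odot> \<langle>Y\<rangle> \<odot> \<Delta> \<cdot> \<Sigma> p (X \<otimes> Y)"
      by ((rule diagram)+, simp)
    also have "\<dots> = \<langle>X\<rangle> \<odot> \<langle>Y\<rangle> \<odot> \<Delta> \<cdot> \<Sigma> p (X \<otimes> Y)"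
      unfolding tau_sigma[OF Y H_obj] by ((rule diagram)+, simp)
    finally have 2: "\<langle>X\<rangle> \<odot> \<tau> H Y \<odot> \<langle>H\<rangle> \<cdot> ?c = \<langle>X\<rangle> \<odot> \<langle>Y\<rangle> \<odot> \<Delta> \<cdot> \<Sigma> p (X \<otimes> Y)" .
    \<comment> \<open>The two equations differ by composition with the mutually inverse crossings
      \<open>\<sigma> Y H\<close> and \<open>\<tau> H Y\<close>.\<close>
    show ?thesis unfolding a b using 1 2 by metis
  qed
  have h: "\<Delta> \<cdot> p \<cdot> mC \<in> hom (C \<otimes> C) (H \<otimes> H)"
    "((p \<odot> p \<cdot> \<langle>C\<rangle> \<odot> \<omega>_inv \<odot> \<langle>C\<rangle> \<cdot> \<delta> C \<odot> \<Delta>C) \<odot> \<omega>) \<cdot> \<langle>C\<rangle> \<odot> \<sigma> C C \<odot> \<langle>C\<rangle> \<cdot> \<Delta>C \<odot> \<Delta>C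
        \<in> hom (C \<otimes> C) (H \<otimes> H)"
      by (rule diagram_hom, (rule diagram)+)+
  have act: "r \<odot> s \<cdot> n M N = sharp (\<Sigma> p) (M, r) \<odot> sharp (\<Sigma> p) (N, s) \<cdot> \<sigma> N M \<cdot> \<sigma> M N"
    if Mr: "is_module (M, r)" and Ns: "is_module (N, s)" for M r N s
  proof -
    note [diagram] = moduleD(1)[OF Mr, THEN atomI] moduleD(2)[OF Mr, THEN diagram_gen]
      moduleD(1)[OF Ns, THEN atomI] moduleD(2)[OF Ns, THEN diagram_gen]
    show ?thesis unfolding n_def sharp_app[OF Mr] sharp_app[OF Ns] by ((rule diagram)+, simp)
  qed
  show ?thesis
    unfolding delta2_iff[OF h] using sharp_ten_iff[OF p n n_nat] act by (simp add: iff)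
qed

lemma Rfam_hom:
  assumes R: "\<RR> \<in> hom (C \<otimes> C) (H \<otimes> H)" and X: "X \<in> Obj V" and Y: "Y \<in> Obj V"
  shows "Rfam \<RR> X Y \<in> hom (X \<otimes> Y) (Y \<otimes> H \<otimes> X \<otimes> H)"
proof -
  note [diagram] = R[THEN diagram_gen] X[THEN atomI] Y[THEN atomI]
  show ?thesis unfolding Rfam_def by (rule diagram_hom, (rule diagram)+)
qed

lemma Rfam_natural:
  assumes R: "\<RR> \<in> hom (C \<otimes> C) (H \<otimes> H)" and f: "f \<in> hom X X'" and g: "g \<in> hom Y Y'"
  shows "g \<odot> \<langle>H\<rangle> \<odot> f \<odot> \<langle>H\<rangle> \<cdot> Rfam \<RR> X Y = Rfam \<RR> X' Y' \<cdot> f \<odot> g"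
proof -
  note [diagram] = R[THEN diagram_gen] f[THEN diagram_gen] g[THEN diagram_gen]
    hom_obj[OF f, THEN atomI] hom_obj[OF g, THEN atomI]
  have gH: "g \<odot> \<langle>H\<rangle> \<in> hom (Y \<otimes> H) (Y' \<otimes> H)" by (rule diagram_hom, (rule diagram)+)
  have "g \<odot> \<langle>H\<rangle> \<odot> f \<odot> \<langle>H\<rangle> \<cdot> Rfam \<RR> X Y = ((g \<odot> \<langle>H\<rangle>) \<odot> f \<cdot> \<sigma> X (Y \<otimes> H)) \<odot> \<langle>H\<rangle> \<cdot> \<langle>X \<otimes> Y\<rangle> \<odot> \<RR> \<cdot> \<delta>2 X Y"
    unfolding Rfam_def by ((rule diagram)+, simp)
  also have "\<dots> = \<sigma> X' (Y' \<otimes> H) \<odot> \<langle>H\<rangle> \<cdot> \<langle>X' \<otimes> Y'\<rangle> \<odot> \<RR> \<cdot> (f \<odot> g \<odot> \<langle>C\<rangle> \<odot> \<langle>C\<rangle> \<cdot> \<delta>2 X Y)"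
    unfolding sigma_natural[OF f gH] by ((rule diagram)+, simp)
  also have "\<dots> = Rfam \<RR> X' Y' \<cdot> f \<odot> g"
    unfolding delta2_natural[OF f g] Rfam_def by ((rule diagram)+, simp)
  finally show ?thesis .
qed

text \<open>The balanced condition is the monoidality of the endomorphism in free-module form.
  Acting by \<open>r\<close> and \<open>s\<close> absorbs \<open>L\<close> and the multiplications,
  and naturality of \<open>Rfam\<close> along the actions turns the remaining composite into the
  double braiding of the modules.\<close>

lemma balanced_iff:
  assumes R: "\<RR> \<in> hom (C \<otimes> C) (H \<otimes> H)" and t: "t \<in> hom C H"
  shows "(\<forall>X \<in> Obj V. \<forall>Y \<in> Obj V. \<langle>X\<rangle> \<odot> \<sigma> Y H \<odot> \<langle>H\<rangle> \<cdot> \<langle>X\<rangle> \<odot> \<langle>Y\<rangle> \<odot> \<Delta> \<cdot> \<Sigma> t (X \<otimes> Y) =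
      L (\<Sigma> t) X \<odot> L (\<Sigma> t) Y \<cdot> \<langle>X\<rangle> \<odot> m \<odot> \<langle>Y\<rangle> \<odot> m \<cdot> Rfam \<RR> (Y \<otimes> H) (X \<otimes> H) \<cdot> Rfam \<RR> X Y) \<longleftrightarrow>
    (\<forall>M r N s. is_module (M, r) \<longrightarrow> is_module (N, s) \<longrightarrow> sharp (\<Sigma> t) (mod_ten (M, r) (N, s)) =
      sharp (\<Sigma> t) (M, r) \<odot> sharp (\<Sigma> t) (N, s) \<cdot> (r \<odot> s \<cdot> Rfam \<RR> N M) \<cdot> s \<odot> r \<cdot> Rfam \<RR> M N)"
proof -
  note [diagram] =
      t[THEN diagram_gen] Sigma_hom[OF t, THEN diagram_gen] Rfam_hom[OF R, THEN diagram_gen]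
  define n where "n X Y =
      L (\<Sigma> t) X \<odot> L (\<Sigma> t) Y \<cdot> \<langle>X\<rangle> \<odot> m \<odot> \<langle>Y\<rangle> \<odot> m \<cdot> Rfam \<RR> (Y \<otimes> H) (X \<otimes> H) \<cdot> Rfam \<RR> X Y" for X Y
  have Lh: "L (\<Sigma> t) X \<in> hom (X \<otimes> H) (X \<otimes> H)" if "X \<in> Obj V" for X
  proof -
    note [diagram] = that[THEN atomI]
    show ?thesis unfolding L_def by (rule diagram_hom, (rule diagram)+)
  qed
  note [diagram] = Lh[THEN diagram_gen]
  have L_nat: "f \<odot> \<langle>H\<rangle> \<cdot> L (\<Sigma> t) X = L (\<Sigma> t) Y \<cdot> f \<odot> \<langle>H\<rangle>" if f: "f \<in> hom X Y" for f X Y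
  proof -
    note [diagram] = f[THEN diagram_gen] hom_obj[OF f, THEN atomI]
    have fH: "f \<odot> \<langle>H\<rangle> \<in> hom (X \<otimes> H) (Y \<otimes> H)" by (rule diagram_hom, (rule diagram)+)
    have "f \<odot> \<langle>H\<rangle> \<cdot> L (\<Sigma> t) X = \<langle>Y\<rangle> \<odot> m \<cdot> ((f \<odot> \<langle>H\<rangle>) \<odot> \<langle>H\<rangle> \<cdot> \<Sigma> t (X \<otimes> H))"
      unfolding L_def by ((rule diagram)+, simp)
    also have "\<dots> = L (\<Sigma> t) Y \<cdot> f \<odot> \<langle>H\<rangle>"
      unfolding Sigma_natural[OF t fH] L_def by ((rule diagram)+, simp)
    finally show ?thesis .
  qed
  have n: "n X Y \<in> hom (X \<otimes> Y) (X \<otimes> H \<otimes> Y \<otimes> H)" if "X \<in> Obj V" "Y \<in> Obj V" for X Y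
  proof -
    note [diagram] = that[THEN atomI]
    show ?thesis unfolding n_def by (rule diagram_hom, (rule diagram)+)
  qed
  have n_nat: "f \<odot> \<langle>H\<rangle> \<odot> g \<odot> \<langle>H\<rangle> \<cdot> n X Y = n X' Y' \<cdot> f \<odot> g" if f: "f \<in> hom X X'"
    and g: "g \<in> hom Y Y'" for f g X X' Y Y'
  proof -
    note [diagram] =
        f[THEN diagram_gen] g[THEN diagram_gen] hom_obj[OF f, THEN atomI] hom_obj[OF g, THEN atomI]
    have fH: "f \<odot> \<langle>H\<rangle> \<in> hom (X \<otimes> H) (X' \<otimes> H)" and gH: "g \<odot> \<langle>H\<rangle> \<in> hom (Y \<otimes> H) (Y' \<otimes> H)"
      by (rule diagram_hom, (rule diagram)+)+
    have "f \<odot> \<langle>H\<rangle> \<odot> g \<odot> \<langle>H\<rangle> \<cdot> n X Y = (f \<odot> \<langle>H\<rangle> \<cdot> L (\<Sigma> t) X) \<odot> (g \<odot> \<langle>H\<rangle> \<cdot> L (\<Sigma> t) Y) \<cdot>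
        \<langle>X\<rangle> \<odot> m \<odot> \<langle>Y\<rangle> \<odot> m \<cdot> Rfam \<RR> (Y \<otimes> H) (X \<otimes> H) \<cdot> Rfam \<RR> X Y"
      unfolding n_def by ((rule diagram)+, simp)
    also have "\<dots> = L (\<Sigma> t) X' \<odot> L (\<Sigma> t) Y' \<cdot> \<langle>X'\<rangle> \<odot> m \<odot> \<langle>Y'\<rangle> \<odot> m \<cdot>
        ((f \<odot> \<langle>H\<rangle>) \<odot> \<langle>H\<rangle> \<odot> (g \<odot> \<langle>H\<rangle>) \<odot> \<langle>H\<rangle> \<cdot> Rfam \<RR> (Y \<otimes> H) (X \<otimes> H)) \<cdot> Rfam \<RR> X Y"
      unfolding L_nat[OF f] L_nat[OF g] by ((rule diagram)+, simp)
    also have "\<dots> = L (\<Sigma> t) X' \<odot> L (\<Sigma> t) Y' \<cdot> \<langle>X'\<rangle> \<odot> m \<odot> \<langle>Y'\<rangle> \<odot> m \<cdot>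
        Rfam \<RR> (Y' \<otimes> H) (X' \<otimes> H) \<cdot> (g \<odot> \<langle>H\<rangle> \<odot> f \<odot> \<langle>H\<rangle> \<cdot> Rfam \<RR> X Y)"
      unfolding Rfam_natural[OF R gH fH] by ((rule diagram)+, simp)
    also have "\<dots> = n X' Y' \<cdot> f \<odot> g"
      unfolding Rfam_natural[OF R f g] n_def by ((rule diagram)+, simp)
    finally show ?thesis .
  qed
  \<comment> \<open>\<open>L (\<Sigma> t) M\<close> is the action of \<open>t\<close> on the free
    module, so this is naturality along the linear map \<open>r\<close>.\<close>
  have rL: "r \<cdot> L (\<Sigma> t) M = sharp (\<Sigma> t) (M, r) \<cdot> r" if Mr: "is_module (M, r)" for M r
  proof -
    note M = moduleD[OF Mr]
    note [diagram] = M(1)[THEN atomI] M(2)[THEN diagram_gen]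
    have "r \<cdot> L (\<Sigma> t) M = (r \<cdot> \<langle>M\<rangle> \<odot> m) \<cdot> \<Sigma> t (M \<otimes> H)" unfolding L_def by ((rule diagram)+, simp)
    also have "\<dots> = r \<cdot> (r \<odot> \<langle>H\<rangle> \<cdot> \<Sigma> t (M \<otimes> H))" unfolding M(3)[symmetric] by ((rule diagram)+, simp)
    also have "\<dots> = sharp (\<Sigma> t) (M, r) \<cdot> r"
      unfolding Sigma_natural[OF t M(2)] sharp_app[OF Mr] by ((rule diagram)+, simp)
    finally show ?thesis .
  qed
  have act: "r \<odot> s \<cdot> n M N =
      sharp (\<Sigma> t) (M, r) \<odot> sharp (\<Sigma> t) (N, s) \<cdot> (r \<odot> s \<cdot> Rfam \<RR> N M) \<cdot> s \<odot> r \<cdot> Rfam \<RR> M N"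
    if Mr: "is_module (M, r)" and Ns: "is_module (N, s)" for M r N s
  proof -
    note M = moduleD[OF Mr] and N = moduleD[OF Ns]
    note [diagram] = M(1)[THEN atomI] M(2)[THEN diagram_gen] N(1)[THEN atomI] N(2)[THEN diagram_gen]
      natural_endD(1)[OF sharp_natural[OF t], THEN diagram_gen] Mr Ns
    have "r \<odot> s \<cdot> n M N =
        (r \<cdot> L (\<Sigma> t) M) \<odot> (s \<cdot> L (\<Sigma> t) N) \<cdot> \<langle>M\<rangle> \<odot> m \<odot> \<langle>N\<rangle> \<odot> m \<cdot> Rfam \<RR> (N \<otimes> H) (M \<otimes> H) \<cdot> Rfam \<RR> M N"
      unfolding n_def by ((rule diagram)+, simp)
    also have "\<dots> = sharp (\<Sigma> t) (M, r) \<odot> sharp (\<Sigma> t) (N, s) \<cdot> (r \<cdot> \<langle>M\<rangle> \<odot> m) \<odot> (s \<cdot> \<langle>N\<rangle> \<odot> m) \<cdot>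
        Rfam \<RR> (N \<otimes> H) (M \<otimes> H) \<cdot> Rfam \<RR> M N"
      unfolding rL[OF Mr] rL[OF Ns] by ((rule diagram)+, simp)
    also have "\<dots> = sharp (\<Sigma> t) (M, r) \<odot> sharp (\<Sigma> t) (N, s) \<cdot> r \<odot> s \<cdot>
        (r \<odot> \<langle>H\<rangle> \<odot> s \<odot> \<langle>H\<rangle> \<cdot> Rfam \<RR> (N \<otimes> H) (M \<otimes> H)) \<cdot> Rfam \<RR> M N"
      unfolding M(3)[symmetric] N(3)[symmetric] by ((rule diagram)+, simp)
    also have "\<dots> = sharp (\<Sigma> t) (M, r) \<odot> sharp (\<Sigma> t) (N, s) \<cdot> (r \<odot> s \<cdot> Rfam \<RR> N M) \<cdot> s \<odot> r \<cdot>
        Rfam \<RR> M N"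
      unfolding Rfam_natural[OF R N(2) M(2)] by ((rule diagram)+, simp)
    finally show ?thesis .
  qed
  show ?thesis
    using sharp_ten_iff[OF t n n_nat] act unfolding n_def by simp
qed

section \<open>Structures on the module category, computed on underlying morphisms\<close>

interpretation md: rigid_data Mod .

lemma Mod_sel [simp]:
  "Obj Mod = {A. is_module A}"
  "Arr Mod = {(A, f, B). is_module A \<and> is_module B \<and> linear A B f}"
  "Dom Mod (A, f, B) = A" "Cod Mod (A, f, B) = B"
  "ident Mod A = (A, \<langle>fst A\<rangle>, A)" "cmp Mod (B', g, D) (A, f, B) = (A, g \<cdot> f, D)"
  "tenO Mod = mod_ten" "tenA Mod (A, f, B) (A', f', B') = (mod_ten A A', f \<odot> f', mod_ten B B')"
  "unitO Mod = mod_unit" "ld Mod = mod_ld" "rd Mod = mod_rd"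
  "evl Mod A = (mod_ten (mod_ld A) A, evl V (fst A), mod_unit)"
  "coevl Mod A = (mod_unit, coevl V (fst A), mod_ten A (mod_ld A))"
  "evr Mod A = (mod_ten A (mod_rd A), evr V (fst A), mod_unit)"
  "coevr Mod A = (mod_unit, coevr V (fst A), mod_ten (mod_rd A) A)"
  unfolding Mod_def by simp_all

lemma md_hom: "x \<in> md.hom A B \<longleftrightarrow> (\<exists>f. x = (A, f, B) \<and> is_module A \<and> is_module B \<and> linear A B f)"
  unfolding md.hom_def by auto

lemma fst_mod [simp]:
  "fst (mod_ten A B) = fst A \<otimes> fst B" "fst mod_unit = \<one>"
  "fst (mod_rd A) = rd V (fst A)" "fst (mod_ld A) = ld V (fst A)"
  by (simp_all add: mod_ten_def mod_unit_def mod_rd_def mod_ld_def Let_def split: prod.splits)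

lemma ten_mod_unit [simp]:
  "is_module A \<Longrightarrow> mod_ten A mod_unit = A" "is_module A \<Longrightarrow> mod_ten mod_unit A = A"
  using mod_ten_unit[of "fst A" "snd A"] by simp_all

lemma module_closed [simp]:
  "is_module mod_unit" "is_module A \<Longrightarrow> is_module (mod_rd A)" "is_module A \<Longrightarrow> is_module (mod_ld A)"
  "is_module A \<Longrightarrow> is_module B \<Longrightarrow> is_module (mod_ten A B)"
  using unit_module mod_rd_eq[of "fst A" "snd A"] rd_action_module[of "fst A" "snd A"]
    mod_ld_eq[of "fst A" "snd A"] ld_action_module[of "fst A" "snd A"]
    ten_module[of "fst A" "snd A" "fst B" "snd B"] by auto

text \<open>Composition and tensor in \<open>Mod\<close> act on middle components, so constructions
  there have those of \<open>V\<close> as underlying morphisms. The typing of \<open>f\<close>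
  supplies the objects that \<open>rdual_arr\<close> reads off from its argument.\<close>

lemma md_rdual_arr:
  assumes "is_module A" "is_module B" "f \<in> hom (fst A) (fst B)"
  shows "md.rdual_arr (A, f, B) = (mod_rd B, rdual_arr f, mod_rd A)"
  using assms unfolding md.rdual_arr_def rdual_arr_def hom_dom_cod[OF assms(3)]
    by (simp add: Let_def)

lemma md_rdd_ten:
  assumes A: "is_module A" and B: "is_module B"
  shows "md.rdd_ten A B = (mod_ten (mod_rd (mod_rd A)) (mod_rd (mod_rd B)),
    rdd_ten (fst A) (fst B), mod_rd (mod_rd (mod_ten A B)))"
proof -
  have o: "fst A \<in> Obj V" "fst B \<in> Obj V" using A B moduleD(1) by (metis prod.collapse)+
  have "md.rd_split A B =
      (mod_rd (mod_ten A B), rd_split (fst A) (fst B), mod_ten (mod_rd B) (mod_rd A))"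
    using A B unfolding md.rd_split_def rd_split_def by (simp add: ten_ident o rd_obj)
  moreover have "md.rd_ten (mod_rd B) (mod_rd A) =
    (mod_ten (mod_rd (mod_rd A)) (mod_rd (mod_rd B)), rd_ten (rd V (fst B)) (rd V (fst A)),
     mod_rd (mod_ten (mod_rd B) (mod_rd A)))"
    using A B unfolding md.rd_ten_def rd_ten_def by (simp add: ten_ident o rd_obj)
  ultimately show ?thesis
    using A B rd_split_hom[OF o] unfolding md.rdd_ten_def rdd_ten_def by (simp add: md_rdual_arr)
qed

lemma md_rdd_unit: "md.rdd_unit = (mod_unit, rdd_unit, mod_rd (mod_rd mod_unit))"
proof -
  have "evr V \<one> \<in> hom (rd V \<one>) \<one>" using evr_hom[OF unit_obj] ten_unit rd_obj unit_obj by simp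
  then have "md.rdual_arr (mod_rd mod_unit, evr V \<one>, mod_unit) =
      (mod_rd mod_unit, rdual_arr (evr V \<one>), mod_rd (mod_rd mod_unit))"
    using md_rdual_arr[of "mod_rd mod_unit" mod_unit] by simp
  then show ?thesis
    unfolding md.rdd_unit_def rdd_unit_def by simp
qed

lemma mu_cancel:
  assumes "X \<in> Obj V" "f \<in> hom W X" "g \<in> hom W X"
  shows "\<mu> X \<cdot> f = \<mu> X \<cdot> g \<longleftrightarrow> f = g"
proof -
  note i = inv_arr[OF mu_iso[OF assms(1)] mu_hom[OF assms(1)]]
  have "inv_arr (\<mu> X) \<cdot> (\<mu> X \<cdot> h) = h" if h: "h \<in> hom W X" for h
    using cmp_assoc[OF h mu_hom[OF assms(1)] i(1)] i(2) ident_left[OF h] by simp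
  then show ?thesis using assms by metis
qed

subsection \<open>Pivotal, balanced and ribbon structures\<close>

text \<open>\<open>mu_action\<close>, \<open>mu_ten\<close> and \<open>mu_unit\<close> move
  linearity, monoidality and the unit condition past \<mu>, and \<open>mu_cancel\<close> strips it
  off. The defects of \<mu> stay behind as the factors in the conditions on
  \<open>f\<close>.\<close>

lemma md_piv_iff:
  assumes f: "natural_end f"
  shows "(\<lambda>A\<in>Obj Mod. (A, \<mu> (fst A) \<cdot> f A, mod_rd (mod_rd A))) \<in> md.Piv \<longleftrightarrow>
    (\<forall>M r. is_module (M, r) \<longrightarrow> f (M, r) \<cdot> r = r \<cdot> f (M, r) \<odot> \<langle>H\<rangle> \<cdot> \<langle>M\<rangle> \<odot> (S \<cdot> S) \<cdot> \<sigma> H M \<cdot> \<sigma> M H) \<and>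
    (\<forall>M r N s. is_module (M, r) \<longrightarrow> is_module (N, s) \<longrightarrow>
       f (mod_ten (M, r) (N, s)) = f (M, r) \<odot> f (N, s) \<cdot> \<sigma> N M \<cdot> \<sigma> M N) \<and>
    f mod_unit = \<langle>\<one>\<rangle>" (is "?\<phi> \<in> _ \<longleftrightarrow> _")
proof -
  have lin: "?\<phi> (M, r) \<in> md.hom (M, r) (mod_rd (mod_rd (M, r))) \<longleftrightarrow>
      f (M, r) \<cdot> r = r \<cdot> f (M, r) \<odot> \<langle>H\<rangle> \<cdot> \<langle>M\<rangle> \<odot> (S \<cdot> S) \<cdot> \<sigma> H M \<cdot> \<sigma> M H"
    if Mr: "is_module (M, r)" for M r
  proof -
    note M = moduleD[OF Mr] and fM = natural_endD(1)[OF f Mr]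
    obtain r' where r': "mod_rd (M, r) = (rd V M, r')" "rd_action M r r'"
      using mod_rd_eq[OF Mr] by blast
    note Mr' = rd_action_module[OF Mr r'(2)]
    obtain r'' where r'': "mod_rd (rd V M, r') = (rd V (rd V M), r'')" "rd_action (rd V M) r' r''"
      using mod_rd_eq[OF Mr'] by blast
    note r''_hom = moduleD(2)[OF rd_action_module[OF Mr' r''(2)]]
    note [diagram] =
        M(1)[THEN atomI] M(2)[THEN diagram_gen] fM[THEN diagram_gen] r''_hom[THEN diagram_gen]
    have "r'' \<cdot> (\<mu> M \<cdot> f (M, r)) \<odot> \<langle>H\<rangle> = (r'' \<cdot> \<mu> M \<odot> \<langle>H\<rangle>) \<cdot> f (M, r) \<odot> \<langle>H\<rangle>"
      by ((rule diagram)+, simp)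
    also have "\<dots> = \<mu> M \<cdot> r \<cdot> \<langle>M\<rangle> \<odot> (S \<cdot> S) \<cdot> \<sigma> H M \<cdot> (\<sigma> M H \<cdot> f (M, r) \<odot> \<langle>H\<rangle>)"
      unfolding mu_action[OF Mr r'(2) r''(2)] by ((rule diagram)+, simp)
    also have "\<dots> = \<mu> M \<cdot> r \<cdot> \<langle>M\<rangle> \<odot> (S \<cdot> S) \<cdot> (\<sigma> H M \<cdot> \<langle>H\<rangle> \<odot> f (M, r)) \<cdot> \<sigma> M H"
      unfolding sigma_natural_left[OF fM H_obj, symmetric] by ((rule diagram)+, simp)
    also have "\<dots> = \<mu> M \<cdot> (r \<cdot> f (M, r) \<odot> \<langle>H\<rangle> \<cdot> \<langle>M\<rangle> \<odot> (S \<cdot> S) \<cdot> \<sigma> H M \<cdot> \<sigma> M H)"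
      unfolding sigma_natural_right[OF fM H_obj, symmetric] by ((rule diagram)+, simp)
    finally have e: "r'' \<cdot> (\<mu> M \<cdot> f (M, r)) \<odot> \<langle>H\<rangle> =
        \<mu> M \<cdot> (r \<cdot> f (M, r) \<odot> \<langle>H\<rangle> \<cdot> \<langle>M\<rangle> \<odot> (S \<cdot> S) \<cdot> \<sigma> H M \<cdot> \<sigma> M H)" .
    have a: "(\<mu> M \<cdot> f (M, r)) \<cdot> r = \<mu> M \<cdot> (f (M, r) \<cdot> r)" by ((rule diagram)+, simp)
    have h: "f (M, r) \<cdot> r \<in> hom (M \<otimes> H) M"
      "r \<cdot> f (M, r) \<odot> \<langle>H\<rangle> \<cdot> \<langle>M\<rangle> \<odot> (S \<cdot> S) \<cdot> \<sigma> H M \<cdot> \<sigma> M H \<in> hom (M \<otimes> H) M"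
      "\<mu> M \<cdot> f (M, r) \<in> hom M (rd V (rd V M))" by (rule diagram_hom, (rule diagram)+)+
    show ?thesis
      unfolding r'(1) r''(1) using Mr rd_action_module[OF Mr' r''(2)]
      by (simp add: md_hom linear_iff e a h(3) mu_cancel[OF M(1) h(1,2)] r'(1) r''(1))
  qed
  have ten: "?\<phi> (mod_ten (M, r) (N, s)) =
      md.rdd_ten (M, r) (N, s) \<cdot>\<^bsub>Mod\<^esub> (?\<phi> (M, r) \<odot>\<^bsub>Mod\<^esub> ?\<phi> (N, s)) \<longleftrightarrow>
      f (mod_ten (M, r) (N, s)) = f (M, r) \<odot> f (N, s) \<cdot> \<sigma> N M \<cdot> \<sigma> M N"
    if Mr: "is_module (M, r)" and Ns: "is_module (N, s)" for M r N s
  proof -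
    note M = moduleD(1)[OF Mr] and N = moduleD(1)[OF Ns] and fM = natural_endD(1)[OF f Mr] and fN =
        natural_endD(1)[OF f Ns]
    note MN = ten_module[OF Mr Ns, unfolded mod_ten_eq]
    note fMN = natural_endD(1)[OF f MN]
    note [diagram] =
        M[THEN atomI] N[THEN atomI] fM[THEN diagram_gen] fN[THEN diagram_gen]
            rdd_ten_hom[OF M N, THEN diagram_gen]
    have "rdd_ten M N \<cdot> (\<mu> M \<cdot> f (M, r)) \<odot> (\<mu> N \<cdot> f (N, s)) =
        (rdd_ten M N \<cdot> \<mu> M \<odot> \<mu> N) \<cdot> f (M, r) \<odot> f (N, s)"
      by ((rule diagram)+, simp)
    also have "\<dots> = \<mu> (M \<otimes> N) \<cdot> \<sigma> N M \<cdot> (\<sigma> M N \<cdot> f (M, r) \<odot> f (N, s))"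
      unfolding mu_ten[OF M N] by ((rule diagram)+, simp)
    also have "\<dots> = \<mu> (M \<otimes> N) \<cdot> (\<sigma> N M \<cdot> f (N, s) \<odot> f (M, r)) \<cdot> \<sigma> M N"
      unfolding sigma_natural[OF fM fN, symmetric] by ((rule diagram)+, simp)
    also have "\<dots> = \<mu> (M \<otimes> N) \<cdot> (f (M, r) \<odot> f (N, s) \<cdot> \<sigma> N M \<cdot> \<sigma> M N)"
      unfolding sigma_natural[OF fN fM, symmetric] by ((rule diagram)+, simp)
    finally have e: "rdd_ten M N \<cdot> (\<mu> M \<cdot> f (M, r)) \<odot> (\<mu> N \<cdot> f (N, s)) =
        \<mu> (M \<otimes> N) \<cdot> (f (M, r) \<odot> f (N, s) \<cdot> \<sigma> N M \<cdot> \<sigma> M N)" .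
    have h: "f (M, r) \<odot> f (N, s) \<cdot> \<sigma> N M \<cdot> \<sigma> M N \<in> hom (M \<otimes> N) (M \<otimes> N)"
      by (rule diagram_hom, (rule diagram)+)
    show ?thesis
      using Mr Ns MN by (simp add: md_rdd_ten e mu_cancel[OF ten_obj[OF M N] fMN h] mod_ten_eq)
  qed
  have unit: "?\<phi> mod_unit = md.rdd_unit \<longleftrightarrow> f mod_unit = \<langle>\<one>\<rangle>"
  proof -
    have f1: "f mod_unit \<in> hom \<one> \<one>"
      using natural_endD(1)[OF f, of \<one> \<epsilon>] unit_module unfolding mod_unit_def by simp
    have "?\<phi> mod_unit = md.rdd_unit \<longleftrightarrow> \<mu> \<one> \<cdot> f mod_unit = \<mu> \<one> \<cdot> \<langle>\<one>\<rangle>"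
      unfolding md_rdd_unit ident_right[OF mu_hom[OF unit_obj]] by (simp add: mu_unit)
    then show ?thesis unfolding mu_cancel[OF unit_obj f1 ident_hom[OF unit_obj]] .
  qed
  \<comment> \<open>Naturality of the whole family follows from that of \<open>f\<close> and of
    \<mu>, so it adds no condition on \<open>f\<close>.\<close>
  have nat: "md.rdual_arr (md.rdual_arr (A, g, B)) \<cdot>\<^bsub>Mod\<^esub> ?\<phi> A = ?\<phi> B \<cdot>\<^bsub>Mod\<^esub> (A, g, B)"
    if A: "is_module A" and B: "is_module B" and g: "linear A B g" for A g B
  proof -
    obtain M r N s where [simp]: "A = (M, r)" "B = (N, s)" by (metis surj_pair)
    have gh: "g \<in> hom M N" "g \<cdot> r = s \<cdot> g \<odot> \<langle>H\<rangle>" using g linear_iff by auto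
    note fM = natural_endD(1)[OF f A[unfolded \<open>A = (M, r)\<close>]] and fN =
        natural_endD(1)[OF f B[unfolded \<open>B = (N, s)\<close>]]
    note o = hom_obj[OF gh(1)]
    note rr = rdual_arr_hom[OF gh(1)] rdual_arr_hom[OF rdual_arr_hom[OF gh(1)]]
    note [diagram] =
        fM[THEN diagram_gen] fN[THEN diagram_gen] o[THEN atomI] gh(1)[THEN diagram_gen]
            rr(2)[THEN diagram_gen]
    have "rdual_arr (rdual_arr g) \<cdot> (\<mu> M \<cdot> f (M, r)) = (rdual_arr (rdual_arr g) \<cdot> \<mu> M) \<cdot> f (M, r)"
      by ((rule diagram)+, simp)
    also have "\<dots> = \<mu> N \<cdot> (g \<cdot> f (M, r))" unfolding mu_natural[OF gh(1)] by ((rule diagram)+, simp)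
    also have "\<dots> = (\<mu> N \<cdot> f (N, s)) \<cdot> g"
      unfolding natural_endD(2)[OF f A[unfolded \<open>A = (M, r)\<close>] B[unfolded \<open>B = (N, s)\<close>] gh]
      by ((rule diagram)+, simp)
    finally show ?thesis
      using A B gh(1) rr by (simp add: md_rdual_arr)
  qed
  have "?\<phi> \<in> md.Piv \<longleftrightarrow>
      (\<forall>M r. is_module (M, r) \<longrightarrow> ?\<phi> (M, r) \<in> md.hom (M, r) (mod_rd (mod_rd (M, r)))) \<and>
      (\<forall>M r N s. is_module (M, r) \<longrightarrow> is_module (N, s) \<longrightarrow>
        ?\<phi> (mod_ten (M, r) (N, s)) = md.rdd_ten (M, r) (N, s) \<cdot>\<^bsub>Mod\<^esub> (?\<phi> (M, r) \<odot>\<^bsub>Mod\<^esub> ?\<phi> (N, s))) \<and>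
      ?\<phi> mod_unit = md.rdd_unit"
  proof -
    have "?\<phi> \<in> extensional (Obj Mod)" by simp
    moreover have "\<forall>x\<in>Arr Mod. md.rdual_arr (md.rdual_arr x) \<cdot>\<^bsub>Mod\<^esub> ?\<phi> (Dom Mod x) =
        ?\<phi> (Cod Mod x) \<cdot>\<^bsub>Mod\<^esub> x"
      using nat by (auto simp del: restrict_apply)
    ultimately show ?thesis
      unfolding md.Piv_def md.Nat_def md.id_functor_def md.rdd_functor_def
      by (simp del: restrict_apply)
  qed
  then show ?thesis using lin ten unit by simp
qed

text \<open>Naturality of \<open>f\<close> concerns the forgetful functor, whereas components in
  \<open>Mod\<close> must be linear. Linearity is thus a condition of its own, the categorical form
  of centrality.\<close>

lemma md_bal_iff:
  assumes f: "natural_end f"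
  shows "(\<lambda>A\<in>Obj Mod. (A, f A, A)) \<in> md.Bal (cR \<RR>) \<longleftrightarrow>
    (\<forall>M r. is_module (M, r) \<longrightarrow> f (M, r) \<cdot> r = r \<cdot> f (M, r) \<odot> \<langle>H\<rangle>) \<and>
    (\<forall>M r N s. is_module (M, r) \<longrightarrow> is_module (N, s) \<longrightarrow>
       f (mod_ten (M, r) (N, s)) =
           f (M, r) \<odot> f (N, s) \<cdot> (r \<odot> s \<cdot> Rfam \<RR> N M) \<cdot> s \<odot> r \<cdot> Rfam \<RR> M N) \<and>
    f mod_unit = \<langle>\<one>\<rangle>" (is "?\<theta> \<in> _ \<longleftrightarrow> _")
proof -
  have lin: "?\<theta> (M, r) \<in> md.hom (M, r) (M, r) \<longleftrightarrow> f (M, r) \<cdot> r = r \<cdot> f (M, r) \<odot> \<langle>H\<rangle>"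
    if Mr: "is_module (M, r)" for M r
    using Mr natural_endD(1)[OF f Mr] by (simp add: md_hom linear_iff)
  have nat: "(A, g, B) \<cdot>\<^bsub>Mod\<^esub> ?\<theta> A = ?\<theta> B \<cdot>\<^bsub>Mod\<^esub> (A, g, B)"
    if A: "is_module A" and B: "is_module B" and g: "linear A B g" for A g B
    using natural_endD(2)[OF f, of "fst A" "snd A" "fst B" "snd B" g] that linear_iff[of "fst A"
      "snd A" "fst B" "snd B"]
    by simp
  have "?\<theta> \<in> md.Bal (cR \<RR>) \<longleftrightarrow> (\<forall>M r. is_module (M, r) \<longrightarrow> ?\<theta> (M, r) \<in> md.hom (M, r) (M, r)) \<and>
      (\<forall>M r N s. is_module (M, r) \<longrightarrow> is_module (N, s) \<longrightarrow> ?\<theta> (mod_ten (M, r) (N, s)) =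
         (?\<theta> (M, r) \<odot>\<^bsub>Mod\<^esub> ?\<theta> (N, s)) \<cdot>\<^bsub>Mod\<^esub> cR \<RR> (N, s) (M, r) \<cdot>\<^bsub>Mod\<^esub> cR \<RR> (M, r) (N, s)) \<and>
      ?\<theta> mod_unit = (mod_unit, \<langle>\<one>\<rangle>, mod_unit)"
  proof -
    have "?\<theta> \<in> extensional (Obj Mod)" by simp
    moreover have "\<forall>x\<in>Arr Mod. x \<cdot>\<^bsub>Mod\<^esub> ?\<theta> (Dom Mod x) = ?\<theta> (Cod Mod x) \<cdot>\<^bsub>Mod\<^esub> x"
      using nat by (auto simp del: restrict_apply)
    ultimately show ?thesis
      unfolding md.Bal_def md.Nat_def md.id_functor_def
      by (simp del: restrict_apply)
  qed
  then show ?thesis using lin by (simp add: cR_def)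
qed

lemma md_ribbon_iff:
  assumes f: "natural_end f" and A: "is_module A"
  shows "(A, f A, A) =
      md.from_lr A \<cdot>\<^bsub>Mod\<^esub> md.ldual_arr (mod_rd A, f (mod_rd A), mod_rd A) \<cdot>\<^bsub>Mod\<^esub> md.to_lr A \<longleftrightarrow>
    evr V (fst A) \<cdot> f A \<odot> \<langle>rd V (fst A)\<rangle> = evr V (fst A) \<cdot> \<langle>fst A\<rangle> \<odot> f (mod_rd A)"
proof -
  have o: "fst A \<in> Obj V" using A moduleD(1) by (metis prod.collapse)
  have fA: "f A \<in> hom (fst A) (fst A)" and fA': "f (mod_rd A) \<in> hom (rd V (fst A)) (rd V (fst A))"
    using natural_endD(1)[OF f] A by (metis prod.collapse module_closed(2) fst_mod(3))+
  \<comment> \<open>The inner source and target modules can stay unspecified: composition in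
    \<open>Mod\<close> keeps the outer ones, which are \<open>A\<close> on both sides.\<close>
  have "\<exists>x y. md.ldual_arr (mod_rd A, f (mod_rd A), mod_rd A) = (x, ldual_arr (f (mod_rd A)), y)"
    unfolding md.ldual_arr_def ldual_arr_eq[OF fA'] by (simp add: Let_def)
  moreover have "\<exists>x. md.from_lr A = (x, from_lr (fst A), A)"
    using A unfolding md.from_lr_def from_lr_def by simp
  moreover have "\<exists>x. md.to_lr A = (A, to_lr (fst A), x)"
    using A unfolding md.to_lr_def to_lr_def by simp
  ultimately have "md.from_lr A \<cdot>\<^bsub>Mod\<^esub> md.ldual_arr (mod_rd A, f (mod_rd A), mod_rd A) \<cdot>\<^bsub>Mod\<^esub>
      md.to_lr A =
      (A, from_lr (fst A) \<cdot> ldual_arr (f (mod_rd A)) \<cdot> to_lr (fst A), A)" by auto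
  then show ?thesis using eq_ldual_arr_conj_iff[OF o fA' fA] by simp
qed

text \<open>The hypothesis is applied to a dual of \<open>A\<close> instead of \<open>A\<close>.
  This involves the mixed double dual, and naturality along the linear map \<open>to_rl\<close> or
  \<open>to_lr\<close> brings the endomorphism back to \<open>A\<close>.\<close>

lemma ribbon_sides_iff:
  assumes f: "natural_end f"
  shows "(\<forall>A. is_module A \<longrightarrow> evr V (fst A) \<cdot> f A \<odot> \<langle>rd V (fst A)\<rangle> =
      evr V (fst A) \<cdot> \<langle>fst A\<rangle> \<odot> f (mod_rd A)) \<longleftrightarrow>
    (\<forall>A. is_module A \<longrightarrow> evl V (fst A) \<cdot> \<langle>ld V (fst A)\<rangle> \<odot> f A =
        evl V (fst A) \<cdot> f (mod_ld A) \<odot> \<langle>fst A\<rangle>)"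
proof (intro iffI allI impI)
  fix A assume R: "\<forall>A. is_module A \<longrightarrow> evr V (fst A) \<cdot> f A \<odot> \<langle>rd V (fst A)\<rangle> =
      evr V (fst A) \<cdot> \<langle>fst A\<rangle> \<odot> f (mod_rd A)"
    and A: "is_module A"
  obtain M r where [simp]: "A = (M, r)" by (metis surj_pair)
  have Mr: "is_module (M, r)" using A by simp
  note M = moduleD(1)[OF Mr]
  obtain r' where r': "mod_ld (M, r) = (ld V M, r')" "ld_action M r r'"
    using mod_ld_eq[OF Mr] by blast
  note Nr = ld_action_module[OF Mr r'(2)]
  obtain r'' where r'': "mod_rd (ld V M, r') = (rd V (ld V M), r'')" "rd_action (ld V M) r' r''"
    using mod_rd_eq[OF Nr] by blast
  note Kr = rd_action_module[OF Nr r''(2)]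
  note [diagram] =
      M[THEN atomI] natural_endD(1)[OF f Mr, THEN diagram_gen]
          natural_endD(1)[OF f Nr, THEN diagram_gen]
    natural_endD(1)[OF f Kr, THEN diagram_gen]
  have "evl V M \<cdot> f (ld V M, r') \<odot> \<langle>M\<rangle> =
      (evr V (ld V M) \<cdot> f (ld V M, r') \<odot> \<langle>rd V (ld V M)\<rangle>) \<cdot> \<langle>ld V M\<rangle> \<odot> to_rl M"
    unfolding to_rl_evr[OF M, symmetric] by ((rule diagram)+, simp)
  also have "\<dots> = evr V (ld V M) \<cdot> \<langle>ld V M\<rangle> \<odot> (f (rd V (ld V M), r'') \<cdot> to_rl M)"
    using R[rule_format, OF Nr] unfolding fst_conv r''(1) by (simp only:) ((rule diagram)+, simp)
  also have "\<dots> = (evr V (ld V M) \<cdot> \<langle>ld V M\<rangle> \<odot> to_rl M) \<cdot> \<langle>ld V M\<rangle> \<odot> f (M, r)"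
    unfolding natural_endD(2)[OF f Mr Kr to_rl_hom[OF M] to_rl_linear[OF Mr r'(2) r''(2)],
        symmetric]
    by ((rule diagram)+, simp)
  also have "\<dots> = evl V M \<cdot> \<langle>ld V M\<rangle> \<odot> f (M, r)" unfolding to_rl_evr[OF M] ..
  finally show "evl V (fst A) \<cdot> \<langle>ld V (fst A)\<rangle> \<odot> f A = evl V (fst A) \<cdot> f (mod_ld A) \<odot> \<langle>fst A\<rangle>"
    using r'(1) by simp
next
  fix A assume R: "\<forall>A. is_module A \<longrightarrow> evl V (fst A) \<cdot> \<langle>ld V (fst A)\<rangle> \<odot> f A =
      evl V (fst A) \<cdot> f (mod_ld A) \<odot> \<langle>fst A\<rangle>"
    and A: "is_module A"
  obtain M r where [simp]: "A = (M, r)" by (metis surj_pair)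
  have Mr: "is_module (M, r)" using A by simp
  note M = moduleD(1)[OF Mr]
  obtain r' where r': "mod_rd (M, r) = (rd V M, r')" "rd_action M r r'"
    using mod_rd_eq[OF Mr] by blast
  note Nr = rd_action_module[OF Mr r'(2)]
  obtain r'' where r'': "mod_ld (rd V M, r') = (ld V (rd V M), r'')" "ld_action (rd V M) r' r''"
    using mod_ld_eq[OF Nr] by blast
  note Kr = ld_action_module[OF Nr r''(2)]
  note [diagram] =
      M[THEN atomI] natural_endD(1)[OF f Mr, THEN diagram_gen]
          natural_endD(1)[OF f Nr, THEN diagram_gen]
    natural_endD(1)[OF f Kr, THEN diagram_gen]
  have "evr V M \<cdot> \<langle>M\<rangle> \<odot> f (rd V M, r') =
      (evl V (rd V M) \<cdot> \<langle>ld V (rd V M)\<rangle> \<odot> f (rd V M, r')) \<cdot> to_lr M \<odot> \<langle>rd V M\<rangle>"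
    unfolding to_lr_evl[OF M, symmetric] by ((rule diagram)+, simp)
  also have "\<dots> = evl V (rd V M) \<cdot> (f (ld V (rd V M), r'') \<cdot> to_lr M) \<odot> \<langle>rd V M\<rangle>"
    using R[rule_format, OF Nr] unfolding fst_conv r''(1) by (simp only:) ((rule diagram)+, simp)
  also have "\<dots> = (evl V (rd V M) \<cdot> to_lr M \<odot> \<langle>rd V M\<rangle>) \<cdot> f (M, r) \<odot> \<langle>rd V M\<rangle>"
    unfolding natural_endD(2)[OF f Mr Kr to_lr_hom[OF M] to_lr_linear[OF Mr r'(2) r''(2)],
        symmetric]
    by ((rule diagram)+, simp)
  also have "\<dots> = evr V M \<cdot> f (M, r) \<odot> \<langle>rd V M\<rangle>" unfolding to_lr_evl[OF M] ..
  finally show "evr V (fst A) \<cdot> f A \<odot> \<langle>rd V (fst A)\<rangle> = evr V (fst A) \<cdot> \<langle>fst A\<rangle> \<odot> f (mod_rd A)"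
    using r'(1) by simp
qed

text \<open>The transported duals of the values on left duals form a natural endomorphism, hence
  come from exactly one element; this gives the description in \<open>S_elem\<close> a meaning.
  Comparing that element with \<open>t\<close> is then adjointness with respect to
  \<open>evl\<close>.\<close>

lemma S_elem_eq_iff:
  assumes t: "t \<in> hom C H"
  shows "S_elem t = t \<longleftrightarrow>
    (\<forall>A. is_module A \<longrightarrow> evl V (fst A) \<cdot> \<langle>ld V (fst A)\<rangle> \<odot> sharp (\<Sigma> t) A =
        evl V (fst A) \<cdot> sharp (\<Sigma> t) (mod_ld A) \<odot> \<langle>fst A\<rangle>)"
proof -
  let ?f = "sharp (\<Sigma> t)"
  define q where "q A = from_rl (fst A) \<cdot> rdual_arr (?f (mod_ld A)) \<cdot> to_rl (fst A)" for A
  note f = sharp_natural[OF t]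
  have q_iff: "g = q (M, r) \<longleftrightarrow> evl V M \<cdot> \<langle>ld V M\<rangle> \<odot> g = evl V M \<cdot> ?f (mod_ld (M, r)) \<odot> \<langle>M\<rangle>"
    if Mr: "is_module (M, r)" and g: "g \<in> hom M M" for M r g
  proof -
    obtain r' where r': "mod_ld (M, r) = (ld V M, r')" "ld_action M r r'"
      using mod_ld_eq[OF Mr] by blast
    show ?thesis
      unfolding q_def r'(1) fst_conv
      by (rule eq_rdual_arr_conj_iff[OF moduleD(1)[OF Mr]
          natural_endD(1)[OF f ld_action_module[OF Mr r'(2)]] g])
  qed
  have q_hom: "q (M, r) \<in> hom M M" if Mr: "is_module (M, r)" for M r
  proof -
    obtain r' where r': "mod_ld (M, r) = (ld V M, r')" "ld_action M r r'"
      using mod_ld_eq[OF Mr] by blast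
    note fN = natural_endD(1)[OF f ld_action_module[OF Mr r'(2)]]
    note [diagram] = moduleD(1)[OF Mr, THEN atomI] fN fN[THEN diagram_gen]
    show ?thesis unfolding q_def r'(1) fst_conv by (rule diagram_hom, (rule diagram)+)
  qed
  \<comment> \<open>Paired with \<open>evl\<close>, naturality of \<open>q\<close> along
    \<open>g\<close> becomes naturality of the original endomorphism along
    \<open>ldual_arr g\<close>, which runs between the left dual modules in the opposite
    direction.\<close>
  have "natural_end q"
    unfolding natural_end_def linear_iff
  proof (intro conjI allI impI)
    fix M r assume "is_module (M, r)"
    then show "q (M, r) \<in> hom M M" by (rule q_hom)
  next
    fix M r N s g assume Mr: "is_module (M, r)" and Ns: "is_module (N, s)"
      and g: "g \<in> hom M N \<and> g \<cdot> r = s \<cdot> g \<odot> \<langle>H\<rangle>"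
    note g = conjunct1[OF g] conjunct2[OF g]
    note M = moduleD(1)[OF Mr] and N = moduleD(1)[OF Ns]
    obtain r' where r': "mod_ld (M, r) = (ld V M, r')" "ld_action M r r'"
      using mod_ld_eq[OF Mr] by blast
    obtain s' where s': "mod_ld (N, s) = (ld V N, s')" "ld_action N s s'"
      using mod_ld_eq[OF Ns] by blast
    note M' = ld_action_module[OF Mr r'(2)] and N' = ld_action_module[OF Ns s'(2)]
    note qM = q_hom[OF Mr] and qN = q_hom[OF Ns]
    note [diagram] =
        M[THEN atomI] N[THEN atomI] g(1) g(1)[THEN diagram_gen] qM[THEN diagram_gen]
            qN[THEN diagram_gen]
      natural_endD(1)[OF f M', THEN diagram_gen] natural_endD(1)[OF f N', THEN diagram_gen]
    have qMe: "evl V M \<cdot> \<langle>ld V M\<rangle> \<odot> q (M, r) = evl V M \<cdot> ?f (ld V M, r') \<odot> \<langle>M\<rangle>"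
      and qNe: "evl V N \<cdot> \<langle>ld V N\<rangle> \<odot> q (N, s) = evl V N \<cdot> ?f (ld V N, s') \<odot> \<langle>N\<rangle>"
      using q_iff[OF Mr qM] q_iff[OF Ns qN] r'(1) s'(1) by simp_all
    show "g \<cdot> q (M, r) = q (N, s) \<cdot> g"
    proof (rule evl_eqI[OF N])
      show "g \<cdot> q (M, r) \<in> hom M N" by (rule diagram_hom, (rule diagram)+)
      show "q (N, s) \<cdot> g \<in> hom M N" by (rule diagram_hom, (rule diagram)+)
      have "evl V N \<cdot> \<langle>ld V N\<rangle> \<odot> (g \<cdot> q (M, r)) = (evl V N \<cdot> \<langle>ld V N\<rangle> \<odot> g) \<cdot> \<langle>ld V N\<rangle> \<odot> q (M, r)"
        by ((rule diagram)+, simp)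
      also have "\<dots> = (evl V M \<cdot> \<langle>ld V M\<rangle> \<odot> q (M, r)) \<cdot> ldual_arr g \<odot> \<langle>M\<rangle>"
        unfolding ldual_arr_evl[OF g(1), symmetric] by ((rule diagram)+, simp)
      also have "\<dots> = evl V M \<cdot> (?f (ld V M, r') \<cdot> ldual_arr g) \<odot> \<langle>M\<rangle>"
        unfolding qMe by ((rule diagram)+, simp)
      also have "\<dots> = (evl V M \<cdot> ldual_arr g \<odot> \<langle>M\<rangle>) \<cdot> ?f (ld V N, s') \<odot> \<langle>M\<rangle>"
        unfolding natural_endD(2)[OF f N' M' ldual_arr_hom[OF g(1)]
            ldual_arr_linear[OF Mr Ns r'(2) s'(2) g], symmetric]
        by ((rule diagram)+, simp)
      also have "\<dots> = (evl V N \<cdot> ?f (ld V N, s') \<odot> \<langle>N\<rangle>) \<cdot> \<langle>ld V N\<rangle> \<odot> g"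
        unfolding ldual_arr_evl[OF g(1)] by ((rule diagram)+, simp)
      also have "\<dots> = evl V N \<cdot> \<langle>ld V N\<rangle> \<odot> (q (N, s) \<cdot> g)"
        unfolding qNe[symmetric] by ((rule diagram)+, simp)
      finally show "evl V N \<cdot> \<langle>ld V N\<rangle> \<odot> (g \<cdot> q (M, r)) = evl V N \<cdot> \<langle>ld V N\<rangle> \<odot> (q (N, s) \<cdot> g)" .
    qed
  qed
  from sharp_surj[OF this] obtain b where b: "b \<in> hom C H"
    and bq: "\<And>M r. is_module (M, r) \<Longrightarrow> sharp (\<Sigma> b) (M, r) = q (M, r)" by blast
  have "S_elem t = b"
    unfolding S_elem_def
  proof (rule the_equality)
    show "b \<in> hom C H \<and> (\<forall>A\<in>Obj Mod. sharp (\<Sigma> b) A =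
        from_rl (fst A) \<cdot> rdual_arr (?f (mod_ld A)) \<cdot> to_rl (fst A))"
      using b bq unfolding q_def by auto
    fix b' assume "b' \<in> hom C H \<and> (\<forall>A\<in>Obj Mod. sharp (\<Sigma> b') A =
        from_rl (fst A) \<cdot> rdual_arr (?f (mod_ld A)) \<cdot> to_rl (fst A))"
    then show "b' = b" using sharp_inj[OF _ b] bq unfolding q_def by simp
  qed
  then have "S_elem t = t \<longleftrightarrow> (\<forall>M r. is_module (M, r) \<longrightarrow> ?f (M, r) = q (M, r))"
    using sharp_inj[OF t b] bq by metis
  then show ?thesis using q_iff natural_endD(1)[OF f] by auto
qed

section \<open>Assembly of the bijections\<close>

lemma pivotal_of_Piv_iff:
  assumes p: "p \<in> hom C H"
  shows "pivotal_of p \<in> md.Piv \<longleftrightarrow> p \<in> CPiv"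
  unfolding pivotal_of_def md_piv_iff[OF sharp_natural[OF p]] CPiv_def twisted_grouplike_def
  using p by (auto simp: sharp_unit[OF p] grouplike_iff[OF p] twisted_linear_iff[OF p])

lemma endo_of_Bal_iff:
  assumes R: "\<RR> \<in> hom (C \<otimes> C) (H \<otimes> H)" and t: "t \<in> hom C H"
  shows "endo_of t \<in> md.Bal (cR \<RR>) \<longleftrightarrow> t \<in> CBal \<RR>"
  unfolding endo_of_def md_bal_iff[OF sharp_natural[OF t]] CBal_def
  using t by (auto simp: sharp_unit[OF t] balanced_iff[OF R t] central_iff[OF t])

lemma endo_of_Rbn_iff:
  assumes R: "\<RR> \<in> hom (C \<otimes> C) (H \<otimes> H)" and t: "t \<in> hom C H"
  shows "endo_of t \<in> md.Rbn (cR \<RR>) \<longleftrightarrow> t \<in> CRbn \<RR>"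
  unfolding md.Rbn_def CRbn_def S_elem_eq_iff[OF t] mem_Collect_eq endo_of_Bal_iff[OF R t]
    ribbon_sides_iff[OF sharp_natural[OF t], symmetric]
  using md_ribbon_iff[OF sharp_natural[OF t]] by (simp add: endo_of_def)

lemma Piv_surj:
  assumes \<phi>: "\<phi> \<in> md.Piv"
  shows "\<exists>p \<in> hom C H. pivotal_of p = \<phi>"
proof -
  \<comment> \<open>The underlying morphism of the pivotal structure, divided by \<mu>. Its source
    and target are then the same object, as \<open>sharp_surj\<close> requires.\<close>
  define f where "f A = inv_arr (\<mu> (fst A)) \<cdot> fst (snd (\<phi> A))" for A
  have ext: "\<phi> \<in> extensional (Obj Mod)"
    and hom: "\<And>A. is_module A \<Longrightarrow> \<phi> A \<in> md.hom A (mod_rd (mod_rd A))"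
    and nat: "\<And>A g B. is_module A \<Longrightarrow> is_module B \<Longrightarrow> linear A B g \<Longrightarrow>
      md.rdual_arr (md.rdual_arr (A, g, B)) \<cdot>\<^bsub>Mod\<^esub> \<phi> A = \<phi> B \<cdot>\<^bsub>Mod\<^esub> (A, g, B)"
    using \<phi> unfolding md.Piv_def md.Nat_def md.id_functor_def md.rdd_functor_def by auto
  define \<psi> where "\<psi> A = fst (snd (\<phi> A))" for A
  have \<phi>_eq: "\<phi> A = (A, \<psi> A, mod_rd (mod_rd A))" if "is_module A" for A
    using hom[OF that] unfolding md_hom \<psi>_def by auto
  have \<psi>: "\<psi> (M, r) \<in> hom M (rd V (rd V M))" if Mr: "is_module (M, r)" for M r
    using hom[OF Mr] module_closed(2)[OF module_closed(2)[OF Mr]]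
    unfolding \<phi>_eq[OF Mr] md_hom
    by (auto simp: linear_def split: prod.splits) (metis fst_conv fst_mod(3))
  have i: "inv_arr (\<mu> M) \<in> hom (rd V (rd V M)) M" "inv_arr (\<mu> M) \<cdot> \<mu> M = \<langle>M\<rangle>"
    "\<mu> M \<cdot> inv_arr (\<mu> M) = \<langle>rd V (rd V M)\<rangle>"
    if "M \<in> Obj V" for M
    using inv_arr[OF mu_iso[OF that] mu_hom[OF that]] by auto
  have f_eq: "f (M, r) = inv_arr (\<mu> M) \<cdot> \<psi> (M, r)" for M r unfolding f_def \<psi>_def by simp
  have f_hom: "f (M, r) \<in> hom M M" if Mr: "is_module (M, r)" for M r
    unfolding f_eq using cmp_hom[OF \<psi>[OF Mr] i(1)[OF moduleD(1)[OF Mr]]] .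
  have \<mu>f: "\<mu> M \<cdot> f (M, r) = \<psi> (M, r)" if Mr: "is_module (M, r)" for M r
  proof -
    note M = moduleD(1)[OF Mr]
    note [diagram] = M[THEN atomI] \<psi>[OF Mr, THEN diagram_gen] i(1)[OF M, THEN diagram_gen]
    have "\<mu> M \<cdot> f (M, r) = (\<mu> M \<cdot> inv_arr (\<mu> M)) \<cdot> \<psi> (M, r)"
      unfolding f_eq by ((rule diagram)+, simp)
    also have "\<dots> = \<psi> (M, r)" unfolding i(3)[OF M] by ((rule diagram)+, simp)
    finally show ?thesis .
  qed
  have "natural_end f"
    unfolding natural_end_def
  proof (intro conjI allI impI)
    fix M r assume "is_module (M, r)"
    then show "f (M, r) \<in> hom M M" by (rule f_hom)
  next
    fix M r N s g assume Mr: "is_module (M, r)" and Ns: "is_module (N, s)"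
      and lin: "linear (M, r) (N, s) g"
    have g: "g \<in> hom M N" using lin unfolding linear_iff by blast
    note M = moduleD(1)[OF Mr] and N = moduleD(1)[OF Ns]
    note rr = rdual_arr_hom[OF rdual_arr_hom[OF g]]
    note [diagram] =
        M[THEN atomI] N[THEN atomI] g[THEN diagram_gen] f_hom[OF Mr, THEN diagram_gen]
            f_hom[OF Ns, THEN diagram_gen]
      rr[THEN diagram_gen]
    have e: "rdual_arr (rdual_arr g) \<cdot> \<psi> (M, r) = \<psi> (N, s) \<cdot> g"
      using nat[OF Mr Ns lin] Mr Ns g rdual_arr_hom[OF g] unfolding \<phi>_eq[OF Mr] \<phi>_eq[OF Ns]
        by (simp add: md_rdual_arr)
    have h: "g \<cdot> f (M, r) \<in> hom M N" "f (N, s) \<cdot> g \<in> hom M N"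
      by (rule diagram_hom, (rule diagram)+)+
    have "\<mu> N \<cdot> (g \<cdot> f (M, r)) = (\<mu> N \<cdot> g) \<cdot> f (M, r)" by ((rule diagram)+, simp)
    also have "\<dots> = rdual_arr (rdual_arr g) \<cdot> (\<mu> M \<cdot> f (M, r))"
      unfolding mu_natural[OF g, symmetric] by ((rule diagram)+, simp)
    also have "\<dots> = (\<mu> N \<cdot> f (N, s)) \<cdot> g" unfolding \<mu>f[OF Mr] \<mu>f[OF Ns] e ..
    also have "\<dots> = \<mu> N \<cdot> (f (N, s) \<cdot> g)" by ((rule diagram)+, simp)
    finally show "g \<cdot> f (M, r) = f (N, s) \<cdot> g" unfolding mu_cancel[OF N h] .
  qed
  from sharp_surj[OF this] obtain p where p: "p \<in> hom C H"
    and pf: "\<And>M r. is_module (M, r) \<Longrightarrow> sharp (\<Sigma> p) (M, r) = f (M, r)" by blast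
  have "pivotal_of p = \<phi>"
  proof (rule extensionalityI[OF _ ext])
    show "pivotal_of p \<in> extensional (Obj Mod)" unfolding pivotal_of_def by simp
    fix A assume "A \<in> Obj Mod"
    then show "pivotal_of p A = \<phi> A"
      using pf[of "fst A" "snd A"] \<mu>f[of "fst A"
        "snd A"] \<phi>_eq[of A] unfolding pivotal_of_def by simp
  qed
  then show ?thesis using p by blast
qed

text \<open>The underlying morphisms form a natural endomorphism of the forgetful functor, so
  \<open>sharp_surj\<close> yields the element. That it satisfies the balanced axioms is decided by
  \<open>endo_of_Bal_iff\<close>.\<close>

lemma Bal_surj:
  assumes \<theta>: "\<theta> \<in> md.Bal c"
  shows "\<exists>t \<in> hom C H. endo_of t = \<theta>"
proof -
  define f where "f A = fst (snd (\<theta> A))" for A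
  have ext: "\<theta> \<in> extensional (Obj Mod)"
    and hom: "\<And>A. is_module A \<Longrightarrow> \<theta> A \<in> md.hom A A"
    and nat: "\<And>A g B. is_module A \<Longrightarrow> is_module B \<Longrightarrow> linear A B g \<Longrightarrow>
      (A, g, B) \<cdot>\<^bsub>Mod\<^esub> \<theta> A = \<theta> B \<cdot>\<^bsub>Mod\<^esub> (A, g, B)"
    using \<theta> unfolding md.Bal_def md.Nat_def md.id_functor_def by auto
  have \<theta>_eq: "\<theta> A = (A, f A, A)" if "is_module A" for A
    using hom[OF that] unfolding md_hom f_def by auto
  have "natural_end f"
    unfolding natural_end_def
  proof (intro conjI allI impI)
    fix M r assume Mr: "is_module (M, r)"
    then show "f (M, r) \<in> hom M M" using hom[OF Mr] unfolding \<theta>_eq[OF Mr] md_hom linear_iff by simp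
  next
    fix M r N s g assume Mr: "is_module (M, r)" and Ns: "is_module (N, s)"
      and lin: "linear (M, r) (N, s) g"
    show "g \<cdot> f (M, r) = f (N, s) \<cdot> g"
      using nat[OF Mr Ns lin] unfolding \<theta>_eq[OF Mr] \<theta>_eq[OF Ns] by simp
  qed
  from sharp_surj[OF this] obtain t where t: "t \<in> hom C H"
    and tf: "\<And>M r. is_module (M, r) \<Longrightarrow> sharp (\<Sigma> t) (M, r) = f (M, r)" by blast
  have "endo_of t = \<theta>"
  proof (rule extensionalityI[OF _ ext])
    show "endo_of t \<in> extensional (Obj Mod)" unfolding endo_of_def by simp
    fix A assume "A \<in> Obj Mod"
    then show "endo_of t A = \<theta> A"
      using tf[of "fst A" "snd A"] \<theta>_eq[of A] unfolding endo_of_def by simp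
  qed
  then show ?thesis using t by blast
qed

lemma pivotal_of_inj: "inj_on pivotal_of (hom C H)"
proof (rule inj_onI)
  fix p q assume p: "p \<in> hom C H" and q: "q \<in> hom C H" and eq: "pivotal_of p = pivotal_of q"
  show "p = q"
  proof (rule sharp_inj[OF p q])
    fix M r assume Mr: "is_module (M, r)"
    have "\<mu> M \<cdot> sharp (\<Sigma> p) (M, r) = \<mu> M \<cdot> sharp (\<Sigma> q) (M, r)"
      using fun_cong[OF eq, of "(M, r)"] Mr unfolding pivotal_of_def by simp
    then show "sharp (\<Sigma> p) (M, r) = sharp (\<Sigma> q) (M, r)"
      unfolding mu_cancel[OF moduleD(1)[OF Mr] natural_endD(1)[OF sharp_natural[OF p] Mr]
          natural_endD(1)[OF sharp_natural[OF q] Mr]] .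
  qed
qed

lemma endo_of_inj: "inj_on endo_of (hom C H)"
proof (rule inj_onI)
  fix p q assume p: "p \<in> hom C H" and q: "q \<in> hom C H" and eq: "endo_of p = endo_of q"
  show "p = q"
  proof (rule sharp_inj[OF p q])
    fix M r assume Mr: "is_module (M, r)"
    then show "sharp (\<Sigma> p) (M, r) = sharp (\<Sigma> q) (M, r)"
      using fun_cong[OF eq, of "(M, r)"] unfolding endo_of_def by simp
  qed
qed

lemma bij_pivotal_of: "bij_betw pivotal_of CPiv md.Piv"
proof (rule bij_betw_imageI)
  have sub: "CPiv \<subseteq> hom C H" unfolding CPiv_def by blast
  show "inj_on pivotal_of CPiv" using inj_on_subset[OF pivotal_of_inj sub] .
  show "pivotal_of ` CPiv = md.Piv"
    using pivotal_of_Piv_iff Piv_surj sub by blast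
qed

lemma bij_endo_of_Bal:
  assumes R: "\<RR> \<in> hom (C \<otimes> C) (H \<otimes> H)"
  shows "bij_betw endo_of (CBal \<RR>) (md.Bal (cR \<RR>))"
proof (rule bij_betw_imageI)
  have sub: "CBal \<RR> \<subseteq> hom C H" unfolding CBal_def by blast
  show "inj_on endo_of (CBal \<RR>)" using inj_on_subset[OF endo_of_inj sub] .
  show "endo_of ` CBal \<RR> = md.Bal (cR \<RR>)"
    using endo_of_Bal_iff[OF R] Bal_surj sub by blast
qed

text \<open>Surjectivity is inherited from the balanced case: a ribbon structure is balanced and
  hence comes from an element, and \<open>endo_of_Rbn_iff\<close> shows that this element is
  ribbon.\<close>

lemma bij_endo_of_Rbn:
  assumes R: "\<RR> \<in> hom (C \<otimes> C) (H \<otimes> H)"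
  shows "bij_betw endo_of (CRbn \<RR>) (md.Rbn (cR \<RR>))"
proof (rule bij_betw_imageI)
  have sub: "CRbn \<RR> \<subseteq> hom C H" unfolding CRbn_def CBal_def by blast
  have sub': "md.Rbn (cR \<RR>) \<subseteq> md.Bal (cR \<RR>)" unfolding md.Rbn_def by blast
  show "inj_on endo_of (CRbn \<RR>)" using inj_on_subset[OF endo_of_inj sub] .
  show "endo_of ` CRbn \<RR> = md.Rbn (cR \<RR>)"
    using endo_of_Rbn_iff[OF R] Bal_surj sub sub' by blast
qed

end

theorem theorem1p2:
  fixes V :: "('o, 'a) rigid_cat"
    and \<sigma> :: "'o \<Rightarrow> 'o \<Rightarrow> 'a"
    and C :: 'o and \<iota> :: "'o \<Rightarrow> 'a"
    and H :: "('o, 'a) hopf"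
  assumes "braided_rigid_category V \<sigma>"
    and "coend_data.is_coend V C \<iota>"
    and "hopf_data.hopf_algebra V \<sigma> H"
  shows "bij_betw (hopf_coend_data.pivotal_of V \<sigma> H \<iota>)
           (hopf_coend_data.CPiv V \<sigma> H C \<iota>)
           (rigid_data.Piv (hopf_data.Mod V \<sigma> H))
       \<and> (\<forall>\<RR>. hopf_coend_data.R_matrix V \<sigma> H C \<iota> \<RR> \<longrightarrow>
           bij_betw (hopf_coend_data.endo_of V \<sigma> H \<iota>)
             (hopf_coend_data.CBal V \<sigma> H C \<iota> \<RR>)
             (rigid_data.Bal (hopf_data.Mod V \<sigma> H) (hopf_coend_data.cR V \<sigma> H C \<iota> \<RR>))
         \<and> bij_betw (hopf_coend_data.endo_of V \<sigma> H \<iota>)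
             (hopf_coend_data.CRbn V \<sigma> H C \<iota> \<RR>)
             (rigid_data.Rbn (hopf_data.Mod V \<sigma> H) (hopf_coend_data.cR V \<sigma> H C \<iota> \<RR>)))"
proof -
  interpret braided_rigid_category V \<sigma> by fact
  interpret braided_hopf_coend V \<sigma> H C \<iota>
    using assms(2,3) by unfold_locales
  show ?thesis
    using bij_pivotal_of bij_endo_of_Bal bij_endo_of_Rbn unfolding R_matrix_def by blast
qed
end
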